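(* Let $\beta_0^0,\beta_1^0\in\mathbb{R}$ and $(\sigma^2)^0>0$ be the true parameters of the simple Poisson mixed model with $m$ groups and $n$ repeated measures per group (defined in the context), let $X$ denote a random variable with the common distribution of the predictors $X_{ij}$, and let $\phi(t)=E\{\exp(tX)\}$. Let $\underline{\widehat\beta}_0$, $\underline{\widehat\beta}_1$, $\underline{\widehat\sigma}^2$ be the Gaussian variational approximate maximum likelihood estimators of $\beta_0^0$, $\beta_1^0$, $(\sigma^2)^0$ (defined in the context). Assume that: (A1) the moment generating function $\phi(t)=E\{\exp(tX)\}$ of $X$ is well defined (finite) on the whole real line; (A2) the mapping that takes $\beta$ to $\phi'(\beta)/\phi(\beta)$ is invertible; (A3) in some neighborhood of $\beta_1^0$, $(d^2/d\beta^2)\log\phi(\beta)$ does not vanish; (A4) $m=m(n)$ diverges to infinity with $n$, such that $n/m\to0$ as $n\to\infty$; (A5) for a constant $C>0$, $m=O(n^C)$ as $m$ and $n$ diverge. Define $$\tau^2=\frac{\exp\{-(\sigma^2)^0/2-\beta_0^0\}\,\phi(\beta_1^0)}{\phi''(\beta_1^0)\phi(\beta_1^0)-\phi'(\beta_1^0)^2}.$$ Then, as $n\to\infty$, $$\underline{\widehat\beta}_0-\beta_0^0=m^{-1/2}N_0+o_p(n^{-1}+m^{-1/2}),$$ where the random variable $N_0$ is normal $N(0,(\sigma^2)^0)$; $$\underline{\widehat\beta}_1-\beta_1^0=(mn)^{-1/2}N_1+o_p\{n^{-2}+(mn)^{-1/2}\},$$ where the random variable $N_1$ is normal $N(0,\tau^2)$;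 and $$\underline{\widehat\sigma}^2-(\sigma^2)^0=m^{-1/2}N_2+o_p(n^{-1}+m^{-1/2}),$$ where the random variable $N_2$ is normal $N(0,2\{(\sigma^2)^0\}^2)$.
   Context: Simple Poisson mixed model. For $1\le i\le m$ and $1\le j\le n$, the random variables $X_{ij}$ and $U_i$ are totally independent, the $X_{ij}$ are all distributed as $X$, and the $U_i$ are $N(0,(\sigma^2)^0)$. Conditionally on the $X_{ij}$ and $U_i$, the $Y_{ij}$ are independent, with $Y_{ij}$ Poisson distributed with mean $\exp(\beta_0^0+\beta_1^0X_{ij}+U_i)$. The pairs $(X_{ij},Y_{ij})$ are observed; the $U_i$ are unobserved. Gaussian variational approximate log-likelihood. For $\boldsymbol\beta=(\beta_0,\beta_1)\in\mathbb{R}^2$, $\sigma^2>0$, and variational parameters $\boldsymbol\mu=(\mu_1,\ldots,\mu_m)\in\mathbb{R}^m$ and $\boldsymbol\lambda=(\lambda_1,\ldots,\lambda_m)\in(0,\infty)^m$, put $$\underline{\ell}(\boldsymbol\beta,\sigma^2,\boldsymbol\mu,\boldsymbol\lambda)=\sum_{i=1}^m\sum_{j=1}^n\left\{Y_{ij}(\beta_0+\beta_1X_{ij}+\mu_i)-e^{\beta_0+\beta_1X_{ij}+\mu_i+\lambda_i/2}-\log(Y_{ij}!)\right\}-\frac m2\log(\sigma^2)+\frac m2-\frac1{2\sigma^2}\sum_{i=1}^m(\mu_i^2+\lambda_i)+\frac12\sum_{i=1}^m\log(\lambda_i).$$ Estimators. The Gaussian variational approximate maximum likelihood estimators $(\underline{\widehat\beta}_0,\underline{\widehat\beta}_1,\underline{\widehat\sigma}^2)$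 are the $(\boldsymbol\beta,\sigma^2)$ component of $$\mathop{\arg\max}_{\boldsymbol\beta,\sigma^2,\boldsymbol\mu,\boldsymbol\lambda}\ \underline{\ell}(\boldsymbol\beta,\sigma^2,\boldsymbol\mu,\boldsymbol\lambda).$$ Notation. $N(a,b)$ denotes the normal distribution with mean $a$ and variance $b$; $o_p(a_n)$ denotes a random quantity which, divided by $a_n$, converges to $0$ in probability as $n\to\infty$ (with $m=m(n)$). *)

theory Defs
  imports "HOL-Probability.Probability" "HOL-Library.Landau_Symbols"
begin

section \<open>Conditional independence and stochastic order\<close>

definition generated_algebra :: "'a measure \<Rightarrow> 'k set \<Rightarrow> ('k \<Rightarrow> 'a \<Rightarrow> real) \<Rightarrow> 'a measure" where
  "generated_algebra M I Z =
     sigma (space M) {Z k -` B \<inter> space M | k B. k \<in> I \<and> B \<in> sets borel}"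

definition cond_prob_alg :: "'a measure \<Rightarrow> 'a measure \<Rightarrow> 'a set \<Rightarrow> 'a \<Rightarrow> real" where
  "cond_prob_alg M F A = real_cond_exp M F (indicator A)"

definition cond_indep_vars ::
    "'a measure \<Rightarrow> 'a measure \<Rightarrow> ('k \<Rightarrow> 'b measure) \<Rightarrow> ('k \<Rightarrow> 'a \<Rightarrow> 'b) \<Rightarrow> 'k set \<Rightarrow> bool" where
  "cond_indep_vars M F N Z I \<longleftrightarrow>
     (\<forall>k\<in>I. Z k \<in> M \<rightarrow>\<^sub>M N k) \<and>
     (\<forall>J B. J \<subseteq> I \<and> finite J \<and> J \<noteq> {} \<and> (\<forall>k\<in>J. B k \<in> sets (N k)) \<longrightarrow>
        (AE \<omega> in M. cond_prob_alg M F (\<Inter>k\<in>J. Z k -` B k \<inter> space M) \<omega> =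
           (\<Prod>k\<in>J. cond_prob_alg M F (Z k -` B k \<inter> space M) \<omega>)))"

text \<open>\<open>R\<^sub>n = o\<^sub>p(a\<^sub>n)\<close>; the \<open>n\<close>-th variable may live on its own probability space \<open>M n\<close>.\<close>

definition small_o_p :: "(nat \<Rightarrow> 'a measure) \<Rightarrow> (nat \<Rightarrow> 'a \<Rightarrow> real) \<Rightarrow> (nat \<Rightarrow> real) \<Rightarrow> bool" where
  "small_o_p M R a \<longleftrightarrow>
     (\<forall>\<epsilon>>0. (\<lambda>n. measure (M n) {\<omega> \<in> space (M n). \<bar>R n \<omega> / a n\<bar> > \<epsilon>}) \<longlonglongrightarrow> 0)"

section \<open>The simple Poisson mixed model\<close>

text \<open>\<open>D\<close> is the common law of the predictors, \<open>s\<close> the variance of the random intercepts.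
  Note that \<^const>\<open>normal_density\<close> takes a standard deviation.\<close>

locale simple_poisson_mixed_model = prob_space M for M :: "'a measure" +
  fixes m n :: nat
    and X :: "nat \<Rightarrow> nat \<Rightarrow> 'a \<Rightarrow> real"
    and U :: "nat \<Rightarrow> 'a \<Rightarrow> real"
    and Y :: "nat \<Rightarrow> nat \<Rightarrow> 'a \<Rightarrow> nat"
    and D :: "real measure"
    and b0 b1 s :: real
  assumes indep_XU:
      "indep_vars (\<lambda>_. borel) (case_sum (\<lambda>(i, j). X i j) U) (({1..m} \<times> {1..n}) <+> {1..m})"
    and distr_X: "\<And>i j. i \<in> {1..m} \<Longrightarrow> j \<in> {1..n} \<Longrightarrow> distr M borel (X i j) = D"
    and distr_U: "\<And>i. i \<in> {1..m} \<Longrightarrow> distributed M lborel (U i) (normal_density 0 (sqrt s))"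
    and cond_indep_Y:
      "cond_indep_vars M
         (generated_algebra M (({1..m} \<times> {1..n}) <+> {1..m}) (case_sum (\<lambda>(i, j). X i j) U))
         (\<lambda>_. count_space UNIV) (\<lambda>(i, j). Y i j) ({1..m} \<times> {1..n})"
    and cond_distr_Y:
      "\<And>i j k. i \<in> {1..m} \<Longrightarrow> j \<in> {1..n} \<Longrightarrow>
         AE \<omega> in M. cond_prob_alg M
             (generated_algebra M (({1..m} \<times> {1..n}) <+> {1..m}) (case_sum (\<lambda>(i, j). X i j) U))
             (Y i j -` {k} \<inter> space M) \<omega>
           = pmf (poisson_pmf (exp (b0 + b1 * X i j \<omega> + U i \<omega>))) k"

section \<open>Gaussian variational approximation\<close>

text \<open>A parameter is a tuple \<open>(\<beta>\<^sub>0, \<beta>\<^sub>1, \<sigma>\<^sup>2, \<mu>, lam)\<close>; vectors of length \<open>m\<close> are extensional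
  functions on \<open>{1..m}\<close>.\<close>

type_synonym gva_param = "real \<times> real \<times> real \<times> (nat \<Rightarrow> real) \<times> (nat \<Rightarrow> real)"

definition gva_params :: "nat \<Rightarrow> gva_param set" where
  "gva_params m = {(\<beta>0, \<beta>1, s, \<mu>, lam). s > 0 \<and>
     \<mu> \<in> {1..m} \<rightarrow>\<^sub>E UNIV \<and> lam \<in> {1..m} \<rightarrow>\<^sub>E {0<..}}"

definition gva_loglik ::
    "nat \<Rightarrow> nat \<Rightarrow> (nat \<Rightarrow> nat \<Rightarrow> real) \<Rightarrow> (nat \<Rightarrow> nat \<Rightarrow> nat) \<Rightarrow> gva_param \<Rightarrow> real" where
  "gva_loglik m n x y = (\<lambda>(\<beta>0, \<beta>1, s, \<mu>, lam).
     (\<Sum>i=1..m. \<Sum>j=1..n.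
        real (y i j) * (\<beta>0 + \<beta>1 * x i j + \<mu> i)
        - exp (\<beta>0 + \<beta>1 * x i j + \<mu> i + lam i / 2) - ln (fact (y i j)))
     - real m / 2 * ln s + real m / 2
     - 1 / (2 * s) * (\<Sum>i=1..m. (\<mu> i)\<^sup>2 + lam i)
     + 1 / 2 * (\<Sum>i=1..m. ln (lam i)))"

text \<open>The argmax is empty for some data sets (for instance if all responses vanish) and need not
  be a singleton (for instance if all predictors coincide), so estimators are described by a
  relation.\<close>

definition is_gva_mle ::
    "nat \<Rightarrow> nat \<Rightarrow> (nat \<Rightarrow> nat \<Rightarrow> real) \<Rightarrow> (nat \<Rightarrow> nat \<Rightarrow> nat) \<Rightarrow> real \<times> real \<times> real \<Rightarrow> bool" where
  "is_gva_mle m n x y = (\<lambda>(\<beta>0, \<beta>1, s). \<exists>\<mu> lam.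
     is_arg_max (gva_loglik m n x y) (\<lambda>\<theta>. \<theta> \<in> gva_params m) (\<beta>0, \<beta>1, s, \<mu>, lam))"

text \<open>Random variables that, for every sample point at which a maximiser exists, are the
  \<open>(\<beta>, \<sigma>\<^sup>2)\<close> component of a maximiser.\<close>

definition gva_estimator ::
    "'a measure \<Rightarrow> nat \<Rightarrow> nat \<Rightarrow> (nat \<Rightarrow> nat \<Rightarrow> 'a \<Rightarrow> real) \<Rightarrow> (nat \<Rightarrow> nat \<Rightarrow> 'a \<Rightarrow> nat) \<Rightarrow>
     ('a \<Rightarrow> real) \<Rightarrow> ('a \<Rightarrow> real) \<Rightarrow> ('a \<Rightarrow> real) \<Rightarrow> bool" where
  "gva_estimator M m n X Y B0 B1 S \<longleftrightarrow>
     B0 \<in> borel_measurable M \<and> B1 \<in> borel_measurable M \<and> S \<in> borel_measurable M \<and>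
     (\<forall>\<omega> \<in> space M.
        (\<exists>\<theta>. is_gva_mle m n (\<lambda>i j. X i j \<omega>) (\<lambda>i j. Y i j \<omega>) \<theta>) \<longrightarrow>
        is_gva_mle m n (\<lambda>i j. X i j \<omega>) (\<lambda>i j. Y i j \<omega>) (B0 \<omega>, B1 \<omega>, S \<omega>))"

section \<open>Moment generating function and asymptotic variance of the slope\<close>

definition mgf :: "'b measure \<Rightarrow> ('b \<Rightarrow> real) \<Rightarrow> real \<Rightarrow> real" where
  "mgf P X t = (\<integral>\<omega>. exp (t * X \<omega>) \<partial>P)"

definition tau_sq :: "(real \<Rightarrow> real) \<Rightarrow> real \<Rightarrow> real \<Rightarrow> real \<Rightarrow> real" where
  "tau_sq \<phi> b0 b1 s =
     exp (- s / 2 - b0) * \<phi> b1 / ((deriv ^^ 2) \<phi> b1 * \<phi> b1 - (deriv \<phi> b1)\<^sup>2)"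

end

theory Submission
 imports Defs "HOL-Real_Asymp.Real_Asymp"
begin

text \<open>Put \<open>n = L\<^sup>2\<^sup>0\<^sup>0\<close> and \<open>q = m\<^sup>-\<^sup>1\<^sup>/\<^sup>2\<close>. Outside an event of vanishing probability the predictors and
 intercepts are bounded by \<open>L\<close>, the group totals deviate relatively by at most \<open>L\<^sup>-\<^sup>9\<^sup>7\<close> from their
 conditional means, and all relevant averages over groups are close to their expectations. On such
 good data the stationarity equations of the variational likelihood determine every stationary point up to
 negligible errors, without randomness: the intercept error is the average of the \<open>U\<^sub>i\<close>, the
 variance estimate is the average of the \<open>U\<^sub>i\<^sup>2\<close>, and the slope error is the score divided by \<open>n I\<close>,
 where the score uses predictors centred at their tilted group means and \<open>I = 1 / \<tau>\<^sup>2\<close>. The terms of order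
 \<open>1 / n\<close> cancel because \<open>exp (- U) (1 + U / \<sigma>\<^sup>2)\<close> and \<open>exp (- U) (1 - U - U\<^sup>2 / \<sigma>\<^sup>2)\<close> have mean zero.
 Stationary points are reached without consistency theory: the maximum over the closed parameter space
 \<open>\<sigma> >= 0\<close> exists, and the same expansions, which apply at \<open>\<sigma> = 0\<close> too, show that it is interior.

 Given predictors and intercepts the score is a centred Poisson sum with explicit characteristic function,
 so it is asymptotically normal; so is the sum of the \<open>U\<^sub>i\<^sup>2\<close>. Both are coupled to exactly normal variables
 on the given spaces, using the quantile transform and the atomless law of \<open>U\<^sub>1\<close>.\<close>

section \<open>Averages, orders of magnitude and weighted sums\<close>

text \<open>The difficulty is precision. When m grows faster than n^2, errors of order 1/n dominate
  m^(-1/2), so they must be shown to cancel, not merely to be small; for the slope even 1/n^2 is the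
  standard. This forces a second-order expansion of every group's equation, with remainders
  controlled uniformly over the groups. Making n a 200th power leaves room to pay for constants,
  truncations and tails with a few powers of L at each step while 1/n = L^-200 stays out of reach;
  the individual exponents record this bookkeeping and are not optimal. At an unknown stationary
  point nothing is known about the parameters, not even that they are bounded. The only foothold is
  the inequality of \<open>gva_eq\<close>, which keeps the residuals Y - G of square-root size on
  average. It localises the slope, because the score is monotone and steep, and leaves all but few
  groups with fitted totals close to the observed ones; shrinkage towards the fixed-effect fits
  localises the rest. Only after that are expansions around the truth legitimate.\<close>

definition avg :: "nat => (nat => real) => real" where
 "avg m f = (\<Sum>i=1..m. f i) / real m"

lemma avg_add: "avg m (\<lambda>i. f i + g i) = avg m f + avg m g"
 by (simp add: avg_def sum.distrib add_divide_distrib)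

lemma avg_diff: "avg m (\<lambda>i. f i - g i) = avg m f - avg m g"
 by (simp add: avg_def sum_subtractf diff_divide_distrib)

lemma avg_cmult: "avg m (\<lambda>i. c * f i) = c * avg m f"
 by (simp add: avg_def sum_distrib_left[symmetric])

lemma avg_cong: "(\<And>i. i \<in> {1..m} ==> f i = g i) ==> avg m f = avg m g"
 by (simp add: avg_def)

lemma avg_const: "m >= 1 ==> avg m (\<lambda>i. c) = c"
 by (simp add: avg_def)

lemma avg_mono: "(\<And>i. i \<in> {1..m} ==> f i <= g i) ==> avg m f <= avg m g"
 unfolding avg_def by (intro divide_right_mono sum_mono) auto

lemma abs_avg_le: "\<bar>avg m f\<bar> <= avg m (\<lambda>i. \<bar>f i\<bar>)"
 unfolding avg_def by (simp add: abs_divide divide_right_mono)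

lemma avg_le_const: "m >= 1 ==> (\<And>i. i \<in> {1..m} ==> f i <= c) ==> avg m f <= c"
 using avg_mono[of m f "\<lambda>_. c"] by (simp add: avg_const)

lemma avg_nonneg: "(\<And>i. i \<in> {1..m} ==> 0 <= f i) ==> 0 <= avg m f"
 unfolding avg_def by (intro divide_nonneg_nonneg sum_nonneg) auto

lemma avg_square_le: "m >= 1 ==> (avg m f)\<^sup>2 <= avg m (\<lambda>i. (f i)\<^sup>2)"
proof -
 assume m: "m >= 1"
 have "0 <= avg m (\<lambda>i. (f i - avg m f)\<^sup>2)" by (intro avg_nonneg) auto
 also have "\<dots> = avg m (\<lambda>i. (f i)\<^sup>2 - 2 * avg m f * f i + (avg m f)\<^sup>2)"
  by (intro avg_cong) (simp add: power2_diff)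
 also have "\<dots> = avg m (\<lambda>i. (f i)\<^sup>2) - (avg m f)\<^sup>2"
  using m by (simp add: avg_add avg_diff avg_cmult avg_const power2_eq_square)
 finally show ?thesis by simp
qed

lemma avg_abs_le_sqrt: "m >= 1 ==> avg m (\<lambda>i. \<bar>f i\<bar>) <= sqrt (avg m (\<lambda>i. (f i)\<^sup>2))"
 using avg_square_le[of m "\<lambda>i. \<bar>f i\<bar>"] by (intro real_le_rsqrt) simp

text \<open>Exponents are to stay integers: the simplifier would otherwise rewrite
  \<open>L powi 200\<close> to \<open>L ^ 200\<close> and destroy the common form on which
  \<open>powi_mult\<close> and \<open>powi_mono\<close> act.\<close>

declare power_int_numeral [simp del] power_int_minus1_right [simp del]
 power_int_add_numeral [simp del] power_int_add_numeral2 [simp del]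

section \<open>Calculus of error exponents\<close>

locale scale =
 fixes L :: real
 assumes L10: "L >= 10"
begin

text \<open>Errors are measured in integer powers of \<open>L\<close>; since \<open>L >= 10\<close>, one spare power absorbs a sum of several terms.\<close>

definition ub :: "int => real => bool" where "ub a x \<longleftrightarrow> \<bar>x\<bar> <= L powi a"

lemma L_pos [simp]: "L > 0" "L >= 0" "L \<noteq> 0" "L >= 1" "L > 1"
 using L10 by auto

lemma powi_pos [simp]: "L powi a > 0" "L powi a >= 0" "L powi a \<noteq> 0"
 by (auto simp: zero_less_power_int less_imp_le)

lemma powi_mono: "a <= b ==> L powi a <= L powi b"
 by (intro power_int_increasing) auto

lemma powi_10: "a < b ==> 10 * L powi a <= L powi b"
proof -
 assume "a < b"
 then have "L powi (a + 1) <= L powi b" by (intro powi_mono) auto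
 moreover have "L powi (a + 1) = L * L powi a" by (simp add: power_int_add)
 moreover have "10 * L powi a <= L * L powi a" using L10 by (intro mult_right_mono) auto
 ultimately show ?thesis by linarith
qed

lemma powi_mult: "L powi a * L powi b = L powi (a + b)"
 by (simp add: power_int_add)

lemma powi_div: "L powi a / L powi b = L powi (a - b)"
 by (simp add: power_int_diff)

lemma ub_mono: "ub a x ==> a <= b ==> ub b x"
 using powi_mono[of a b] by (auto simp: ub_def)

lemma ub_le: "ub a y ==> \<bar>x\<bar> <= \<bar>y\<bar> ==> ub a x"
 by (auto simp: ub_def)

lemma ub_mult: "ub a x ==> ub b y ==> a + b <= c ==> ub c (x * y)"
proof -
 assume a: "ub a x" "ub b y" and c: "a + b <= c"
 have "\<bar>x * y\<bar> <= L powi a * L powi b" using a unfolding ub_def abs_mult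
  by (intro mult_mono) auto
 also have "\<dots> <= L powi c" using powi_mono[OF c] by (simp add: powi_mult)
 finally show ?thesis by (simp add: ub_def)
qed

lemma ub_sq: "ub a x ==> 2 * a <= c ==> ub c (x\<^sup>2)"
 unfolding power2_eq_square by (rule ub_mult[of a _ a]) auto

lemma ub_add: "ub a x ==> ub b y ==> a < c ==> b < c ==> ub c (x + y)"
 using powi_10[of a c] powi_10[of b c] unfolding ub_def by (smt (verit) powi_pos)

lemma ub_add3: "ub a x ==> ub b y ==> ub d z ==> a < c ==> b < c ==> d < c ==> ub c (x + y + z)"
 using powi_10[of a c] powi_10[of b c] powi_10[of d c] unfolding ub_def by (smt (verit) powi_pos)

lemma ub_add4: "ub a x ==> ub b y ==> ub d z ==> ub e w ==> a < c ==> b < c ==> d < c ==> e < c ==>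
  ub c (x + y + z + w)"
 using powi_10[of a c] powi_10[of b c] powi_10[of d c] powi_10[of e c]
 unfolding ub_def by (smt (verit) powi_pos)

lemma ub_minus [simp]: "ub a (- x) = ub a x"
 by (simp add: ub_def)

lemma ub_abs [simp]: "ub a \<bar>x\<bar> = ub a x"
 by (simp add: ub_def)

lemma ub_diff: "ub a x ==> ub b y ==> a < c ==> b < c ==> ub c (x - y)"
 using ub_add[of a x b "- y" c] by simp

lemma ub_const: "\<bar>x\<bar> <= 10 ==> 1 <= a ==> ub a x"
 using powi_mono[of 1 a] L10 by (auto simp: ub_def)

lemma ub_one: "\<bar>x\<bar> <= 1 ==> 0 <= a ==> ub a x"
 using powi_mono[of 0 a] unfolding ub_def by (metis order.trans power_int_0_right)

lemma ub_cmult: "\<bar>k\<bar> <= 10 ==> ub a x ==> a < c ==> ub c (k * x)"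
 by (rule ub_mult[of 1 k a x c]) (auto intro: ub_const)

lemma ub_div:
 assumes "ub a x" "L powi b <= \<bar>y\<bar>" "a - b <= c"
 shows "ub c (x / y)"
proof -
 have "\<bar>x / y\<bar> = \<bar>x\<bar> / \<bar>y\<bar>" by simp
 also have "\<dots> <= L powi a / L powi b"
  using assms(1,2) unfolding ub_def by (intro frac_le) auto
 also have "\<dots> <= L powi c" using powi_mono[OF assms(3)] by (simp add: powi_div)
 finally show ?thesis by (simp add: ub_def)
qed

lemma ub_inverse: "L powi b <= \<bar>y\<bar> ==> - b <= c ==> ub c (1 / y)"
 by (rule ub_div[of 0 1 b]) (auto intro: ub_one)

lemma ub_avg: "m >= 1 ==> (\<And>i. i \<in> {1..m} ==> ub a (f i)) ==> ub a (avg m f)"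
 unfolding ub_def using abs_avg_le[of m f] avg_le_const[of m "\<lambda>i. \<bar>f i\<bar>" "L powi a"] by auto

lemma powi_le_mult: "L powi a <= x ==> L powi b <= y ==> c <= a + b ==> L powi c <= x * y"
proof -
 assume a: "L powi a <= x" "L powi b <= y" and c: "c <= a + b"
 have "L powi c <= L powi a * L powi b" using powi_mono[OF c] by (simp add: powi_mult)
 also have "\<dots> <= x * y" using a by (intro mult_mono) (auto intro: order_trans[OF powi_pos(2)])
 finally show ?thesis .
qed

lemma powi_le_half: "L powi a <= x ==> c < a ==> L powi c <= x / 2"
 using powi_10[of c a] powi_pos(1)[of c] by linarith

end

text \<open>The squares of the relative deviations \<open>Z i\<close> average to order 1/n, so the
  logarithm of 1 + \<open>Z i\<close> is needed with its quadratic term and only the cube may be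
  dropped. Along the segment t z the remainder has derivative t^2 z^3 / (1 + t z), and 1 + t z is at
  least 1/2.\<close>

lemma ln_one_plus_third_order:
 fixes z :: real
 assumes z: "\<bar>z\<bar> <= 1 / 2"
 shows "\<bar>ln (1 + z) - z + z\<^sup>2 / 2\<bar> <= 2 * \<bar>z\<bar> ^ 3"
proof -
 define f where "f = (\<lambda>t. ln (1 + t * z) - t * z + (t * z)\<^sup>2 / 2)"
 have pos: "1 + t * z >= 1 / 2" if "0 <= t" "t <= 1" for t
 proof -
  have "\<bar>t * z\<bar> <= 1 * (1 / 2)" unfolding abs_mult using that z by (intro mult_mono) auto
  then show ?thesis by linarith
 qed
 have D: "(f has_real_derivative z / (1 + t * z) - z + t * z * z) (at t)" if "0 <= t" "t <= 1" for t
  unfolding f_def using pos[OF that]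
  by (auto intro!: derivative_eq_intros simp: power2_eq_square field_simps)
 have "\<exists>t. 0 < t \<and> t < 1 \<and> f 1 - f 0 = (1 - 0) * (z / (1 + t * z) - z + t * z * z)"
  by (rule MVT2) (use D in auto)
 then obtain t where t: "0 < t" "t < 1" and e: "f 1 - f 0 = z / (1 + t * z) - z + t * z * z" by auto
 have p: "1 + t * z >= 1 / 2" using pos t by auto
 have "z / (1 + t * z) - z + t * z * z = t\<^sup>2 * z ^ 3 / (1 + t * z)"
  using p by (simp add: field_simps power2_eq_square power3_eq_cube)
 then have "\<bar>f 1 - f 0\<bar> = t\<^sup>2 * \<bar>z\<bar> ^ 3 / (1 + t * z)"
  using p e by (simp add: abs_mult power_abs)
 also have "\<dots> <= (1 * \<bar>z\<bar> ^ 3) / (1 / 2)"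
  using p t by (intro frac_le mult_right_mono) (auto simp: power_le_one)
 finally show ?thesis by (simp add: f_def)
qed

text \<open>Up to the factor 1/n this is the \<open>k\<close>-th derivative of the empirical moment
  generating function of one group's predictors. \<open>wmean\<close> and \<open>wvar\<close> are
  therefore the first two derivatives of its logarithm, the mean and variance under the
  exponentially tilted empirical law.\<close>

definition wsum :: "nat => (nat => real) => nat => real => real" where
 "wsum n x k b = (\<Sum>j=1..n. x j ^ k * exp (b * x j))"

definition wmean :: "nat => (nat => real) => real => real" where
 "wmean n x b = wsum n x 1 b / wsum n x 0 b"

definition wvar :: "nat => (nat => real) => real => real" where
 "wvar n x b = wsum n x 2 b / wsum n x 0 b - (wmean n x b)\<^sup>2"

lemma wsum_0_pos: "n >= 1 ==> wsum n x 0 b > 0"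
 unfolding wsum_def by (intro sum_pos) auto

lemma wsum_deriv: "((\<lambda>b. wsum n x k b) has_real_derivative wsum n x (Suc k) b) (at b)"
 unfolding wsum_def by (auto intro!: derivative_eq_intros sum.cong)

lemma wmean_deriv:
 assumes "n >= 1"
 shows "((\<lambda>b. wmean n x b) has_real_derivative wvar n x b) (at b)"
proof -
 have p: "wsum n x 0 b > 0" using wsum_0_pos[OF assms] .
 have "((\<lambda>b. wsum n x 1 b / wsum n x 0 b) has_real_derivative
   (wsum n x 2 b * wsum n x 0 b - wsum n x 1 b * wsum n x 1 b) / (wsum n x 0 b * wsum n x 0 b)) (at b)"
  using DERIV_divide[OF wsum_deriv[of n x 1 b] wsum_deriv[of n x 0 b]] p
  by (simp add: numeral_2_eq_2)
 moreover have "(wsum n x 2 b * wsum n x 0 b - wsum n x 1 b * wsum n x 1 b) / (wsum n x 0 b * wsum n x 0 b)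
   = wvar n x b"
  using p by (simp add: wvar_def wmean_def field_simps power2_eq_square)
 ultimately show ?thesis by (simp add: wmean_def[abs_def])
qed

lemma ln_wsum_deriv:
 assumes "n >= 1"
 shows "((\<lambda>b. ln (wsum n x 0 b)) has_real_derivative wmean n x b) (at b)"
 using wsum_0_pos[OF assms, of x b]
 by (auto intro!: derivative_eq_intros wsum_deriv simp: wmean_def)

text \<open>Steiner's identity. The centre \<open>c = wmean n x b\<close> gives nonnegativity; the
  mean at a different tilt, taken as centre, gives the upper bound behind
  \<open>wvar_tilt\<close>.\<close>

lemma wvar_alt:
 assumes "n >= 1"
 shows "(\<Sum>j=1..n. (x j - c)\<^sup>2 * exp (b * x j)) / wsum n x 0 b = wvar n x b + (wmean n x b - c)\<^sup>2"
proof -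
 have p: "wsum n x 0 b > 0" using wsum_0_pos[OF assms] .
 have "(\<Sum>j=1..n. (x j - c)\<^sup>2 * exp (b * x j)) = wsum n x 2 b - 2 * c * wsum n x 1 b + c\<^sup>2 * wsum n x 0 b"
  unfolding wsum_def sum_distrib_left sum_subtractf[symmetric] sum.distrib[symmetric]
  by (intro sum.cong) (auto simp: power2_eq_square algebra_simps)
 then have "(\<Sum>j=1..n. (x j - c)\<^sup>2 * exp (b * x j)) / wsum n x 0 b
   = (wsum n x 2 b - 2 * c * wsum n x 1 b + c\<^sup>2 * wsum n x 0 b) / wsum n x 0 b" by simp
 then show ?thesis using p
  unfolding wvar_def wmean_def by (simp add: diff_divide_distrib add_divide_distrib power2_eq_square algebra_simps)
qed

lemma wvar_nonneg:
 assumes "n >= 1"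
 shows "wvar n x b >= 0"
proof -
 have "0 <= (\<Sum>j=1..n. (x j - wmean n x b)\<^sup>2 * exp (b * x j)) / wsum n x 0 b"
  using wsum_0_pos[OF assms, of x b] by (intro divide_nonneg_nonneg sum_nonneg) auto
 then show ?thesis using wvar_alt[OF assms, of x "wmean n x b" b] by simp
qed

lemma wmean_abs_le:
 assumes "n >= 1" and "\<And>j. j \<in> {1..n} ==> \<bar>x j\<bar> <= c"
 shows "\<bar>wmean n x b\<bar> <= c"
proof -
 have p: "wsum n x 0 b > 0" using wsum_0_pos[OF assms(1)] .
 have "\<bar>wsum n x 1 b\<bar> <= (\<Sum>j=1..n. \<bar>x j ^ 1 * exp (b * x j)\<bar>)"
  unfolding wsum_def by (rule sum_abs)
 also have "\<dots> <= (\<Sum>j=1..n. c * exp (b * x j))"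
  using assms(2) by (intro sum_mono) (auto simp: abs_mult)
 also have "\<dots> = c * wsum n x 0 b" by (simp add: wsum_def sum_distrib_left)
 finally show ?thesis using p by (simp add: wmean_def abs_divide field_simps)
qed

lemma wvar_le:
 assumes "n >= 1" and "\<And>j. j \<in> {1..n} ==> \<bar>x j\<bar> <= c"
 shows "wvar n x b <= c\<^sup>2"
proof -
 have p: "wsum n x 0 b > 0" using wsum_0_pos[OF assms(1)] .
 have "wvar n x b <= wsum n x 2 b / wsum n x 0 b" by (simp add: wvar_def)
 also have "wsum n x 2 b <= (\<Sum>j=1..n. c\<^sup>2 * exp (b * x j))" unfolding wsum_def
  using assms(2) by (intro sum_mono mult_right_mono) (auto intro: abs_le_square_iff[THEN iffD1] order_trans[OF _ abs_ge_self])
 also have "\<dots> = c\<^sup>2 * wsum n x 0 b" by (simp add: wsum_def sum_distrib_left)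
 finally show ?thesis using p by (simp add: field_simps)
qed

text \<open>The variance minimises the weighted square distance to a point, and tilting by \<open>b' - b\<close>
 changes each weight by a factor between \<open>exp (- d c)\<close> and \<open>exp (d c)\<close>.\<close>

lemma wvar_tilt:
 assumes n: "n >= 1" and x: "\<And>j. j \<in> {1..n} ==> \<bar>x j\<bar> <= c" and d: "\<bar>b' - b\<bar> <= d"
 shows "wvar n x b' <= exp (2 * d * c) * wvar n x b"
proof -
 have p: "wsum n x 0 b > 0" "wsum n x 0 b' > 0" using wsum_0_pos[OF n] by auto
 have c0: "c >= 0" using x[of 1] n by force
 have dx: "\<bar>(b' - b) * x j\<bar> <= d * c" if "j \<in> {1..n}" for j
  unfolding abs_mult using x[OF that] d c0 by (intro mult_mono) auto
 have up: "exp (b' * x j) <= exp (d * c) * exp (b * x j)" if "j \<in> {1..n}" for j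
  using dx[OF that] unfolding exp_add[symmetric] by (simp add: algebra_simps abs_le_iff)
 have lo: "exp (b * x j) <= exp (d * c) * exp (b' * x j)" if "j \<in> {1..n}" for j
  using dx[OF that] unfolding exp_add[symmetric] by (simp add: algebra_simps abs_le_iff)
 define N where "N = (\<lambda>b'. \<Sum>j=1..n. (x j - wmean n x b)\<^sup>2 * exp (b' * x j))"
 have "wvar n x b' <= N b' / wsum n x 0 b'"
  using wvar_alt[OF n, of x "wmean n x b" b'] by (simp add: N_def)
 also have "\<dots> <= (exp (d * c) * N b) / (wsum n x 0 b / exp (d * c))"
 proof (rule frac_le)
  show "N b' <= exp (d * c) * N b" unfolding N_def sum_distrib_left
  proof (intro sum_mono)
   fix j assume j: "j \<in> {1..n}"
   have "(x j - wmean n x b)\<^sup>2 * exp (b' * x j) <= (x j - wmean n x b)\<^sup>2 * (exp (d * c) * exp (b * x j))"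
    by (intro mult_left_mono up j) auto
   then show "(x j - wmean n x b)\<^sup>2 * exp (b' * x j) <= exp (d * c) * ((x j - wmean n x b)\<^sup>2 * exp (b * x j))"
    by (simp add: mult_ac)
  qed
  have "wsum n x 0 b <= exp (d * c) * wsum n x 0 b'"
   unfolding wsum_def sum_distrib_left using lo by (intro sum_mono) auto
  then show "wsum n x 0 b / exp (d * c) <= wsum n x 0 b'" by (simp add: field_simps)
  show "0 <= exp (d * c) * N b" unfolding N_def by (intro mult_nonneg_nonneg sum_nonneg) auto
 qed (use p in auto)
 also have "\<dots> = exp (2 * d * c) * (N b / wsum n x 0 b)"
  by (simp add: field_simps exp_add[symmetric])
 also have "N b / wsum n x 0 b = wvar n x b"
  using wvar_alt[OF n, of x "wmean n x b" b] by (simp add: N_def)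
 finally show ?thesis .
qed

section \<open>Stationary points on good data\<close>

text \<open>The stationarity equations of the likelihood; \<open>G i\<close> is the fitted total of group \<open>i\<close>. The inequality
 is redundant for \<open>s > 0\<close>, where it follows from the other equations; it characterises maximisers on the boundary \<open>s = 0\<close>.\<close>

definition gva_eq :: "nat => nat => (nat => nat => real) => (nat => nat => nat) => real => real => real =>
  (nat => real) => (nat => real) => (nat => real) => bool" where
 "gva_eq m n x y \<beta>0 \<beta>1 s \<mu> lam G \<longleftrightarrow> s >= 0 \<and>
   (\<forall>i\<in>{1..m}. G i = exp \<beta>0 * wsum n (x i) 0 \<beta>1 * exp (\<mu> i + lam i / 2) \<and>
    \<mu> i = s * (real (\<Sum>j=1..n. y i j) - G i) \<and> lam i = s / (1 + s * G i)) \<and>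
   (\<Sum>i=1..m. G i) = (\<Sum>i=1..m. real (\<Sum>j=1..n. y i j)) \<and>
   (\<Sum>i=1..m. G i * wmean n (x i) \<beta>1) = (\<Sum>i=1..m. \<Sum>j=1..n. x i j * real (y i j)) \<and>
   (\<Sum>i=1..m. (real (\<Sum>j=1..n. y i j) - G i)\<^sup>2) <= (\<Sum>i=1..m. real (\<Sum>j=1..n. y i j)) \<and>
   s = avg m (\<lambda>i. (\<mu> i)\<^sup>2 + lam i)"

text \<open>All randomness is discharged into these inequalities, and everything inside the locale
  is deterministic. The thresholds are standard deviations padded by powers of \<open>L\<close>.
  Here \<open>\<theta> i\<close> is the conditional mean of the group total and lies between
  \<open>L powi 198\<close> and \<open>L powi 202\<close>, so \<open>Z i\<close> has conditional
  standard deviation at most \<open>L powi -99\<close>. The averages of terms of order 1/n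
  (\<open>Z2_avg\<close> to \<open>st2\<close>) gain a further factor
  \<open>q <= L powi -100\<close>, which takes them from about \<open>L powi -198\<close> below
  \<open>L powi -250\<close>.\<close>

locale good_data = scale L for L +
 fixes m n :: nat and b0 b1 s0 \<gamma> I q :: real
  and x :: "nat => nat => real" and u :: "nat => real" and y :: "nat => nat => nat"
  and Y \<theta> Z R :: "nat => real"
 defines "Y i \<equiv> real (\<Sum>j=1..n. y i j)"
  and "\<theta> i \<equiv> exp (b0 + u i) * wsum n (x i) 0 b1"
  and "Z i \<equiv> Y i / \<theta> i - 1"
  and "R i \<equiv> wmean n (x i) b1"
 assumes m1: "m >= 1" and nL: "real n = L powi 200"
  and q: "0 < q" "q <= L powi -100"
  and s0: "1 / L <= s0" "s0 <= L" and I: "1 / L <= I" "I <= L"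
  and x_bd: "\<And>i j. i \<in> {1..m} ==> j \<in> {1..n} ==> \<bar>x i j\<bar> <= L"
  and ex_bd: "\<And>i j. i \<in> {1..m} ==> j \<in> {1..n} ==> 1 / L <= exp (b0 + b1 * x i j) \<and> exp (b0 + b1 * x i j) <= L"
  and u_bd: "\<And>i. i \<in> {1..m} ==> \<bar>u i\<bar> <= L"
  and eu_bd: "\<And>i. i \<in> {1..m} ==> 1 / L <= exp (u i) \<and> exp (u i) <= L"
  and Z_bd: "\<And>i. i \<in> {1..m} ==> \<bar>Z i\<bar> <= L powi -97"
  and R_avg: "avg m (\<lambda>i. \<bar>R i - \<gamma>\<bar>) <= L powi -90"
  and u_avg: "\<bar>avg m u\<bar> <= q * L" and u2_avg: "\<bar>avg m (\<lambda>i. (u i)\<^sup>2) - s0\<bar> <= q * L"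
  and uw_avg: "\<bar>avg m (\<lambda>i. u i * (R i - avg m R))\<bar> <= q * L powi 5"
  and Zw_avg: "\<bar>avg m (\<lambda>i. Z i * (R i - avg m R))\<bar> <= q * L powi 5"
  and Z_avg: "\<bar>avg m Z\<bar> <= q * L powi -10" and uZ_avg: "\<bar>avg m (\<lambda>i. u i * Z i)\<bar> <= q * L powi -10"
  and Z2_avg: "\<bar>avg m (\<lambda>i. (Z i)\<^sup>2 - 1 / \<theta> i)\<bar> <= L powi -250"
  and uZ2_avg: "\<bar>avg m (\<lambda>i. u i * ((Z i)\<^sup>2 - 1 / \<theta> i))\<bar> <= L powi -250"
  and st1: "\<bar>avg m (\<lambda>i. (1 + u i / s0) / \<theta> i)\<bar> <= L powi -250"
  and st2: "\<bar>avg m (\<lambda>i. (1 - u i - (u i)\<^sup>2 / s0) / \<theta> i)\<bar> <= L powi -250"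
  and S_avg: "\<bar>avg m (\<lambda>i. \<Sum>j=1..n. (x i j - R i) * real (y i j))\<bar> <= q * L powi 106"
  and I_avg: "\<bar>avg m (\<lambda>i. Y i * wvar n (x i) b1) - real n * I\<bar> <= L powi 180"
begin

section \<open>A priori bounds on good data\<close>

definition S :: real where "S = avg m (\<lambda>i. \<Sum>j=1..n. (x i j - R i) * real (y i j))"

lemma n1: "n >= 1"
 using nL powi_pos(1)[of 200] by (cases n) auto

lemma ub_u: "i \<in> {1..m} ==> ub 1 (u i)"
 using u_bd by (simp add: ub_def)

lemma ub_Z: "i \<in> {1..m} ==> ub (-97) (Z i)"
 using Z_bd by (simp add: ub_def)

lemma inv_L: "1 / L = L powi -1"
 by (simp add: power_int_minus divide_inverse)

lemma ub_s0: "ub 1 s0" "L powi -1 <= s0" "s0 > 0"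
proof -
 show l: "L powi -1 <= s0" using s0 by (simp only: inv_L)
 show p: "s0 > 0" using l powi_pos(1)[of "-1"] by linarith
 show "ub 1 s0" using s0 p by (simp add: ub_def)
qed

lemma ub_I: "ub 1 I" "L powi -1 <= I" "I > 0"
proof -
 show l: "L powi -1 <= I" using I by (simp only: inv_L)
 show p: "I > 0" using l powi_pos(1)[of "-1"] by linarith
 show "ub 1 I" using I p by (simp add: ub_def)
qed

lemma wsum_bd:
 assumes i: "i \<in> {1..m}"
 shows "L powi 199 <= exp b0 * wsum n (x i) 0 b1" "exp b0 * wsum n (x i) 0 b1 <= L powi 201"
proof -
 have e: "exp b0 * wsum n (x i) 0 b1 = (\<Sum>j=1..n. exp (b0 + b1 * x i j))"
  by (simp add: wsum_def sum_distrib_left exp_add)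
 have "(\<Sum>j=1..n. 1 / L) <= (\<Sum>j=1..n. exp (b0 + b1 * x i j))"
  using ex_bd[OF i] by (intro sum_mono) auto
 moreover have "(\<Sum>j=1..n. 1 / L) = L powi 200 * L powi -1" by (simp only: inv_L sum_constant) (simp add: nL)
 ultimately show "L powi 199 <= exp b0 * wsum n (x i) 0 b1" by (simp add: e powi_mult)
 have "(\<Sum>j=1..n. exp (b0 + b1 * x i j)) <= (\<Sum>j=1..n. L)"
  using ex_bd[OF i] by (intro sum_mono) auto
 also have "(\<Sum>j=1..n. L) = L powi 201" using powi_mult[of 200 1] by (simp add: nL)
 finally show "exp b0 * wsum n (x i) 0 b1 <= L powi 201" by (simp add: e)
qed

lemma th_bd:
 assumes i: "i \<in> {1..m}"
 shows "L powi 198 <= \<theta> i" "\<theta> i <= L powi 202" "\<theta> i > 0"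
proof -
 have e: "\<theta> i = (exp b0 * wsum n (x i) 0 b1) * exp (u i)" by (simp add: \<theta>_def exp_add)
 have "L powi -1 <= exp (u i)" using eu_bd[OF i] by (simp only: inv_L)
 then show l: "L powi 198 <= \<theta> i" unfolding e by (rule powi_le_mult[OF wsum_bd(1)[OF i]]) simp
 then show "\<theta> i > 0" using powi_pos(1)[of 198] by linarith
 have "\<theta> i <= L powi 201 * L powi 1" unfolding e
  using wsum_bd[OF i] eu_bd[OF i] by (intro mult_mono) auto
 then show "\<theta> i <= L powi 202" by (simp only: powi_mult) simp
qed

lemma ub_small: "ub a z ==> a <= -1 ==> \<bar>z\<bar> <= 1 / 2"
proof -
 assume "ub a z" "a <= -1"
 then have "\<bar>z\<bar> <= 1 / L" using powi_mono[of a "-1"] unfolding ub_def inv_L by linarith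
 also have "\<dots> <= 1 / 2" using L10 by (intro frac_le) auto
 finally show ?thesis .
qed

lemma Y_eq: "i \<in> {1..m} ==> Y i = \<theta> i * (1 + Z i)"
 using th_bd(3)[of i] by (simp add: Z_def)

lemma Y_bd:
 assumes i: "i \<in> {1..m}"
 shows "L powi 197 <= Y i" "Y i <= L powi 203" "Y i > 0"
proof -
 have z: "\<bar>Z i\<bar> <= 1 / 2" using ub_small[OF ub_Z[OF i]] by simp
 have t: "\<theta> i > 0" using th_bd[OF i] by simp
 have "\<theta> i * (1 / 2) <= \<theta> i * (1 + Z i)" using z t by (intro mult_left_mono) linarith+
 then have "\<theta> i / 2 <= Y i" unfolding Y_eq[OF i] by simp
 moreover have "L powi 197 <= \<theta> i / 2" by (rule powi_le_half[OF th_bd(1)[OF i]]) simp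
 ultimately show l: "L powi 197 <= Y i" by simp
 then show "Y i > 0" using powi_pos(1)[of 197] by linarith
 have "\<theta> i * (1 + Z i) <= \<theta> i * 2" using z t by (intro mult_left_mono) linarith+
 then have "Y i <= 2 * \<theta> i" unfolding Y_eq[OF i] by simp
 also have "\<dots> <= 10 * L powi 202" using th_bd[OF i] by linarith
 also have "\<dots> <= L powi 203" by (rule powi_10) simp
 finally show "Y i <= L powi 203" .
qed

lemma R_bd: "i \<in> {1..m} ==> ub 1 (wmean n (x i) b)"
 using wmean_abs_le[OF n1, of "x i" L] x_bd by (simp add: ub_def)

lemma V_bd: "i \<in> {1..m} ==> ub 2 (wvar n (x i) b)"
proof -
 assume i: "i \<in> {1..m}"
 have "wvar n (x i) b <= L\<^sup>2" using wvar_le[OF n1, of "x i" L] x_bd[OF i] by auto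
 moreover have "L powi 2 = L\<^sup>2" by (simp add: power_int_def)
 ultimately show ?thesis using wvar_nonneg[OF n1, of "x i" b] by (simp add: ub_def)
qed

text \<open>\<open>wvar_tilt\<close> in both directions: predictors bounded by \<open>L\<close> and
  a shift of at most \<open>L powi -90\<close> give the factor exp(2 L^-89), whose distance from 1
  is below \<open>L powi -88\<close>.\<close>

lemma V_tilt:
 assumes i: "i \<in> {1..m}" and d: "ub (-90) (b - b')"
 shows "\<bar>wvar n (x i) b' - wvar n (x i) b\<bar> <= L powi -88 * wvar n (x i) b"
proof -
 define c where "c = exp (2 * L powi -90 * L)"
 have e: "2 * L powi -90 * L = 2 * L powi -89" using powi_mult[of "-90" 1] by simp
 have sm: "2 * L powi -89 <= 1" using ub_small[of "-89" "L powi -89"] by (simp add: ub_def)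
 have c: "c <= 1 + 4 * L powi -89"
 proof -
  have "c <= 1 + 2 * L powi -89 + (2 * L powi -89)\<^sup>2"
   unfolding c_def e by (rule exp_bound) (use sm in auto)
  also have "(2 * L powi -89)\<^sup>2 <= (2 * L powi -89) * 1"
   unfolding power2_eq_square by (rule mult_left_mono[OF sm]) simp
  finally show ?thesis by simp
 qed
 have x: "\<And>j. j \<in> {1..n} ==> \<bar>x i j\<bar> <= L" using x_bd[OF i] by auto
 have 1: "wvar n (x i) b' <= c * wvar n (x i) b"
  unfolding c_def by (rule wvar_tilt[OF n1 x]) (use d in \<open>auto simp: ub_def\<close>)
 have 2: "wvar n (x i) b <= c * wvar n (x i) b'"
  unfolding c_def by (rule wvar_tilt[OF n1 x]) (use d in \<open>auto simp: ub_def\<close>)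
 have v: "wvar n (x i) b >= 0" "wvar n (x i) b' >= 0" using wvar_nonneg[OF n1] by auto
 have c1: "1 <= c" unfolding c_def by simp
 have k: "4 * L powi -89 <= L powi -88" using powi_10[of "-89" "-88"] powi_pos(1)[of "-89"] by linarith
 have A: "wvar n (x i) b' - wvar n (x i) b <= L powi -88 * wvar n (x i) b"
 proof -
  have "c * wvar n (x i) b <= (1 + L powi -88) * wvar n (x i) b" using c k v by (intro mult_right_mono) linarith+
  then show ?thesis using 1 by (simp add: algebra_simps)
 qed
 have B: "wvar n (x i) b - wvar n (x i) b' <= L powi -88 * wvar n (x i) b"
 proof -
  have "wvar n (x i) b / c <= wvar n (x i) b'" using 2 c1 by (simp add: field_simps)
  moreover have "1 - (c - 1) <= 1 / c"
  proof -
   have "(2 - c) * c <= 1" using zero_le_power2[of "c - 1"] by (simp add: power2_eq_square algebra_simps)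
   then show ?thesis using c1 by (simp add: field_simps)
  qed
  ultimately have "(1 - (c - 1)) * wvar n (x i) b <= wvar n (x i) b'"
   using mult_right_mono[OF _ v(1), of "1 - (c - 1)" "1 / c"] by simp
  moreover have "(c - 1) * wvar n (x i) b <= L powi -88 * wvar n (x i) b" using c k v by (intro mult_right_mono) linarith+
  ultimately show ?thesis by (simp add: algebra_simps)
 qed
 show ?thesis using A B by linarith
qed

lemma wmean_mvt:
 "\<exists>\<xi>. \<bar>\<xi> - b1\<bar> <= \<bar>b - b1\<bar> \<and> wmean n (x i) b - wmean n (x i) b1 = (b - b1) * wvar n (x i) \<xi>"
proof (cases b b1 rule: linorder_cases)
 case less
 then obtain z where "b < z" "z < b1" "wmean n (x i) b1 - wmean n (x i) b = (b1 - b) * wvar n (x i) z"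
  using MVT2[OF less, of "wmean n (x i)" "wvar n (x i)"] wmean_deriv[OF n1] by auto
 then show ?thesis by (intro exI[of _ z]) (auto simp: algebra_simps)
next
 case greater
 then obtain z where "b1 < z" "z < b" "wmean n (x i) b - wmean n (x i) b1 = (b - b1) * wvar n (x i) z"
  using MVT2[OF greater, of "wmean n (x i)" "wvar n (x i)"] wmean_deriv[OF n1] by auto
 then show ?thesis by (intro exI[of _ z]) auto
qed auto

lemma ln_wsum_mvt:
 "\<exists>\<xi>. ln (wsum n (x i) 0 b) - ln (wsum n (x i) 0 b1) = (b - b1) * wmean n (x i) \<xi>"
proof (cases b b1 rule: linorder_cases)
 case less
 then obtain z where "b < z" "z < b1" "ln (wsum n (x i) 0 b1) - ln (wsum n (x i) 0 b) = (b1 - b) * wmean n (x i) z"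
  using MVT2[OF less, of "\<lambda>b. ln (wsum n (x i) 0 b)" "wmean n (x i)"] ln_wsum_deriv[OF n1] by auto
 then show ?thesis by (intro exI[of _ z]) (auto simp: algebra_simps)
next
 case greater
 then obtain z where "b1 < z" "z < b" "ln (wsum n (x i) 0 b) - ln (wsum n (x i) 0 b1) = (b - b1) * wmean n (x i) z"
  using MVT2[OF greater, of "\<lambda>b. ln (wsum n (x i) 0 b)" "wmean n (x i)"] ln_wsum_deriv[OF n1] by auto
 then show ?thesis by (intro exI[of _ z]) auto
qed auto

section \<open>The slope score as a function of the slope\<close>

lemma wmean_mono: "b <= b' ==> wmean n (x i) b <= wmean n (x i) b'"
 using DERIV_nonneg_imp_nondecreasing[of b b' "wmean n (x i)"] wmean_deriv[OF n1] wvar_nonneg[OF n1] by blast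

text \<open>The derivative, averaged over groups, of the multinomial log-likelihood of the responses
  given the group totals. Intercept and random effects have dropped out of it, which is why the
  slope can be located before anything else; concavity of that likelihood is
  \<open>score_antimono\<close>.\<close>

definition score :: "real => real" where
 "score b = avg m (\<lambda>i. (\<Sum>j=1..n. x i j * real (y i j)) - Y i * wmean n (x i) b)"

lemma score_b1: "score b1 = S"
 unfolding score_def S_def R_def Y_def
 by (intro avg_cong) (simp add: left_diff_distrib sum_subtractf sum_distrib_left[symmetric] mult.commute[of _ "wmean _ _ _"])

lemma score_antimono: "b <= b' ==> score b' <= score b"
 unfolding score_def using Y_bd(3) by (intro avg_mono diff_left_mono mult_left_mono wmean_mono) (auto simp: less_imp_le)

text \<open>A secant form of the score. The mean value theorem is applied group by group, so every
  group has its own tilt \<open>\<xi> i\<close>; \<open>V_tilt\<close> shows that the resulting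
  secant slope \<open>K\<close> is still the total information \<open>real n * I\<close> up to a
  small relative error.\<close>

lemma score_expand:
 assumes d: "ub (-90) (b - b1)"
 shows "\<exists>K. score b = S - (b - b1) * K \<and> \<bar>K - real n * I\<bar> <= L powi 181"
proof -
 have "\<forall>i. \<exists>\<xi>. \<bar>\<xi> - b1\<bar> <= \<bar>b - b1\<bar> \<and> wmean n (x i) b - wmean n (x i) b1 = (b - b1) * wvar n (x i) \<xi>"
  using wmean_mvt by auto
 then obtain \<xi> where \<xi>: "\<And>i. \<bar>\<xi> i - b1\<bar> <= \<bar>b - b1\<bar>"
  "\<And>i. wmean n (x i) b - wmean n (x i) b1 = (b - b1) * wvar n (x i) (\<xi> i)" by metis
 define K where "K = avg m (\<lambda>i. Y i * wvar n (x i) (\<xi> i))"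
 have "score b - S = avg m (\<lambda>i. - (b - b1) * (Y i * wvar n (x i) (\<xi> i)))"
  unfolding score_b1[symmetric] score_def avg_diff[symmetric]
 proof (intro avg_cong)
  fix i
  have "Y i * (wmean n (x i) b - wmean n (x i) b1) = (b - b1) * (Y i * wvar n (x i) (\<xi> i))"
   unfolding \<xi>(2) by simp
  then show "(\<Sum>j = 1..n. x i j * real (y i j)) - Y i * wmean n (x i) b -
     ((\<Sum>j = 1..n. x i j * real (y i j)) - Y i * wmean n (x i) b1) =
     - (b - b1) * (Y i * wvar n (x i) (\<xi> i))" by (simp add: right_diff_distrib left_diff_distrib)
 qed
 also have "\<dots> = - (b - b1) * K"
  unfolding K_def avg_cmult[symmetric] by simp
 finally have e: "score b = S - (b - b1) * K" by (simp add: algebra_simps)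
 have "\<bar>K - avg m (\<lambda>i. Y i * wvar n (x i) b1)\<bar> <= avg m (\<lambda>i. \<bar>Y i * wvar n (x i) (\<xi> i) - Y i * wvar n (x i) b1\<bar>)"
  unfolding K_def avg_diff[symmetric] by (rule abs_avg_le)
 also have "\<dots> <= L powi 120"
 proof (rule avg_le_const[OF m1])
  fix i assume i: "i \<in> {1..m}"
  have d': "ub (-90) (b1 - \<xi> i)" using d \<xi>(1)[of i] unfolding ub_def by linarith
  have "ub (-86) (L powi -88 * wvar n (x i) b1)"
   by (rule ub_mult[of "-88" _ 2]) (use V_bd[OF i] in \<open>auto simp: ub_def\<close>)
  then have "ub (-86) (wvar n (x i) (\<xi> i) - wvar n (x i) b1)"
   by (rule ub_le) (use V_tilt[OF i d'] in linarith)
  then have "ub 120 (Y i * (wvar n (x i) (\<xi> i) - wvar n (x i) b1))"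
   by (rule ub_mult[rotated, of "-86" _ 203]) (use Y_bd[OF i] in \<open>auto simp: ub_def\<close>)
  then show "\<bar>Y i * wvar n (x i) (\<xi> i) - Y i * wvar n (x i) b1\<bar> <= L powi 120"
   by (simp add: ub_def right_diff_distrib)
 qed
 finally have "\<bar>K - real n * I\<bar> <= L powi 120 + L powi 180" using I_avg by linarith
 also have "\<dots> <= L powi 181" using powi_mono[of 120 180] powi_10[of 180 181] powi_pos(1)[of 180] by linarith
 finally show ?thesis using e by blast
qed

lemma nI: "L powi 199 <= real n * I"
 unfolding nL using powi_le_mult[of 200 "L powi 200" "-1" I 199] ub_I by simp

lemma K_ge: "\<bar>K - real n * I\<bar> <= L powi 182 ==> L powi 198 <= K"
 using nI powi_10[of 198 199] powi_10[of 182 198] powi_pos(1)[of 198] by linarith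

end

section \<open>Errors on the two scales m^(-1/2) and 1/n\<close>

context good_data begin

text \<open>Since m may be any large power of n, a multiple of \<open>q = m^(-1/2)\<close> cannot be
  traded for a power of \<open>L\<close> without loss. Final errors are therefore tracked by a pair
  of exponents, one for the sampling scale \<open>q\<close> and one for the deterministic scale n,
  matching the two summands inside the o_p of the theorem.\<close>

definition vb :: "int => int => real => bool" where "vb a b z \<longleftrightarrow> \<bar>z\<bar> <= q * L powi a + L powi b"

lemma q_mono: "a <= b ==> q * L powi a <= q * L powi b"
 using q powi_mono by (intro mult_left_mono) auto

lemma q_ub: "q * L powi a <= L powi (a - 100)"
proof -
 have "q * L powi a <= L powi -100 * L powi a" using q by (intro mult_right_mono) auto
 then show ?thesis by (simp add: powi_mult)
qed

lemma vb_of_ub: "ub b z ==> vb a b z"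
 using q mult_pos_pos[OF q(1) powi_pos(1)[of a]] unfolding ub_def vb_def by linarith

lemma vb_of_q: "\<bar>z\<bar> <= q * L powi a ==> vb a b z"
 unfolding vb_def using powi_pos(1)[of b] by linarith

lemma vb_minus [simp]: "vb a b (- z) = vb a b z" by (simp add: vb_def)

lemma vb_mono: "vb a b z ==> a <= c ==> b <= d ==> vb c d z"
 using q_mono[of a c] powi_mono[of b d] unfolding vb_def by linarith

lemma vb_add: "vb a b z ==> vb a' b' w ==> a < c ==> a' < c ==> b < d ==> b' < d ==> vb c d (z + w)"
proof -
 assume h: "vb a b z" "vb a' b' w" "a < c" "a' < c" "b < d" "b' < d"
 have "q * (10 * L powi a) <= q * L powi c" "q * (10 * L powi a') <= q * L powi c"
  using h q powi_10 by (auto intro!: mult_left_mono)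
 moreover have "10 * L powi b <= L powi d" "10 * L powi b' <= L powi d" using h powi_10 by auto
 moreover have "q * L powi c > 0" "L powi d > 0" using q by auto
 ultimately show ?thesis using h(1,2) unfolding vb_def by linarith
qed

lemma vb_diff: "vb a b z ==> vb a' b' w ==> a < c ==> a' < c ==> b < d ==> b' < d ==> vb c d (z - w)"
 using vb_add[of a b z a' b' "- w" c d] by simp

lemma vb_mult: "vb a b z ==> ub e w ==> a + e <= c ==> b + e <= d ==> vb c d (z * w)"
proof -
 assume h: "vb a b z" "ub e w" "a + e <= c" "b + e <= d"
 have "\<bar>z * w\<bar> <= (q * L powi a + L powi b) * L powi e"
  using h(1,2) q unfolding vb_def ub_def abs_mult by (intro mult_mono) auto
 also have "\<dots> = q * L powi (a + e) + L powi (b + e)"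
  by (simp add: distrib_right mult.assoc powi_mult)
 also have "\<dots> <= q * L powi c + L powi d"
  using q_mono[OF h(3)] powi_mono[OF h(4)] by linarith
 finally show ?thesis by (simp add: vb_def)
qed

lemma vb_div: "vb a b z ==> L powi e <= \<bar>w\<bar> ==> a - e <= c ==> b - e <= d ==> vb c d (z / w)"
 using vb_mult[of a b z "- e" "1 / w" c d] ub_inverse[of e w "- e"] by simp

lemma vb_avg: "(\<And>i. i \<in> {1..m} ==> vb a b (f i)) ==> vb a b (avg m f)"
 unfolding vb_def using abs_avg_le[of m f] avg_le_const[OF m1, of "\<lambda>i. \<bar>f i\<bar>" "q * L powi a + L powi b"] by auto

lemma ub_ln:
 assumes "ub a z" "a <= -1"
 shows "ub (2 * a + 1) (ln (1 + z) - z)" "ub (a + 1) (ln (1 + z))"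
proof -
 have z: "\<bar>z\<bar> <= 1 / 2" using ub_small[OF assms] .
 have "ub (2 * a + 1) (2 * z\<^sup>2)"
  by (rule ub_mult[of 1 _ "2 * a"]) (auto intro: ub_const ub_sq[OF assms(1)])
 then show 1: "ub (2 * a + 1) (ln (1 + z) - z)"
  by (rule ub_le) (use abs_ln_one_plus_x_minus_x_bound[OF z] in auto)
 have "ub a (z * 1)" by (rule ub_mult[OF assms(1), of 0]) (auto intro: ub_one)
 have "ub (a + 1) (2 * z)" by (rule ub_cmult[OF _ assms(1)]) auto
 moreover have "\<bar>ln (1 + z)\<bar> <= 2 * \<bar>z\<bar>"
 proof -
  have "\<bar>ln (1 + z)\<bar> <= \<bar>z\<bar> + 2 * z\<^sup>2" using abs_ln_one_plus_x_minus_x_bound[OF z] by linarith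
  also have "2 * z\<^sup>2 <= \<bar>z\<bar>"
   using mult_left_mono[OF z, of "\<bar>z\<bar>"] by (simp add: power2_eq_square abs_mult_self_eq flip: abs_mult)
  finally show ?thesis by simp
 qed
 ultimately show "ub (a + 1) (ln (1 + z))" by (auto simp: ub_def)
qed

lemma ub_S: "\<bar>S\<bar> <= q * L powi 106"
 using S_avg by (simp add: S_def)

section \<open>Localisation of an arbitrary stationary point\<close>

context
 fixes \<beta>0 \<beta>1 s :: real and \<mu> lam G :: "nat => real"
 assumes eq: "gva_eq m n x y \<beta>0 \<beta>1 s \<mu> lam G"
begin

lemma s_nonneg: "s >= 0" using eq unfolding gva_eq_def by blast

lemma sum_G: "(\<Sum>i=1..m. G i) = (\<Sum>i=1..m. Y i)"
 using eq unfolding gva_eq_def Y_def by blast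

lemma sum_GR: "(\<Sum>i=1..m. G i * wmean n (x i) \<beta>1) = (\<Sum>i=1..m. \<Sum>j=1..n. x i j * real (y i j))"
 using eq unfolding gva_eq_def by blast

lemma sum_sq: "(\<Sum>i=1..m. (Y i - G i)\<^sup>2) <= (\<Sum>i=1..m. Y i)"
 using eq unfolding gva_eq_def Y_def by blast

lemma s_avg: "s = avg m (\<lambda>i. (\<mu> i)\<^sup>2 + lam i)"
 using eq unfolding gva_eq_def by blast

lemma G_eq: "i \<in> {1..m} ==> G i = exp \<beta>0 * wsum n (x i) 0 \<beta>1 * exp (\<mu> i + lam i / 2)"
 using eq unfolding gva_eq_def by blast

lemma G_pos: "i \<in> {1..m} ==> G i > 0"
 using G_eq[of i] wsum_0_pos[OF n1, of "x i" \<beta>1] by simp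

lemma mu_eq: "i \<in> {1..m} ==> \<mu> i = s * (Y i - G i)"
 using eq unfolding gva_eq_def Y_def by blast

lemma lam_eq: "i \<in> {1..m} ==> lam i = s / (1 + s * G i)"
 using eq unfolding gva_eq_def by blast

lemma lam_nonneg: "i \<in> {1..m} ==> lam i >= 0"
 unfolding lam_eq using s_nonneg G_pos[of i] by simp

lemma lam_le: "i \<in> {1..m} ==> lam i <= 1 / G i" "i \<in> {1..m} ==> lam i <= s"
proof -
 assume i: "i \<in> {1..m}"
 have g: "G i > 0" "s >= 0" using G_pos[OF i] s_nonneg by auto
 then have p: "1 + s * G i > 0" by (simp add: add_pos_nonneg)
 then show "lam i <= 1 / G i" unfolding lam_eq[OF i] using g by (simp add: field_simps)
 have "s * 1 <= s * (1 + s * G i)" using g by (intro mult_left_mono) auto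
 then show "lam i <= s" unfolding lam_eq[OF i] using p by (simp add: field_simps)
qed

lemma avg_G: "avg m G = avg m Y"
 unfolding avg_def sum_G ..

lemma avg_mu: "avg m \<mu> = 0"
proof -
 have "avg m \<mu> = avg m (\<lambda>i. s * (Y i - G i))" by (intro avg_cong mu_eq)
 then show ?thesis by (simp only: avg_cmult avg_diff) (simp add: avg_G)
qed

text \<open>The foothold: it follows from the inequality of \<open>gva_eq\<close> for every value of
  \<open>s\<close>, including 0, and presupposes nothing about the position of the stationary
  point.\<close>

lemma avg_sq: "avg m (\<lambda>i. (Y i - G i)\<^sup>2) <= L powi 203"
proof -
 have "avg m (\<lambda>i. (Y i - G i)\<^sup>2) <= avg m Y"
  unfolding avg_def by (intro divide_right_mono sum_sq) auto
 also have "\<dots> <= L powi 203" using Y_bd by (intro avg_le_const[OF m1])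
 finally show ?thesis .
qed

lemma s_eq: "s = avg m (\<lambda>i. (\<mu> i)\<^sup>2) + avg m lam"
 unfolding avg_add[symmetric] by (rule s_avg)

lemma score_beta1: "score \<beta>1 = avg m (\<lambda>i. (G i - Y i) * wmean n (x i) \<beta>1)"
 unfolding score_def avg_def using sum_GR by (simp add: left_diff_distrib sum_subtractf)

definition d0 :: real where "d0 = \<beta>0 - b0"
definition d1 :: real where "d1 = \<beta>1 - b1"

text \<open>Cauchy-Schwarz turns \<open>avg_sq\<close> into an average residual of at most
  \<open>L powi 102\<close>, of square-root order in n up to powers of \<open>L\<close>; the tilted
  means contribute one more factor \<open>L\<close>.\<close>

lemma score_small: "\<bar>score \<beta>1\<bar> <= L powi 103"
proof -
 have "\<bar>score \<beta>1\<bar> <= avg m (\<lambda>i. \<bar>(G i - Y i) * wmean n (x i) \<beta>1\<bar>)"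
  unfolding score_beta1 by (rule abs_avg_le)
 also have "\<dots> <= avg m (\<lambda>i. L * \<bar>Y i - G i\<bar>)"
 proof (rule avg_mono)
  fix i assume i: "i \<in> {1..m}"
  have "\<bar>wmean n (x i) \<beta>1\<bar> <= L" using R_bd[OF i] by (simp add: ub_def)
  then show "\<bar>(G i - Y i) * wmean n (x i) \<beta>1\<bar> <= L * \<bar>Y i - G i\<bar>"
   unfolding abs_mult by (subst mult.commute) (intro mult_mono, auto)
 qed
 also have "\<dots> = L * avg m (\<lambda>i. \<bar>Y i - G i\<bar>)" by (rule avg_cmult)
 also have "avg m (\<lambda>i. \<bar>Y i - G i\<bar>) <= sqrt (L powi 203)"
  using avg_abs_le_sqrt[OF m1, of "\<lambda>i. Y i - G i"] avg_sq real_sqrt_le_mono order_trans by blast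
 also have "sqrt (L powi 203) <= L powi 102"
  by (rule real_le_lsqrt) (auto simp: power2_eq_square powi_mult intro: powi_mono)
 finally show ?thesis using powi_mult[of 1 102] by simp
qed

text \<open>The score decreases with secant slope at least \<open>L powi 198\<close>. Hence at
  distance \<open>L powi -90\<close> from \<open>b1\<close> its absolute value already exceeds L^108
  - L^10, and by monotonicity even more so farther away, whereas \<open>score_small\<close> allows
  only L^103 at \<open>\<beta>1\<close>.\<close>

lemma crude_d1: "ub (-90) d1"
proof (rule ccontr)
 assume n: "\<not> ub (-90) d1"
 define \<delta> where "\<delta> = L powi -90"
 have S: "\<bar>S\<bar> <= L powi 10" using ub_S q_ub[of 106] powi_mono[of 6 10] by simp
 have e: "L powi 103 + L powi 10 < L powi 108"
  using powi_10[of 103 108] powi_mono[of 10 103] powi_pos(1)[of 103] by linarith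
 have *: "L powi 108 <= \<delta> * K" if "\<bar>K - real n * I\<bar> <= L powi 181" for K
 proof -
  have "L powi 198 <= K" using that powi_mono[of 181 182] by (intro K_ge) linarith
  then show ?thesis unfolding \<delta>_def by (intro powi_le_mult[of "-90" _ 198]) auto
 qed
 consider "d1 > \<delta>" | "d1 < - \<delta>" using n unfolding ub_def \<delta>_def by linarith
 then show False
 proof cases
  case 1
  obtain K where K: "score (b1 + \<delta>) = S - ((b1 + \<delta>) - b1) * K" "\<bar>K - real n * I\<bar> <= L powi 181"
   using score_expand[of "b1 + \<delta>"] by (auto simp: \<delta>_def ub_def)
  have "score \<beta>1 <= score (b1 + \<delta>)" using 1 by (intro score_antimono) (simp add: d1_def)
  then show False using K(1) *[OF K(2)] score_small S e by simp
 next
  case 2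
  obtain K where K: "score (b1 - \<delta>) = S - ((b1 - \<delta>) - b1) * K" "\<bar>K - real n * I\<bar> <= L powi 181"
   using score_expand[of "b1 - \<delta>"] by (auto simp: \<delta>_def ub_def)
  have "score \<beta>1 >= score (b1 - \<delta>)" using 2 by (intro score_antimono) (simp add: d1_def)
  then show False using K(1) *[OF K(2)] score_small S e by simp
 qed
qed

definition r :: "nat => real" where "r i = ln (wsum n (x i) 0 \<beta>1) - ln (wsum n (x i) 0 b1)"

lemma r_mvt: "\<exists>\<rho>. (\<forall>i. r i = d1 * \<rho> i) \<and> (\<forall>i\<in>{1..m}. ub 1 (\<rho> i))"
proof -
 have "\<forall>i. \<exists>\<xi>. r i = d1 * wmean n (x i) \<xi>" using ln_wsum_mvt[of _ \<beta>1] unfolding r_def d1_def by blast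
 then obtain \<xi> where "\<And>i. r i = d1 * wmean n (x i) (\<xi> i)" by metis
 then show ?thesis using R_bd by (intro exI[of _ "\<lambda>i. wmean n (x i) (\<xi> i)"]) auto
qed

lemma ub_r: "i \<in> {1..m} ==> ub (-89) (r i)"
proof -
 assume i: "i \<in> {1..m}"
 obtain \<rho> where "\<And>i. r i = d1 * \<rho> i" "\<And>i. i \<in> {1..m} ==> ub 1 (\<rho> i)" using r_mvt by blast
 then show ?thesis using i by (auto intro!: ub_mult[OF crude_d1])
qed

text \<open>The fixed-effect fit of \<open>u i\<close> at slope \<open>\<beta>1\<close>: the value
  of \<open>\<mu> i + d0\<close> for which the fitted total equals the observed one when the
  variance correction \<open>lam i / 2\<close> is ignored.\<close>

definition a :: "nat => real" where "a i = ln (Y i) - b0 - ln (wsum n (x i) 0 \<beta>1)"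

lemma a_eq: "i \<in> {1..m} ==> a i = u i + ln (1 + Z i) - r i"
proof -
 assume i: "i \<in> {1..m}"
 have "\<bar>Z i\<bar> <= 1 / 2" using ub_small[OF ub_Z[OF i]] by simp
 then have "ln (Y i) = ln (\<theta> i) + ln (1 + Z i)"
  unfolding Y_eq[OF i] using th_bd(3)[OF i] by (intro ln_mult_pos) auto
 also have "ln (\<theta> i) = b0 + u i + ln (wsum n (x i) 0 b1)"
  unfolding \<theta>_def by (subst ln_mult_pos) (auto simp: wsum_0_pos[OF n1])
 finally show ?thesis by (simp add: a_def r_def)
qed

lemma ub_au: "i \<in> {1..m} ==> ub (-87) (a i - u i)"
proof -
 assume i: "i \<in> {1..m}"
 have "ub (-87) (ln (1 + Z i) - r i)"
  by (rule ub_diff[OF ub_ln(2)[OF ub_Z[OF i]] ub_r[OF i]]) auto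
 then show ?thesis by (simp add: a_eq[OF i])
qed

lemma ub_a: "i \<in> {1..m} ==> ub 2 (a i)"
 using ub_add[OF ub_au ub_u, of i i 2] by simp

lemma ub_invY: "i \<in> {1..m} ==> ub (-196) (1 / (2 * Y i))"
 using powi_mono[of 196 197] Y_bd[of i] by (intro ub_inverse[of 196]) auto

lemma ln_G: "i \<in> {1..m} ==> ln (G i) = ln (Y i) - a i + d0 + \<mu> i + lam i / 2"
 unfolding G_eq a_def d0_def using wsum_0_pos[OF n1, of "x i" \<beta>1] by (simp add: ln_mult)

text \<open>Shrinkage. The sign of \<open>\<mu> i\<close> is that of \<open>Y i - G i\<close>, which
  in turn is governed by \<open>\<mu> i + lam i / 2 - (a i - d0)\<close> through
  \<open>ln_G\<close>. So \<open>\<mu> i\<close> lies between 0 and \<open>a i - d0\<close>, up to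
  the variance correction, and this holds without any knowledge of \<open>s\<close>.\<close>

lemma mu_cases:
 assumes i: "i \<in> {1..m}"
 shows "G i <= Y i ==> 0 <= \<mu> i \<and> \<mu> i <= a i - d0"
  and "Y i <= G i ==> \<mu> i <= 0 \<and> a i - d0 - 1 / (2 * Y i) <= \<mu> i"
proof -
 assume g: "G i <= Y i"
 have "ln (G i) <= ln (Y i)" using G_pos[OF i] g by simp
 then show "0 <= \<mu> i \<and> \<mu> i <= a i - d0"
  using ln_G[OF i] lam_nonneg[OF i] g s_nonneg mu_eq[OF i] by auto
next
 assume g: "Y i <= G i"
 have "ln (Y i) <= ln (G i)" using Y_bd(3)[OF i] g by simp
 moreover have "\<mu> i <= 0" using mu_eq[OF i] g s_nonneg by (simp add: mult_nonneg_nonpos)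
 moreover have "lam i <= 1 / Y i"
  using lam_le(1)[OF i] frac_le[of 1 1 "Y i" "G i"] g Y_bd(3)[OF i] by linarith
 moreover have "1 / Y i = 2 * (1 / (2 * Y i))" by simp
 ultimately show "\<mu> i <= 0 \<and> a i - d0 - 1 / (2 * Y i) <= \<mu> i"
  using ln_G[OF i] by linarith
qed

lemma mu_abs: "i \<in> {1..m} ==> \<bar>\<mu> i\<bar> <= \<bar>a i - d0\<bar> + 1 / (2 * Y i)"
proof -
 assume i: "i \<in> {1..m}"
 have "0 < 1 / (2 * Y i)" using Y_bd(3)[OF i] by simp
 then show ?thesis using mu_cases[OF i] by linarith
qed

text \<open>Fitted and observed totals have the same sum, so some group is fitted from below and
  some group from above. Shrinkage in the first bounds \<open>d0\<close> above by some
  \<open>a i\<close>, in the second below by some \<open>a k\<close>.\<close>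

lemma ub_d0_crude: "ub 3 d0"
proof -
 have "\<exists>i\<in>{1..m}. G i <= Y i"
 proof (rule ccontr)
  assume "\<not> ?thesis"
  then have "\<forall>i\<in>{1..m}. Y i < G i" by (meson not_le)
  then have "(\<Sum>i=1..m. Y i) < (\<Sum>i=1..m. G i)" using m1 by (intro sum_strict_mono) auto
  then show False using avg_G m1 by (simp add: avg_def)
 qed
 then obtain i where i: "i \<in> {1..m}" "G i <= Y i" by auto
 have "\<exists>i\<in>{1..m}. Y i <= G i"
 proof (rule ccontr)
  assume "\<not> ?thesis"
  then have "\<forall>i\<in>{1..m}. G i < Y i" by (meson not_le)
  then have "(\<Sum>i=1..m. G i) < (\<Sum>i=1..m. Y i)" using m1 by (intro sum_strict_mono) auto
  then show False using avg_G m1 by (simp add: avg_def)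
 qed
 then obtain k where k: "k \<in> {1..m}" "Y k <= G k" by auto
 have 1: "d0 <= a i" using mu_cases(1)[OF i] by linarith
 have 2: "a k - 1 / (2 * Y k) <= d0" using mu_cases(2)[OF k] by linarith
 have "ub 3 (a k - 1 / (2 * Y k))" by (rule ub_diff[OF ub_a[OF k(1)] ub_invY[OF k(1)]]) auto
 moreover have "ub 3 (a i)" using ub_mono[OF ub_a[OF i(1)]] by simp
 ultimately show ?thesis using 1 2 unfolding ub_def by linarith
qed

lemma ub_mu: "i \<in> {1..m} ==> ub 5 (\<mu> i)"
proof -
 assume i: "i \<in> {1..m}"
 have "ub 5 (\<bar>a i - d0\<bar> + 1 / (2 * Y i))"
  by (rule ub_add[OF _ ub_invY[OF i], of 4])
    (use ub_diff[OF ub_a[OF i] ub_d0_crude, of 4] in auto)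
 then show ?thesis by (rule ub_le) (use mu_abs[OF i] in linarith)
qed

lemma mu_decomp:
 "i \<in> {1..m} ==> \<mu> i = ln (1 + (G i - Y i) / Y i) + ln (1 + Z i) + u i - d0 - r i - lam i / 2"
proof -
 assume i: "i \<in> {1..m}"
 have "1 + (G i - Y i) / Y i = G i / Y i" using Y_bd(3)[OF i] by (simp add: field_simps)
 then have "ln (1 + (G i - Y i) / Y i) = ln (G i) - ln (Y i)"
  using Y_bd(3)[OF i] G_pos[OF i] by (simp add: ln_div)
 then show ?thesis using ln_G[OF i] a_eq[OF i] by simp
qed

lemma G_lower:
 assumes i: "i \<in> {1..m}" and d: "ub e ((G i - Y i) / Y i)" "e <= -1"
 shows "L powi 196 <= G i" "ub (-196) (lam i)"
proof -
 have "\<bar>(G i - Y i) / Y i\<bar> <= 1 / 2" by (rule ub_small[OF d])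
 then have "\<bar>G i - Y i\<bar> <= Y i / 2" using Y_bd(3)[OF i] by (simp add: abs_divide field_simps)
 then have "Y i / 2 <= G i" by linarith
 moreover have "L powi 196 <= Y i / 2" by (rule powi_le_half[OF Y_bd(1)[OF i]]) simp
 ultimately show g: "L powi 196 <= G i" by linarith
 have "ub (-196) (1 / G i)" using g by (intro ub_inverse[of 196]) auto
 then show "ub (-196) (lam i)" by (rule ub_le) (use lam_le(1)[OF i] lam_nonneg[OF i] G_pos[OF i] in auto)
qed

definition v :: "nat => real" where "v i = u i - d0"
text \<open>A majorant of the indicator of the event that the residual exceeds
  \<open>L powi 140\<close>, with average at most L^203 L^-280 = L^-77. Below that threshold the
  relative residual is at most L^140 / L^197 = L^-57 and the group can be linearised; the rare
  remaining groups are handled with crude bounds, which cost only a few powers of \<open>L\<close>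
  times L^-77.\<close>

definition w2 :: "nat => real" where "w2 i = (Y i - G i)\<^sup>2 * L powi -280"

lemma w2_nonneg: "w2 i >= 0" by (simp add: w2_def)

lemma avg_w2: "avg m w2 <= L powi -77"
proof -
 have "avg m w2 = L powi -280 * avg m (\<lambda>i. (Y i - G i)\<^sup>2)"
  unfolding avg_cmult[symmetric] by (intro avg_cong) (simp add: w2_def)
 also have "\<dots> <= L powi -280 * L powi 203" using avg_sq by (intro mult_left_mono) auto
 finally show ?thesis by (simp add: powi_mult)
qed

lemma typical_or_rare:
 assumes i: "i \<in> {1..m}"
 obtains "ub (-55) (\<mu> i - v i)" "ub (-196) (lam i)" | "w2 i >= 1"
proof (cases "\<bar>Y i - G i\<bar> <= L powi 140")
 case True
 have d: "ub (-57) ((G i - Y i) / Y i)"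
  by (rule ub_div[of 140 _ 197]) (use True Y_bd[OF i] in \<open>auto simp: ub_def abs_minus_commute\<close>)
 have l: "ub (-196) (lam i)" by (rule G_lower(2)[OF i d]) auto
 have "ub (-55) (ln (1 + (G i - Y i) / Y i) + (a i - u i) + (- lam i / 2))"
 proof (rule ub_add3[of "-56" _ "-87" _ "-195"])
  show "ub (-56) (ln (1 + (G i - Y i) / Y i))" using ub_ln(2)[OF d] by simp
  show "ub (-87) (a i - u i)" using ub_au[OF i] .
  show "ub (-195) (- lam i / 2)" using ub_cmult[OF _ l, of "- 1 / 2" "-195"] by simp
 qed auto
 also have "ln (1 + (G i - Y i) / Y i) + (a i - u i) + (- lam i / 2) = \<mu> i - v i"
  using mu_decomp[OF i] a_eq[OF i] by (simp add: v_def)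
 finally show ?thesis using l that(1) by blast
next
 case False
 have "L powi 140 * L powi 140 <= \<bar>Y i - G i\<bar> * \<bar>Y i - G i\<bar>"
  using False by (intro mult_mono) auto
 then have "L powi 280 <= (Y i - G i)\<^sup>2" by (simp add: powi_mult power2_eq_square abs_mult_self_eq)
 then have "L powi 280 * L powi -280 <= w2 i" unfolding w2_def by (intro mult_right_mono) auto
 then show ?thesis using that(2) by (simp add: powi_mult)
qed

lemma ub_v: "i \<in> {1..m} ==> ub 4 (v i)"
 unfolding v_def by (rule ub_diff[OF ub_u ub_d0_crude]) auto

lemma avg_mu_v: "avg m (\<lambda>i. \<bar>\<mu> i - v i\<bar>) <= L powi -54"
proof -
 have "avg m (\<lambda>i. \<bar>\<mu> i - v i\<bar>) <= avg m (\<lambda>i. L powi -55 + L powi 6 * w2 i)"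
 proof (rule avg_mono)
  fix i assume i: "i \<in> {1..m}"
  show "\<bar>\<mu> i - v i\<bar> <= L powi -55 + L powi 6 * w2 i"
  proof (rule typical_or_rare[OF i])
   assume "ub (-55) (\<mu> i - v i)"
   moreover have "0 <= L powi 6 * w2 i" using w2_nonneg by simp
   ultimately show ?thesis unfolding ub_def by linarith
  next
   assume "w2 i >= 1"
   then have "L powi 6 * 1 <= L powi 6 * w2 i" by (intro mult_left_mono) auto
   moreover have "ub 6 (\<mu> i - v i)" by (rule ub_diff[OF ub_mu[OF i] ub_v[OF i]]) auto
   ultimately show ?thesis using powi_pos(1)[of "-55"] unfolding ub_def by linarith
  qed
 qed
 also have "\<dots> = L powi -55 + L powi 6 * avg m w2" by (simp add: avg_add avg_cmult avg_const[OF m1])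
 also have "L powi 6 * avg m w2 <= L powi 6 * L powi -77" using avg_w2 by (intro mult_left_mono) auto
 also have "\<dots> = L powi -71" by (simp add: powi_mult)
 finally show ?thesis
  using powi_10[of "-55" "-54"] powi_mono[of "-71" "-55"] powi_pos(1)[of "-55"] by linarith
qed

lemma ub_avg_u: "ub (-99) (avg m u)"
 using u_avg q_ub[of 1] by (simp add: ub_def)

text \<open>Because the \<open>\<mu> i\<close> average to zero, their closeness to
  \<open>u i - d0\<close> on average pins \<open>d0\<close> to the average of the
  \<open>u i\<close>.\<close>

lemma ub_d0: "ub (-52) d0"
proof -
 have "avg m (\<lambda>i. \<mu> i - v i) = - avg m u + d0"
  by (simp add: avg_diff avg_mu v_def avg_const[OF m1])
 moreover have "ub (-54) (avg m (\<lambda>i. \<mu> i - v i))"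
  using avg_mu_v abs_avg_le[of m "\<lambda>i. \<mu> i - v i"] unfolding ub_def by linarith
 ultimately have "ub (-54) (- avg m u + d0)" by simp
 then have "ub (-52) ((- avg m u + d0) + avg m u)" by (rule ub_add[OF _ ub_avg_u]) auto
 then show ?thesis by simp
qed

lemma avg_mu2: "ub (-46) (avg m (\<lambda>i. (\<mu> i)\<^sup>2) - s0)"
proof -
 have "avg m (\<lambda>i. (\<mu> i)\<^sup>2) - avg m (\<lambda>i. (v i)\<^sup>2) = avg m (\<lambda>i. (\<mu> i - v i) * (\<mu> i + v i))"
  unfolding avg_diff[symmetric] by (intro avg_cong) (simp add: power2_eq_square algebra_simps)
 moreover have "\<bar>avg m (\<lambda>i. (\<mu> i - v i) * (\<mu> i + v i))\<bar> <= avg m (\<lambda>i. L powi 6 * \<bar>\<mu> i - v i\<bar>)"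
 proof (rule order_trans[OF abs_avg_le], rule avg_mono)
  fix i assume i: "i \<in> {1..m}"
  have "ub 6 (\<mu> i + v i)" by (rule ub_add[OF ub_mu[OF i] ub_v[OF i]]) auto
  then show "\<bar>(\<mu> i - v i) * (\<mu> i + v i)\<bar> <= L powi 6 * \<bar>\<mu> i - v i\<bar>"
   unfolding abs_mult ub_def by (subst mult.commute) (intro mult_right_mono, auto)
 qed
 moreover have "avg m (\<lambda>i. L powi 6 * \<bar>\<mu> i - v i\<bar>) <= L powi 6 * L powi -54"
  unfolding avg_cmult using avg_mu_v by (intro mult_left_mono) auto
 ultimately have 1: "ub (-48) (avg m (\<lambda>i. (\<mu> i)\<^sup>2) - avg m (\<lambda>i. (v i)\<^sup>2))"
  by (simp add: ub_def powi_mult)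
 have "avg m (\<lambda>i. (v i)\<^sup>2) = avg m (\<lambda>i. (u i)\<^sup>2 - (2 * d0) * u i + d0\<^sup>2)"
  by (intro avg_cong) (simp add: v_def power2_diff algebra_simps)
 then have e: "avg m (\<lambda>i. (v i)\<^sup>2) - s0 = (avg m (\<lambda>i. (u i)\<^sup>2) - s0) + (- (2 * (d0 * avg m u))) + d0\<^sup>2"
  by (simp only: avg_add avg_diff avg_cmult avg_const[OF m1])
 have "ub (-48) (avg m (\<lambda>i. (v i)\<^sup>2) - s0)" unfolding e
 proof (rule ub_add3[of "-99" _ "-150" _ "-104"])
  show "ub (-99) (avg m (\<lambda>i. (u i)\<^sup>2) - s0)" using u2_avg q_ub[of 1] by (simp add: ub_def)
  show "ub (-150) (- (2 * (d0 * avg m u)))"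
   using ub_cmult[OF _ ub_mult[OF ub_d0 ub_avg_u, of "-151"], of 2 "-150"] by simp
  show "ub (-104) (d0\<^sup>2)" by (rule ub_sq[OF ub_d0]) simp
 qed auto
 from ub_add[OF 1 this, of "-46"] show ?thesis by simp
qed

lemma avg_lam: "0 <= avg m lam" "avg m lam <= L powi -196 + s * L powi -77"
proof -
 show "0 <= avg m lam" using lam_nonneg by (intro avg_nonneg)
 have "avg m lam <= avg m (\<lambda>i. L powi -196 + s * w2 i)"
 proof (rule avg_mono)
  fix i assume i: "i \<in> {1..m}"
  show "lam i <= L powi -196 + s * w2 i"
  proof (rule typical_or_rare[OF i])
   assume "ub (-196) (lam i)"
   moreover have "0 <= s * w2 i" using w2_nonneg s_nonneg by simp
   ultimately show ?thesis unfolding ub_def by linarith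
  next
   assume "w2 i >= 1"
   then have "s * 1 <= s * w2 i" using s_nonneg by (intro mult_left_mono)
   then show ?thesis using lam_le(2)[OF i] powi_pos(1)[of "-196"] by linarith
  qed
 qed
 also have "\<dots> = L powi -196 + s * avg m w2" by (simp add: avg_add avg_cmult avg_const[OF m1])
 also have "s * avg m w2 <= s * L powi -77" using avg_w2 s_nonneg by (intro mult_left_mono)
 finally show "avg m lam <= L powi -196 + s * L powi -77" by simp
qed

text \<open>In rare groups only \<open>lam i <= s\<close> is known, so \<open>s\<close> appears on
  both sides of \<open>s_eq\<close>; its coefficient \<open>L powi -77\<close> on the right is
  absorbed on the left. The remaining mean square of the \<open>\<mu> i\<close> is close to
  \<open>s0\<close>. This is the place where a stationary point with \<open>s = 0\<close> is
  excluded.\<close>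

lemma s_consistent: "ub (-45) (s - s0)" "ub 3 s" "L powi -2 <= s"
proof -
 have m2: "\<bar>avg m (\<lambda>i. (\<mu> i)\<^sup>2) - s0\<bar> <= L powi -46" using avg_mu2 by (simp add: ub_def)
 have small: "L powi -77 <= 1 / 2" using ub_small[of "-77" "L powi -77"] by (simp add: ub_def)
 have "s * L powi -77 <= s * (1 / 2)" using small s_nonneg by (intro mult_left_mono)
 then have "s <= 2 * (s0 + L powi -46 + L powi -196)" 
 proof -
  have 1: "avg m (\<lambda>i. (\<mu> i)\<^sup>2) <= s0 + L powi -46" using m2 by linarith
  have 2: "avg m lam <= L powi -196 + s / 2"
   using avg_lam(2) \<open>s * L powi -77 <= s * (1 / 2)\<close> by simp
  have "avg m (\<lambda>i. (\<mu> i)\<^sup>2) + avg m lam <= (s0 + L powi -46) + (L powi -196 + s / 2)"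
   by (rule add_mono[OF 1 2])
  then have "s <= (s0 + L powi -46) + (L powi -196 + s / 2)" by (subst s_eq)
  then show ?thesis by (simp add: field_simps)
 qed
 also have "\<dots> <= 6 * L powi 1"
 proof -
  have "L powi -46 <= L powi 1" "L powi -196 <= L powi 1" by (intro powi_mono, simp)+
  moreover have "s0 <= L powi 1" using ub_s0(1) by (simp add: ub_def)
  ultimately have "s0 + L powi -46 + L powi -196 <= L powi 1 + L powi 1 + L powi 1" by (intro add_mono)
  then show ?thesis by simp
 qed
 also have "\<dots> <= L powi 2" using powi_10[of 1 2] powi_pos(1)[of 1] by linarith
 finally have s2: "s <= L powi 2" .
 then show "ub 3 s" using s_nonneg powi_mono[of 2 3] by (simp add: ub_def)
 have "s * L powi -77 <= L powi 2 * L powi -77" using s2 by (intro mult_right_mono) auto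
 also have "\<dots> = L powi -75" by (simp add: powi_mult)
 finally have "avg m lam <= L powi -196 + L powi -75" using avg_lam(2) by linarith
 then have "ub (-46) (avg m lam)"
  using avg_lam(1) powi_mono[of "-196" "-75"] powi_10[of "-75" "-46"] powi_pos(1)[of "-75"]
  unfolding ub_def by linarith
 have e: "s - s0 = (avg m (\<lambda>i. (\<mu> i)\<^sup>2) - s0) + avg m lam" using s_eq by linarith
 show 1: "ub (-45) (s - s0)" unfolding e by (rule ub_add[OF avg_mu2 \<open>ub (-46) (avg m lam)\<close>]) auto
 have "10 * L powi -2 <= L powi -1" "L powi -45 <= L powi -2" by (intro powi_10 powi_mono, simp)+
 then show "L powi -2 <= s" using 1 ub_s0(2) powi_pos(1)[of "-2"] unfolding ub_def by linarith
qed

lemma s_pos: "s > 0" using s_consistent(3) powi_pos(1)[of "-2"] by linarith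

definition d :: "nat => real" where "d i = (G i - Y i) / Y i"

lemma GY: "i \<in> {1..m} ==> G i - Y i = - \<mu> i / s"
 using mu_eq[of i] s_pos by (simp add: field_simps)

text \<open>Once \<open>s\<close> is bounded away from 0, the equation
  \<open>\<mu> i = s * (Y i - G i)\<close> can be solved for the residual. It is bounded by a fixed
  power of \<open>L\<close> in every group, so the distinction between typical and rare groups ends
  here.\<close>

lemma ub_GY: "i \<in> {1..m} ==> ub 7 (G i - Y i)"
 unfolding GY by (rule ub_div[of 5 _ "-2"]) (use ub_mu s_consistent(3) in auto)

lemma ub_d: "i \<in> {1..m} ==> ub (-190) (d i)"
 unfolding d_def by (rule ub_div[OF ub_GY, of _ 197]) (auto intro: order_trans[OF Y_bd(1) abs_ge_self])

lemma ub_lam: "i \<in> {1..m} ==> ub (-196) (lam i)"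
 by (rule G_lower(2)[OF _ ub_d[unfolded d_def]]) auto

lemma G_ge: "i \<in> {1..m} ==> L powi 196 <= G i"
 by (rule G_lower(1)[OF _ ub_d[unfolded d_def]]) auto

section \<open>First-order expansion and the slope\<close>

definition p :: "nat => real" where "p i = \<mu> i - (u i - d0 + Z i - r i)"

lemma ub_p: "i \<in> {1..m} ==> ub (-188) (p i)"
proof -
 assume i: "i \<in> {1..m}"
 have "ub (-188) (ln (1 + d i) + (ln (1 + Z i) - Z i) + (- lam i / 2))"
 proof (rule ub_add3[of "-189" _ "-193" _ "-195"])
  show "ub (-189) (ln (1 + d i))" using ub_ln(2)[OF ub_d[OF i]] by simp
  show "ub (-193) (ln (1 + Z i) - Z i)" using ub_ln(1)[OF ub_Z[OF i]] by simp
  show "ub (-195) (- lam i / 2)" using ub_cmult[OF _ ub_lam[OF i], of "- 1 / 2" "-195"] by simp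
 qed auto
 also have "ln (1 + d i) + (ln (1 + Z i) - Z i) + (- lam i / 2) = p i"
  using mu_decomp[OF i] by (simp add: p_def d_def)
 finally show ?thesis .
qed

lemma mu_dec: "i \<in> {1..m} ==> \<mu> i = ln (1 + d i) + ln (1 + Z i) + u i - d0 - r i - lam i / 2"
 using mu_decomp by (simp add: d_def)

definition w :: "nat => real" where "w i = R i - avg m R"

lemma ub_w: "i \<in> {1..m} ==> ub 2 (w i)"
 unfolding w_def R_def by (rule ub_diff[OF R_bd ub_avg[OF m1 R_bd]]) auto

lemma avg_w: "avg m w = 0"
 unfolding w_def[abs_def] avg_diff avg_const[OF m1] by simp

lemma avg_abs_w: "avg m (\<lambda>i. \<bar>w i\<bar>) <= L powi -89"
proof -
 have "\<bar>avg m R - \<gamma>\<bar> = \<bar>avg m (\<lambda>i. R i - \<gamma>)\<bar>" by (simp add: avg_diff avg_const[OF m1])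
 also have "\<dots> <= L powi -90" using abs_avg_le R_avg by (rule order_trans)
 finally have 1: "\<bar>avg m R - \<gamma>\<bar> <= L powi -90" .
 have "avg m (\<lambda>i. \<bar>w i\<bar>) <= avg m (\<lambda>i. \<bar>R i - \<gamma>\<bar> + L powi -90)"
  using 1 by (intro avg_mono) (auto simp: w_def)
 also have "\<dots> <= 2 * L powi -90" using R_avg by (simp add: avg_add avg_const[OF m1])
 also have "\<dots> <= L powi -89" using powi_10[of "-90" "-89"] powi_pos(1)[of "-90"] by linarith
 finally show ?thesis .
qed

text \<open>The score at \<open>\<beta>1\<close> is not zero: the predicted effects leak into it as
  minus the average of \<open>\<mu> i * wmean n (x i) \<beta>1\<close> divided by \<open>s\<close>.
  Since the \<open>\<mu> i\<close> average to zero, the tilted means may be replaced by the centred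
  \<open>w i\<close> plus a multiple of \<open>d1\<close>; since the \<open>w i\<close> average to
  zero, \<open>d0\<close> then cancels. Every surviving term either carries the factor
  \<open>d1\<close>, and merely perturbs \<open>K\<close>, or is a controlled average. The remainder
  \<open>p\<close> profits from the small average of the \<open>w i\<close>: L^-188 L^-89 =
  L^-277.\<close>

lemma slope_equation:
 "\<exists>K E. d1 * K = S + E \<and> \<bar>K - real n * I\<bar> <= L powi 182 \<and> vb 9 (-274) E"
proof -
 obtain K0 where K0: "score \<beta>1 = S - d1 * K0" "\<bar>K0 - real n * I\<bar> <= L powi 181"
  using score_expand[of \<beta>1] crude_d1 by (auto simp: d1_def)
 have "\<forall>i. \<exists>\<xi>. wmean n (x i) \<beta>1 - R i = d1 * wvar n (x i) \<xi>"
  using wmean_mvt unfolding d1_def R_def by blast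
 then obtain \<xi> where \<xi>: "\<And>i. wmean n (x i) \<beta>1 - R i = d1 * wvar n (x i) (\<xi> i)" by metis
 obtain \<rho> where \<rho>: "\<And>i. r i = d1 * \<rho> i" "\<And>i. i \<in> {1..m} ==> ub 1 (\<rho> i)" using r_mvt by blast
 define A where "A = avg m (\<lambda>i. \<mu> i * wvar n (x i) (\<xi> i))"
 define B where "B = avg m (\<lambda>i. \<rho> i * w i)"
 define E where "E = (avg m (\<lambda>i. u i * w i) + avg m (\<lambda>i. Z i * w i) + avg m (\<lambda>i. p i * w i)) / s"
 have "avg m (\<lambda>i. \<mu> i * wmean n (x i) \<beta>1) = avg m (\<lambda>i. d1 * (\<mu> i * wvar n (x i) (\<xi> i)) + \<mu> i * w i + avg m R * \<mu> i)"
 proof (rule avg_cong)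
  fix i
  have "wmean n (x i) \<beta>1 = d1 * wvar n (x i) (\<xi> i) + w i + avg m R" using \<xi>[of i] by (simp add: w_def)
  then show "\<mu> i * wmean n (x i) \<beta>1 = d1 * (\<mu> i * wvar n (x i) (\<xi> i)) + \<mu> i * w i + avg m R * \<mu> i"
   by (simp only: distrib_left) (simp add: mult_ac)
 qed
 also have "\<dots> = d1 * A + avg m (\<lambda>i. \<mu> i * w i)"
  unfolding avg_add avg_cmult A_def avg_mu by simp
 also have "avg m (\<lambda>i. \<mu> i * w i) = avg m (\<lambda>i. u i * w i + Z i * w i + p i * w i - d1 * (\<rho> i * w i) - d0 * w i)"
 proof (rule avg_cong)
  fix i
  have "\<mu> i = u i + Z i + p i - d1 * \<rho> i - d0" unfolding p_def \<rho>(1)[symmetric] by simp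
  then show "\<mu> i * w i = u i * w i + Z i * w i + p i * w i - d1 * (\<rho> i * w i) - d0 * w i"
   by (simp only: distrib_right left_diff_distrib mult.assoc)
 qed
 also have "\<dots> = s * E - d1 * B"
  using s_pos unfolding avg_add avg_diff avg_cmult avg_w E_def B_def by simp
 finally have 1: "avg m (\<lambda>i. \<mu> i * wmean n (x i) \<beta>1) = d1 * A + (s * E - d1 * B)" .
 have "score \<beta>1 = avg m (\<lambda>i. (- 1 / s) * (\<mu> i * wmean n (x i) \<beta>1))"
  unfolding score_beta1 by (rule avg_cong) (simp add: GY)
 also have "\<dots> = (- 1 / s) * (d1 * A + (s * E - d1 * B))" unfolding avg_cmult 1 ..
 also have "\<dots> = - (d1 * (A - B)) / s - E" using s_pos by (simp add: field_simps)
 finally have "S - d1 * K0 = - (d1 * (A - B)) / s - E" unfolding K0(1) .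
 then have e: "d1 * (K0 - (A - B) / s) = S + E" using s_pos by (simp add: field_simps)
 have "ub 7 A" unfolding A_def by (rule ub_avg[OF m1]) (auto intro!: ub_mult[OF ub_mu V_bd])
 moreover have "ub 3 B" unfolding B_def by (rule ub_avg[OF m1]) (auto intro!: ub_mult[OF \<rho>(2) ub_w])
 ultimately have "ub 8 (A - B)" by (rule ub_diff) auto
 then have "ub 10 ((A - B) / s)" by (rule ub_div[of _ _ "-2"]) (use s_consistent(3) in auto)
 then have "\<bar>K0 - (A - B) / s - real n * I\<bar> <= L powi 181 + L powi 10" using K0(2) unfolding ub_def by linarith
 also have "\<dots> <= L powi 182" using powi_mono[of 10 181] powi_10[of 181 182] powi_pos(1)[of 181] by linarith
 finally have k: "\<bar>K0 - (A - B) / s - real n * I\<bar> <= L powi 182" .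
 have "\<bar>avg m (\<lambda>i. p i * w i)\<bar> <= avg m (\<lambda>i. L powi -188 * \<bar>w i\<bar>)"
  by (rule order_trans[OF abs_avg_le avg_mono])
    (use ub_p in \<open>auto simp: ub_def abs_mult intro!: mult_right_mono\<close>)
 also have "\<dots> <= L powi -188 * L powi -89" unfolding avg_cmult using avg_abs_w by (intro mult_left_mono) auto
 finally have "ub (-277) (avg m (\<lambda>i. p i * w i))" by (simp add: ub_def powi_mult)
 then have "vb 5 (-277) (avg m (\<lambda>i. p i * w i))" by (rule vb_of_ub)
 note 5 = this
 have 6: "vb 6 (-278) (avg m (\<lambda>i. u i * w i) + avg m (\<lambda>i. Z i * w i))"
  using uw_avg Zw_avg by (intro vb_add[of 5 "-279" _ 5 "-279"] vb_of_q) (auto simp: w_def)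
 have "vb 7 (-276) (avg m (\<lambda>i. u i * w i) + avg m (\<lambda>i. Z i * w i) + avg m (\<lambda>i. p i * w i))"
  by (rule vb_add[OF 6 5]) auto
 then have "vb 9 (-274) E" unfolding E_def by (rule vb_div[of _ _ _ "-2"]) (use s_consistent(3) in auto)
 then show ?thesis using e k by blast
qed

text \<open>On the two scales, (mn)^(-1/2) / L is \<open>q * L powi -101\<close> and n^-2 / L is
  \<open>L powi -401\<close>; the first claim meets exactly these. Replacing \<open>K\<close> by
  \<open>real n * I\<close> is harmless because their relative distance is at most L^182 /
  L^199.\<close>

lemma slope_expansion: "vb (-101) (-401) (d1 - S / (real n * I))" "vb (-91) (-400) d1"
proof -
 obtain K E where K: "d1 * K = S + E" "\<bar>K - real n * I\<bar> <= L powi 182" and E: "vb 9 (-274) E"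
  using slope_equation by blast
 have Kl: "L powi 198 <= K" by (rule K_ge[OF K(2)])
 have K0: "K > 0" using Kl powi_pos(1)[of 198] by linarith
 have nI0: "real n * I > 0" using nI powi_pos(1)[of 199] by linarith
 have S: "vb 106 b S" for b using ub_S by (rule vb_of_q)
 have "d1 = (S + E) / K" using K(1) K0 by (simp add: field_simps)
 then have e: "d1 - S / (real n * I) = E / K + (S * (real n * I - K)) / (K * (real n * I))"
 proof -
  have "S * (N - K) / (K * N) = S / K - S / N" if "N > 0" for N
   using K0 that by (simp add: field_simps)
  from this[OF nI0] show ?thesis using \<open>d1 = (S + E) / K\<close> by (simp add: add_divide_distrib)
 qed
 have 1: "vb (-189) (-472) (E / K)" by (rule vb_div[OF E, of 198]) (use Kl in auto)
 have "vb 288 (-200) (S * (real n * I - K))"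
  by (rule vb_mult[OF S[of "-382"], of 182]) (use K(2) in \<open>auto simp: ub_def abs_minus_commute\<close>)
 then have 2: "vb (-109) (-597) ((S * (real n * I - K)) / (K * (real n * I)))"
  by (rule vb_div[of _ _ _ 397]) (use powi_le_mult[OF Kl nI, of 397] in auto)
 show 3: "vb (-101) (-401) (d1 - S / (real n * I))"
  unfolding e by (rule vb_add[OF 1 2]) auto
 have "vb (-93) (-401) (S / (real n * I))"
  by (rule vb_div[OF S[of "-202"], of 199]) (use nI in auto)
 from vb_add[OF 3 this, of "-91" "-400"] show "vb (-91) (-400) d1" by simp
qed

section \<open>Second-order expansion: intercept and variance\<close>

lemma vb_r: "i \<in> {1..m} ==> vb (-90) (-399) (r i)"
proof -
 assume i: "i \<in> {1..m}"
 obtain \<rho> where "\<And>i. r i = d1 * \<rho> i" "\<And>i. i \<in> {1..m} ==> ub 1 (\<rho> i)" using r_mvt by blast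
 then show ?thesis using i by (auto intro!: vb_mult[OF slope_expansion(2)])
qed

text \<open>The correction of order 1/n to \<open>\<mu> i\<close>, from three sources: the quadratic
  term of the logarithm of 1 + \<open>Z i\<close>, the shrinkage of \<open>u i\<close>, and the
  variance correction \<open>lam i / 2\<close>.\<close>

definition Q :: "nat => real" where "Q i = (Z i)\<^sup>2 / 2 + u i / (s0 * \<theta> i) + 1 / (2 * \<theta> i)"
definition err :: "nat => real" where "err i = \<mu> i - (u i - d0 - r i + Z i - Q i)"

lemma inv_lam: "i \<in> {1..m} ==> lam i = 1 / (1 / s + G i)"
 using lam_eq[of i] s_pos by (simp add: field_simps)

lemma ub_inv_s: "ub 2 (1 / s)"
 by (rule ub_inverse[of "-2"]) (use s_consistent(3) in auto)

lemma lam_theta: "i \<in> {1..m} ==> ub (-287) (lam i - 1 / \<theta> i)"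
proof -
 assume i: "i \<in> {1..m}"
 have t: "\<theta> i > 0" and g: "1 / s + G i > 0"
  using th_bd(3)[OF i] s_pos G_pos[OF i] by (auto intro: add_pos_pos)
 have e: "lam i - 1 / \<theta> i = (\<theta> i * (- Z i) - (G i - Y i) - 1 / s) / (\<theta> i * (1 / s + G i))"
 proof -
  have "\<theta> i * (- Z i) - (G i - Y i) - 1 / s = \<theta> i - (1 / s + G i)" by (simp add: Y_eq[OF i] algebra_simps)
  then have "(\<theta> i * (- Z i) - (G i - Y i) - 1 / s) / (\<theta> i * (1 / s + G i))
    = \<theta> i / (\<theta> i * (1 / s + G i)) - (1 / s + G i) / (\<theta> i * (1 / s + G i))"
   by (simp only: diff_divide_distrib)
  also have "\<dots> = 1 / (1 / s + G i) - 1 / \<theta> i" using t g by simp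
  finally show ?thesis using inv_lam[OF i] by simp
 qed
 have "ub 105 (\<theta> i * (- Z i))" by (rule ub_mult[of 202 _ "-97"]) (use th_bd[OF i] ub_Z[OF i] in \<open>auto simp: ub_def\<close>)
 then have "ub 106 (\<theta> i * (- Z i) - (G i - Y i))" by (rule ub_diff[OF _ ub_GY[OF i]]) auto
 then have "ub 107 (\<theta> i * (- Z i) - (G i - Y i) - 1 / s)" by (rule ub_diff[OF _ ub_inv_s]) auto
 moreover have "L powi 394 <= \<theta> i * (1 / s + G i)"
  using G_ge[OF i] s_pos by (intro powi_le_mult[OF th_bd(1)[OF i], of 196]) (auto intro: add_increasing)
 ultimately show ?thesis unfolding e using t g by (intro ub_div[of 107 _ 394]) auto
qed

lemma ub_mu_u: "i \<in> {1..m} ==> ub (-51) (\<mu> i - u i)"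
proof -
 assume i: "i \<in> {1..m}"
 have "ub (-51) (- d0 + Z i + (- r i) + p i)"
  by (rule ub_add4[of "-52" _ "-97" _ "-89" _ "-188"]) (use ub_d0 ub_Z[OF i] ub_r[OF i] ub_p[OF i] in auto)
 then show ?thesis by (simp add: p_def)
qed

text \<open>The relative residual \<open>d i = - \<mu> i / (s * Y i)\<close> is itself of order 1/n.
  It therefore suffices to replace \<open>\<mu> i\<close>, \<open>s\<close> and \<open>Y i\<close>
  by \<open>u i\<close>, \<open>s0\<close> and \<open>\<theta> i\<close> with the crude accuracies
  already available.\<close>

lemma shrinkage: "i \<in> {1..m} ==> ub (-236) (d i + u i / (s0 * \<theta> i))"
proof -
 assume i: "i \<in> {1..m}"
 have p: "Y i > 0" "\<theta> i > 0" "s > 0" "s0 > 0" using Y_bd(3)[OF i] th_bd(3)[OF i] s_pos ub_s0 by auto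
 have sY: "L powi 195 <= s * Y i" using powi_le_mult[OF s_consistent(3) Y_bd(1)[OF i], of 195] by simp
 have "d i = - \<mu> i / s / Y i" unfolding d_def GY[OF i] ..
 then have "d i + u i / (s0 * \<theta> i) = - ((\<mu> i - u i) / (s * Y i)) - u i * (1 / (s * Y i) - 1 / (s0 * \<theta> i))"
  by (simp add: diff_divide_distrib right_diff_distrib)
 moreover have "1 / (s * Y i) - 1 / (s0 * \<theta> i) = ((s0 - s) - s * Z i) / (s0 * (s * Y i))"
 proof -
  have n: "s0 * \<theta> i - s * Y i = \<theta> i * ((s0 - s) - s * Z i)" by (simp add: Y_eq[OF i] algebra_simps)
  have "1 / (s * Y i) - 1 / (s0 * \<theta> i) = (s0 * \<theta> i - s * Y i) / (\<theta> i * (s0 * (s * Y i)))"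
   using p by (simp add: field_simps)
  then show ?thesis unfolding n using p by simp
 qed
 ultimately have e: "d i + u i / (s0 * \<theta> i)
   = - ((\<mu> i - u i) / (s * Y i)) - u i * (((s0 - s) - s * Z i) / (s0 * (s * Y i)))" by simp
 have 1: "ub (-246) ((\<mu> i - u i) / (s * Y i))"
  by (rule ub_div[OF ub_mu_u[OF i], of 195]) (use sY p in auto)
 have "ub (-44) ((s0 - s) - s * Z i)"
 proof (rule ub_diff[of "-45" _ "-94"])
  show "ub (-45) (s0 - s)" using s_consistent(1) by (simp add: ub_def abs_minus_commute)
  show "ub (-94) (s * Z i)" by (rule ub_mult[OF s_consistent(2) ub_Z[OF i]]) simp
 qed auto
 then have "ub (-238) (((s0 - s) - s * Z i) / (s0 * (s * Y i)))"
  by (rule ub_div[of _ _ 194]) (use powi_le_mult[OF ub_s0(2) sY, of 194] p in auto)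
 then have 2: "ub (-237) (u i * (((s0 - s) - s * Z i) / (s0 * (s * Y i))))"
  by (rule ub_mult[OF ub_u[OF i]]) simp
 have "ub (-236) (- ((\<mu> i - u i) / (s * Y i)) - u i * (((s0 - s) - s * Z i) / (s0 * (s * Y i))))"
  by (rule ub_diff[of "-246" _ "-237"]) (use 1 2 in auto)
 then show ?thesis using e by simp
qed

lemma ub_err: "i \<in> {1..m} ==> ub (-235) (err i)"
proof -
 assume i: "i \<in> {1..m}"
 have z: "\<bar>Z i\<bar> <= 1 / 2" using ub_small[OF ub_Z[OF i]] by simp
 have e: "err i = (ln (1 + d i) - d i) + (ln (1 + Z i) - Z i + (Z i)\<^sup>2 / 2)
   + (d i + u i / (s0 * \<theta> i)) + (- (1 / 2)) * (lam i - 1 / \<theta> i)"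
  unfolding err_def Q_def by (subst mu_dec[OF i]) (simp add: algebra_simps)
 show ?thesis unfolding e
 proof (rule ub_add4[of "-379" _ "-290" _ "-236" _ "-286"])
  show "ub (-379) (ln (1 + d i) - d i)" using ub_ln(1)[OF ub_d[OF i]] by simp
  have "ub (-194) ((Z i)\<^sup>2)" by (rule ub_sq[OF ub_Z[OF i]]) simp
  then have "ub (-291) (Z i * (Z i)\<^sup>2)" by (rule ub_mult[OF ub_Z[OF i]]) simp
  from ub_cmult[OF _ this, of 2 "-290"] have "ub (-290) (2 * (Z i * (Z i)\<^sup>2))" by simp
  then show "ub (-290) (ln (1 + Z i) - Z i + (Z i)\<^sup>2 / 2)"
   by (rule ub_le) (use ln_one_plus_third_order[OF z] in \<open>auto simp: abs_mult power3_eq_cube power2_eq_square\<close>)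
  show "ub (-236) (d i + u i / (s0 * \<theta> i))" by (rule shrinkage[OF i])
  show "ub (-286) (- (1 / 2) * (lam i - 1 / \<theta> i))" by (rule ub_cmult[OF _ lam_theta[OF i]]) auto
 qed auto
qed

lemma ub_Q: "i \<in> {1..m} ==> ub (-192) (Q i)"
proof -
 assume i: "i \<in> {1..m}"
 have p: "\<theta> i > 0" "s0 > 0" using th_bd(3)[OF i] ub_s0 by auto
 have "ub (-194) ((Z i)\<^sup>2)" by (rule ub_sq[OF ub_Z[OF i]]) simp
 then have 1: "ub (-193) ((Z i)\<^sup>2 / 2)" using ub_cmult[of "1 / 2" "-194" "(Z i)\<^sup>2" "-193"] by simp
 have 2: "ub (-196) (u i / (s0 * \<theta> i))"
  by (rule ub_div[OF ub_u[OF i], of 197]) (use powi_le_mult[OF ub_s0(2) th_bd(1)[OF i], of 197] p in auto)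
 have "ub (-198) (1 / \<theta> i)" by (rule ub_inverse[of 198]) (use th_bd[OF i] in auto)
 then have 3: "ub (-197) (1 / (2 * \<theta> i))" using ub_cmult[of "1 / 2" "-198" "1 / \<theta> i" "-197"] by simp
 show ?thesis unfolding Q_def by (rule ub_add3[OF 1 2 3]) auto
qed

text \<open>On average half of \<open>(Z i)\<^sup>2\<close> contributes
  \<open>1 / (2 * \<theta> i)\<close>, which joins the equal contribution of the variance
  correction. Together with shrinkage this is the combination
  \<open>(1 + u i / s0) / \<theta> i\<close> of \<open>st1\<close>, so the 1/n bias of the intercept
  cancels.\<close>

lemma avg_Q: "ub (-248) (avg m Q)"
proof -
 have "avg m Q = avg m (\<lambda>i. (1 / 2) * ((Z i)\<^sup>2 - 1 / \<theta> i) + (1 + u i / s0) / \<theta> i)"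
  by (rule avg_cong) (simp add: Q_def add_divide_distrib diff_divide_distrib)
 also have "\<dots> = (1 / 2) * avg m (\<lambda>i. (Z i)\<^sup>2 - 1 / \<theta> i) + avg m (\<lambda>i. (1 + u i / s0) / \<theta> i)"
  unfolding avg_add avg_cmult ..
 finally have e: "avg m Q = (1 / 2) * avg m (\<lambda>i. (Z i)\<^sup>2 - 1 / \<theta> i) + avg m (\<lambda>i. (1 + u i / s0) / \<theta> i)" .
 show ?thesis unfolding e
  by (rule ub_add[OF ub_cmult[of _ "-250" _ "-249"], of _ _ "-250"]) (use Z2_avg st1 in \<open>auto simp: ub_def\<close>)
qed

lemma intercept_expansion: "vb (-8) (-233) (d0 - avg m u)"
proof -
 have "avg m err = avg m (\<lambda>i. \<mu> i - u i + d0 + r i - Z i + Q i)"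
  by (rule avg_cong) (simp add: err_def)
 also have "\<dots> = - avg m u + d0 + avg m r - avg m Z + avg m Q"
  unfolding avg_add avg_diff avg_const[OF m1] avg_mu by simp
 finally have e: "d0 - avg m u = (- avg m r + avg m Z) + (avg m err - avg m Q)" by simp
 have "vb (-90) (-399) (avg m r)" using vb_r by (rule vb_avg)
 moreover have "vb (-10) (-399) (avg m Z)" using Z_avg by (rule vb_of_q)
 ultimately have 1: "vb (-9) (-398) (- avg m r + avg m Z)" by (intro vb_add) auto
 have "ub (-234) (avg m err - avg m Q)"
  by (rule ub_diff[OF ub_avg[OF m1 ub_err] avg_Q]) auto
 then have 2: "vb (-9) (-234) (avg m err - avg m Q)" by (rule vb_of_ub)
 show ?thesis unfolding e by (rule vb_add[OF 1 2]) auto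
qed

definition F :: "nat => real" where "F i = - d0 - r i - Q i + err i"

lemma vb_d0: "vb 3 (-230) d0"
proof -
 have "vb 1 (-231) (avg m u)" using u_avg by (intro vb_of_q) simp
 from vb_add[OF intercept_expansion this, of 3 "-230"] show ?thesis by simp
qed

lemma vb_F: "i \<in> {1..m} ==> vb 6 (-189) (F i)"
proof -
 assume i: "i \<in> {1..m}"
 have "vb 4 (-229) (d0 + r i)" by (rule vb_add[OF vb_d0 vb_r[OF i]]) auto
 moreover have "ub (-191) (err i - Q i)" by (rule ub_diff[OF ub_err[OF i] ub_Q[OF i]]) auto
 then have "vb 4 (-191) (err i - Q i)" by (rule vb_of_ub)
 moreover note vb_diff[of 4 "-191" "err i - Q i" 4 "-229" "d0 + r i" 6 "-189"]
 moreover have "F i = (err i - Q i) - (d0 + r i)" by (simp add: F_def)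
 ultimately show ?thesis by simp
qed

lemma ub_F: "i \<in> {1..m} ==> ub (-51) (F i)"
proof -
 assume i: "i \<in> {1..m}"
 have "ub (-51) ((- d0) + (- r i) + (- Q i) + err i)"
  by (rule ub_add4[of "-52" _ "-89" _ "-192" _ "-235"])
    (use ub_d0 ub_r[OF i] ub_Q[OF i] ub_err[OF i] in auto)
 then show ?thesis by (simp add: F_def)
qed

lemma variance_expansion: "vb (-5) (-220) (s - avg m (\<lambda>i. (u i)\<^sup>2))"
proof -
 have "avg m (\<lambda>i. (\<mu> i)\<^sup>2) + avg m lam - avg m (\<lambda>i. (u i)\<^sup>2)
   = avg m (\<lambda>i. (\<mu> i)\<^sup>2 + lam i - (u i)\<^sup>2)" unfolding avg_add avg_diff ..
 \<comment> \<open>Every square of \<open>Z i\<close> is paired with its conditional mean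
   \<open>1 / \<theta> i\<close>. At order 1/n there remain 1 from \<open>(Z i)\<^sup>2\<close> and
   1 from \<open>lam i\<close>, then -2 u from the cross term with \<open>Q i\<close> and -2 u^2 /
   s0 from shrinkage, all over \<open>\<theta> i\<close>: twice the combination of
   \<open>st2\<close>.\<close>
 also have "\<dots> = avg m (\<lambda>i. 2 * (u i * Z i) + ((Z i)\<^sup>2 - 1 / \<theta> i) - u i * ((Z i)\<^sup>2 - 1 / \<theta> i)
   + 2 * ((1 - u i - (u i)\<^sup>2 / s0) / \<theta> i) - (2 * d0) * u i - 2 * (u i * r i) + 2 * (u i * err i)
   + F i * (2 * Z i + F i) + (lam i - 1 / \<theta> i))"
 proof (rule avg_cong)
  fix i assume i: "i \<in> {1..m}"
  have t: "\<theta> i > 0" using th_bd(3)[OF i] .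
  have m: "\<mu> i = u i + (Z i + F i)" by (simp add: F_def err_def)
  have "(\<mu> i)\<^sup>2 - (u i)\<^sup>2 = 2 * (u i * Z i) + 2 * u i * F i + (Z i)\<^sup>2 + F i * (2 * Z i + F i)"
   unfolding m by (simp add: power2_eq_square algebra_simps)
  also have "2 * u i * F i = - (2 * d0) * u i - 2 * (u i * r i) + 2 * (u i * err i) - 2 * (u i * Q i)"
   by (simp add: F_def algebra_simps)
  also have "2 * (u i * Q i) = u i * (Z i)\<^sup>2 + 2 * ((u i)\<^sup>2 / s0 / \<theta> i) + u i / \<theta> i"
   by (simp add: Q_def algebra_simps power2_eq_square)
  finally have m: "(\<mu> i)\<^sup>2 - (u i)\<^sup>2 = 2 * (u i * Z i) + (- (2 * d0) * u i - 2 * (u i * r i) + 2 * (u i * err i)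
    - (u i * (Z i)\<^sup>2 + 2 * ((u i)\<^sup>2 / s0 / \<theta> i) + u i / \<theta> i)) + (Z i)\<^sup>2 + F i * (2 * Z i + F i)" .
  have "2 * ((1 - u i - (u i)\<^sup>2 / s0) / \<theta> i) = 2 * (1 / \<theta> i) - 2 * (u i / \<theta> i) - 2 * ((u i)\<^sup>2 / s0 / \<theta> i)"
   by (simp add: diff_divide_distrib)
  moreover have "u i * ((Z i)\<^sup>2 - 1 / \<theta> i) = u i * (Z i)\<^sup>2 - u i / \<theta> i" by (simp add: right_diff_distrib)
  ultimately show "(\<mu> i)\<^sup>2 + lam i - (u i)\<^sup>2 = 2 * (u i * Z i) + ((Z i)\<^sup>2 - 1 / \<theta> i) - u i * ((Z i)\<^sup>2 - 1 / \<theta> i)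
   + 2 * ((1 - u i - (u i)\<^sup>2 / s0) / \<theta> i) - (2 * d0) * u i - 2 * (u i * r i) + 2 * (u i * err i)
   + F i * (2 * Z i + F i) + (lam i - 1 / \<theta> i)"
   using m by linarith
 qed
 also have "\<dots> = 2 * avg m (\<lambda>i. u i * Z i) + avg m (\<lambda>i. (Z i)\<^sup>2 - 1 / \<theta> i)
   - avg m (\<lambda>i. u i * ((Z i)\<^sup>2 - 1 / \<theta> i)) + 2 * avg m (\<lambda>i. (1 - u i - (u i)\<^sup>2 / s0) / \<theta> i)
   - (2 * d0) * avg m u - 2 * avg m (\<lambda>i. u i * r i) + 2 * avg m (\<lambda>i. u i * err i)
   + avg m (\<lambda>i. F i * (2 * Z i + F i)) + avg m (\<lambda>i. lam i - 1 / \<theta> i)"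
  unfolding avg_add avg_diff avg_cmult ..
 finally have e: "s - avg m (\<lambda>i. (u i)\<^sup>2) = (2 * avg m (\<lambda>i. u i * Z i) - 2 * (d0 * avg m u)
   + (avg m (\<lambda>i. F i * (2 * Z i + F i)) - 2 * avg m (\<lambda>i. u i * r i)))
   + (((avg m (\<lambda>i. (Z i)\<^sup>2 - 1 / \<theta> i) - avg m (\<lambda>i. u i * ((Z i)\<^sup>2 - 1 / \<theta> i)))
    + 2 * avg m (\<lambda>i. (1 - u i - (u i)\<^sup>2 / s0) / \<theta> i))
    + 2 * avg m (\<lambda>i. u i * err i) + avg m (\<lambda>i. lam i - 1 / \<theta> i))"
  using s_eq by (simp add: algebra_simps)
 have 1: "vb (-9) (-230) (avg m (\<lambda>i. u i * Z i) * 2)"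
  by (rule vb_mult[OF vb_of_q[OF uZ_avg, of "-231"] ub_const[of 2 1]]) auto
 have "vb (-49) (-282) (d0 * avg m u)" by (rule vb_mult[OF vb_mono[OF vb_d0] ub_avg_u]) auto
 then have 2: "vb (-48) (-281) ((d0 * avg m u) * 2)" by (rule vb_mult[OF _ ub_const[of 2 1]]) auto
 have 3: "vb (-44) (-239) (avg m (\<lambda>i. F i * (2 * Z i + F i)))"
 proof (rule vb_avg)
  fix i assume i: "i \<in> {1..m}"
  have "ub (-50) (2 * Z i + F i)"
   by (rule ub_add[OF ub_cmult[OF _ ub_Z[OF i], of _ "-96"] ub_F[OF i]]) auto
  then show "vb (-44) (-239) (F i * (2 * Z i + F i))" by (rule vb_mult[OF vb_F[OF i]]) auto
 qed
 have "vb (-89) (-398) (avg m (\<lambda>i. r i * u i))"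
  by (rule vb_avg) (auto intro!: vb_mult[OF vb_r ub_u])
 then have "vb (-88) (-397) (avg m (\<lambda>i. r i * u i) * 2)" by (rule vb_mult[OF _ ub_const[of 2 1]]) auto
 then have 4: "vb (-88) (-397) (avg m (\<lambda>i. u i * r i) * 2)" by (simp add: mult.commute)
 have A: "vb (-6) (-225) (avg m (\<lambda>i. u i * Z i) * 2 - (d0 * avg m u) * 2
   + (avg m (\<lambda>i. F i * (2 * Z i + F i)) - avg m (\<lambda>i. u i * r i) * 2))"
  by (rule vb_add[of "-8" "-229" _ "-43" "-238"], rule vb_diff[OF 1 2], simp_all, rule vb_diff[OF 3 4], simp_all)
 have B1: "ub (-249) (avg m (\<lambda>i. (Z i)\<^sup>2 - 1 / \<theta> i) - avg m (\<lambda>i. u i * ((Z i)\<^sup>2 - 1 / \<theta> i)))"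
  using Z2_avg uZ2_avg by (intro ub_diff[of "-250" _ "-250"]) (auto simp: ub_def)
 have B2: "ub (-249) (2 * avg m (\<lambda>i. (1 - u i - (u i)\<^sup>2 / s0) / \<theta> i))"
  using st2 by (intro ub_cmult[of _ "-250"]) (auto simp: ub_def)
 have B3: "ub (-233) (2 * avg m (\<lambda>i. u i * err i))"
  by (rule ub_cmult[of _ "-234"]) (auto intro!: ub_avg[OF m1] ub_mult[OF ub_u ub_err])
 have B4: "ub (-287) (avg m (\<lambda>i. lam i - 1 / \<theta> i))" using lam_theta by (rule ub_avg[OF m1])
 have B: "ub (-232) ((avg m (\<lambda>i. (Z i)\<^sup>2 - 1 / \<theta> i) - avg m (\<lambda>i. u i * ((Z i)\<^sup>2 - 1 / \<theta> i))
    + 2 * avg m (\<lambda>i. (1 - u i - (u i)\<^sup>2 / s0) / \<theta> i))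
    + 2 * avg m (\<lambda>i. u i * err i) + avg m (\<lambda>i. lam i - 1 / \<theta> i))"
  by (rule ub_add3[OF ub_add[OF B1 B2, of "-248"] B3 B4]) auto
 show ?thesis unfolding e
  by (rule vb_add[of "-6" "-225" _ "-6" "-232"]) (use A vb_of_ub[OF B] in \<open>auto simp: mult.commute\<close>)
qed

lemma final_bounds:
 shows "s > 0" "\<bar>d0 - avg m u\<bar> <= (L powi -200 + q) / L"
  "\<bar>d1 - S / (real n * I)\<bar> <= (L powi -400 + q * L powi -100) / L"
  "\<bar>s - avg m (\<lambda>i. (u i)\<^sup>2)\<bar> <= (L powi -200 + q) / L"
proof -
 have e: "z / L = z * L powi -1" for z by (simp add: power_int_minus divide_inverse)
 show "s > 0" by (rule s_pos)
 have *: "\<bar>z\<bar> <= (L powi -200 + q) / L" if "vb (-1) (-201) z" for z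
  using that unfolding e vb_def by (simp add: distrib_right powi_mult)
 show "\<bar>d0 - avg m u\<bar> <= (L powi -200 + q) / L"
  by (rule *[OF vb_mono[OF intercept_expansion]]) auto
 show "\<bar>s - avg m (\<lambda>i. (u i)\<^sup>2)\<bar> <= (L powi -200 + q) / L"
  by (rule *[OF vb_mono[OF variance_expansion]]) auto
 show "\<bar>d1 - S / (real n * I)\<bar> <= (L powi -400 + q * L powi -100) / L"
  using slope_expansion(1) unfolding e vb_def by (simp add: distrib_right powi_mult mult.assoc)
qed

end

end

section \<open>Existence of maximisers\<close>

lemma sum_indicator_single:
 fixes f :: "nat => real"
 assumes "i \<in> {1..m}"
 shows "(\<Sum>k=1..m. f k * (if k = i then 1 else 0)) = f i"
 using assms by (simp add: if_distrib[of "\<lambda>z. f _ * z"] sum.delta cong: if_cong)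

text \<open>One derivative along an arbitrary line replaces the partial derivatives in 2 m + 3
  variables: each stationarity equation is a choice of direction. The directions used later vanish
  outside \<open>{1..m}\<close>, so that the line consists of extensional vectors.\<close>

lemma loglik_direction:
 fixes \<beta>0 \<beta>1 s a b g :: real and \<mu> lam c e :: "nat => real" and x :: "nat => nat => real"
 assumes s: "s > 0" and lam: "\<And>i. i \<in> {1..m} ==> lam i > 0"
 defines "E \<equiv> \<lambda>i j. exp (\<beta>0 + \<beta>1 * x i j + \<mu> i + lam i / 2)"
 shows "((\<lambda>t. gva_loglik m n x y (\<beta>0 + t * a, \<beta>1 + t * b, s + t * g, \<lambda>k. \<mu> k + t * c k, \<lambda>k. lam k + t * e k))
   has_real_derivative
    (\<Sum>i=1..m. \<Sum>j=1..n. real (y i j) * (a + b * x i j + c i) - E i j * (a + b * x i j + c i + e i / 2))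
    - real m / 2 * (g / s) + g / (2 * s\<^sup>2) * (\<Sum>i=1..m. (\<mu> i)\<^sup>2 + lam i)
    - 1 / (2 * s) * (\<Sum>i=1..m. 2 * \<mu> i * c i + e i) + 1 / 2 * (\<Sum>i=1..m. e i / lam i)) (at 0)"
proof -
 have 1: "((\<lambda>t. \<Sum>i=1..m. \<Sum>j=1..n. real (y i j) * (\<beta>0 + t * a + (\<beta>1 + t * b) * x i j + (\<mu> i + t * c i))
    - exp (\<beta>0 + t * a + (\<beta>1 + t * b) * x i j + (\<mu> i + t * c i) + (lam i + t * e i) / 2) - ln (fact (y i j)))
   has_real_derivative
    (\<Sum>i=1..m. \<Sum>j=1..n. real (y i j) * (a + b * x i j + c i) - E i j * (a + b * x i j + c i + e i / 2))) (at 0)"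
  unfolding E_def
  by (intro DERIV_sum) (auto intro!: derivative_eq_intros simp: algebra_simps)
 have 2: "((\<lambda>t. real m / 2 * ln (s + t * g)) has_real_derivative real m / 2 * (g / s)) (at 0)"
  using s by (auto intro!: derivative_eq_intros simp: field_simps)
 have 3: "((\<lambda>t. 1 / (2 * (s + t * g)) * (\<Sum>i=1..m. (\<mu> i + t * c i)\<^sup>2 + (lam i + t * e i))) has_real_derivative
   - (g / (2 * s\<^sup>2)) * (\<Sum>i=1..m. (\<mu> i)\<^sup>2 + lam i) + 1 / (2 * s) * (\<Sum>i=1..m. 2 * \<mu> i * c i + e i)) (at 0)"
 proof -
  have A: "((\<lambda>t. 1 / (2 * (s + t * g))) has_real_derivative - (g / (2 * s\<^sup>2))) (at 0)"
   using s by (auto intro!: derivative_eq_intros simp: field_simps power2_eq_square)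
  have B: "((\<lambda>t. \<Sum>i=1..m. (\<mu> i + t * c i)\<^sup>2 + (lam i + t * e i)) has_real_derivative
    (\<Sum>i=1..m. 2 * \<mu> i * c i + e i)) (at 0)"
   by (intro DERIV_sum) (auto intro!: derivative_eq_intros)
  show ?thesis using DERIV_mult[OF A B] by (simp add: add.commute mult.commute)
 qed
 have 4: "((\<lambda>t. 1 / 2 * (\<Sum>i=1..m. ln (lam i + t * e i))) has_real_derivative 1 / 2 * (\<Sum>i=1..m. e i / lam i)) (at 0)"
  by (intro DERIV_cmult DERIV_sum) (use lam in \<open>auto intro!: derivative_eq_intros simp: divide_inverse mult.commute\<close>)
 have "((\<lambda>t. (\<Sum>i=1..m. \<Sum>j=1..n. real (y i j) * (\<beta>0 + t * a + (\<beta>1 + t * b) * x i j + (\<mu> i + t * c i))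
    - exp (\<beta>0 + t * a + (\<beta>1 + t * b) * x i j + (\<mu> i + t * c i) + (lam i + t * e i) / 2) - ln (fact (y i j)))
   - real m / 2 * ln (s + t * g) + real m / 2
   - 1 / (2 * (s + t * g)) * (\<Sum>i=1..m. (\<mu> i + t * c i)\<^sup>2 + (lam i + t * e i))
   + 1 / 2 * (\<Sum>i=1..m. ln (lam i + t * e i))) has_real_derivative
   (\<Sum>i=1..m. \<Sum>j=1..n. real (y i j) * (a + b * x i j + c i) - E i j * (a + b * x i j + c i + e i / 2))
   - real m / 2 * (g / s) + 0
   - (- (g / (2 * s\<^sup>2)) * (\<Sum>i=1..m. (\<mu> i)\<^sup>2 + lam i) + 1 / (2 * s) * (\<Sum>i=1..m. 2 * \<mu> i * c i + e i))
   + 1 / 2 * (\<Sum>i=1..m. e i / lam i)) (at 0)"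
  by (intro DERIV_add DERIV_diff 1 2 3 4 DERIV_const)
 then show ?thesis unfolding gva_loglik_def by (simp add: diff_diff_eq2 diff_add_eq)
qed

lemma has_max_derivative_zero:
 fixes f :: "real => real"
 assumes "(f has_real_derivative l) (at 0)" and "\<forall>\<^sub>F t in at 0. f t <= f 0"
 shows "l = 0"
proof -
 obtain d where d: "d > 0" "\<And>t. t \<noteq> 0 ==> dist t 0 < d ==> f t <= f 0"
  using assms(2) unfolding eventually_at by auto
 have "f t <= f 0" if "\<bar>0 - t\<bar> < d" for t
  using d(2)[of t] that by (cases "t = 0") (auto simp: dist_real_def)
 then have "\<forall>t. \<bar>0 - t\<bar> < d \<longrightarrow> f t <= f 0" by blast
 then show ?thesis using DERIV_local_max[OF assms(1) d(1)] by simp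
qed

lemma argmax_imp_gva_eq:
 assumes n: "n >= 1" and m: "m >= 1"
  and am: "is_arg_max (gva_loglik m n x y) (\<lambda>\<theta>. \<theta> \<in> gva_params m) (\<beta>0, \<beta>1, s, \<mu>, lam)"
 shows "\<exists>G. gva_eq m n x y \<beta>0 \<beta>1 s \<mu> lam G"
proof -
 have par: "s > 0" "\<mu> \<in> {1..m} \<rightarrow>\<^sub>E UNIV" "lam \<in> {1..m} \<rightarrow>\<^sub>E {0<..}"
  using am by (auto simp: is_arg_max_def gva_params_def)
 have lam: "lam i > 0" if "i \<in> {1..m}" for i using par(3) that by (auto simp: PiE_iff)
 have mx: "gva_loglik m n x y \<theta> <= gva_loglik m n x y (\<beta>0, \<beta>1, s, \<mu>, lam)" if "\<theta> \<in> gva_params m" for \<theta>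
  using am that unfolding is_arg_max_linorder by blast
 define E where "E = (\<lambda>i j. exp (\<beta>0 + \<beta>1 * x i j + \<mu> i + lam i / 2))"
 define Y where "Y = (\<lambda>i. real (\<Sum>j=1..n. y i j))"
 define G where "G = (\<lambda>i. \<Sum>j=1..n. E i j)"
 have zero: "(\<Sum>i=1..m. \<Sum>j=1..n. real (y i j) * (a + b * x i j + c i) - E i j * (a + b * x i j + c i + e i / 2))
    - real m / 2 * (g / s) + g / (2 * s\<^sup>2) * (\<Sum>i=1..m. (\<mu> i)\<^sup>2 + lam i)
    - 1 / (2 * s) * (\<Sum>i=1..m. 2 * \<mu> i * c i + e i) + 1 / 2 * (\<Sum>i=1..m. e i / lam i) = 0"
  if ce: "\<And>k. k \<notin> {1..m} ==> c k = 0 \<and> e k = 0" for a b g :: real and c e :: "nat => real"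
 proof (rule has_max_derivative_zero)
  show "((\<lambda>t. gva_loglik m n x y (\<beta>0 + t * a, \<beta>1 + t * b, s + t * g, \<lambda>k. \<mu> k + t * c k, \<lambda>k. lam k + t * e k))
   has_real_derivative
    (\<Sum>i=1..m. \<Sum>j=1..n. real (y i j) * (a + b * x i j + c i) - E i j * (a + b * x i j + c i + e i / 2))
    - real m / 2 * (g / s) + g / (2 * s\<^sup>2) * (\<Sum>i=1..m. (\<mu> i)\<^sup>2 + lam i)
    - 1 / (2 * s) * (\<Sum>i=1..m. 2 * \<mu> i * c i + e i) + 1 / 2 * (\<Sum>i=1..m. e i / lam i)) (at 0)"
   unfolding E_def by (rule loglik_direction[OF par(1) lam])
  have 1: "\<forall>\<^sub>F t in at 0. s + t * g > 0"
  proof (rule order_tendstoD(1))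
   show "((\<lambda>t. s + t * g) \<longlongrightarrow> s + 0 * g) (at 0)" by (intro tendsto_intros)
  qed (use par in simp)
  have 2: "\<forall>\<^sub>F t in at 0. \<forall>i\<in>{1..m}. lam i + t * e i > 0"
  proof (intro eventually_ball_finite ballI)
   fix i assume i: "i \<in> {1..m}"
   show "\<forall>\<^sub>F t in at 0. lam i + t * e i > 0"
   proof (rule order_tendstoD(1))
    show "((\<lambda>t. lam i + t * e i) \<longlongrightarrow> lam i + 0 * e i) (at 0)" by (intro tendsto_intros)
   qed (use lam[OF i] in simp)
  qed auto
  show "\<forall>\<^sub>F t in at 0. gva_loglik m n x y (\<beta>0 + t * a, \<beta>1 + t * b, s + t * g, \<lambda>k. \<mu> k + t * c k, \<lambda>k. lam k + t * e k)
    <= gva_loglik m n x y (\<beta>0 + 0 * a, \<beta>1 + 0 * b, s + 0 * g, \<lambda>k. \<mu> k + 0 * c k, \<lambda>k. lam k + 0 * e k)"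
   using 1 2
  proof eventually_elim
   case (elim t)
   have "(\<beta>0 + t * a, \<beta>1 + t * b, s + t * g, \<lambda>k. \<mu> k + t * c k, \<lambda>k. lam k + t * e k) \<in> gva_params m"
    using elim ce par(2,3) by (auto simp: gva_params_def PiE_iff extensional_def)
   from mx[OF this] show ?case by simp
  qed
 qed
 have Gpos: "G i > 0" for i unfolding G_def E_def using n by (intro sum_pos) auto
 have b0: "(\<Sum>i=1..m. G i) = (\<Sum>i=1..m. Y i)"
  using zero[of "\<lambda>_. 0" "\<lambda>_. 0" 1 0 0] by (simp add: sum_subtractf G_def Y_def)
 have b1: "(\<Sum>i=1..m. \<Sum>j=1..n. E i j * x i j) = (\<Sum>i=1..m. \<Sum>j=1..n. real (y i j) * x i j)"
  using zero[of "\<lambda>_. 0" "\<lambda>_. 0" 0 1 0] by (simp add: sum_subtractf)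
 have mu: "\<mu> i = s * (Y i - G i)" if i: "i \<in> {1..m}" for i
 proof -
  let ?c = "\<lambda>k. if k = i then 1 else 0 :: real"
  have "(\<Sum>k=1..m. \<Sum>j=1..n. real (y k j) * ?c k - E k j * ?c k) = (\<Sum>k=1..m. (Y k - G k) * ?c k)"
   by (intro sum.cong refl) (simp add: sum_subtractf Y_def G_def sum_distrib_right)
  then have 1: "(\<Sum>k=1..m. \<Sum>j=1..n. real (y k j) * ?c k - E k j * ?c k) = Y i - G i"
   using sum_indicator_single[OF i, of "\<lambda>k. Y k - G k"] by simp
  have 2: "(\<Sum>k=1..m. 2 * \<mu> k * ?c k) = 2 * \<mu> i"
   using sum_indicator_single[OF i, of "\<lambda>k. 2 * \<mu> k"] by simp
  have "(\<Sum>k=1..m. \<Sum>j=1..n. real (y k j) * ?c k - E k j * ?c k) - 1 / (2 * s) * (\<Sum>k=1..m. 2 * \<mu> k * ?c k) = 0"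
  proof -
   have "?c k = 0 \<and> (0::real) = 0" if "k \<notin> {1..m}" for k using that i by auto
   from zero[of ?c "\<lambda>_. 0" 0 0 0, OF this] show ?thesis by simp
  qed
  then show ?thesis unfolding 1 2 using par(1) by (simp add: field_simps)
 qed
 have la: "lam i = s / (1 + s * G i)" if i: "i \<in> {1..m}" for i
 proof -
  let ?e = "\<lambda>k. if k = i then 1 else 0 :: real"
  have "(\<Sum>k=1..m. \<Sum>j=1..n. - (E k j * (?e k / 2))) = (\<Sum>k=1..m. - (G k / 2) * ?e k)"
   by (intro sum.cong refl) (simp add: sum_negf G_def sum_distrib_right sum_divide_distrib)
  then have 1: "(\<Sum>k=1..m. \<Sum>j=1..n. - (E k j * (?e k / 2))) = - (G i / 2)"
   using sum_indicator_single[OF i, of "\<lambda>k. - (G k / 2)"] by simp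
  have 2: "(\<Sum>k=1..m. ?e k) = 1" using sum_indicator_single[OF i, of "\<lambda>k. 1"] by simp
  have 3: "(\<Sum>k=1..m. ?e k / lam k) = 1 / lam i"
   using sum_indicator_single[OF i, of "\<lambda>k. 1 / lam k"] by simp
  have "(\<Sum>k=1..m. \<Sum>j=1..n. - (E k j * (?e k / 2))) - 1 / (2 * s) * (\<Sum>k=1..m. ?e k)
    + 1 / 2 * (\<Sum>k=1..m. ?e k / lam k) = 0"
  proof -
   have "(0::real) = 0 \<and> ?e k = 0" if "k \<notin> {1..m}" for k using that i by auto
   from zero[of "\<lambda>_. 0" ?e 0 0 0, OF this] show ?thesis by simp
  qed
  then have "1 / lam i = G i + 1 / s" unfolding 1 2 3 by (simp add: field_simps)
  then have "lam i = 1 / (G i + 1 / s)" using lam[OF i] by (metis div_by_1 divide_divide_eq_right mult_1)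
  then show ?thesis using par(1) by (simp add: field_simps)
 qed
 have ss: "real m * s = (\<Sum>i=1..m. (\<mu> i)\<^sup>2 + lam i)"
  using zero[of "\<lambda>_. 0" "\<lambda>_. 0" 0 0 1] par(1) by (simp add: field_simps power2_eq_square)
 have G_alt: "G i = exp \<beta>0 * wsum n (x i) 0 \<beta>1 * exp (\<mu> i + lam i / 2)" for i
  by (simp add: G_def E_def wsum_def sum_distrib_left sum_distrib_right exp_add mult_ac)
 have GR: "G i * wmean n (x i) \<beta>1 = (\<Sum>j=1..n. E i j * x i j)" for i
 proof -
  have "G i * wmean n (x i) \<beta>1 = exp \<beta>0 * exp (\<mu> i + lam i / 2) * wsum n (x i) 1 \<beta>1"
   unfolding G_alt wmean_def using wsum_0_pos[OF n, of "x i" \<beta>1] by simp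
  also have "\<dots> = (\<Sum>j=1..n. E i j * x i j)"
   by (simp add: E_def wsum_def sum_distrib_left exp_add mult_ac)
  finally show ?thesis .
 qed
 \<comment> \<open>The scale equation says that the squares of the \<open>\<mu> i\<close> sum to the
   sum of the \<open>s - lam i\<close>, and each \<open>s - lam i\<close> is at most
   \<open>s\<^sup>2 * G i\<close>. Dividing by \<open>s\<^sup>2\<close> leaves a bound free of
   \<open>s\<close>, a form that still makes sense on the boundary.\<close>
 have sq: "(\<Sum>i=1..m. (Y i - G i)\<^sup>2) <= (\<Sum>i=1..m. Y i)"
 proof -
  have "s\<^sup>2 * (\<Sum>i=1..m. (Y i - G i)\<^sup>2) = (\<Sum>i=1..m. (\<mu> i)\<^sup>2)"
   unfolding sum_distrib_left by (intro sum.cong refl) (simp add: mu power_mult_distrib)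
  also have "\<dots> = (\<Sum>i=1..m. s - lam i)" using ss by (simp add: sum.distrib sum_subtractf)
  also have "\<dots> <= (\<Sum>i=1..m. s\<^sup>2 * G i)"
  proof (rule sum_mono)
   fix i assume i: "i \<in> {1..m}"
   have p: "1 + s * G i > 0" using par(1) Gpos[of i] by (simp add: add_pos_pos)
   have "s - lam i = s\<^sup>2 * G i / (1 + s * G i)"
    unfolding la[OF i] using p by (simp add: field_simps power2_eq_square)
   also have "\<dots> <= s\<^sup>2 * G i / 1"
    using par(1) Gpos[of i] by (intro divide_left_mono) (auto intro: add_pos_pos)
   finally show "s - lam i <= s\<^sup>2 * G i" by simp
  qed
  finally have "s\<^sup>2 * (\<Sum>i=1..m. (Y i - G i)\<^sup>2) <= s\<^sup>2 * (\<Sum>i=1..m. Y i)"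
   using b0 by (simp add: sum_distrib_left[symmetric])
  then show ?thesis using par(1) by simp
 qed
 have "gva_eq m n x y \<beta>0 \<beta>1 s \<mu> lam G"
  unfolding gva_eq_def
 proof (intro conjI ballI)
  show "s >= 0" using par by simp
  show "s = avg m (\<lambda>i. (\<mu> i)\<^sup>2 + lam i)" using ss m by (simp add: avg_def field_simps)
  show "(\<Sum>i = 1..m. G i * wmean n (x i) \<beta>1) = (\<Sum>i = 1..m. \<Sum>j = 1..n. x i j * real (y i j))"
   unfolding GR b1 by (simp add: mult.commute)
  show "(\<Sum>i = 1..m. G i) = (\<Sum>i = 1..m. real (\<Sum>j = 1..n. y i j))" using b0 by (simp only: Y_def)
  show "(\<Sum>i = 1..m. (real (\<Sum>j = 1..n. y i j) - G i)\<^sup>2) <= (\<Sum>i = 1..m. real (\<Sum>j = 1..n. y i j))"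
   using sq by (simp only: Y_def)
  fix i assume i: "i \<in> {1..m}"
  show "G i = exp \<beta>0 * wsum n (x i) 0 \<beta>1 * exp (\<mu> i + lam i / 2)" by (rule G_alt)
  show "\<mu> i = s * (real (\<Sum>j = 1..n. y i j) - G i)" using mu[OF i] by (simp only: Y_def)
  show "lam i = s / (1 + s * G i)" by (rule la[OF i])
 qed
 then show ?thesis by blast
qed

text \<open>With \<open>\<mu> = \<sigma> \<nu>\<close> and \<open>lam = \<sigma>\<^sup>2 \<kappa>\<close> the log-likelihood extends continuously to \<open>\<sigma> = 0\<close>, the ordinary
 Poisson regression, and becomes coercive. Hence a maximiser exists at least on the closed
 parameter space.\<close>

definition scaled_loglik ::
  "nat => nat => (nat => nat => real) => (nat => nat => nat) => gva_param => real" where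
 "scaled_loglik m n x y = (\<lambda>(\<beta>0, \<beta>1, \<sigma>, \<nu>, \<kappa>).
   (\<Sum>i=1..m. \<Sum>j=1..n. real (y i j) * (\<beta>0 + \<beta>1 * x i j + \<sigma> * \<nu> i)
    - exp (\<beta>0 + \<beta>1 * x i j + \<sigma> * \<nu> i + \<sigma>\<^sup>2 * \<kappa> i / 2))
   - 1 / 2 * (\<Sum>i=1..m. (\<nu> i)\<^sup>2 + (\<kappa> i - ln (\<kappa> i) - 1)))"

definition scaled_params :: "nat => gva_param set" where
 "scaled_params m = {(\<beta>0, \<beta>1, \<sigma>, \<nu>, \<kappa>). \<sigma> >= 0 \<and>
   \<nu> \<in> {1..m} \<rightarrow>\<^sub>E UNIV \<and> \<kappa> \<in> {1..m} \<rightarrow>\<^sub>E {0<..}}"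

section \<open>Coercivity and compactness of the scaled problem\<close>

lemma scaled_loglik_eq:
 assumes s: "\<sigma> > 0" and k: "\<And>i. i \<in> {1..m} ==> \<kappa> i > 0"
  and mu: "\<And>i. i \<in> {1..m} ==> \<mu> i = \<sigma> * \<nu> i" and la: "\<And>i. i \<in> {1..m} ==> lam i = \<sigma>\<^sup>2 * \<kappa> i"
 shows "gva_loglik m n x y (\<beta>0, \<beta>1, \<sigma>\<^sup>2, \<mu>, lam)
  = scaled_loglik m n x y (\<beta>0, \<beta>1, \<sigma>, \<nu>, \<kappa>) - (\<Sum>i=1..m. \<Sum>j=1..n. ln (fact (y i j)))"
proof -
 have 1: "1 / (2 * \<sigma>\<^sup>2) * (\<Sum>i=1..m. (\<mu> i)\<^sup>2 + lam i) = 1 / 2 * (\<Sum>i=1..m. (\<nu> i)\<^sup>2 + \<kappa> i)"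
  unfolding sum_distrib_left using s
  by (intro sum.cong refl) (simp add: mu la power_mult_distrib field_simps)
 have 2: "(\<Sum>i=1..m. ln (lam i)) = real m * ln (\<sigma>\<^sup>2) + (\<Sum>i=1..m. ln (\<kappa> i))"
 proof -
  have "(\<Sum>i=1..m. ln (lam i)) = (\<Sum>i=1..m. ln (\<sigma>\<^sup>2) + ln (\<kappa> i))"
   using s k by (intro sum.cong refl) (simp add: la ln_mult_pos)
  then show ?thesis by (simp add: sum.distrib)
 qed
 have 3: "(\<Sum>i=1..m. (\<nu> i)\<^sup>2 + (\<kappa> i - ln (\<kappa> i) - 1)) = (\<Sum>i=1..m. (\<nu> i)\<^sup>2 + \<kappa> i) - (\<Sum>i=1..m. ln (\<kappa> i)) - real m"
  by (simp add: sum.distrib sum_subtractf)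
 have 4: "(\<Sum>i=1..m. \<Sum>j=1..n. real (y i j) * (\<beta>0 + \<beta>1 * x i j + \<mu> i)
    - exp (\<beta>0 + \<beta>1 * x i j + \<mu> i + lam i / 2) - ln (fact (y i j)))
   = (\<Sum>i=1..m. \<Sum>j=1..n. real (y i j) * (\<beta>0 + \<beta>1 * x i j + \<sigma> * \<nu> i)
    - exp (\<beta>0 + \<beta>1 * x i j + \<sigma> * \<nu> i + \<sigma>\<^sup>2 * \<kappa> i / 2)) - (\<Sum>i=1..m. \<Sum>j=1..n. ln (fact (y i j)))"
  unfolding sum_subtractf[symmetric] by (intro sum.cong refl) (simp add: mu la)
 show ?thesis unfolding gva_loglik_def scaled_loglik_def prod.case 1 2 3 4
  by (simp add: algebra_simps)
qed

text \<open>For l = 0 and k >= 1 the maximum over \<open>\<eta>\<close> is k ln k - k; the square is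
  a cruder bound that also covers k = 0. Beyond \<open>\<eta> = k\<close>, writing
  \<open>\<eta> = k + z\<close>, the estimate k z <= (1 + k)(1 + z) <= exp(k) exp(z) does the
  work.\<close>

lemma poisson_term_le:
 fixes \<eta> :: real
 assumes "l >= 0"
 shows "real k * \<eta> - exp (\<eta> + l / 2) <= (real k)\<^sup>2"
proof -
 have e: "exp \<eta> <= exp (\<eta> + l / 2)" using assms by simp
 show ?thesis
 proof (cases "\<eta> <= real k")
  case True
  have "real k * \<eta> <= real k * real k" using True by (intro mult_left_mono) auto
  then show ?thesis using exp_gt_zero[of "\<eta> + l / 2"] unfolding power2_eq_square by linarith
 next
  case False
  define z where "z = \<eta> - real k"
  have z: "z > 0" using False by (simp add: z_def)
  have k: "1 + real k <= exp (real k)" by (rule exp_ge_add_one_self)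
  have "1 + z <= exp z" by (rule exp_ge_add_one_self)
  have "real k * z <= (1 + real k) * (1 + z)" using z by (simp add: algebra_simps)
  also have "\<dots> <= exp (real k) * exp z" using k \<open>1 + z <= exp z\<close> z by (intro mult_mono) auto
  also have "\<dots> = exp \<eta>" by (simp add: z_def exp_add[symmetric])
  finally have "real k * \<eta> <= real k * real k + exp \<eta>" by (simp add: z_def algebra_simps)
  then show ?thesis using e unfolding power2_eq_square by linarith
 qed
qed

text \<open>A lower bound on one likelihood term confines both the linear predictor and the
  variance. A positive count is essential: for k = 0 the term tends to 0 as \<open>\<eta>\<close>
  tends to minus infinity. Hence positive responses at two different predictor values are what
  bounds both regression coefficients later.\<close>

lemma poisson_term_coercive:
 fixes \<eta> :: real
 assumes "l >= 0" "k >= 1" "K >= 0" "real k * \<eta> - exp (\<eta> + l / 2) >= - K"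
 shows "\<bar>\<eta>\<bar> <= 2 * real k + 2 * K + 1" "l <= 8 * real k + 8 * K + 4"
proof -
 have "real k * \<eta> >= - K" using assms(4) exp_gt_zero[of "\<eta> + l / 2"] by linarith
 have lo: "\<eta> >= - K"
 proof (rule ccontr)
  assume "\<not> \<eta> >= - K"
  then have "real k * \<eta> < real k * (- K)" using assms(2) by (intro mult_strict_left_mono) auto
  also have "real k * (- K) <= 1 * (- K)" using assms(2,3) by (intro mult_right_mono_neg) auto
  finally show False using \<open>real k * \<eta> >= - K\<close> by simp
 qed
 define z where "z = \<eta> + l / 2"
 have "real k * \<eta> <= real k * z" unfolding z_def using assms(1) by (intro mult_left_mono) auto
 then have ez: "exp z <= K + real k * z" using assms(4) by (simp add: z_def)
 have z: "z <= 2 * real k + 2 * K + 1"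
 proof (rule ccontr)
  assume "\<not> ?thesis"
  then have a: "z > 2 * real k + 2 * K + 1" by simp
  then have z1: "z >= 1" using assms(3) by auto
  have "z * (2 * real k + 2 * K + 1) <= z * z" using a z1 by (intro mult_left_mono) auto
  moreover have "1 + z + z\<^sup>2 / 2 <= exp z" using z1 by (intro exp_lower_Taylor_quadratic) auto
  moreover have "K * 1 <= K * z" using z1 assms(3) by (intro mult_left_mono) auto
  ultimately show False using ez z1 by (simp add: power2_eq_square algebra_simps)
 qed
 show "\<bar>\<eta>\<bar> <= 2 * real k + 2 * K + 1" using lo z assms(1,3) by (auto simp: z_def abs_le_iff)
 show "l <= 8 * real k + 8 * K + 4" using lo z assms(3) by (auto simp: z_def)
qed

lemma entropy_nonneg: "k > 0 ==> (k::real) - ln k - 1 >= 0"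
 using ln_le_minus_one[of k] by simp

lemma entropy_coercive:
 fixes k K :: real
 assumes "k > 0" "k - ln k - 1 <= K"
 shows "exp (- K - 1) <= k" "k <= 2 * K + 2"
proof -
 have "- K - 1 <= ln k" using assms by simp
 then have "exp (- K - 1) <= exp (ln k)" by simp
 then show "exp (- K - 1) <= k" using assms(1) by simp
 have "ln (k / 2) <= k / 2 - 1" using assms(1) by (intro ln_le_minus_one) auto
 then have "ln k <= k / 2 - 1 + ln 2" using assms(1) by (simp add: ln_div)
 also have "ln (2::real) <= 1" using ln_le_minus_one[of 2] by simp
 finally show "k <= 2 * K + 2" using assms(2) by simp
qed

text \<open>Giving the coordinates outside \<open>I\<close> the singleton of
  \<open>undefined\<close> makes a box of extensional functions a product of compact sets over the
  whole index type, so that Tychonoff's theorem applies to parameters in their given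
  encoding.\<close>

lemma compact_box:
 fixes a b :: "nat => real"
 shows "compact {f. (\<forall>i\<in>I. a i <= f i \<and> f i <= b i) \<and> (\<forall>i. i \<notin> I \<longrightarrow> f i = undefined)}"
proof -
 have "compactin (product_topology (\<lambda>_. euclidean) UNIV)
   (PiE UNIV (\<lambda>i. if i \<in> I then {a i..b i} else {undefined}))"
  by (subst compactin_PiE) auto
 moreover have "PiE UNIV (\<lambda>i. if i \<in> I then {a i..b i} else {undefined}) =
   {f. (\<forall>i\<in>I. a i <= f i \<and> f i <= b i) \<and> (\<forall>i. i \<notin> I \<longrightarrow> f i = undefined)}"
  by (auto simp: PiE_def Pi_def split: if_splits)
 ultimately show ?thesis by (simp add: euclidean_product_topology)
qed

lemma continuous_on_scaled_loglik:
 assumes "\<And>\<theta> i. \<theta> \<in> A ==> i \<in> {1..m} ==> snd (snd (snd (snd \<theta>))) i > 0"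
 shows "continuous_on A (scaled_loglik m n x y)"
proof -
 have e: "scaled_loglik m n x y = (\<lambda>\<theta>. (\<Sum>i=1..m. \<Sum>j=1..n. real (y i j) * (fst \<theta> + fst (snd \<theta>) * x i j + fst (snd (snd \<theta>)) * fst (snd (snd (snd \<theta>))) i)
    - exp (fst \<theta> + fst (snd \<theta>) * x i j + fst (snd (snd \<theta>)) * fst (snd (snd (snd \<theta>))) i + (fst (snd (snd \<theta>)))\<^sup>2 * snd (snd (snd (snd \<theta>))) i / 2))
   - 1 / 2 * (\<Sum>i=1..m. (fst (snd (snd (snd \<theta>))) i)\<^sup>2 + (snd (snd (snd (snd \<theta>))) i - ln (snd (snd (snd (snd \<theta>))) i) - 1)))"
  by (auto simp: scaled_loglik_def fun_eq_iff)
 have 1: "continuous_on A (\<lambda>\<theta>::gva_param. fst (snd (snd (snd \<theta>))) i)" for i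
  by (rule continuous_on_product_then_coordinatewise) (intro continuous_intros)
 have 2: "continuous_on A (\<lambda>\<theta>::gva_param. snd (snd (snd (snd \<theta>))) i)" for i
  by (rule continuous_on_product_then_coordinatewise) (intro continuous_intros)
 show ?thesis unfolding e
  by (intro continuous_intros 1 2) (use assms in \<open>auto simp: less_imp_neq[symmetric]\<close>)
qed

lemma scaled_maximiser_exists:
 assumes n: "n >= 1" and m: "m >= 1"
  and pos: "\<And>i. i \<in> {1..m} ==> \<exists>j\<in>{1..n}. y i j >= 1"
  and sep: "i1 \<in> {1..m}" "j1 \<in> {1..n}" "i2 \<in> {1..m}" "j2 \<in> {1..n}" "y i1 j1 >= 1" "y i2 j2 >= 1"
   "x i1 j1 \<noteq> x i2 j2"
 shows "\<exists>\<theta>\<in>scaled_params m. \<forall>\<theta>'\<in>scaled_params m. scaled_loglik m n x y \<theta>' <= scaled_loglik m n x y \<theta>"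
proof -
 let ?h = "scaled_loglik m n x y"
 \<comment> \<open>A reference point with no random effects and zero penalty. Maximisation may be
   restricted to the points at least as good as this one, the set \<open>A\<close>.\<close>
 define \<theta>0 where "\<theta>0 = (0::real, 0::real, 0::real, \<lambda>i::nat. if i \<in> {1..m} then 0 else undefined :: real,
   \<lambda>i::nat. if i \<in> {1..m} then 1 else undefined :: real)"
 have \<theta>0: "\<theta>0 \<in> scaled_params m" by (auto simp: \<theta>0_def scaled_params_def PiE_iff extensional_def)
 define A where "A = {\<theta> \<in> scaled_params m. ?h \<theta> >= ?h \<theta>0}"
 define b0 b1 \<sigma> where "b0 = (\<lambda>\<theta>::gva_param. fst \<theta>)" and "b1 = (\<lambda>\<theta>::gva_param. fst (snd \<theta>))"
  and "\<sigma> = (\<lambda>\<theta>::gva_param. fst (snd (snd \<theta>)))"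
 define \<nu> \<kappa> where "\<nu> = (\<lambda>\<theta>::gva_param. fst (snd (snd (snd \<theta>))))" and "\<kappa> = (\<lambda>\<theta>::gva_param. snd (snd (snd (snd \<theta>))))"
 define \<eta> where "\<eta> = (\<lambda>i j \<theta>. b0 \<theta> + b1 \<theta> * x i j + \<sigma> \<theta> * \<nu> \<theta> i)"
 define T where "T = (\<lambda>i j \<theta>. real (y i j) * \<eta> i j \<theta> - exp (\<eta> i j \<theta> + (\<sigma> \<theta>)\<^sup>2 * \<kappa> \<theta> i / 2))"
 define W where "W = (\<lambda>i \<theta>. (\<nu> \<theta> i)\<^sup>2 + (\<kappa> \<theta> i - ln (\<kappa> \<theta> i) - 1))"
 have h: "?h \<theta> = (\<Sum>i=1..m. \<Sum>j=1..n. T i j \<theta>) - 1 / 2 * (\<Sum>i=1..m. W i \<theta>)" for \<theta>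
  by (cases \<theta>) (simp add: scaled_loglik_def T_def W_def \<eta>_def b0_def b1_def \<sigma>_def \<nu>_def \<kappa>_def)
 have par: "\<sigma> \<theta> >= 0" "i \<in> {1..m} ==> \<kappa> \<theta> i > 0" if "\<theta> \<in> scaled_params m" for \<theta> i
  using that by (auto simp: scaled_params_def \<sigma>_def \<kappa>_def PiE_iff)
 have T_le: "T i j \<theta> <= (real (y i j))\<^sup>2" if "\<theta> \<in> scaled_params m" "i \<in> {1..m}" for i j \<theta>
  unfolding T_def by (rule poisson_term_le) (use par[OF that(1)] that(2) in \<open>auto simp: less_imp_le\<close>)
 have W_ge: "W i \<theta> >= 0" "(\<nu> \<theta> i)\<^sup>2 <= W i \<theta>" "\<kappa> \<theta> i - ln (\<kappa> \<theta> i) - 1 <= W i \<theta>"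
  if "\<theta> \<in> scaled_params m" "i \<in> {1..m}" for i \<theta>
  unfolding W_def using entropy_nonneg[OF par(2)[OF that]] by auto
 define Q where "Q = (\<Sum>i=1..m. \<Sum>j=1..n. (real (y i j))\<^sup>2)"
 define K where "K = Q - ?h \<theta>0"
 have sumT: "(\<Sum>i=1..m. \<Sum>j=1..n. T i j \<theta>) <= Q" if "\<theta> \<in> scaled_params m" for \<theta>
  unfolding Q_def using T_le[OF that] by (intro sum_mono) auto
 have sumW: "(\<Sum>i=1..m. W i \<theta>) >= 0" if "\<theta> \<in> scaled_params m" for \<theta>
  using W_ge(1)[OF that] by (intro sum_nonneg) auto
 have K0: "K >= 0" using sumT[OF \<theta>0] sumW[OF \<theta>0] by (simp add: K_def h)
 \<comment> \<open>The deficits \<open>(real (y i j))\<^sup>2 - T i j \<theta>\<close> are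
   nonnegative and on \<open>A\<close> their sum is at most \<open>K\<close>, so each single deficit
   is at most \<open>K\<close>.\<close>
 have T_ge: "T i j \<theta> >= - K" if "\<theta> \<in> A" "i \<in> {1..m}" "j \<in> {1..n}" for i j \<theta>
 proof -
  have p: "\<theta> \<in> scaled_params m" using that by (simp add: A_def)
  have "(\<Sum>i=1..m. \<Sum>j=1..n. (real (y i j))\<^sup>2 - T i j \<theta>) <= K"
   using that sumW[OF p] by (simp add: A_def h K_def Q_def sum_subtractf)
  moreover have "(\<Sum>j=1..n. (real (y i j))\<^sup>2 - T i j \<theta>) <= (\<Sum>i=1..m. \<Sum>j=1..n. (real (y i j))\<^sup>2 - T i j \<theta>)"
   using that T_le[OF p] by (intro member_le_sum sum_nonneg) auto
  moreover have "(real (y i j))\<^sup>2 - T i j \<theta> <= (\<Sum>j=1..n. (real (y i j))\<^sup>2 - T i j \<theta>)"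
   using that T_le[OF p] by (intro member_le_sum) auto
  moreover have "(real (y i j))\<^sup>2 >= 0" by simp
  ultimately show ?thesis by linarith
 qed
 have W_le: "W i \<theta> <= 2 * K" if "\<theta> \<in> A" "i \<in> {1..m}" for i \<theta>
 proof -
  have p: "\<theta> \<in> scaled_params m" using that by (simp add: A_def)
  have "(\<Sum>i=1..m. W i \<theta>) <= 2 * K" using that sumT[OF p] by (simp add: A_def h K_def)
  moreover have "W i \<theta> <= (\<Sum>i=1..m. W i \<theta>)"
   using that W_ge(1)[OF p] by (intro member_le_sum) auto
  ultimately show ?thesis by linarith
 qed
 \<comment> \<open>Boundedness on \<open>A\<close> is closed under arithmetic. It is known for
   selected linear predictors and for \<open>\<nu>\<close>, then obtained for
   \<open>\<sigma>\<close>; solving the two linear predictors with different predictor values for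
   the coefficients bounds those as well.\<close>
 define bd where "bd = (\<lambda>f :: gva_param => real. \<exists>c. \<forall>\<theta>\<in>A. \<bar>f \<theta>\<bar> <= c)"
 have bdI: "bd f" if "\<And>\<theta>. \<theta> \<in> A ==> \<bar>f \<theta>\<bar> <= c" for f c using that unfolding bd_def by blast
 have bd_const: "bd (\<lambda>_. c)" for c by (rule bdI[of _ "\<bar>c\<bar>"]) auto
 have bd_add: "bd (\<lambda>\<theta>. f \<theta> + g \<theta>)" if fg: "bd f" "bd g" for f g
 proof -
  obtain c e where "\<And>\<theta>. \<theta> \<in> A ==> \<bar>f \<theta>\<bar> <= c" "\<And>\<theta>. \<theta> \<in> A ==> \<bar>g \<theta>\<bar> <= e" using fg unfolding bd_def by blast
  then show ?thesis by (intro bdI[of _ "c + e"]) (smt (verit))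
 qed
 have bd_mult: "bd (\<lambda>\<theta>. f \<theta> * g \<theta>)" if fg: "bd f" "bd g" for f g
 proof -
  obtain c e where "\<And>\<theta>. \<theta> \<in> A ==> \<bar>f \<theta>\<bar> <= c" "\<And>\<theta>. \<theta> \<in> A ==> \<bar>g \<theta>\<bar> <= e" using fg unfolding bd_def by blast
  then show ?thesis by (intro bdI[of _ "c * e"]) (auto simp: abs_mult intro!: mult_mono')
 qed
 have bd_diff: "bd (\<lambda>\<theta>. f \<theta> - g \<theta>)" if fg: "bd f" "bd g" for f g
  using bd_add[OF fg(1) bd_mult[OF bd_const[of "-1"] fg(2)]] by simp
 have \<nu>_bd: "bd (\<lambda>\<theta>. \<nu> \<theta> i)" if i: "i \<in> {1..m}" for i
 proof (rule bdI)
  fix \<theta> assume t: "\<theta> \<in> A"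
  then have "(\<nu> \<theta> i)\<^sup>2 <= 2 * K" using W_ge(2)[of \<theta> i] W_le[OF t i] i by (auto simp: A_def)
  then show "\<bar>\<nu> \<theta> i\<bar> <= sqrt (2 * K)" by (intro real_le_rsqrt) simp
 qed
 have ent: "\<kappa> \<theta> i > 0 \<and> \<kappa> \<theta> i - ln (\<kappa> \<theta> i) - 1 <= 2 * K" if "\<theta> \<in> A" "i \<in> {1..m}" for \<theta> i
  using W_ge(3)[of \<theta> i] W_le[OF that] par(2)[of \<theta> i] that by (auto simp: A_def)
 have \<kappa>_lo: "exp (- (2 * K) - 1) <= \<kappa> \<theta> i" if "\<theta> \<in> A" "i \<in> {1..m}" for \<theta> i
  using entropy_coercive(1) ent[OF that] by blast
 have \<kappa>_hi: "\<kappa> \<theta> i <= 2 * (2 * K) + 2" if "\<theta> \<in> A" "i \<in> {1..m}" for \<theta> i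
  using entropy_coercive(2) ent[OF that] by blast
 have co: "\<bar>\<eta> i j \<theta>\<bar> <= 2 * real (y i j) + 2 * K + 1 \<and> (\<sigma> \<theta>)\<^sup>2 * \<kappa> \<theta> i <= 8 * real (y i j) + 8 * K + 4"
  if t: "\<theta> \<in> A" and ij: "i \<in> {1..m}" "j \<in> {1..n}" "y i j >= 1" for i j \<theta>
 proof -
  have l: "(\<sigma> \<theta>)\<^sup>2 * \<kappa> \<theta> i >= 0" using ent[OF t ij(1)] by (simp add: less_imp_le)
  show ?thesis using poisson_term_coercive[OF l ij(3) K0] T_ge[OF t ij(1,2)] by (simp add: T_def)
 qed
 have \<eta>_bd: "bd (\<eta> i j)" if "i \<in> {1..m}" "j \<in> {1..n}" "y i j >= 1" for i j
  by (rule bdI) (use co that in blast)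
 obtain j where j: "j \<in> {1..n}" "y 1 j >= 1" using pos[of 1] m by auto
 define c where "c = (8 * real (y 1 j) + 8 * K + 4) / exp (- (2 * K) - 1)"
 have \<sigma>_bd: "bd \<sigma>"
 proof (rule bdI[of _ "sqrt c"])
  fix \<theta> assume t: "\<theta> \<in> A"
  have "(\<sigma> \<theta>)\<^sup>2 * exp (- (2 * K) - 1) <= (\<sigma> \<theta>)\<^sup>2 * \<kappa> \<theta> 1"
   using \<kappa>_lo[OF t, of 1] m by (intro mult_left_mono) auto
  also have "\<dots> <= 8 * real (y 1 j) + 8 * K + 4" using co[OF t _ j] m by auto
  finally have "(\<sigma> \<theta>)\<^sup>2 <= c" unfolding c_def by (simp add: pos_le_divide_eq)
  then show "\<bar>\<sigma> \<theta>\<bar> <= sqrt c" by (intro real_le_rsqrt) simp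
 qed
 have b1_bd: "bd b1"
 proof -
  have "bd (\<lambda>\<theta>. ((\<eta> i1 j1 \<theta> - \<eta> i2 j2 \<theta>) - \<sigma> \<theta> * (\<nu> \<theta> i1 - \<nu> \<theta> i2)) * (1 / (x i1 j1 - x i2 j2)))"
   by (intro bd_mult bd_diff \<eta>_bd \<nu>_bd \<sigma>_bd bd_const sep)
  moreover have "((\<eta> i1 j1 \<theta> - \<eta> i2 j2 \<theta>) - \<sigma> \<theta> * (\<nu> \<theta> i1 - \<nu> \<theta> i2)) * (1 / (x i1 j1 - x i2 j2)) = b1 \<theta>" for \<theta>
  proof -
   have "(\<eta> i1 j1 \<theta> - \<eta> i2 j2 \<theta>) - \<sigma> \<theta> * (\<nu> \<theta> i1 - \<nu> \<theta> i2) = b1 \<theta> * (x i1 j1 - x i2 j2)"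
    by (simp add: \<eta>_def algebra_simps)
   then show ?thesis using sep(7) by simp
  qed
  ultimately show ?thesis by simp
 qed
 have b0_bd: "bd b0"
 proof -
  have "bd (\<lambda>\<theta>. \<eta> i1 j1 \<theta> - b1 \<theta> * x i1 j1 - \<sigma> \<theta> * \<nu> \<theta> i1)"
   by (intro bd_mult bd_diff \<eta>_bd \<nu>_bd \<sigma>_bd b1_bd bd_const sep)
  then show ?thesis by (simp add: \<eta>_def)
 qed
 obtain c0 where c0: "\<And>\<theta>. \<theta> \<in> A ==> \<bar>b0 \<theta>\<bar> <= c0" using b0_bd by (auto simp: bd_def)
 obtain c1 where c1: "\<And>\<theta>. \<theta> \<in> A ==> \<bar>b1 \<theta>\<bar> <= c1" using b1_bd by (auto simp: bd_def)
 obtain cs where cs: "\<And>\<theta>. \<theta> \<in> A ==> \<bar>\<sigma> \<theta>\<bar> <= cs" using \<sigma>_bd by (auto simp: bd_def)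
 have "\<forall>i. \<exists>c. i \<in> {1..m} \<longrightarrow> (\<forall>\<theta>\<in>A. \<bar>\<nu> \<theta> i\<bar> <= c)" using \<nu>_bd by (auto simp: bd_def)
 then obtain cn where cn: "\<And>i \<theta>. i \<in> {1..m} ==> \<theta> \<in> A ==> \<bar>\<nu> \<theta> i\<bar> <= cn i" by metis
 define B where "B = {- c0..c0} \<times> {- c1..c1} \<times> {0..cs} \<times>
   {f. (\<forall>i\<in>{1..m}. - cn i <= f i \<and> f i <= cn i) \<and> (\<forall>i. i \<notin> {1..m} \<longrightarrow> f i = undefined)} \<times>
   {f. (\<forall>i\<in>{1..m}. exp (- (2 * K) - 1) <= f i \<and> f i <= 2 * (2 * K) + 2) \<and> (\<forall>i. i \<notin> {1..m} \<longrightarrow> f i = undefined)}"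
 have "compact B" unfolding B_def by (intro compact_Times compact_box compact_Icc)
 have AB: "A \<subseteq> B"
 proof
  fix \<theta> assume t: "\<theta> \<in> A"
  obtain \<beta>0 \<beta>1 s f k where e: "\<theta> = (\<beta>0, \<beta>1, s, f, k)" by (cases \<theta>)
  have p: "\<theta> \<in> scaled_params m" using t by (simp add: A_def)
  then have "s >= 0" "\<forall>i. i \<notin> {1..m} \<longrightarrow> f i = undefined" "\<forall>i. i \<notin> {1..m} \<longrightarrow> k i = undefined"
   by (auto simp: e scaled_params_def PiE_def extensional_def)
  moreover have "\<bar>\<beta>0\<bar> <= c0" "\<bar>\<beta>1\<bar> <= c1" "\<bar>s\<bar> <= cs" using c0[OF t] c1[OF t] cs[OF t] by (auto simp: e b0_def b1_def \<sigma>_def)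
  moreover have "\<forall>i\<in>{1..m}. - cn i <= f i \<and> f i <= cn i"
  proof
   fix i assume "i \<in> {1..m}"
   then have "\<bar>f i\<bar> <= cn i" using cn[OF _ t] by (simp add: e \<nu>_def)
   then show "- cn i <= f i \<and> f i <= cn i" by linarith
  qed
  moreover have "\<forall>i\<in>{1..m}. exp (- (2 * K) - 1) <= k i \<and> k i <= 2 * (2 * K) + 2"
   using \<kappa>_lo[OF t] \<kappa>_hi[OF t] by (auto simp: e \<kappa>_def)
  ultimately show "\<theta> \<in> B" unfolding B_def e mem_Times_iff by auto
 qed
 have BP: "B \<subseteq> scaled_params m"
  by (auto simp: B_def scaled_params_def PiE_def extensional_def intro: less_le_trans[OF exp_gt_zero])
 have "continuous_on B ?h"
  by (rule continuous_on_scaled_loglik) (use BP par(2) in \<open>auto simp: \<kappa>_def\<close>)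
 moreover have "\<theta>0 \<in> A" using \<theta>0 by (simp add: A_def)
 then have "B \<noteq> {}" using AB by blast
 ultimately obtain \<theta> where \<theta>: "\<theta> \<in> B" "\<And>\<theta>'. \<theta>' \<in> B ==> ?h \<theta>' <= ?h \<theta>"
  using continuous_attains_sup[OF \<open>compact B\<close>] by blast
 show ?thesis
 proof (intro bexI ballI)
  fix \<theta>' assume t': "\<theta>' \<in> scaled_params m"
  show "?h \<theta>' <= ?h \<theta>"
  proof (cases "\<theta>' \<in> A")
   case True
   then show ?thesis using AB \<theta>(2) by blast
  next
   case False
   then have "?h \<theta>' <= ?h \<theta>0" using t' by (simp add: A_def)
   also have "\<dots> <= ?h \<theta>" using \<open>\<theta>0 \<in> A\<close> AB \<theta>(2) by blast
   finally show ?thesis .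
  qed
 qed (use \<theta>(1) BP in blast)
qed

lemma scaled_interior_argmax:
 assumes m: "m >= 1" and p: "(\<beta>0, \<beta>1, \<sigma>, \<nu>, \<kappa>) \<in> scaled_params m" and s: "\<sigma> > 0"
  and mx: "\<And>\<theta>. \<theta> \<in> scaled_params m ==> scaled_loglik m n x y \<theta> <= scaled_loglik m n x y (\<beta>0, \<beta>1, \<sigma>, \<nu>, \<kappa>)"
 shows "\<exists>\<theta>. is_gva_mle m n x y \<theta>"
proof -
 define \<mu> where "\<mu> = (\<lambda>i\<in>{1..m}. \<sigma> * \<nu> i)"
 define lam where "lam = (\<lambda>i\<in>{1..m}. \<sigma>\<^sup>2 * \<kappa> i)"
 have k: "\<kappa> i > 0" if "i \<in> {1..m}" for i using p that by (auto simp: scaled_params_def PiE_iff)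
 have g: "(\<beta>0, \<beta>1, \<sigma>\<^sup>2, \<mu>, lam) \<in> gva_params m"
  using s k by (auto simp: gva_params_def \<mu>_def lam_def)
 have e: "gva_loglik m n x y (\<beta>0, \<beta>1, \<sigma>\<^sup>2, \<mu>, lam)
   = scaled_loglik m n x y (\<beta>0, \<beta>1, \<sigma>, \<nu>, \<kappa>) - (\<Sum>i=1..m. \<Sum>j=1..n. ln (fact (y i j)))"
  by (rule scaled_loglik_eq[OF s k]) (auto simp: \<mu>_def lam_def)
 have "is_arg_max (gva_loglik m n x y) (\<lambda>\<theta>. \<theta> \<in> gva_params m) (\<beta>0, \<beta>1, \<sigma>\<^sup>2, \<mu>, lam)"
  unfolding is_arg_max_linorder
 proof (intro conjI allI impI g)
  fix \<theta>' assume t: "\<theta>' \<in> gva_params m"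
  obtain \<beta>0' \<beta>1' s' \<mu>' lam' where t': "\<theta>' = (\<beta>0', \<beta>1', s', \<mu>', lam')" by (cases \<theta>')
  have s': "s' > 0" "\<And>i. i \<in> {1..m} ==> lam' i > 0"
   using t by (auto simp: t' gva_params_def PiE_iff)
  define \<nu>' where "\<nu>' = (\<lambda>i\<in>{1..m}. \<mu>' i / sqrt s')"
  define \<kappa>' where "\<kappa>' = (\<lambda>i\<in>{1..m}. lam' i / s')"
  have p': "(\<beta>0', \<beta>1', sqrt s', \<nu>', \<kappa>') \<in> scaled_params m"
   using s' by (auto simp: scaled_params_def \<nu>'_def \<kappa>'_def)
  have sq: "(sqrt s')\<^sup>2 = s'" using s' by simp
  have "gva_loglik m n x y (\<beta>0', \<beta>1', (sqrt s')\<^sup>2, \<mu>', lam')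
   = scaled_loglik m n x y (\<beta>0', \<beta>1', sqrt s', \<nu>', \<kappa>') - (\<Sum>i=1..m. \<Sum>j=1..n. ln (fact (y i j)))"
   by (rule scaled_loglik_eq) (use s' in \<open>auto simp: \<nu>'_def \<kappa>'_def\<close>)
  then show "gva_loglik m n x y \<theta>' <= gva_loglik m n x y (\<beta>0, \<beta>1, \<sigma>\<^sup>2, \<mu>, lam)"
   using mx[OF p'] unfolding e t' sq by linarith
 qed
 then have "is_gva_mle m n x y (\<beta>0, \<beta>1, \<sigma>\<^sup>2)" unfolding is_gva_mle_def by blast
 then show ?thesis by blast
qed

text \<open>A maximiser on the boundary \<open>\<sigma> = 0\<close> is a Poisson regression fit; comparing it with
 \<open>\<sigma> = \<surd>\<tau>\<close>, \<open>\<nu> = \<surd>\<tau> (Y - G)\<close>, \<open>\<kappa> = 1\<close> to first order in \<open>\<tau>\<close> excludes overdispersion.\<close>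

lemma scaled_boundary_gva_eq:
 assumes m: "m >= 1" and n: "n >= 1" and p: "(\<beta>0, \<beta>1, 0, \<nu>, \<kappa>) \<in> scaled_params m"
  and mx: "\<And>\<theta>. \<theta> \<in> scaled_params m ==> scaled_loglik m n x y \<theta> <= scaled_loglik m n x y (\<beta>0, \<beta>1, 0, \<nu>, \<kappa>)"
 shows "\<exists>G. gva_eq m n x y \<beta>0 \<beta>1 0 (\<lambda>_. 0) (\<lambda>_. 0) G"
proof -
 define \<eta> where "\<eta> = (\<lambda>i j. \<beta>0 + \<beta>1 * x i j)"
 define E where "E = (\<lambda>i j. exp (\<eta> i j))"
 define Y where "Y = (\<lambda>i. real (\<Sum>j=1..n. y i j))"
 define G where "G = (\<lambda>i. \<Sum>j=1..n. E i j)"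
 \<comment> \<open>The perturbation is parametrised by the variance \<open>\<tau>\<close>, not by
   \<open>\<sigma>\<close>, with \<open>\<nu> = \<surd>\<tau> c\<close>: then \<open>\<tau>\<close>
   enters smoothly and the one-sided derivative at 0 exists. The formula makes sense for negative
   \<open>\<tau>\<close> too, although only \<open>\<tau> >= 0\<close> corresponds to
   parameters.\<close>
 define f where "f = (\<lambda>a b \<tau> c. (\<Sum>i=1..m. \<Sum>j=1..n. real (y i j) * (\<eta> i j + a + b * x i j + \<tau> * c i)
   - exp (\<eta> i j + a + b * x i j + \<tau> * (c i + 1 / 2))) - 1 / 2 * \<tau> * (\<Sum>i=1..m. (c i)\<^sup>2))"
 have "(\<Sum>i=1..m. (\<nu> i)\<^sup>2 + (\<kappa> i - ln (\<kappa> i) - 1)) >= 0"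
  using p entropy_nonneg by (intro sum_nonneg add_nonneg_nonneg) (auto simp: scaled_params_def PiE_iff)
 then have h0: "scaled_loglik m n x y (\<beta>0, \<beta>1, 0, \<nu>, \<kappa>) <= f 0 0 0 c" for c
  by (simp add: scaled_loglik_def f_def \<eta>_def)
 have fle: "f a b \<tau> c <= f 0 0 0 c" if \<tau>: "\<tau> >= 0" for a b \<tau> :: real and c :: "nat => real"
 proof -
  define \<nu>' where "\<nu>' = (\<lambda>i\<in>{1..m}. sqrt \<tau> * c i)"
  define \<kappa>' where "\<kappa>' = (\<lambda>i\<in>{1..m}. 1 :: real)"
  have q: "(\<beta>0 + a, \<beta>1 + b, sqrt \<tau>, \<nu>', \<kappa>') \<in> scaled_params m"
   using \<tau> by (auto simp: scaled_params_def \<nu>'_def \<kappa>'_def)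
  have "scaled_loglik m n x y (\<beta>0 + a, \<beta>1 + b, sqrt \<tau>, \<nu>', \<kappa>') = f a b \<tau> c"
  proof -
   have 1: "(\<Sum>i=1..m. (\<nu>' i)\<^sup>2 + (\<kappa>' i - ln (\<kappa>' i) - 1)) = \<tau> * (\<Sum>i=1..m. (c i)\<^sup>2)"
    unfolding sum_distrib_left using \<tau>
    by (intro sum.cong refl) (auto simp: \<nu>'_def \<kappa>'_def power_mult_distrib)
   have 2: "(\<Sum>i=1..m. \<Sum>j=1..n. real (y i j) * (\<beta>0 + a + (\<beta>1 + b) * x i j + sqrt \<tau> * \<nu>' i)
    - exp (\<beta>0 + a + (\<beta>1 + b) * x i j + sqrt \<tau> * \<nu>' i + (sqrt \<tau>)\<^sup>2 * \<kappa>' i / 2))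
    = (\<Sum>i=1..m. \<Sum>j=1..n. real (y i j) * (\<eta> i j + a + b * x i j + \<tau> * c i)
   - exp (\<eta> i j + a + b * x i j + \<tau> * (c i + 1 / 2)))"
   proof (intro sum.cong refl)
    fix i j assume i: "i \<in> {1..m}"
    have v: "sqrt \<tau> * \<nu>' i = \<tau> * c i" using i \<tau> by (simp add: \<nu>'_def flip: mult.assoc)
    have w: "(sqrt \<tau>)\<^sup>2 * \<kappa>' i / 2 = \<tau> / 2" using i \<tau> by (simp add: \<kappa>'_def)
    show "real (y i j) * (\<beta>0 + a + (\<beta>1 + b) * x i j + sqrt \<tau> * \<nu>' i)
     - exp (\<beta>0 + a + (\<beta>1 + b) * x i j + sqrt \<tau> * \<nu>' i + (sqrt \<tau>)\<^sup>2 * \<kappa>' i / 2)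
     = real (y i j) * (\<eta> i j + a + b * x i j + \<tau> * c i) - exp (\<eta> i j + a + b * x i j + \<tau> * (c i + 1 / 2))"
     unfolding v w \<eta>_def by (simp add: algebra_simps)
   qed
   show ?thesis unfolding scaled_loglik_def prod.case 1 2 f_def by simp
  qed
  then show ?thesis using mx[OF q] h0[of c] by simp
 qed
 have D: "((\<lambda>t. f (t * a) (t * b) (t * d) c) has_real_derivative
   (\<Sum>i=1..m. \<Sum>j=1..n. real (y i j) * (a + b * x i j + d * c i) - E i j * (a + b * x i j + d * (c i + 1 / 2)))
   - 1 / 2 * d * (\<Sum>i=1..m. (c i)\<^sup>2)) (at 0)" for a b d c
  unfolding f_def E_def
  by (intro DERIV_diff DERIV_sum) (auto intro!: derivative_eq_intros simp: algebra_simps)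
 have z: "(\<Sum>i=1..m. \<Sum>j=1..n. real (y i j) * (a + b * x i j) - E i j * (a + b * x i j)) = 0" for a b
 proof -
  have "((\<lambda>t. f (t * a) (t * b) (t * 0) (\<lambda>_. 0)) has_real_derivative
   (\<Sum>i=1..m. \<Sum>j=1..n. real (y i j) * (a + b * x i j) - E i j * (a + b * x i j))) (at 0)"
   using D[of a b 0 "\<lambda>_. 0"] by simp
  moreover have "\<forall>\<^sub>F t in at 0. f (t * a) (t * b) (t * 0) (\<lambda>_. 0) <= f (0 * a) (0 * b) (0 * 0) (\<lambda>_. 0)"
   using fle[of 0] by (intro always_eventually) auto
  ultimately show ?thesis by (rule has_max_derivative_zero)
 qed
 have b0: "(\<Sum>i=1..m. G i) = (\<Sum>i=1..m. Y i)"
  using z[of 1 0] by (simp add: sum_subtractf G_def Y_def)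
 have b1: "(\<Sum>i=1..m. \<Sum>j=1..n. E i j * x i j) = (\<Sum>i=1..m. \<Sum>j=1..n. real (y i j) * x i j)"
  using z[of 0 1] by (simp add: sum_subtractf)
 have sq: "(\<Sum>i=1..m. (Y i - G i)\<^sup>2) <= (\<Sum>i=1..m. Y i)"
 proof -
  \<comment> \<open>The first-order gain in \<open>\<tau>\<close> is the sum of c (Y - G) - c^2 / 2
    - G / 2 over the groups, which is largest at this choice of \<open>c\<close>.\<close>
  define c where "c = (\<lambda>i. Y i - G i)"
  define l where "l = (\<Sum>i=1..m. \<Sum>j=1..n. real (y i j) * c i - E i j * (c i + 1 / 2)) - 1 / 2 * (\<Sum>i=1..m. (c i)\<^sup>2)"
  have "l <= 0"
  proof (rule ccontr)
   assume "\<not> l <= 0"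
   moreover have "((\<lambda>t. f (t * 0) (t * 0) (t * 1) c) has_real_derivative l) (at 0)"
    using D[of 0 0 1 c] by (simp add: l_def)
   ultimately obtain d where "d > 0" "\<And>h. h > 0 ==> h < d ==> f 0 0 0 c < f 0 0 h c"
    using DERIV_pos_inc_right[of "\<lambda>t. f (t * 0) (t * 0) (t * 1) c" l 0] by auto
   from this(2)[of "d / 2"] this(1) show False using fle[of "d / 2" 0 0 c] by simp
  qed
  moreover have "(\<Sum>i=1..m. \<Sum>j=1..n. real (y i j) * c i - E i j * (c i + 1 / 2)) = (\<Sum>i=1..m. (c i)\<^sup>2 - G i / 2)"
  proof (intro sum.cong refl)
   fix i
   have "(\<Sum>j=1..n. real (y i j) * c i - E i j * (c i + 1 / 2)) = Y i * c i - G i * (c i + 1 / 2)"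
    by (simp add: sum_subtractf Y_def G_def sum_distrib_right)
   then show "(\<Sum>j=1..n. real (y i j) * c i - E i j * (c i + 1 / 2)) = (c i)\<^sup>2 - G i / 2"
    by (simp add: c_def power2_eq_square algebra_simps)
  qed
  moreover have "(\<Sum>i=1..m. (c i)\<^sup>2 - G i / 2) = (\<Sum>i=1..m. (c i)\<^sup>2) - 1 / 2 * (\<Sum>i=1..m. Y i)"
   using b0 by (simp add: sum_subtractf sum_divide_distrib[symmetric])
  ultimately have "(\<Sum>i=1..m. (c i)\<^sup>2) <= (\<Sum>i=1..m. Y i)" unfolding l_def by linarith
  then show ?thesis by (simp add: c_def)
 qed
 have G_alt: "G i = exp \<beta>0 * wsum n (x i) 0 \<beta>1" for i
  by (simp add: G_def E_def \<eta>_def wsum_def sum_distrib_left exp_add)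
 have GR: "G i * wmean n (x i) \<beta>1 = (\<Sum>j=1..n. E i j * x i j)" for i
 proof -
  have "G i * wmean n (x i) \<beta>1 = exp \<beta>0 * wsum n (x i) 1 \<beta>1"
   unfolding G_alt wmean_def using wsum_0_pos[OF n, of "x i" \<beta>1] by simp
  also have "\<dots> = (\<Sum>j=1..n. E i j * x i j)"
   by (simp add: E_def \<eta>_def wsum_def sum_distrib_left exp_add mult_ac)
  finally show ?thesis .
 qed
 have "gva_eq m n x y \<beta>0 \<beta>1 0 (\<lambda>_. 0) (\<lambda>_. 0) G"
  unfolding gva_eq_def
 proof (intro conjI ballI)
  show "(\<Sum>i = 1..m. G i * wmean n (x i) \<beta>1) = (\<Sum>i = 1..m. \<Sum>j = 1..n. x i j * real (y i j))"
   unfolding GR b1 by (simp add: mult.commute)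
  show "(\<Sum>i = 1..m. G i) = (\<Sum>i = 1..m. real (\<Sum>j = 1..n. y i j))" using b0 by (simp only: Y_def)
  show "(\<Sum>i = 1..m. (real (\<Sum>j = 1..n. y i j) - G i)\<^sup>2) <= (\<Sum>i = 1..m. real (\<Sum>j = 1..n. y i j))"
   using sq by (simp only: Y_def)
 qed (use G_alt in \<open>auto simp: avg_def\<close>)
 then show ?thesis by blast
qed

lemma mle_or_boundary:
 assumes "n >= 1" "m >= 1" "\<And>i. i \<in> {1..m} ==> \<exists>j\<in>{1..n}. y i j >= 1"
  "i1 \<in> {1..m}" "j1 \<in> {1..n}" "i2 \<in> {1..m}" "j2 \<in> {1..n}" "y i1 j1 >= 1" "y i2 j2 >= 1"
  "x i1 j1 \<noteq> x i2 j2"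
 shows "(\<exists>\<theta>. is_gva_mle m n x y \<theta>) \<or> (\<exists>\<beta>0 \<beta>1 G. gva_eq m n x y \<beta>0 \<beta>1 0 (\<lambda>_. 0) (\<lambda>_. 0) G)"
proof -
 obtain \<beta>0 \<beta>1 \<sigma> \<nu> \<kappa> where p: "(\<beta>0, \<beta>1, \<sigma>, \<nu>, \<kappa>) \<in> scaled_params m"
  and mx: "\<And>\<theta>. \<theta> \<in> scaled_params m ==> scaled_loglik m n x y \<theta> <= scaled_loglik m n x y (\<beta>0, \<beta>1, \<sigma>, \<nu>, \<kappa>)"
  using scaled_maximiser_exists[of n m y i1 j1 i2 j2 x] assms by (metis prod_cases5)
 show ?thesis
 proof (cases "\<sigma> = 0")
  case True
  then show ?thesis using scaled_boundary_gva_eq[OF assms(2,1)] p mx by metis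
 next
  case False
  then have "\<sigma> > 0" using p by (simp add: scaled_params_def)
  then show ?thesis using scaled_interior_argmax[OF assms(2) p _ mx] by blast
 qed
qed

section \<open>Coupling with normal variables\<close>

text \<open>If every small \<open>c\<close> left an atom at some value \<open>w c\<close>, the
  corresponding events would be almost surely disjoint, because two of them together determine the
  value of the atomless \<open>A\<close>. Uncountably many almost disjoint events of positive
  probability cannot exist: infinitely many would have probability above some 1 / (k + 1). No
  independence of \<open>Z\<close> and \<open>A\<close> enters.\<close>

lemma (in prob_space) atomless_perturbation:
 fixes Z A :: "'a => real"
 assumes [measurable]: "Z \<in> borel_measurable M" "A \<in> borel_measurable M"
  and A: "\<And>a. prob {pt \<in> space M. A pt = a} = 0" and e: "e > 0"
 shows "\<exists>c. 0 < c \<and> c < e \<and> (\<forall>w. prob {pt \<in> space M. Z pt + c * A pt = w} = 0)"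
proof (rule ccontr)
 assume "\<not> ?thesis"
 then have "\<forall>c. 0 < c \<and> c < e \<longrightarrow> (\<exists>w. prob {pt \<in> space M. Z pt + c * A pt = w} > 0)"
  by (meson measure_nonneg not_less order_le_less zero_less_measure_iff)
 then obtain w where w: "\<And>c. c \<in> {0<..<e} ==> prob {pt \<in> space M. Z pt + c * A pt = w c} > 0"
  by (metis greaterThanLessThan_iff)
 define E where "E = (\<lambda>c. {pt \<in> space M. Z pt + c * A pt = w c})"
 have [measurable]: "E c \<in> events" for c unfolding E_def by measurable
 have "{0<..<e} = (\<Union>k::nat. {c \<in> {0<..<e}. prob (E c) > 1 / real (Suc k)})"
 proof safe
  fix c assume "c \<in> {0<..<e}"
  then have "prob (E c) > 0" using w by (simp add: E_def)
  then obtain k where "1 / real (Suc k) < prob (E c)" using nat_approx_posE by metis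
  then show "c \<in> (\<Union>k::nat. {c \<in> {0<..<e}. prob (E c) > 1 / real (Suc k)})" using \<open>c \<in> {0<..<e}\<close> by auto
 qed
 moreover have "uncountable {0<..<e}" using e by (simp add: uncountable_open_interval)
 moreover have "countable (\<Union>k::nat. {c \<in> {0<..<e}. prob (E c) > 1 / real (Suc k)})"
  if "\<And>k. finite {c \<in> {0<..<e}. prob (E c) > 1 / real (Suc k)}"
  by (intro countable_UN countableI_type countable_finite that)
 ultimately obtain k where "infinite {c \<in> {0<..<e}. prob (E c) > 1 / real (Suc k)}"
  by metis
 then obtain F where F: "finite F" "card F = Suc k" "F \<subseteq> {c \<in> {0<..<e}. prob (E c) > 1 / real (Suc k)}"
  using infinite_arbitrarily_large by blast
 have disj: "AE pt in M. \<not> (pt \<in> E c \<and> pt \<in> E c')" if "c \<noteq> c'" for c c'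
 proof -
  define a where "a = (w c - w c') / (c - c')"
  have "AE pt in M. A pt \<noteq> a"
   using A[of a] by (subst AE_iff_measurable[OF _ refl]) (auto simp: emeasure_eq_measure)
  then show ?thesis
  proof eventually_elim
   case (elim pt)
   have "A pt = a" if "pt \<in> E c \<and> pt \<in> E c'"
   proof -
    have "(c - c') * A pt = w c - w c'" using that by (auto simp: E_def algebra_simps)
    then show ?thesis using \<open>c \<noteq> c'\<close> by (simp add: a_def field_simps)
   qed
   then show ?case using elim by blast
  qed
 qed
 have "AE pt in M. \<forall>c\<in>F. \<forall>c'\<in>F. c \<noteq> c' \<longrightarrow> \<not> (pt \<in> E c \<and> pt \<in> E c')"
 proof (intro AE_finite_allI F(1))
  fix c c'
  show "AE pt in M. c \<noteq> c' \<longrightarrow> \<not> (pt \<in> E c \<and> pt \<in> E c')"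
   using disj[of c c'] by (cases "c = c'") auto
 qed
 then have le: "AE pt in M. (\<Sum>c\<in>F. indicator (E c) pt) <= (1::real)"
 proof eventually_elim
  case (elim pt)
  show ?case
  proof (cases "\<exists>c\<in>F. pt \<in> E c")
   case True
   then obtain c where c: "c \<in> F" "pt \<in> E c" by auto
   have "(\<Sum>c\<in>F. indicator (E c) pt) = (\<Sum>c'\<in>F. if c' = c then 1 else (0::real))"
    using elim c by (intro sum.cong refl) (auto simp: indicator_def)
   then show ?thesis using F(1) c by simp
  next
   case False
   then have "(\<Sum>c\<in>F. indicator (E c) pt) = (0::real)" by (intro sum.neutral) (auto simp: indicator_def)
   then show ?thesis by simp
  qed
 qed
 have "(\<Sum>c\<in>F. prob (E c)) = (\<integral>pt. (\<Sum>c\<in>F. indicator (E c) pt) \<partial>M)"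
  by (subst Bochner_Integration.integral_sum) (auto simp: emeasure_eq_measure)
 also have "\<dots> <= (\<integral>pt. 1 \<partial>M)"
  using le by (intro integral_mono_AE) (auto simp: emeasure_eq_measure)
 finally have "(\<Sum>c\<in>F. prob (E c)) <= 1" by (simp add: prob_space)
 moreover have "(\<Sum>c\<in>F. 1 / real (Suc k)) < (\<Sum>c\<in>F. prob (E c))"
  using F by (intro sum_strict_mono) auto
 ultimately show False using F(2) by simp
qed

lemma (in prob_space) cdf_transform_uniform:
 fixes W :: "'a => real"
 assumes [measurable]: "W \<in> borel_measurable M"
  and at: "\<And>w. prob {pt \<in> space M. W pt = w} = 0" and p: "0 <= p" "p <= 1"
 defines "F \<equiv> cdf (distr M borel W)"
 shows "prob {pt \<in> space M. F (W pt) <= p} = p"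
proof -
 interpret D: real_distribution "distr M borel W" by simp
 have F_eq: "F x = prob {pt \<in> space M. W pt <= x}" for x
  unfolding F_def cdf_def by (subst measure_distr) (auto intro!: arg_cong[where f=prob])
 have cont: "isCont F x" for x
 proof -
  have "measure (distr M borel W) {x} = 0"
   using at[of x] by (subst measure_distr) (auto simp: vimage_def Int_def conj_commute)
  then show ?thesis unfolding F_def by (simp add: D.isCont_cdf)
 qed
 have mono: "x <= y ==> F x <= F y" for x y unfolding F_def by (rule D.cdf_nondecreasing)
 have [measurable]: "F \<in> borel_measurable borel" using mono by (intro borel_measurable_mono monoI)
 have ivt: "\<exists>x. F x = r" if r: "0 < r" "r < 1" for r
 proof -
  have "\<exists>a. F a < r"
   using order_tendstoD(2)[OF D.cdf_lim_at_bot r(1)] unfolding F_def by (auto simp: eventually_at_bot_linorder)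
  moreover have "\<exists>b. F b > r"
   using order_tendstoD(1)[OF D.cdf_lim_at_top_prob r(2)] unfolding F_def by (auto simp: eventually_at_top_linorder)
  ultimately obtain a b where ab: "F a < r" "r < F b" by auto
  then have "a <= b" using mono by (meson less_le_not_le linorder_le_cases order_less_trans)
  then show ?thesis using IVT[of F a r b] ab cont by (auto simp: less_imp_le)
 qed
 have le: "prob {pt \<in> space M. F (W pt) <= r'} <= r" if r: "0 < r" "r < 1" "r' < r" for r r'
 proof -
  obtain x where x: "F x = r" using ivt r by blast
  have "prob {pt \<in> space M. F (W pt) <= r'} <= prob {pt \<in> space M. W pt <= x}"
  proof (rule finite_measure_mono)
   show "{pt \<in> space M. F (W pt) <= r'} \<subseteq> {pt \<in> space M. W pt <= x}"
    using mono x r by (smt (verit) Collect_mono_iff)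
  qed measurable
  then show ?thesis using x F_eq by simp
 qed
 have ge: "r <= prob {pt \<in> space M. F (W pt) <= r}" if r: "0 < r" "r < 1" for r
 proof -
  obtain x where x: "F x = r" using ivt r by blast
  have "prob {pt \<in> space M. W pt <= x} <= prob {pt \<in> space M. F (W pt) <= r}"
   by (rule finite_measure_mono) (use mono x in auto)
  then show ?thesis using x F_eq by simp
 qed
 show ?thesis
 proof (rule antisym)
  show "prob {pt \<in> space M. F (W pt) <= p} <= p"
  proof (cases "p = 1")
   case False
   show ?thesis
   proof (rule dense_ge_bounded[of p 1])
    show "p < 1" using p False by simp
    fix r assume "p < r" "r < 1"
    then show "prob {pt \<in> space M. F (W pt) <= p} <= r" using le p by auto
   qed
  qed simp
  show "p <= prob {pt \<in> space M. F (W pt) <= p}"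
  proof (cases "p = 0")
   case False
   show ?thesis
   proof (rule dense_le_bounded[of 0 p])
    show "0 < p" using p False by simp
    fix r assume r: "0 < r" "r < p"
    have "r <= prob {pt \<in> space M. F (W pt) <= r}" using ge r p by auto
    also have "\<dots> <= prob {pt \<in> space M. F (W pt) <= p}"
     by (rule finite_measure_mono) (use r in auto)
    finally show "r <= prob {pt \<in> space M. F (W pt) <= p}" .
   qed
  qed simp
 qed
qed

text \<open>\<open>N\<close> is the \<open>D\<close>-quantile of the uniform variable
  \<open>F (W pt)\<close>, hence a nondecreasing function of \<open>W\<close> up to a null set. The
  events \<open>W <= x\<close> and \<open>N <= x\<close> are then nested, and what lies between them
  has the probability of the gap between the two distribution functions.\<close>

lemma (in prob_space) quantile_coupling:
 fixes W :: "'a => real" and D :: "real measure"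
 assumes W[measurable]: "W \<in> borel_measurable M"
  and at: "\<And>w. prob {pt \<in> space M. W pt = w} = 0" and D: "real_distribution D"
 shows "\<exists>N \<in> borel_measurable M. distr M borel N = D \<and>
  (\<forall>x. prob {pt \<in> space M. W pt <= x \<and> x < N pt} <= \<bar>cdf (distr M borel W) x - cdf D x\<bar> \<and>
     prob {pt \<in> space M. N pt <= x \<and> x < W pt} <= 2 * \<bar>cdf (distr M borel W) x - cdf D x\<bar>)"
proof -
 define F where "F = cdf (distr M borel W)"
 interpret W: real_distribution "distr M borel W" by simp
 interpret D: real_distribution D by (rule D)
 interpret D: cdf_distribution D ..
 have mono: "x <= y ==> F x <= F y" for x y unfolding F_def by (rule W.cdf_nondecreasing)
 have [measurable]: "F \<in> borel_measurable borel" using mono by (intro borel_measurable_mono monoI)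
 have F_eq: "F x = prob {pt \<in> space M. W pt <= x}" for x
  unfolding F_def cdf_def by (subst measure_distr) (auto intro!: arg_cong[where f=prob])
 have unif: "prob {pt \<in> space M. F (W pt) <= p} = p" if "0 <= p" "p <= 1" for p
  unfolding F_def by (rule cdf_transform_uniform[OF W at that])
 have C01: "0 <= cdf D x" "cdf D x <= 1" for x by (auto simp: D.cdf_nonneg D.cdf_bounded_prob)
 \<comment> \<open>The quantile function is used at levels strictly between 0 and 1 only; the value
   0 elsewhere is taken on a null set, as \<open>inside\<close> shows.\<close>
 define N where "N = (\<lambda>pt. if 0 < F (W pt) \<and> F (W pt) < 1 then D.I (F (W pt)) else 0)"
 have N_iff: "N pt <= x \<longleftrightarrow> F (W pt) <= cdf D x" if "0 < F (W pt)" "F (W pt) < 1" for pt x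
  using D.pseudoinverse[OF that, of x] that by (simp add: N_def)
 have N[measurable]: "N \<in> borel_measurable M"
 proof (rule borel_measurableI_le)
  fix x
  have "{pt \<in> space M. N pt <= x} = {pt \<in> space M. if 0 < F (W pt) \<and> F (W pt) < 1 then F (W pt) <= cdf D x else 0 <= x}"
  proof (intro Collect_cong conj_cong refl)
   fix pt
   show "N pt <= x \<longleftrightarrow> (if 0 < F (W pt) \<and> F (W pt) < 1 then F (W pt) <= cdf D x else 0 <= x)"
    using N_iff[of pt x] by (auto simp: N_def)
  qed
  also have "\<dots> \<in> events" by measurable
  finally show "{pt \<in> space M. N pt <= x} \<in> events" .
 qed
 have inside: "AE pt in M. 0 < F (W pt) \<and> F (W pt) < 1"
 proof -
  have "prob {pt \<in> space M. F (W pt) <= 0} = 0" using unif[of 0] by simp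
  then have 1: "AE pt in M. 0 < F (W pt)"
   by (subst AE_iff_measurable[OF _ refl]) (auto simp: emeasure_eq_measure not_less)
  have "prob {pt \<in> space M. \<not> F (W pt) < 1} <= e" if e: "e > 0" for e
  proof (cases "e < 1")
   case True
   have "prob {pt \<in> space M. \<not> F (W pt) < 1} <= prob (space M - {pt \<in> space M. F (W pt) <= 1 - e})"
    by (rule finite_measure_mono) (use e in auto)
   also have "\<dots> = 1 - (1 - e)" using unif[of "1 - e"] True e by (subst prob_compl) auto
   finally show ?thesis by simp
  next
   case False
   then show ?thesis using prob_le_1[of "{pt \<in> space M. \<not> F (W pt) < 1}"] by linarith
  qed
  then have "prob {pt \<in> space M. \<not> F (W pt) < 1} <= 0" by (rule field_le_epsilon) simp
  then have "prob {pt \<in> space M. \<not> F (W pt) < 1} = 0" by (simp add: measure_le_0_iff)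
  then have 2: "AE pt in M. F (W pt) < 1"
   by (subst AE_iff_measurable[OF _ refl]) (auto simp: emeasure_eq_measure)
  show ?thesis using 1 2 by eventually_elim auto
 qed
 have N_cdf: "prob {pt \<in> space M. N pt <= x} = cdf D x" for x
 proof -
  have "prob {pt \<in> space M. N pt <= x} = prob {pt \<in> space M. F (W pt) <= cdf D x}"
   by (rule finite_measure_eq_AE) (use inside N_iff in auto)
  then show ?thesis using unif C01 by simp
 qed
 have distr: "distr M borel N = D"
 proof (rule cdf_unique)
  show "cdf (distr M borel N) = cdf D"
  proof
   fix x
   have "cdf (distr M borel N) x = prob {pt \<in> space M. N pt <= x}"
    unfolding cdf_def by (subst measure_distr) (auto intro!: arg_cong[where f=prob])
   then show "cdf (distr M borel N) x = cdf D x" using N_cdf by simp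
  qed
 qed (auto intro: D)
 have up: "prob {pt \<in> space M. W pt <= x \<and> x < N pt} <= \<bar>F x - cdf D x\<bar>" for x
 proof (cases "F x <= cdf D x")
  case True
  have "prob {pt \<in> space M. W pt <= x \<and> x < N pt} = prob {}"
  proof (rule finite_measure_eq_AE)
   show "AE pt in M. (pt \<in> {pt \<in> space M. W pt <= x \<and> x < N pt}) = (pt \<in> {})"
    using inside
   proof eventually_elim
    case (elim pt)
    then show ?case using N_iff[of pt x] mono[of "W pt" x] True by auto
   qed
  qed auto
  then show ?thesis by simp
 next
  case False
  have "prob {pt \<in> space M. W pt <= x \<and> x < N pt}
    <= prob ({pt \<in> space M. F (W pt) <= F x} - {pt \<in> space M. F (W pt) <= cdf D x})"
   by (rule finite_measure_mono_AE) (use inside N_iff mono in \<open>auto simp: not_le[symmetric]\<close>)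
  also have "\<dots> = prob {pt \<in> space M. F (W pt) <= F x} - prob {pt \<in> space M. F (W pt) <= cdf D x}"
   by (rule finite_measure_Diff) (use False in auto)
  also have "\<dots> = F x - cdf D x"
   using unif[of "F x"] unif[of "cdf D x"] C01 by (simp add: F_def W.cdf_nonneg W.cdf_bounded_prob)
  finally show ?thesis by simp
 qed
 \<comment> \<open>The probabilities of the two opposite crossings differ exactly by the gap of the
   distribution functions at \<open>x\<close>. The second crossing thus follows from the first,
   which is the origin of the factor 2.\<close>
 have dn: "prob {pt \<in> space M. N pt <= x \<and> x < W pt} <= 2 * \<bar>F x - cdf D x\<bar>" for x
 proof -
  have "{pt \<in> space M. N pt <= x} \<union> {pt \<in> space M. W pt <= x \<and> x < N pt}
    = {pt \<in> space M. W pt <= x} \<union> {pt \<in> space M. N pt <= x \<and> x < W pt}" by auto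
  then have "prob {pt \<in> space M. N pt <= x} + prob {pt \<in> space M. W pt <= x \<and> x < N pt}
    = prob {pt \<in> space M. W pt <= x} + prob {pt \<in> space M. N pt <= x \<and> x < W pt}"
   by (subst (1 2) finite_measure_Union[symmetric]) auto
  then have "prob {pt \<in> space M. N pt <= x \<and> x < W pt} = (cdf D x - F x) + prob {pt \<in> space M. W pt <= x \<and> x < N pt}"
   unfolding N_cdf F_eq[symmetric] by simp
  also have "\<dots> <= \<bar>F x - cdf D x\<bar> + \<bar>F x - cdf D x\<bar>" by (intro add_mono up) simp
  finally show ?thesis by simp
 qed
 show ?thesis using N distr up dn unfolding F_def by blast
qed

lemma distr_std_normal_atomless: "measure std_normal_distribution {x} = 0"
proof -
 have "emeasure (density lborel (\<lambda>x. ennreal (std_normal_density x))) {x} = 0"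
  by (subst emeasure_density) (auto simp: nn_integral_0_iff_AE AE_lborel_singleton intro!: AE_mp[OF AE_lborel_singleton[of x]])
 then show ?thesis by (simp add: measure_def)
qed

text \<open>If \<open>N\<close> and \<open>W\<close> are more than \<open>e\<close> apart, a point
  of the grid of width \<open>e\<close> separates them; if moreover \<open>N\<close> is at most
  \<open>e * k\<close> in size, this point is among finitely many. A union bound over the grid
  reduces closeness of the variables to closeness of the distribution functions at finitely many
  points.\<close>

lemma (in prob_space) coupling_distance:
 fixes W N :: "'a => real"
 assumes [measurable]: "W \<in> borel_measurable M" "N \<in> borel_measurable M"
  and e: "e > 0"
  and up: "\<And>x. prob {pt \<in> space M. W pt <= x \<and> x < N pt} <= g x"
  and dn: "\<And>x. prob {pt \<in> space M. N pt <= x \<and> x < W pt} <= 2 * g x"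
 shows "prob {pt \<in> space M. \<bar>N pt - W pt\<bar> > e}
   <= prob {pt \<in> space M. \<bar>N pt\<bar> > e * real k} + (\<Sum>l\<in>{- int k - 2..int k + 2}. 3 * g (e * of_int l))"
proof -
 define A where "A = (\<lambda>l. {pt \<in> space M. W pt <= e * of_int l \<and> e * of_int l < N pt} \<union>
   {pt \<in> space M. N pt <= e * of_int l \<and> e * of_int l < W pt})"
 have A: "A l \<in> events" for l unfolding A_def by measurable
 have "{pt \<in> space M. \<bar>N pt - W pt\<bar> > e} \<subseteq> {pt \<in> space M. \<bar>N pt\<bar> > e * real k} \<union> (\<Union>l\<in>{- int k - 2..int k + 2}. A l)"
 proof
  fix pt assume w: "pt \<in> {pt \<in> space M. \<bar>N pt - W pt\<bar> > e}"
  show "pt \<in> {pt \<in> space M. \<bar>N pt\<bar> > e * real k} \<union> (\<Union>l\<in>{- int k - 2..int k + 2}. A l)"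
  proof (cases "\<bar>N pt\<bar> > e * real k")
   case True
   then show ?thesis using w by auto
  next
   case False
   define l where "l = \<lceil>N pt / e\<rceil>"
   have l: "N pt / e <= of_int l" "of_int l < N pt / e + 1" unfolding l_def by linarith+
   have l': "N pt <= e * of_int l" "e * of_int l < N pt + e" using l e by (simp_all add: field_simps)
   have "\<bar>N pt / e\<bar> <= real k" using False e by (simp add: abs_divide field_simps)
   then have "- real k <= N pt / e" "N pt / e <= real k" by linarith+
   then have "- real k <= of_int l" "of_int l < real k + 1" using l by linarith+
   then have "real_of_int (- int k) <= real_of_int l" "real_of_int l < real_of_int (int k + 1)" by simp_all
   then have "- int k <= l" "l < int k + 1" by (simp_all only: of_int_le_iff of_int_less_iff)
   then have r: "l \<in> {- int k - 2..int k + 2}" "l - 1 \<in> {- int k - 2..int k + 2}" by auto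
   consider "W pt > N pt + e" | "W pt < N pt - e" using w by (auto simp: abs_if split: if_splits)
   then show ?thesis
   proof cases
    case 1
    then have "pt \<in> A l" using l' w by (auto simp: A_def)
    then show ?thesis using r by blast
   next
    case 2
    have "e * of_int (l - 1) = e * of_int l - e" by (simp add: algebra_simps)
    then have "W pt <= e * of_int (l - 1)" "e * of_int (l - 1) < N pt" using l' 2 by linarith+
    then have "pt \<in> A (l - 1)" using w by (auto simp: A_def)
    then show ?thesis using r by blast
   qed
  qed
 qed
 then have "prob {pt \<in> space M. \<bar>N pt - W pt\<bar> > e} <= prob ({pt \<in> space M. \<bar>N pt\<bar> > e * real k} \<union> (\<Union>l\<in>{- int k - 2..int k + 2}. A l))"
  using A by (intro finite_measure_mono) auto
 also have "\<dots> <= prob {pt \<in> space M. \<bar>N pt\<bar> > e * real k} + prob (\<Union>l\<in>{- int k - 2..int k + 2}. A l)"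
  using A by (intro measure_Un_le) auto
 also have "prob (\<Union>l\<in>{- int k - 2..int k + 2}. A l) <= (\<Sum>l\<in>{- int k - 2..int k + 2}. prob (A l))"
  using A by (intro finite_measure_subadditive_finite) auto
 also have "\<dots> <= (\<Sum>l\<in>{- int k - 2..int k + 2}. 3 * g (e * of_int l))"
 proof (rule sum_mono)
  fix l
  have "prob (A l) <= g (e * of_int l) + 2 * g (e * of_int l)"
   unfolding A_def by (rule order_trans[OF measure_Un_le add_mono[OF up dn]]) measurable
  then show "prob (A l) <= 3 * g (e * of_int l)" by simp
 qed
 finally show ?thesis by simp
qed

lemma norm_char_diff_le:
 fixes W Z :: "'a => real"
 assumes "prob_space M" and [measurable]: "W \<in> borel_measurable M" "Z \<in> borel_measurable M"
  and d: "\<And>pt. pt \<in> space M ==> \<bar>W pt - Z pt\<bar> <= d"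
 shows "norm (char (distr M borel W) t - char (distr M borel Z) t) <= \<bar>t\<bar> * d"
proof -
 interpret prob_space M by fact
 have "char (distr M borel W) t - char (distr M borel Z) t = (CLINT pt|M. iexp (t * W pt) - iexp (t * Z pt))"
  unfolding char_def
  by (subst Bochner_Integration.integral_diff) (auto simp: integral_distr intro!: integrable_iexp)
 also have "norm \<dots> <= (\<integral>pt. norm (iexp (t * W pt) - iexp (t * Z pt)) \<partial>M)" by (rule integral_norm_bound)
 also have "\<dots> <= (\<integral>pt. \<bar>t\<bar> * d \<partial>M)"
 proof (rule integral_mono)
  show "integrable M (\<lambda>pt. norm (iexp (t * W pt) - iexp (t * Z pt)))"
   by (intro integrable_norm Bochner_Integration.integrable_diff integrable_iexp) auto
  fix pt assume w: "pt \<in> space M"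
  have "iexp (t * W pt) - iexp (t * Z pt) = iexp (t * Z pt) * (iexp (t * W pt - t * Z pt) - 1)"
   by (simp add: right_diff_distrib exp_add[symmetric] algebra_simps)
  then have "norm (iexp (t * W pt) - iexp (t * Z pt)) = norm (iexp (t * W pt - t * Z pt) - 1)"
   by (simp add: norm_mult)
  also have "\<dots> <= \<bar>t * W pt - t * Z pt\<bar>" using iexp_approx1[of "t * W pt - t * Z pt" 0] by simp
  also have "\<dots> = \<bar>t\<bar> * \<bar>W pt - Z pt\<bar>" by (simp add: abs_mult right_diff_distrib[symmetric])
  also have "\<dots> <= \<bar>t\<bar> * d" using d[OF w] by (intro mult_left_mono) auto
  finally show "norm (iexp (t * W pt) - iexp (t * Z pt)) <= \<bar>t\<bar> * d" .
 qed auto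
 finally show ?thesis by (simp add: prob_space)
qed

text \<open>Asymptotic normality is realised by exactly normal variables on the given spaces. The atomless
 variable \<open>A\<close> only serves to make the laws of the perturbed \<open>Z\<close> continuous; it may depend on \<open>Z\<close>.\<close>

theorem normal_coupling:
 fixes M :: "nat => 'a measure" and Z A :: "nat => 'a => real"
 assumes P: "\<And>n. n >= 1 ==> prob_space (M n)"
  and Z: "\<And>n. n >= 1 ==> Z n \<in> borel_measurable (M n)" and A: "\<And>n. n >= 1 ==> A n \<in> borel_measurable (M n)"
  and at: "\<And>n a. n >= 1 ==> measure (M n) {pt \<in> space (M n). A n pt = a} = 0"
  and char: "\<And>t. (\<lambda>n. char (distr (M n) borel (Z n)) t) \<longlonglongrightarrow> complex_of_real (exp (- (t^2) / 2))"
 shows "\<exists>N. (\<forall>n\<ge>1. N n \<in> borel_measurable (M n) \<and> distr (M n) borel (N n) = std_normal_distribution) \<and>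
  (\<forall>e>0. (\<lambda>n. measure (M n) {pt \<in> space (M n). \<bar>N n pt - Z n pt\<bar> > e}) \<longlonglongrightarrow> 0)"
proof -
 \<comment> \<open>\<open>arctan\<close> is injective, which keeps the law atomless, and bounded by
   2, which makes the perturbation at most 2/n at every sample point.\<close>
 have "\<exists>c. 0 < c \<and> c < 1 / real n \<and> (\<forall>w. measure (M n) {pt \<in> space (M n). Z n pt + c * arctan (A n pt) = w} = 0)"
  if n: "n >= 1" for n
 proof -
  interpret prob_space "M n" using P n by simp
  note [measurable] = Z[OF n] A[OF n]
  show ?thesis
  proof (rule atomless_perturbation)
   fix a
   have "prob {pt \<in> space (M n). arctan (A n pt) = a} <= prob {pt \<in> space (M n). A n pt = tan a}"
    by (intro finite_measure_mono) (auto simp: arctan)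
   then show "prob {pt \<in> space (M n). arctan (A n pt) = a} = 0"
    using at[OF n, of "tan a"] by (simp add: measure_le_0_iff)
  qed (use n in auto)
 qed
 then have "\<forall>n. \<exists>c. n >= 1 \<longrightarrow> 0 < c \<and> c < 1 / real n \<and>
   (\<forall>w. measure (M n) {pt \<in> space (M n). Z n pt + c * arctan (A n pt) = w} = 0)" by blast
 from choice[OF this] obtain c where c: "\<And>n. n >= 1 ==> 0 < c n \<and> c n < 1 / real n \<and>
   (\<forall>w. measure (M n) {pt \<in> space (M n). Z n pt + c n * arctan (A n pt) = w} = 0)" by blast
 define W where "W = (\<lambda>n pt. Z n pt + c n * arctan (A n pt))"
 have W: "W n \<in> borel_measurable (M n)" if "n >= 1" for n
  using Z[OF that] A[OF that] unfolding W_def by measurable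
 have W_at: "measure (M n) {pt \<in> space (M n). W n pt = w} = 0" if "n >= 1" for n w
  using c[OF that] by (simp add: W_def)
 have WZ: "\<bar>W n pt - Z n pt\<bar> <= 2 / real n" if "n >= 1" for n pt
 proof -
  have "\<bar>arctan (A n pt)\<bar> <= 2" using arctan_bounded[of "A n pt"] pi_less_4 by (auto simp: abs_le_iff)
  then have "\<bar>c n\<bar> * \<bar>arctan (A n pt)\<bar> <= (1 / real n) * 2" using c[OF that] by (intro mult_mono) auto
  then show ?thesis unfolding W_def by (simp add: abs_mult)
 qed
 have rd: "real_distribution std_normal_distribution" by (rule real_dist_normal_dist)
 \<comment> \<open>Levy's continuity theorem speaks of a sequence all of whose members are
   probability laws, whereas the hypotheses start at 1; hence the shift to
   \<open>Suc n\<close>.\<close>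
 have wc: "(\<lambda>n. cdf (distr (M (Suc n)) borel (W (Suc n))) x) \<longlonglongrightarrow> cdf std_normal_distribution x" for x
 proof -
  have "weak_conv_m (\<lambda>n. distr (M (Suc n)) borel (W (Suc n))) std_normal_distribution"
  proof (rule levy_continuity[OF _ rd])
   fix n
   interpret prob_space "M (Suc n)" using P by simp
   show "real_distribution (distr (M (Suc n)) borel (W (Suc n)))" using W[of "Suc n"] by simp
  next
   fix t
   have "(\<lambda>n. char (distr (M (Suc n)) borel (W (Suc n))) t - char (distr (M (Suc n)) borel (Z (Suc n))) t) \<longlonglongrightarrow> 0"
   proof (rule Lim_null_comparison)
    show "\<forall>\<^sub>F n in sequentially. norm (char (distr (M (Suc n)) borel (W (Suc n))) t - char (distr (M (Suc n)) borel (Z (Suc n))) t)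
      <= \<bar>t\<bar> * (2 / real (Suc n))"
    proof (intro always_eventually allI)
     fix n
     show "norm (char (distr (M (Suc n)) borel (W (Suc n))) t - char (distr (M (Suc n)) borel (Z (Suc n))) t)
      <= \<bar>t\<bar> * (2 / real (Suc n))"
      by (rule norm_char_diff_le[OF P W Z WZ]) auto
    qed
    show "(\<lambda>n. \<bar>t\<bar> * (2 / real (Suc n))) \<longlonglongrightarrow> 0"
     by (intro tendsto_mult_right_zero LIMSEQ_Suc lim_const_over_n)
   qed
   moreover have "(\<lambda>n. char (distr (M (Suc n)) borel (Z (Suc n))) t) \<longlonglongrightarrow> complex_of_real (exp (- (t^2) / 2))"
    using char by (rule LIMSEQ_Suc)
   ultimately have "(\<lambda>n. (char (distr (M (Suc n)) borel (W (Suc n))) t - char (distr (M (Suc n)) borel (Z (Suc n))) t)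
     + char (distr (M (Suc n)) borel (Z (Suc n))) t) \<longlonglongrightarrow> 0 + complex_of_real (exp (- (t^2) / 2))"
    by (rule tendsto_add)
   then show "(\<lambda>n. char (distr (M (Suc n)) borel (W (Suc n))) t) \<longlonglongrightarrow> char std_normal_distribution t"
    by (simp add: char_std_normal_distribution)
  qed
  moreover have "isCont (cdf std_normal_distribution) x"
   using real_distribution.finite_borel_measure_M[OF rd] distr_std_normal_atomless
   by (simp add: finite_borel_measure.isCont_cdf)
  ultimately show ?thesis by (simp add: weak_conv_m_def weak_conv_def)
 qed
 define g where "g = (\<lambda>n x. \<bar>cdf (distr (M n) borel (W n)) x - cdf std_normal_distribution x\<bar>)"
 have g0: "(\<lambda>n. g n x) \<longlonglongrightarrow> 0" for x
 proof -
  have "(\<lambda>n. g (Suc n) x) \<longlonglongrightarrow> \<bar>cdf std_normal_distribution x - cdf std_normal_distribution x\<bar>"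
   unfolding g_def by (intro tendsto_intros wc)
  then show ?thesis by (simp add: LIMSEQ_imp_Suc)
 qed
 have "\<exists>N. N \<in> borel_measurable (M n) \<and> distr (M n) borel N = std_normal_distribution \<and>
  (\<forall>x. measure (M n) {pt \<in> space (M n). W n pt <= x \<and> x < N pt} <= g n x \<and>
     measure (M n) {pt \<in> space (M n). N pt <= x \<and> x < W n pt} <= 2 * g n x)" if "n >= 1" for n
  using prob_space.quantile_coupling[OF P[OF that] W[OF that] W_at[OF that] rd] unfolding g_def by blast
 then have "\<forall>n. \<exists>N. n >= 1 \<longrightarrow> N \<in> borel_measurable (M n) \<and> distr (M n) borel N = std_normal_distribution \<and>
  (\<forall>x. measure (M n) {pt \<in> space (M n). W n pt <= x \<and> x < N pt} <= g n x \<and>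
     measure (M n) {pt \<in> space (M n). N pt <= x \<and> x < W n pt} <= 2 * g n x)" by blast
 from choice[OF this] obtain N where N': "\<And>n. n >= 1 ==> N n \<in> borel_measurable (M n) \<and> distr (M n) borel (N n) = std_normal_distribution \<and>
  (\<forall>x. measure (M n) {pt \<in> space (M n). W n pt <= x \<and> x < N n pt} <= g n x \<and>
     measure (M n) {pt \<in> space (M n). N n pt <= x \<and> x < W n pt} <= 2 * g n x)" by blast
 have N: "\<And>n. n >= 1 ==> N n \<in> borel_measurable (M n)"
  "\<And>n. n >= 1 ==> distr (M n) borel (N n) = std_normal_distribution"
  "\<And>n x. n >= 1 ==> measure (M n) {pt \<in> space (M n). W n pt <= x \<and> x < N n pt} <= g n x"
  "\<And>n x. n >= 1 ==> measure (M n) {pt \<in> space (M n). N n pt <= x \<and> x < W n pt} <= 2 * g n x"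
  using N' by blast+
 have "(\<lambda>n. measure (M n) {pt \<in> space (M n). \<bar>N n pt - Z n pt\<bar> > e}) \<longlonglongrightarrow> 0" if e: "e > 0" for e
 proof (rule LIMSEQ_I)
  fix r :: real assume r: "r > 0"
  \<comment> \<open>A tail of the normal law below r/2 fixes the number of grid points in
    \<open>coupling_distance\<close>; the finitely many gaps on that grid tend to zero, as does the
    distance between \<open>W\<close> and \<open>Z\<close>.\<close>
  interpret S: real_distribution std_normal_distribution by (rule rd)
  have "(\<lambda>k. measure std_normal_distribution (space std_normal_distribution - {- (e / 2 * real k)..e / 2 * real k})) \<longlonglongrightarrow>
    measure std_normal_distribution (\<Inter>k. space std_normal_distribution - {- (e / 2 * real k)..e / 2 * real k})"
  proof (rule S.finite_Lim_measure_decseq)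
   show "decseq (\<lambda>k. space std_normal_distribution - {- (e / 2 * real k)..e / 2 * real k})"
   proof (rule decseq_SucI)
    fix k
    have "e / 2 * real k <= e / 2 * real (Suc k)" using e by (intro mult_left_mono) auto
    then show "space std_normal_distribution - {- (e / 2 * real (Suc k))..e / 2 * real (Suc k)}
      \<subseteq> space std_normal_distribution - {- (e / 2 * real k)..e / 2 * real k}" by auto
   qed
  qed auto
  moreover have "(\<Inter>k. space std_normal_distribution - {- (e / 2 * real k)..e / 2 * real k}) = {}"
  proof -
   have "\<exists>k. x \<in> {- (e / 2 * real k)..e / 2 * real k}" for x
   proof -
    obtain k where "\<bar>x\<bar> / (e / 2) < real k" using reals_Archimedean2 by blast
    then have "\<bar>x\<bar> < e / 2 * real k" using e by (simp add: field_simps)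
    then show ?thesis by (intro exI[of _ k]) auto
   qed
   then show ?thesis by auto
  qed
  ultimately have "(\<lambda>k. measure std_normal_distribution (space std_normal_distribution - {- (e / 2 * real k)..e / 2 * real k})) \<longlonglongrightarrow> 0"
   by (simp only: measure_empty)
  from order_tendstoD(2)[OF this, of "r / 2"] r obtain k where
   k: "measure std_normal_distribution (space std_normal_distribution - {- (e / 2 * real k)..e / 2 * real k}) < r / 2"
   by (auto simp: eventually_sequentially)
  have "(\<lambda>n. \<Sum>l\<in>{- int k - 2..int k + 2}. 3 * g n (e / 2 * of_int l)) \<longlonglongrightarrow> (\<Sum>l\<in>{- int k - 2..int k + 2}. 3 * 0)"
   by (intro tendsto_intros g0)
  then have ev1: "\<forall>\<^sub>F n in sequentially. (\<Sum>l\<in>{- int k - 2..int k + 2}. 3 * g n (e / 2 * of_int l)) < r / 2"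
   using r by (intro order_tendstoD(2)) auto
  have ev2: "\<forall>\<^sub>F n in sequentially. 2 / real n < e / 2"
   using e by (intro order_tendstoD(2)[OF lim_const_over_n]) auto
  have "\<forall>\<^sub>F n in sequentially. norm (measure (M n) {pt \<in> space (M n). \<bar>N n pt - Z n pt\<bar> > e} - 0) < r"
   using ev1 ev2 eventually_ge_at_top[of 1]
  proof eventually_elim
   case (elim n)
   interpret prob_space "M n" using P elim by simp
   note [measurable] = W[OF elim(3)] N(1)[OF elim(3)] Z[OF elim(3)]
   have "prob {pt \<in> space (M n). \<bar>N n pt - Z n pt\<bar> > e} <= prob {pt \<in> space (M n). \<bar>N n pt - W n pt\<bar> > e / 2}"
   proof (rule finite_measure_mono)
    show "{pt \<in> space (M n). \<bar>N n pt - Z n pt\<bar> > e} \<subseteq> {pt \<in> space (M n). \<bar>N n pt - W n pt\<bar> > e / 2}"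
    proof safe
     fix pt assume "e < \<bar>N n pt - Z n pt\<bar>"
     then show "e / 2 < \<bar>N n pt - W n pt\<bar>" using WZ[OF elim(3), of pt] elim(2) by linarith
    qed
   qed measurable
   also have "\<dots> <= prob {pt \<in> space (M n). \<bar>N n pt\<bar> > e / 2 * real k}
     + (\<Sum>l\<in>{- int k - 2..int k + 2}. 3 * g n (e / 2 * of_int l))"
    by (rule coupling_distance) (use e N(3,4)[OF elim(3)] in auto)
   also have "prob {pt \<in> space (M n). \<bar>N n pt\<bar> > e / 2 * real k}
     = measure (distr (M n) borel (N n)) (UNIV - {- (e / 2 * real k)..e / 2 * real k})"
    by (subst measure_distr) (auto intro!: arg_cong[where f=prob] simp: abs_le_iff not_le[symmetric])
   also have "\<dots> < r / 2" using k N(2)[OF elim(3)] by (simp add: space_density)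
   finally show ?case using elim(1) by simp
  qed
  then show "\<exists>no. \<forall>n\<ge>no. norm (measure (M n) {pt \<in> space (M n). \<bar>N n pt - Z n pt\<bar> > e} - 0) < r"
   by (simp add: eventually_sequentially)
 qed
 then show ?thesis using N(1,2) by blast
qed

section \<open>Poisson noise\<close>

lemma (in prob_space) orthogonal_sum:
 fixes f :: "'i => 'a => real"
 assumes fin: "finite I" and rv: "\<And>i. i \<in> I ==> random_variable borel (f i)"
  and sq: "\<And>i. i \<in> I ==> integrable M (\<lambda>pt. (f i pt)\<^sup>2)"
  and orth: "\<And>i k. i \<in> I ==> k \<in> I ==> i \<noteq> k ==> expectation (\<lambda>pt. f i pt * f k pt) = 0"
 shows "integrable M (\<lambda>pt. (\<Sum>i\<in>I. f i pt)\<^sup>2)"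
  and "expectation (\<lambda>pt. (\<Sum>i\<in>I. f i pt)\<^sup>2) = (\<Sum>i\<in>I. expectation (\<lambda>pt. (f i pt)\<^sup>2))"
proof -
 have int: "integrable M (\<lambda>pt. f i pt * f k pt)" if ik: "i \<in> I" "k \<in> I" for i k
 proof (rule Bochner_Integration.integrable_bound)
  show "integrable M (\<lambda>pt. (f i pt)\<^sup>2 + (f k pt)\<^sup>2)" using sq ik by auto
  show "(\<lambda>pt. f i pt * f k pt) \<in> borel_measurable M" using rv ik by auto
  have "\<bar>a * b\<bar> <= a\<^sup>2 + b\<^sup>2" for a b :: real
  proof -
   have "2 * (\<bar>a\<bar> * \<bar>b\<bar>) <= a\<^sup>2 + b\<^sup>2" using zero_le_power2[of "\<bar>a\<bar> - \<bar>b\<bar>"] by (simp add: power2_diff)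
   moreover have "0 <= \<bar>a\<bar> * \<bar>b\<bar>" by simp
   ultimately show ?thesis unfolding abs_mult by linarith
  qed
  then show "AE pt in M. norm (f i pt * f k pt) <= norm ((f i pt)\<^sup>2 + (f k pt)\<^sup>2)"
   by (auto intro: order_trans[OF _ abs_ge_self])
 qed
 have e: "(\<Sum>i\<in>I. f i pt)\<^sup>2 = (\<Sum>i\<in>I. \<Sum>k\<in>I. f i pt * f k pt)" for pt
  by (simp add: power2_eq_square sum_product)
 show "integrable M (\<lambda>pt. (\<Sum>i\<in>I. f i pt)\<^sup>2)" unfolding e using int by auto
 have "expectation (\<lambda>pt. (\<Sum>i\<in>I. f i pt)\<^sup>2) = (\<Sum>i\<in>I. \<Sum>k\<in>I. expectation (\<lambda>pt. f i pt * f k pt))"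
  unfolding e using int by (subst Bochner_Integration.integral_sum, auto)
 also have "\<dots> = (\<Sum>i\<in>I. \<Sum>k\<in>I. if k = i then expectation (\<lambda>pt. (f i pt)\<^sup>2) else 0)"
  using orth by (intro sum.cong refl) (auto simp: power2_eq_square)
 also have "\<dots> = (\<Sum>i\<in>I. expectation (\<lambda>pt. (f i pt)\<^sup>2))" using fin by simp
 finally show "expectation (\<lambda>pt. (\<Sum>i\<in>I. f i pt)\<^sup>2) = (\<Sum>i\<in>I. expectation (\<lambda>pt. (f i pt)\<^sup>2))" .
qed

lemma (in prob_space) second_moment_bound:
 fixes g :: "'a => real"
 assumes [measurable]: "random_variable borel g" and g: "integrable M (\<lambda>pt. (g pt)\<^sup>2)"
  and v: "expectation (\<lambda>pt. (g pt)\<^sup>2) <= v" and a: "a > 0"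
 shows "prob {pt \<in> space M. a < \<bar>g pt\<bar>} <= v / a\<^sup>2"
proof -
 have "prob {pt \<in> space M. a < \<bar>g pt\<bar>} <= prob {pt \<in> space M. (g pt)\<^sup>2 >= a\<^sup>2}"
 proof (rule finite_measure_mono)
  show "{pt \<in> space M. a < \<bar>g pt\<bar>} \<subseteq> {pt \<in> space M. (g pt)\<^sup>2 >= a\<^sup>2}"
   using a by (auto simp: abs_le_square_iff[symmetric])
 qed measurable
 also have "\<dots> <= expectation (\<lambda>pt. (g pt)\<^sup>2) / a\<^sup>2"
  by (rule integral_Markov_inequality_measure[where A="{}"]) (use g a in auto)
 also have "\<dots> <= v / a\<^sup>2" using v by (intro divide_right_mono) auto
 finally show ?thesis .
qed

lemma (in prob_space) orthogonal_sum_bound: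
 fixes f :: "'i => 'a => real"
 assumes fin: "finite I" and rv: "\<And>i. i \<in> I ==> random_variable borel (f i)"
  and sq: "\<And>i. i \<in> I ==> integrable M (\<lambda>pt. (f i pt)\<^sup>2)"
  and orth: "\<And>i k. i \<in> I ==> k \<in> I ==> i \<noteq> k ==> expectation (\<lambda>pt. f i pt * f k pt) = 0"
  and v: "(\<Sum>i\<in>I. expectation (\<lambda>pt. (f i pt)\<^sup>2)) <= v" and a: "a > 0"
 shows "prob {pt \<in> space M. a < \<bar>\<Sum>i\<in>I. f i pt\<bar>} <= v / a\<^sup>2"
 using orthogonal_sum[OF fin rv sq orth] rv v a by (intro second_moment_bound) auto

lemma (in prob_space) indep_vars_orthogonal:
 fixes f :: "'i => 'a => real"
 assumes ind: "indep_vars (\<lambda>_. borel) f I" and int: "\<And>i. i \<in> I ==> integrable M (f i)"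
  and z: "\<And>i. i \<in> I ==> expectation (f i) = 0" and ik: "i \<in> I" "k \<in> I" "i \<noteq> k"
 shows "expectation (\<lambda>pt. f i pt * f k pt) = 0"
proof -
 have "indep_vars (\<lambda>_. borel) f {i, k}" using ind ik by (intro indep_vars_subset[OF ind]) auto
 then have "expectation (\<lambda>pt. \<Prod>l\<in>{i, k}. f l pt) = (\<Prod>l\<in>{i, k}. expectation (f l))"
  using int ik by (intro indep_vars_lebesgue_integral) auto
 then show ?thesis using z ik by simp
qed

lemma integrable_of_square:
 fixes f :: "'a => real"
 assumes "prob_space M" "f \<in> borel_measurable M" "integrable M (\<lambda>pt. (f pt)\<^sup>2)"
 shows "integrable M f"
proof -
 interpret prob_space M by fact
 show ?thesis using square_integrable_imp_integrable assms by blast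
qed

section \<open>Poisson moments, tails and convolutions\<close>

lemma poisson_summable:
 fixes z :: "'b::{real_normed_field,banach,second_countable_topology}"
 assumes r: "r > 0"
 shows "integrable (measure_pmf (poisson_pmf r)) (\<lambda>k. z ^ k)"
  and "measure_pmf.expectation (poisson_pmf r) (\<lambda>k. z ^ k) = exp (of_real r * (z - 1))"
proof -
 have e: "pmf (poisson_pmf r) k *\<^sub>R z ^ k = of_real (exp (- r)) * ((of_real r * z) ^ k /\<^sub>R fact k)" for k
  using r by (simp add: scaleR_conv_of_real power_mult_distrib divide_inverse mult_ac)
 have "summable (\<lambda>k. norm (of_real (exp (- r)) * ((of_real r * z) ^ k /\<^sub>R fact k)))"
  unfolding norm_mult by (intro summable_mult summable_norm_exp)
 then have i: "integrable (count_space UNIV) (\<lambda>k. pmf (poisson_pmf r) k *\<^sub>R z ^ k)"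
  unfolding e integrable_count_space_nat_iff .
 show "integrable (measure_pmf (poisson_pmf r)) (\<lambda>k. z ^ k)"
  unfolding measure_pmf_eq_density using i by (subst integrable_density) auto
 have "measure_pmf.expectation (poisson_pmf r) (\<lambda>k. z ^ k) = (\<integral>k. pmf (poisson_pmf r) k *\<^sub>R z ^ k \<partial>count_space UNIV)"
  unfolding measure_pmf_eq_density by (subst integral_density) auto
 also have "\<dots> = of_real (exp (- r)) * exp (of_real r * z)"
 proof (rule sums_unique2[OF sums_integral_count_space_nat[OF i]])
  show "(\<lambda>k. pmf (poisson_pmf r) k *\<^sub>R z ^ k) sums (of_real (exp (- r)) * exp (of_real r * z))"
   unfolding e by (intro sums_mult exp_converges)
 qed
 also have "\<dots> = exp (of_real r * (z - 1))"
  by (simp add: exp_of_real[symmetric] exp_add[symmetric] algebra_simps)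
 finally show "measure_pmf.expectation (poisson_pmf r) (\<lambda>k. z ^ k) = exp (of_real r * (z - 1))" .
qed

lemma poisson_integrable_power:
 assumes r: "r > 0"
 shows "integrable (measure_pmf (poisson_pmf r)) (\<lambda>k. real k ^ l)"
proof (rule Bochner_Integration.integrable_bound[OF poisson_summable(1)[OF r, of "2 ^ l :: real"]])
 have "real k ^ l <= (2 ^ l) ^ k" for k
 proof -
  have "real k ^ l <= (2 ^ k) ^ l" by (intro power_mono) (auto intro: less_imp_le of_nat_less_two_power)
  then show ?thesis by (simp add: power_mult[symmetric] mult.commute)
 qed
 then show "AE k in measure_pmf (poisson_pmf r). norm (real k ^ l) <= norm ((2 ^ l) ^ k :: real)" by simp
qed simp

text \<open>The Chen-Stein identity, an index shift in the Poisson series. Applied to powers it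
  yields the moments recursively, each from those of lower degree.\<close>

lemma poisson_stein:
 fixes f :: "nat => real"
 assumes r: "r > 0" and i1: "integrable (measure_pmf (poisson_pmf r)) (\<lambda>k. real k * f k)"
  and i2: "integrable (measure_pmf (poisson_pmf r)) (\<lambda>k. f (Suc k))"
 shows "measure_pmf.expectation (poisson_pmf r) (\<lambda>k. real k * f k)
  = r * measure_pmf.expectation (poisson_pmf r) (\<lambda>k. f (Suc k))"
proof -
 have s: "(\<lambda>k. pmf (poisson_pmf r) k * g k) sums measure_pmf.expectation (poisson_pmf r) g"
  if g: "integrable (measure_pmf (poisson_pmf r)) g" for g :: "nat => real"
 proof -
  have "integrable (count_space UNIV) (\<lambda>k. pmf (poisson_pmf r) k *\<^sub>R g k)"
   using g unfolding measure_pmf_eq_density by (subst (asm) integrable_density) auto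
  from sums_integral_count_space_nat[OF this] show ?thesis
   unfolding measure_pmf_eq_density by (subst integral_density) auto
 qed
 have "pmf (poisson_pmf r) (Suc k) * (real (Suc k) * f (Suc k)) = r * (pmf (poisson_pmf r) k * f (Suc k))" for k
  using r by (simp add: field_simps del: of_nat_Suc)
 then have "(\<lambda>k. pmf (poisson_pmf r) (Suc k) * (real (Suc k) * f (Suc k))) sums
   (r * measure_pmf.expectation (poisson_pmf r) (\<lambda>k. f (Suc k)))"
  using sums_mult[OF s[OF i2], of r] by (simp only:)
 then have "(\<lambda>k. pmf (poisson_pmf r) k * (real k * f k)) sums
   (r * measure_pmf.expectation (poisson_pmf r) (\<lambda>k. f (Suc k)))"
  by (subst (asm) sums_Suc_iff) simp
 then show ?thesis using s[OF i1] sums_unique2 by blast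
qed

lemma poisson_moments:
 assumes r: "r > 0"
 shows "measure_pmf.expectation (poisson_pmf r) (\<lambda>k. real k - r) = 0"
  and "measure_pmf.expectation (poisson_pmf r) (\<lambda>k. (real k - r)\<^sup>2) = r"
  and "measure_pmf.expectation (poisson_pmf r) (\<lambda>k. ((real k - r)\<^sup>2 - r)\<^sup>2) = 2 * r\<^sup>2 + r"
proof -
 let ?E = "measure_pmf.expectation (poisson_pmf r)"
 note int = poisson_integrable_power[OF r]
 have i1: "integrable (measure_pmf (poisson_pmf r)) real" using int[of 1] by simp
 have 1: "?E (\<lambda>k. real k) = r"
  using poisson_stein[OF r, of "\<lambda>_. 1"] i1 by simp
 have 2: "?E (\<lambda>k. real k ^ 2) = r * (r + 1)"
 proof -
  have "?E (\<lambda>k. real k * real k) = r * ?E (\<lambda>k. real (Suc k))"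
   by (rule poisson_stein[OF r]) (use int[of 2] i1 in \<open>auto simp: power2_eq_square\<close>)
  also have "?E (\<lambda>k. real (Suc k)) = r + 1" using i1 1 by simp
  finally show ?thesis by (simp add: power2_eq_square)
 qed
 have 3: "?E (\<lambda>k. real k ^ 3) = r * (r * (r + 1) + 2 * r + 1)"
 proof -
  have e: "real (Suc k) ^ 2 = real k ^ 2 + 2 * real k + 1" for k by (simp add: power2_eq_square algebra_simps)
  have i: "integrable (measure_pmf (poisson_pmf r)) (\<lambda>k. real (Suc k) ^ 2)"
   unfolding e using int[of 2] i1 by simp
  have "?E (\<lambda>k. real k * real k ^ 2) = r * ?E (\<lambda>k. real (Suc k) ^ 2)"
   by (rule poisson_stein[OF r _ i]) (use int[of 3] in \<open>simp add: power3_eq_cube power2_eq_square mult.assoc\<close>)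
  also have "?E (\<lambda>k. real (Suc k) ^ 2) = r * (r + 1) + 2 * r + 1"
   unfolding e using i1 int[of 2] 1 2 by simp
  finally show ?thesis by (simp add: power3_eq_cube power2_eq_square mult.assoc)
 qed
 have 4: "?E (\<lambda>k. real k ^ 4) = r * (r * (r * (r + 1) + 2 * r + 1) + 3 * (r * (r + 1)) + 3 * r + 1)"
 proof -
  have e: "real (Suc k) ^ 3 = real k ^ 3 + 3 * real k ^ 2 + 3 * real k + 1" for k
   by (simp add: power3_eq_cube power2_eq_square algebra_simps)
  have i: "integrable (measure_pmf (poisson_pmf r)) (\<lambda>k. real (Suc k) ^ 3)"
   unfolding e using int[of 2] int[of 3] i1 by simp
  have "?E (\<lambda>k. real k * real k ^ 3) = r * ?E (\<lambda>k. real (Suc k) ^ 3)"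
   by (rule poisson_stein[OF r _ i]) (use int[of 4] in \<open>simp add: power3_eq_cube power4_eq_xxxx mult.assoc\<close>)
  also have "?E (\<lambda>k. real (Suc k) ^ 3) = r * (r * (r + 1) + 2 * r + 1) + 3 * (r * (r + 1)) + 3 * r + 1"
   unfolding e using i1 int[of 2] int[of 3] 1 2 3 by simp
  finally show ?thesis by (simp add: power3_eq_cube power4_eq_xxxx mult.assoc)
 qed
 show "?E (\<lambda>k. real k - r) = 0" using i1 1 by simp
 have "?E (\<lambda>k. (real k - r)\<^sup>2) = ?E (\<lambda>k. real k ^ 2 - (2 * r) * real k + r\<^sup>2)"
  by (intro Bochner_Integration.integral_cong refl) (simp add: power2_diff)
 also have "\<dots> = r" using i1 int[of 2] 1 2 by (simp add: power2_eq_square algebra_simps)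
 finally show "?E (\<lambda>k. (real k - r)\<^sup>2) = r" .
 have "?E (\<lambda>k. ((real k - r)\<^sup>2 - r)\<^sup>2) = ?E (\<lambda>k. real k ^ 4 - (4 * r) * real k ^ 3 + (6 * r\<^sup>2 - 2 * r) * real k ^ 2
   + (4 * r\<^sup>2 - 4 * r ^ 3) * real k + (r\<^sup>2 - r)\<^sup>2)"
  by (intro Bochner_Integration.integral_cong refl) (simp add: power2_eq_square power3_eq_cube power4_eq_xxxx algebra_simps)
 also have "\<dots> = ?E (\<lambda>k. real k ^ 4) - (4 * r) * ?E (\<lambda>k. real k ^ 3) + (6 * r\<^sup>2 - 2 * r) * ?E (\<lambda>k. real k ^ 2)
   + (4 * r\<^sup>2 - 4 * r ^ 3) * ?E real + (r\<^sup>2 - r)\<^sup>2"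
  using i1 int[of 2] int[of 3] int[of 4] by simp
 also have "\<dots> = 2 * r\<^sup>2 + r" unfolding 1 2 3 4
  by (simp add: power2_eq_square power3_eq_cube algebra_simps)
 finally show "?E (\<lambda>k. ((real k - r)\<^sup>2 - r)\<^sup>2) = 2 * r\<^sup>2 + r" .
qed

text \<open>Gives r (exp u - 1 - u) <= r u^2 for both signs of u and hence both Poisson tails at
  once. For negative arguments the quadratic lower bound of exp(-t) is inverted.\<close>

lemma exp_le_quadratic:
 fixes t :: real
 assumes "\<bar>t\<bar> <= 1"
 shows "exp t <= 1 + t + t\<^sup>2"
proof (cases "t >= 0")
 case True
 then show ?thesis using exp_bound[of t] assms by simp
next
 case False
 define u where "u = - t"
 have u: "u > 0" "u <= 1" using False assms by (auto simp: u_def)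
 have "1 + u + u\<^sup>2 / 2 <= exp u" using u by (intro exp_lower_Taylor_quadratic) auto
 then have "exp (- u) <= 1 / (1 + u + u\<^sup>2 / 2)" using u by (simp add: exp_minus field_simps add_pos_pos)
 also have "\<dots> <= 1 - u + u\<^sup>2"
 proof -
  have "(1 - u + u\<^sup>2) * (1 + u + u\<^sup>2 / 2) = 1 + u\<^sup>2 / 2 + u ^ 3 / 2 + u ^ 4 / 2"
   by (simp add: power2_eq_square power3_eq_cube power4_eq_xxxx field_simps)
  moreover have "1 + u\<^sup>2 / 2 + u ^ 3 / 2 + u ^ 4 / 2 >= 1" using u by simp
  moreover have "1 + u + u\<^sup>2 / 2 > 0" using u by (simp add: add_pos_pos)
  ultimately show ?thesis by (simp add: pos_divide_le_eq)
 qed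
 finally show ?thesis by (simp add: u_def)
qed

text \<open>Chernoff's bound with the tilts t and -t at a deviation of 2 t r: the exponent is r t^2
  - 2 t^2 r. The factor 2 in the deviation buys this simple form.\<close>

lemma poisson_tail:
 assumes r: "r > 0" and t: "0 < t" "t <= 1"
 shows "measure (measure_pmf (poisson_pmf r)) {k. 2 * t * r < \<bar>real k - r\<bar>} <= 2 * exp (- t\<^sup>2 * r)"
proof -
 have *: "measure (measure_pmf (poisson_pmf r)) {k. 2 * t\<^sup>2 * r <= u * (real k - r)} <= exp (- t\<^sup>2 * r)"
  if u: "\<bar>u\<bar> = t" for u
 proof -
  have e: "exp (u * (real k - r)) = exp (- u * r) * exp u ^ k" for k
   by (simp add: exp_of_nat_mult[symmetric] exp_add[symmetric] algebra_simps)
  have i: "integrable (measure_pmf (poisson_pmf r)) (\<lambda>k. exp (u * (real k - r)))"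
   unfolding e using poisson_summable(1)[OF r, of "exp u"] by simp
  have "measure_pmf.expectation (poisson_pmf r) (\<lambda>k. exp (u * (real k - r))) = exp (- u * r) * exp (r * (exp u - 1))"
   unfolding e using poisson_summable[OF r, of "exp u"] by simp
  also have "\<dots> = exp (r * (exp u - 1 - u))" by (simp add: exp_add[symmetric] algebra_simps)
  also have "\<dots> <= exp (r * t\<^sup>2)"
   using exp_le_quadratic[of u] u t r by (auto simp: power2_abs[of u, symmetric] intro!: mult_left_mono)
  finally have E: "measure_pmf.expectation (poisson_pmf r) (\<lambda>k. exp (u * (real k - r))) <= exp (r * t\<^sup>2)" .
  have "{k. 2 * t\<^sup>2 * r <= u * (real k - r)} = {k \<in> space (measure_pmf (poisson_pmf r)). exp (u * (real k - r)) >= exp (2 * t\<^sup>2 * r)}"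
   by simp
  also have "measure (measure_pmf (poisson_pmf r)) \<dots>
    <= measure_pmf.expectation (poisson_pmf r) (\<lambda>k. exp (u * (real k - r))) / exp (2 * t\<^sup>2 * r)"
   by (rule integral_Markov_inequality_measure[OF i, where A="{}"]) auto
  also have "\<dots> <= exp (r * t\<^sup>2) / exp (2 * t\<^sup>2 * r)" using E by (intro divide_right_mono) auto
  also have "\<dots> = exp (- t\<^sup>2 * r)" by (simp add: exp_diff[symmetric] algebra_simps)
  finally show ?thesis .
 qed
 have "{k. 2 * t * r < \<bar>real k - r\<bar>} \<subseteq> {k. 2 * t\<^sup>2 * r <= t * (real k - r)} \<union> {k. 2 * t\<^sup>2 * r <= - t * (real k - r)}"
 proof
  fix k assume k: "k \<in> {k. 2 * t * r < \<bar>real k - r\<bar>}"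
  then have "t * (2 * t * r) <= t * \<bar>real k - r\<bar>" using t by (intro mult_left_mono) auto
  then show "k \<in> {k. 2 * t\<^sup>2 * r <= t * (real k - r)} \<union> {k. 2 * t\<^sup>2 * r <= - t * (real k - r)}"
   by (cases "real k >= r") (auto simp: power2_eq_square algebra_simps)
 qed
 then have "measure (measure_pmf (poisson_pmf r)) {k. 2 * t * r < \<bar>real k - r\<bar>}
   <= measure (measure_pmf (poisson_pmf r)) ({k. 2 * t\<^sup>2 * r <= t * (real k - r)} \<union> {k. 2 * t\<^sup>2 * r <= - t * (real k - r)})"
  by (intro measure_pmf.finite_measure_mono) auto
 also have "\<dots> <= measure (measure_pmf (poisson_pmf r)) {k. 2 * t\<^sup>2 * r <= t * (real k - r)}
   + measure (measure_pmf (poisson_pmf r)) {k. 2 * t\<^sup>2 * r <= - t * (real k - r)}"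
  by (rule measure_Un_le) auto
 also have "\<dots> <= exp (- t\<^sup>2 * r) + exp (- t\<^sup>2 * r)" using t by (intro add_mono *) auto
 finally show ?thesis by simp
qed

lemma poisson_convolution:
 assumes a: "a > 0" and b: "b > 0"
 shows "map_pmf (\<lambda>(x, y). x + y) (pair_pmf (poisson_pmf a) (poisson_pmf b)) = poisson_pmf (a + b)"
proof (rule pmf_eqI)
 fix n
 have "pmf (map_pmf (\<lambda>(x, y). x + y) (pair_pmf (poisson_pmf a) (poisson_pmf b))) n
  = measure (measure_pmf (pair_pmf (poisson_pmf a) (poisson_pmf b))) ((\<lambda>(x, y). x + y) -` {n})"
  by (simp add: pmf_map)
 also have "(\<lambda>(x, y). x + y) -` {n} = (\<lambda>k. (k, n - k)) ` {..n}" by (auto simp: image_iff)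
 also have "measure (measure_pmf (pair_pmf (poisson_pmf a) (poisson_pmf b))) \<dots>
  = (\<Sum>k\<le>n. pmf (pair_pmf (poisson_pmf a) (poisson_pmf b)) (k, n - k))"
  by (subst measure_measure_pmf_finite) (auto simp: sum.reindex inj_on_def)
 also have "\<dots> = (\<Sum>k\<le>n. real (n choose k) * a ^ k * b ^ (n - k)) / fact n * exp (- (a + b))"
  unfolding sum_divide_distrib sum_distrib_right
 proof (intro sum.cong refl)
  fix k assume k: "k \<in> {..n}"
  have "real (n choose k) = fact n / (fact k * fact (n - k))" using k by (intro binomial_fact) auto
  moreover have "exp (- (a + b)) = exp (- a) * exp (- b)" by (simp add: exp_add[symmetric])
  ultimately show "pmf (pair_pmf (poisson_pmf a) (poisson_pmf b)) (k, n - k)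
    = real (n choose k) * a ^ k * b ^ (n - k) / fact n * exp (- (a + b))"
   using a b by (simp only: pmf_pair pmf_poisson) simp
 qed
 also have "\<dots> = pmf (poisson_pmf (a + b)) n"
  using a b by (simp add: binomial_ring[symmetric])
 finally show "pmf (map_pmf (\<lambda>(x, y). x + y) (pair_pmf (poisson_pmf a) (poisson_pmf b))) n = pmf (poisson_pmf (a + b)) n" .
qed

lemma poisson_sum:
 assumes "finite A" "A \<noteq> {}" "\<And>k. k \<in> A ==> \<theta> k > 0"
 shows "map_pmf (\<lambda>y. \<Sum>k\<in>A. y k) (Pi_pmf A (0::nat) (\<lambda>k. poisson_pmf (\<theta> k))) = poisson_pmf (\<Sum>k\<in>A. \<theta> k)"
 using assms
proof (induction rule: finite_ne_induct)
 case (singleton x)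
 then show ?case by (simp add: Pi_pmf_singleton pmf.map_comp comp_def)
next
 case (insert x A)
 have e: "(\<lambda>y. \<Sum>k\<in>insert x A. y k) \<circ> (\<lambda>(y, f). f(x := y)) = (\<lambda>(a, b). a + b) \<circ> map_prod id (\<lambda>f. \<Sum>k\<in>A. f k :: nat)"
 proof -
  have "(\<Sum>k\<in>A. (f(x := y)) k) = (\<Sum>k\<in>A. f k)" for f and y :: nat
   using insert.hyps by (intro sum.cong) auto
  then show ?thesis using insert.hyps by (auto simp: fun_eq_iff)
 qed
 have "map_pmf (\<lambda>y. \<Sum>k\<in>insert x A. y k) (Pi_pmf (insert x A) 0 (\<lambda>k. poisson_pmf (\<theta> k)))
  = map_pmf (\<lambda>(a, b). a + b) (map_pmf (map_prod id (\<lambda>f. \<Sum>k\<in>A. f k)) (pair_pmf (poisson_pmf (\<theta> x)) (Pi_pmf A 0 (\<lambda>k. poisson_pmf (\<theta> k)))))"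
  unfolding Pi_pmf_insert[OF insert.hyps(1,3)] pmf.map_comp e ..
 also have "map_pmf (map_prod id (\<lambda>f. \<Sum>k\<in>A. f k)) (pair_pmf (poisson_pmf (\<theta> x)) (Pi_pmf A 0 (\<lambda>k. poisson_pmf (\<theta> k))))
  = pair_pmf (poisson_pmf (\<theta> x)) (poisson_pmf (\<Sum>k\<in>A. \<theta> k))"
  unfolding map_prod_def map_pair using insert by (simp add: map_pmf_ident[unfolded id_def])
 also have "map_pmf (\<lambda>(a, b). a + b) \<dots> = poisson_pmf (\<theta> x + (\<Sum>k\<in>A. \<theta> k))"
  using insert by (intro poisson_convolution sum_pos) auto
 finally show ?case using insert by simp
qed

text \<open>On the left half-plane the derivative of exp has norm at most 1. Logarithms of
  characteristic functions lie there, so the functions may be compared through their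
  exponents.\<close>

lemma norm_exp_diff_le:
 fixes a b :: complex
 assumes "Re a <= 0" "Re b <= 0"
 shows "norm (exp a - exp b) <= norm (a - b)"
proof -
 have "norm (exp a - exp b) <= 1 * norm (a - b)"
 proof (rule field_differentiable_bound[where S="{z. Re z <= 0}" and f'=exp])
  show "convex {z. Re z <= 0}" by (rule convex_halfspace_Re_le)
  show "norm (exp z) <= 1" if "z \<in> {z. Re z <= 0}" for z :: complex using that by simp
 qed (use assms in \<open>auto intro!: derivative_eq_intros\<close>)
 then show ?thesis by simp
qed

section \<open>Products of Poisson laws\<close>

context
 fixes A :: "'k set" and \<theta> :: "'k => real" and Q :: "('k => nat) pmf"
 assumes fin: "finite A" and pos: "\<And>k. k \<in> A ==> \<theta> k > 0"
 defines "Q \<equiv> Pi_pmf A 0 (\<lambda>k. poisson_pmf (\<theta> k))"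
begin

lemma Q_component: "k \<in> A ==> map_pmf (\<lambda>y. y k) Q = poisson_pmf (\<theta> k)"
 unfolding Q_def using fin by (simp add: Pi_pmf_component)

lemma Q_component_integral:
 fixes f :: "nat => 'b::{banach, second_countable_topology}"
 assumes "k \<in> A"
 shows "measure_pmf.expectation Q (\<lambda>y. f (y k)) = measure_pmf.expectation (poisson_pmf (\<theta> k)) f"
  "integrable (measure_pmf Q) (\<lambda>y. f (y k)) \<longleftrightarrow> integrable (measure_pmf (poisson_pmf (\<theta> k))) f"
 unfolding Q_component[OF assms, symmetric] by (auto simp: integrable_map_pmf_eq)

lemma Q_indep: "prob_space.indep_vars (measure_pmf Q) (\<lambda>_. count_space UNIV) (\<lambda>k y. y k) A"
 unfolding Q_def by (rule indep_vars_Pi_pmf[OF fin])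

lemma Q_group:
 assumes B: "B \<subseteq> A" "B \<noteq> {}"
 shows "map_pmf (\<lambda>y. \<Sum>k\<in>B. y k) Q = poisson_pmf (\<Sum>k\<in>B. \<theta> k)"
proof -
 have "map_pmf (\<lambda>y. \<Sum>k\<in>B. y k) (Pi_pmf B 0 (\<lambda>k. poisson_pmf (\<theta> k))) = map_pmf (\<lambda>y. \<Sum>k\<in>B. y k) Q"
  unfolding Q_def Pi_pmf_subset[OF fin B(1)] pmf.map_comp comp_def by (intro map_pmf_cong refl) auto
 moreover have "finite B" using B fin finite_subset by blast
 ultimately show ?thesis using poisson_sum[of B \<theta>] B pos by auto
qed

lemma Q_linear_noise:
 assumes v: "(\<Sum>k\<in>A. (c k)\<^sup>2 * \<theta> k) <= v" and a: "a > 0"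
 shows "measure (measure_pmf Q) {y. a < \<bar>\<Sum>k\<in>A. c k * (real (y k) - \<theta> k)\<bar>} <= v / a\<^sup>2"
proof -
 let ?f = "\<lambda>k y. c k * (real (y k) - \<theta> k)"
 have ind: "prob_space.indep_vars (measure_pmf Q) (\<lambda>_. borel) ?f A"
  using prob_space.indep_vars_compose2[OF measure_pmf.prob_space_axioms Q_indep, of "\<lambda>k z. c k * (real z - \<theta> k)" "\<lambda>_. borel"] by simp
 have i2: "integrable (measure_pmf (poisson_pmf (\<theta> k))) (\<lambda>z. (real z - \<theta> k)\<^sup>2)" if "k \<in> A" for k
  using poisson_integrable_power[OF pos[OF that], of 2] poisson_integrable_power[OF pos[OF that], of 1]
  by (simp add: power2_diff)
 have sq: "integrable (measure_pmf Q) (\<lambda>y. (?f k y)\<^sup>2)" if "k \<in> A" for k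
  using i2[OF that] Q_component_integral(2)[OF that, of "\<lambda>z. (real z - \<theta> k)\<^sup>2"] by (simp add: power_mult_distrib)
 have int: "integrable (measure_pmf Q) (?f k)" if "k \<in> A" for k
  by (rule integrable_of_square[OF measure_pmf.prob_space_axioms _ sq[OF that]]) simp
 have z: "measure_pmf.expectation Q (?f k) = 0" if "k \<in> A" for k
  using Q_component_integral(1)[OF that, of "\<lambda>z. real z - \<theta> k"] poisson_moments(1)[OF pos[OF that]] by simp
 have "measure (measure_pmf Q) {y \<in> space (measure_pmf Q). a < \<bar>\<Sum>k\<in>A. ?f k y\<bar>} <= v / a\<^sup>2"
 proof (rule prob_space.orthogonal_sum_bound[OF measure_pmf.prob_space_axioms fin _ sq _ _ a])
  show "measure_pmf.expectation Q (\<lambda>y. ?f i y * ?f k y) = 0" if "i \<in> A" "k \<in> A" "i \<noteq> k" for i k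
   by (rule prob_space.indep_vars_orthogonal[OF measure_pmf.prob_space_axioms ind int z that])
  have "(\<Sum>k\<in>A. measure_pmf.expectation Q (\<lambda>y. (?f k y)\<^sup>2)) = (\<Sum>k\<in>A. (c k)\<^sup>2 * \<theta> k)"
   using Q_component_integral(1)[where f="\<lambda>z. (real z - \<theta> k)\<^sup>2" for k] poisson_moments(2)[OF pos]
   by (intro sum.cong refl) (simp add: power_mult_distrib)
  then show "(\<Sum>k\<in>A. measure_pmf.expectation Q (\<lambda>y. (?f k y)\<^sup>2)) <= v" using v by simp
 qed auto
 then show ?thesis by simp
qed

lemma Q_characteristic:
 "measure_pmf.expectation Q (\<lambda>y. iexp (\<Sum>k\<in>A. c k * real (y k)))
  = exp (\<Sum>k\<in>A. complex_of_real (\<theta> k) * (iexp (c k) - 1))"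
proof -
 have ind: "prob_space.indep_vars (measure_pmf Q) (\<lambda>_. borel) (\<lambda>k y. iexp (c k) ^ y k) A"
  using prob_space.indep_vars_compose2[OF measure_pmf.prob_space_axioms Q_indep, of "\<lambda>k z. iexp (c k) ^ z" "\<lambda>_. borel"] by simp
 have e: "iexp (\<Sum>k\<in>A. c k * real (y k)) = (\<Prod>k\<in>A. iexp (c k) ^ y k)" for y
 proof -
  have "iexp (\<Sum>k\<in>A. c k * real (y k)) = exp (\<Sum>k\<in>A. of_nat (y k) * (\<i> * complex_of_real (c k)))"
   by (simp add: sum_distrib_left mult_ac)
  then show ?thesis using fin by (simp add: exp_sum exp_of_nat_mult)
 qed
 have "measure_pmf.expectation Q (\<lambda>y. \<Prod>k\<in>A. iexp (c k) ^ y k) = (\<Prod>k\<in>A. measure_pmf.expectation Q (\<lambda>y. iexp (c k) ^ y k))"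
  by (rule prob_space.indep_vars_lebesgue_integral[OF measure_pmf.prob_space_axioms fin ind])
    (use Q_component_integral(2)[where f="\<lambda>z. iexp (c k) ^ z" for k] poisson_summable(1)[OF pos] in auto)
 also have "\<dots> = (\<Prod>k\<in>A. exp (complex_of_real (\<theta> k) * (iexp (c k) - 1)))"
  using Q_component_integral(1)[where f="\<lambda>z. iexp (c k) ^ z" for k] poisson_summable(2)[OF pos]
  by (intro prod.cong refl) simp
 finally show ?thesis unfolding e using fin by (simp add: exp_sum)
qed

end

text \<open>Chebyshev's inequality for group totals: they are independent Poisson variables with
  means \<open>t i\<close>, and \<open>2 * (t i)\<^sup>2 + t i\<close> is the variance of the
  squared centred total.\<close>

lemma Q_quadratic_noise:
 fixes I :: "'i set" and J :: "'j set" and \<theta> :: "'i \<times> 'j => real"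
 assumes fin: "finite I" "finite J" "J \<noteq> {}" and pos: "\<And>k. k \<in> I \<times> J ==> \<theta> k > 0"
  and t: "\<And>i. i \<in> I ==> t i = (\<Sum>j\<in>J. \<theta> (i, j))"
  and v: "(\<Sum>i\<in>I. (c i)\<^sup>2 * (2 * (t i)\<^sup>2 + t i)) <= v" and a: "a > 0"
 shows "measure (measure_pmf (Pi_pmf (I \<times> J) 0 (\<lambda>k. poisson_pmf (\<theta> k))))
   {y. a < \<bar>\<Sum>i\<in>I. c i * ((real (\<Sum>j\<in>J. y (i, j)) - t i)\<^sup>2 - t i)\<bar>} <= v / a\<^sup>2"
proof -
 define Q where "Q = Pi_pmf (I \<times> J) 0 (\<lambda>k. poisson_pmf (\<theta> k))"
 have finIJ: "finite (I \<times> J)" using fin by simp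
 define S where "S = (\<lambda>i (y :: 'i \<times> 'j => nat). \<Sum>j\<in>J. y (i, j))"
 have tp: "t i > 0" if "i \<in> I" for i using t[OF that] fin pos that by (auto intro!: sum_pos)
 have S: "map_pmf (S i) Q = poisson_pmf (t i)" if i: "i \<in> I" for i
 proof -
  have "map_pmf (\<lambda>y. \<Sum>k\<in>{i} \<times> J. y k) Q = poisson_pmf (\<Sum>k\<in>{i} \<times> J. \<theta> k)"
   unfolding Q_def using i fin by (intro Q_group finIJ pos) auto
  moreover have "(\<Sum>k\<in>{i} \<times> J. \<theta> k) = (\<Sum>j\<in>J. \<theta> (i, j))"
   using sum.cartesian_product[of "\<lambda>i j. \<theta> (i, j)" J "{i}"] by simp
  moreover have "(\<Sum>k\<in>{i} \<times> J. y k) = S i y" for y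
   unfolding S_def using sum.cartesian_product[of "\<lambda>i j. y (i, j)" J "{i}"] by simp
  then have "(\<lambda>y. \<Sum>k\<in>{i} \<times> J. y k) = S i" by (rule ext)
  ultimately show ?thesis using t[OF i] by simp
 qed
 have S_int: "measure_pmf.expectation Q (\<lambda>y. f (S i y)) = measure_pmf.expectation (poisson_pmf (t i)) f"
  "integrable (measure_pmf Q) (\<lambda>y. f (S i y)) \<longleftrightarrow> integrable (measure_pmf (poisson_pmf (t i))) f"
  if "i \<in> I" for i and f :: "nat => real"
  unfolding S[OF that, symmetric] by (auto simp: integrable_map_pmf_eq)
 \<comment> \<open>Totals of different groups depend on disjoint blocks of coordinates.
   Measurability of a total into the discrete space is obtained by adding one summand at a time and
   splitting over its countably many values.\<close>
 have indS: "prob_space.indep_vars (measure_pmf Q) (\<lambda>_. count_space UNIV) S I"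
 proof -
  have "prob_space.indep_vars (measure_pmf Q) (\<lambda>i. PiM ({i} \<times> J) (\<lambda>_. count_space UNIV)) (\<lambda>i y. restrict (\<lambda>k. y k) ({i} \<times> J)) I"
   by (rule prob_space.indep_vars_restrict[OF measure_pmf.prob_space_axioms indep_vars_Pi_pmf[OF finIJ, of 0 "\<lambda>k. poisson_pmf (\<theta> k)", folded Q_def]])
     (auto simp: disjoint_family_on_def)
  then have "prob_space.indep_vars (measure_pmf Q) (\<lambda>_. count_space UNIV) (\<lambda>i y. (\<lambda>z. \<Sum>j\<in>J. z (i, j)) (restrict (\<lambda>k. y k) ({i} \<times> J))) I"
  proof (rule prob_space.indep_vars_compose2[OF measure_pmf.prob_space_axioms])
   fix i assume "i \<in> I"
   have c: "(\<lambda>z. z (i, j)) \<in> PiM ({i} \<times> J) (\<lambda>_. count_space UNIV) \<rightarrow>\<^sub>M count_space (UNIV :: nat set)" if "j \<in> J" for j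
    using that by (intro measurable_component_singleton) auto
   have "(\<lambda>z. \<Sum>j\<in>K. z (i, j)) \<in> PiM ({i} \<times> J) (\<lambda>_. count_space UNIV) \<rightarrow>\<^sub>M count_space (UNIV :: nat set)"
    if "finite K" "K \<subseteq> J" for K
    using that
   proof (induction rule: finite_induct)
    case (insert j K)
    have IH: "(\<lambda>z. \<Sum>j\<in>K. z (i, j)) \<in> PiM ({i} \<times> J) (\<lambda>_. count_space UNIV) \<rightarrow>\<^sub>M count_space (UNIV :: nat set)"
     using insert by auto
    have "(\<lambda>z. a + (\<Sum>j\<in>K. z (i, j))) \<in> PiM ({i} \<times> J) (\<lambda>_. count_space UNIV) \<rightarrow>\<^sub>M count_space (UNIV :: nat set)" for a
     by (rule measurable_compose[OF IH]) simp
    from measurable_compose_countable[OF this c[of j]] show ?case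
     using insert.prems by (simp add: sum.insert[OF insert.hyps])
   qed simp
   from this[OF fin(2)] show "(\<lambda>z. \<Sum>j\<in>J. z (i, j)) \<in> PiM ({i} \<times> J) (\<lambda>_. count_space UNIV) \<rightarrow>\<^sub>M count_space (UNIV :: nat set)"
    by simp
  qed
  then show ?thesis unfolding S_def by (rule prob_space.indep_vars_cong[OF measure_pmf.prob_space_axioms, THEN iffD1, rotated -1]) auto
 qed
 let ?f = "\<lambda>i y. c i * ((real (S i y) - t i)\<^sup>2 - t i)"
 have ind: "prob_space.indep_vars (measure_pmf Q) (\<lambda>_. borel) ?f I"
  using prob_space.indep_vars_compose2[OF measure_pmf.prob_space_axioms indS, of "\<lambda>i z. c i * ((real z - t i)\<^sup>2 - t i)" "\<lambda>_. borel"] by simp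
 have i2: "integrable (measure_pmf (poisson_pmf (t i))) (\<lambda>z. (real z - t i)\<^sup>2)" if "i \<in> I" for i
  using poisson_integrable_power[OF tp[OF that], of 2] poisson_integrable_power[OF tp[OF that], of 1]
  by (simp add: power2_diff)
 have i4: "integrable (measure_pmf (poisson_pmf (t i))) (\<lambda>z. ((real z - t i)\<^sup>2 - t i)\<^sup>2)" if "i \<in> I" for i
 proof -
  have "(\<lambda>z. ((real z - t i)\<^sup>2 - t i)\<^sup>2) = (\<lambda>k. real k ^ 4 - (4 * t i) * real k ^ 3 + (6 * (t i)\<^sup>2 - 2 * t i) * real k ^ 2
   + (4 * (t i)\<^sup>2 - 4 * t i ^ 3) * real k ^ 1 + ((t i)\<^sup>2 - t i)\<^sup>2)"
   by (simp add: fun_eq_iff power2_eq_square power3_eq_cube power4_eq_xxxx algebra_simps)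
  then show ?thesis
   by (simp only:) (intro Bochner_Integration.integrable_add Bochner_Integration.integrable_diff integrable_mult_right
    poisson_integrable_power[OF tp[OF that]] measure_pmf.integrable_const)
 qed
 have sq: "integrable (measure_pmf Q) (\<lambda>y. (?f i y)\<^sup>2)" if "i \<in> I" for i
  using i4[OF that] S_int(2)[OF that, of "\<lambda>z. ((real z - t i)\<^sup>2 - t i)\<^sup>2"] by (simp add: power_mult_distrib)
 have int: "integrable (measure_pmf Q) (?f i)" if "i \<in> I" for i
  by (rule integrable_of_square[OF measure_pmf.prob_space_axioms _ sq[OF that]]) simp
 have z: "measure_pmf.expectation Q (?f i) = 0" if "i \<in> I" for i
  using S_int(1)[OF that, of "\<lambda>z. (real z - t i)\<^sup>2 - t i"] poisson_moments(2)[OF tp[OF that]] i2[OF that] by simp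
 have "measure (measure_pmf Q) {y \<in> space (measure_pmf Q). a < \<bar>\<Sum>i\<in>I. ?f i y\<bar>} <= v / a\<^sup>2"
 proof (rule prob_space.orthogonal_sum_bound[OF measure_pmf.prob_space_axioms fin(1) _ sq _ _ a])
  show "measure_pmf.expectation Q (\<lambda>y. ?f i y * ?f k y) = 0" if "i \<in> I" "k \<in> I" "i \<noteq> k" for i k
   by (rule prob_space.indep_vars_orthogonal[OF measure_pmf.prob_space_axioms ind int z that])
  have "(\<Sum>i\<in>I. measure_pmf.expectation Q (\<lambda>y. (?f i y)\<^sup>2)) = (\<Sum>i\<in>I. (c i)\<^sup>2 * (2 * (t i)\<^sup>2 + t i))"
  proof (intro sum.cong refl)
   fix i assume i: "i \<in> I"
   show "measure_pmf.expectation Q (\<lambda>y. (?f i y)\<^sup>2) = (c i)\<^sup>2 * (2 * (t i)\<^sup>2 + t i)"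
    using S_int(1)[OF i, of "\<lambda>z. ((real z - t i)\<^sup>2 - t i)\<^sup>2"] poisson_moments(3)[OF tp[OF i]]
    by (simp add: power_mult_distrib)
  qed
  then show "(\<Sum>i\<in>I. measure_pmf.expectation Q (\<lambda>y. (?f i y)\<^sup>2)) <= v" using v by simp
 qed auto
 then show ?thesis by (simp add: S_def Q_def)
qed

section \<open>Conditional laws in the mixed model\<close>

text \<open>The defining identity E(h 1_A) = E(h P(A | F)) for nonnegative, possibly unbounded
  \<open>h\<close>. The conditional probability is given through \<open>real_cond_exp\<close>; it
  can be identified with the nonnegative conditional expectation because the latter is almost surely
  at most 1, hence finite.\<close>

lemma nn_integral_cond_prob:
 fixes A :: "'a set" and p :: "'a => real"
 assumes "prob_space M" and sub: "subalgebra M F" and A: "A \<in> sets M"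
  and p: "AE pt in M. cond_prob_alg M F A pt = p pt" and [measurable]: "h \<in> borel_measurable F"
 shows "(\<integral>\<^sup>+pt. h pt * indicator A pt \<partial>M) = (\<integral>\<^sup>+pt. h pt * ennreal (p pt) \<partial>M)"
proof -
 interpret prob_space M by fact
 interpret finite_measure_subalgebra M F by standard (rule sub)
 let ?n = "nn_cond_exp M F (\<lambda>pt. ennreal (indicator A pt))"
 have i: "(\<lambda>pt. ennreal (indicator A pt)) = indicator A" by (auto simp: indicator_def fun_eq_iff)
 have [measurable]: "A \<in> sets M" by (rule A)
 have "AE pt in M. 0 = nn_cond_exp M F (\<lambda>_. 0) pt" by (rule nn_cond_exp_F_meas) auto
 moreover have "AE pt in M. 1 = nn_cond_exp M F (\<lambda>_. 1) pt" by (rule nn_cond_exp_F_meas) auto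
 moreover have "AE pt in M. ?n pt <= nn_cond_exp M F (\<lambda>_. 1) pt"
  by (rule nn_cond_exp_mono) (auto simp: indicator_def)
 ultimately have "AE pt in M. ?n pt = ennreal (p pt)"
  using p
 proof eventually_elim
  case (elim pt)
  have "(\<lambda>pt. ennreal (- indicator A pt)) = (\<lambda>_. 0)" by (auto simp: indicator_def fun_eq_iff ennreal_neg)
  then have "p pt = enn2real (?n pt)" using elim by (simp add: cond_prob_alg_def real_cond_exp_def)
  moreover have "?n pt < top" using elim(2,3) by (metis ennreal_one_less_top order_le_less_trans)
  ultimately show ?case by simp
 qed
 then have "(\<integral>\<^sup>+pt. h pt * ennreal (p pt) \<partial>M) = (\<integral>\<^sup>+pt. h pt * ?n pt \<partial>M)"
  by (intro nn_integral_cong_AE) auto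
 also have "\<dots> = (\<integral>\<^sup>+pt. h pt * indicator A pt \<partial>M)"
  unfolding i by (rule nn_cond_exp_intg) auto
 finally show ?thesis ..
qed

context simple_poisson_mixed_model
begin

definition Ix :: "(nat \<times> nat) set" where "Ix = {1..m} \<times> {1..n}"

definition W :: "nat \<times> nat + nat => 'a => real" where "W = case_sum (\<lambda>(i, j). X i j) U"

definition F :: "'a measure" where "F = generated_algebra M (Ix <+> {1..m}) W"

definition rate :: "'a => nat \<times> nat => real" where
 "rate pt = (\<lambda>(i, j). exp (b0 + b1 * X i j pt + U i pt))"

text \<open>The value 0 outside \<open>Ix\<close> is the default of \<open>Pi_pmf\<close> in
  \<open>Q\<close>, so that the response vector and the points charged by \<open>Q pt\<close> lie in
  one countable set \<open>Ext\<close>.\<close>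

definition YY :: "'a => nat \<times> nat => nat" where
 "YY pt = (\<lambda>(i, j). if (i, j) \<in> Ix then Y i j pt else 0)"

definition Q :: "'a => (nat \<times> nat => nat) pmf" where
 "Q pt = Pi_pmf Ix 0 (\<lambda>k. poisson_pmf (rate pt k))"

lemma finite_Ix [simp]: "finite Ix" by (simp add: Ix_def)

lemma rate_pos: "rate pt k > 0" by (cases k) (simp add: rate_def)

lemma indep_W: "indep_vars (\<lambda>_. borel) W (Ix <+> {1..m})"
 using indep_XU by (simp add: W_def Ix_def)

lemma W_rv: "k \<in> Ix <+> {1..m} ==> W k \<in> borel_measurable M"
 using indep_W unfolding indep_vars_def by blast

lemma space_F [simp]: "space F = space M"
 unfolding F_def generated_algebra_def by (rule space_measure_of_conv)

lemma subalgebra_F: "subalgebra M F"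
proof -
 have "{W k -` B \<inter> space M | k B. k \<in> Ix <+> {1..m} \<and> B \<in> sets borel} \<subseteq> sets M"
  using W_rv measurable_sets by blast
 then have "sigma_sets (space M) {W k -` B \<inter> space M | k B. k \<in> Ix <+> {1..m} \<and> B \<in> sets borel} \<subseteq> sets M"
  by (rule sets.sigma_sets_subset)
 moreover have "sets F = sigma_sets (space M) {W k -` B \<inter> space M | k B. k \<in> Ix <+> {1..m} \<and> B \<in> sets borel}"
  unfolding F_def generated_algebra_def by (intro sets_measure_of) auto
 ultimately show ?thesis by (simp add: subalgebra_def)
qed

lemma W_F: "k \<in> Ix <+> {1..m} ==> W k \<in> borel_measurable F"
proof (rule measurableI)
 fix B :: "real set" assume k: "k \<in> Ix <+> {1..m}" and B: "B \<in> sets borel"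
 have "W k -` B \<inter> space M \<in> sigma_sets (space M) {W k -` B \<inter> space M | k B. k \<in> Ix <+> {1..m} \<and> B \<in> sets borel}"
  using k B by (intro sigma_sets.Basic) blast
 moreover have "sets F = sigma_sets (space M) {W k -` B \<inter> space M | k B. k \<in> Ix <+> {1..m} \<and> B \<in> sets borel}"
  unfolding F_def generated_algebra_def by (intro sets_measure_of) auto
 ultimately show "W k -` B \<inter> space F \<in> sets F" by simp
qed simp

lemma X_F: "i \<in> {1..m} ==> j \<in> {1..n} ==> X i j \<in> borel_measurable F"
proof -
 assume "i \<in> {1..m}" "j \<in> {1..n}"
 then have "Inl (i, j) \<in> Ix <+> {1..m}" by (auto simp: Ix_def)
 from W_F[OF this] show ?thesis by (simp add: W_def)
qed

lemma U_F: "i \<in> {1..m} ==> U i \<in> borel_measurable F"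
proof -
 assume "i \<in> {1..m}"
 then have "Inr i \<in> Ix <+> {1..m}" by auto
 from W_F[OF this] show ?thesis by (simp add: W_def)
qed

lemma F_M: "f \<in> borel_measurable F ==> f \<in> borel_measurable M"
 by (rule measurable_from_subalg[OF subalgebra_F])

lemma sets_F_M: "A \<in> sets F ==> A \<in> events"
 using subalgebra_F by (auto simp: subalgebra_def)

lemma X_M: "i \<in> {1..m} ==> j \<in> {1..n} ==> X i j \<in> borel_measurable M"
 by (intro F_M X_F)

lemma U_M: "i \<in> {1..m} ==> U i \<in> borel_measurable M"
 by (intro F_M U_F)

lemma rate_F: "k \<in> Ix ==> (\<lambda>pt. rate pt k) \<in> borel_measurable F"
proof -
 assume k: "k \<in> Ix"
 obtain i j where ij: "k = (i, j)" "i \<in> {1..m}" "j \<in> {1..n}" using k by (auto simp: Ix_def)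
 note [measurable] = X_F[OF ij(2,3)] U_F[OF ij(2)]
 show ?thesis by (simp add: rate_def ij)
qed

lemma Y_M: "i \<in> {1..m} ==> j \<in> {1..n} ==> Y i j \<in> M \<rightarrow>\<^sub>M count_space UNIV"
 using cond_indep_Y unfolding cond_indep_vars_def by auto

text \<open>Countability of this set lets conditional laws be treated atom by atom, with no appeal
  to regular conditional distributions.\<close>

definition Ext :: "(nat \<times> nat => nat) set" where "Ext = {y. \<forall>k. k \<notin> Ix \<longrightarrow> y k = 0}"

lemma countable_Ext: "countable Ext"
proof -
 have "Ext \<subseteq> (\<lambda>h k. if k \<in> Ix then h k else 0) ` (PiE Ix (\<lambda>_. UNIV))"
 proof
  fix y assume y: "y \<in> Ext"
  show "y \<in> (\<lambda>h k. if k \<in> Ix then h k else 0) ` (PiE Ix (\<lambda>_. UNIV))"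
  proof (rule image_eqI)
   show "y = (\<lambda>k. if k \<in> Ix then restrict y Ix k else 0)" using y by (auto simp: Ext_def fun_eq_iff)
  qed auto
 qed
 moreover have "countable (PiE Ix (\<lambda>_. UNIV :: nat set))" by (intro countable_PiE) auto
 ultimately show ?thesis by (meson countable_image countable_subset)
qed

lemma YY_Ext: "YY pt \<in> Ext" by (auto simp: YY_def Ext_def)

lemma set_Q: "set_pmf (Q pt) \<subseteq> Ext"
 unfolding Q_def Ext_def by (rule set_Pi_pmf_subset) simp

lemma YY_event: "{pt \<in> space M. YY pt = y} \<in> events"
proof (cases "y \<in> Ext")
 case True
 have "{pt \<in> space M. YY pt = y} = {pt \<in> space M. \<forall>(i, j)\<in>Ix. Y i j pt = y (i, j)}"
  using True by (auto simp: YY_def Ext_def fun_eq_iff)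
 also have "\<dots> \<in> events"
 proof (rule sets.sets_Collect_finite_All)
  show "{pt \<in> space M. case k of (i, j) => Y i j pt = y (i, j)} \<in> events" if k: "k \<in> Ix" for k
  proof -
   obtain i j where ij: "k = (i, j)" "i \<in> {1..m}" "j \<in> {1..n}" using k by (auto simp: Ix_def)
   note [measurable] = Y_M[OF ij(2,3)]
   show ?thesis unfolding ij by simp
  qed
 qed (auto)
 finally show ?thesis .
next
 case False
 then have e: "{pt \<in> space M. YY pt = y} = {}" using YY_Ext by auto
 show ?thesis unfolding e by (rule sets.empty_sets)
qed

lemma YY_measurable: "YY \<in> M \<rightarrow>\<^sub>M count_space Ext"
proof (subst measurable_count_space_eq_countable[OF countable_Ext], intro conjI ballI)
 show "YY \<in> space M \<rightarrow> Ext" using YY_Ext by auto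
 fix y
 have "YY -` {y} \<inter> space M = {pt \<in> space M. YY pt = y}" by auto
 then show "YY -` {y} \<inter> space M \<in> events" using YY_event by simp
qed

lemma pmf_Q: "y \<in> Ext ==> pmf (Q pt) y = (\<Prod>k\<in>Ix. pmf (poisson_pmf (rate pt k)) (y k))"
 unfolding Q_def by (subst pmf_Pi) (auto simp: Ext_def)

lemma pmf_Q_measurable:
 assumes y: "y \<in> Ext"
 shows "(\<lambda>pt. pmf (Q pt) y) \<in> borel_measurable F"
 unfolding pmf_Q[OF y]
proof (rule borel_measurable_prod)
 fix k assume k: "k \<in> Ix"
 note [measurable] = rate_F[OF k]
 have "(\<lambda>pt. rate pt k ^ y k / fact (y k) * exp (- rate pt k)) \<in> borel_measurable F" by measurable
 then show "(\<lambda>pt. pmf (poisson_pmf (rate pt k)) (y k)) \<in> borel_measurable F"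
  by (simp only: pmf_poisson[OF rate_pos])
qed

lemma cond_prob_YY:
 assumes y: "y \<in> Ext" and ne: "m >= 1" "n >= 1"
 shows "AE pt in M. cond_prob_alg M F {pt \<in> space M. YY pt = y} pt = pmf (Q pt) y"
proof -
 have Fe: "F = generated_algebra M (({1..m} \<times> {1..n}) <+> {1..m}) (case_sum (\<lambda>(i, j). X i j) U)"
  by (simp add: F_def W_def Ix_def)
 \<comment> \<open>Nonemptiness matters: \<open>cond_indep_vars\<close> asserts the product formula
   for nonempty index sets.\<close>
 have neI: "Ix \<noteq> {}" using ne by (auto simp: Ix_def)
 have e: "{pt \<in> space M. YY pt = y} = (\<Inter>k\<in>Ix. (case k of (i, j) => Y i j) -` {y k} \<inter> space M)"
  using y neI by (auto simp: YY_def Ext_def fun_eq_iff)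
 have 1: "AE pt in M. cond_prob_alg M F (\<Inter>k\<in>Ix. (case k of (i, j) => Y i j) -` {y k} \<inter> space M) pt
   = (\<Prod>k\<in>Ix. cond_prob_alg M F ((case k of (i, j) => Y i j) -` {y k} \<inter> space M) pt)"
  using cond_indep_Y neI unfolding cond_indep_vars_def Fe[symmetric] Ix_def by auto
 have 2: "AE pt in M. \<forall>k\<in>Ix. cond_prob_alg M F ((case k of (i, j) => Y i j) -` {y k} \<inter> space M) pt
   = pmf (poisson_pmf (rate pt k)) (y k)"
 proof (rule AE_finite_allI)
  fix k assume "k \<in> Ix"
  then obtain i j where k: "k = (i, j)" "i \<in> {1..m}" "j \<in> {1..n}" by (auto simp: Ix_def)
  show "AE pt in M. cond_prob_alg M F ((case k of (i, j) => Y i j) -` {y k} \<inter> space M) pt = pmf (poisson_pmf (rate pt k)) (y k)"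
   using cond_distr_Y[OF k(2,3), of "y k"] unfolding k rate_def Fe[symmetric] by simp
 qed simp
 show ?thesis unfolding e pmf_Q[OF y] using 1 2 by eventually_elim (auto intro: prod.cong)
qed

text \<open>Disintegration of the responses given predictors and intercepts. The integral is split
  over the atoms of \<open>YY\<close>, sum and integral are exchanged, and on each atom the
  indicator is replaced by its conditional probability \<open>pmf (Q pt) y\<close>.\<close>

lemma nn_integral_YY:
 fixes h :: "'a => (nat \<times> nat => nat) => ennreal"
 assumes ne: "m >= 1" "n >= 1" and h: "\<And>y. (\<lambda>pt. h pt y) \<in> borel_measurable F"
 shows "(\<integral>\<^sup>+pt. h pt (YY pt) \<partial>M) = (\<integral>\<^sup>+pt. (\<integral>\<^sup>+y. h pt y \<partial>measure_pmf (Q pt)) \<partial>M)"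
proof -
 interpret C: sigma_finite_measure "count_space Ext"
  using countable_Ext by (rule sigma_finite_measure_count_space_countable)
 interpret P: pair_sigma_finite "count_space Ext" M ..
 have hM: "(\<lambda>pt. h pt y) \<in> borel_measurable M" for y by (rule F_M[OF h])
 have m1: "(\<lambda>(y, pt). h pt y * indicator {pt \<in> space M. YY pt = y} pt) \<in> borel_measurable (count_space Ext \<Otimes>\<^sub>M M)"
 proof (rule measurable_pair_measure_countable1[OF countable_Ext])
  fix y assume "y \<in> Ext"
  show "(\<lambda>pt. case (y, pt) of (y, pt) => h pt y * indicator {pt \<in> space M. YY pt = y} pt) \<in> borel_measurable M"
   using hM[of y] YY_event[of y] by simp
 qed
 have m2: "(\<lambda>(y, pt). h pt y * ennreal (pmf (Q pt) y)) \<in> borel_measurable (count_space Ext \<Otimes>\<^sub>M M)"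
 proof (rule measurable_pair_measure_countable1[OF countable_Ext])
  fix y assume "y \<in> Ext"
  show "(\<lambda>pt. case (y, pt) of (y, pt) => h pt y * ennreal (pmf (Q pt) y)) \<in> borel_measurable M"
   using hM[of y] F_M[OF pmf_Q_measurable[OF \<open>y \<in> Ext\<close>]] by simp
 qed
 have "(\<integral>\<^sup>+pt. h pt (YY pt) \<partial>M) = (\<integral>\<^sup>+pt. (\<integral>\<^sup>+y. h pt y * indicator {pt \<in> space M. YY pt = y} pt \<partial>count_space Ext) \<partial>M)"
 proof (rule nn_integral_cong)
  fix pt assume w: "pt \<in> space M"
  have "(\<integral>\<^sup>+y. h pt y * indicator {pt \<in> space M. YY pt = y} pt \<partial>count_space Ext)
   = (\<integral>\<^sup>+y. h pt (YY pt) * indicator {YY pt} y \<partial>count_space Ext)"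
   using w by (intro nn_integral_cong) (auto simp: indicator_def)
  also have "\<dots> = h pt (YY pt)"
   using YY_Ext[of pt] by (subst nn_integral_cmult_indicator) (auto simp: emeasure_count_space)
  finally show "h pt (YY pt) = (\<integral>\<^sup>+y. h pt y * indicator {pt \<in> space M. YY pt = y} pt \<partial>count_space Ext)" ..
 qed
 also have "\<dots> = (\<integral>\<^sup>+y. (\<integral>\<^sup>+pt. h pt y * indicator {pt \<in> space M. YY pt = y} pt \<partial>M) \<partial>count_space Ext)"
  using P.Fubini'[OF m1] by simp
 also have "\<dots> = (\<integral>\<^sup>+y. (\<integral>\<^sup>+pt. h pt y * ennreal (pmf (Q pt) y) \<partial>M) \<partial>count_space Ext)"
 proof (rule nn_integral_cong)
  fix y assume "y \<in> space (count_space Ext)"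
  then have y: "y \<in> Ext" by simp
  show "(\<integral>\<^sup>+pt. h pt y * indicator {pt \<in> space M. YY pt = y} pt \<partial>M) = (\<integral>\<^sup>+pt. h pt y * ennreal (pmf (Q pt) y) \<partial>M)"
   by (rule nn_integral_cond_prob[OF prob_space_axioms subalgebra_F YY_event cond_prob_YY[OF y ne] h])
 qed
 also have "\<dots> = (\<integral>\<^sup>+pt. (\<integral>\<^sup>+y. h pt y * ennreal (pmf (Q pt) y) \<partial>count_space Ext) \<partial>M)"
  using P.Fubini'[OF m2] by simp
 also have "\<dots> = (\<integral>\<^sup>+pt. (\<integral>\<^sup>+y. h pt y \<partial>measure_pmf (Q pt)) \<partial>M)"
 proof (rule nn_integral_cong)
  fix pt
  have "(\<integral>\<^sup>+y. h pt y \<partial>measure_pmf (Q pt)) = (\<integral>\<^sup>+y. ennreal (pmf (Q pt) y) * h pt y \<partial>count_space UNIV)"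
   by (rule nn_integral_measure_pmf)
  also have "\<dots> = (\<integral>\<^sup>+y. ennreal (pmf (Q pt) y) * h pt y \<partial>count_space Ext)"
   using set_Q[of pt] by (intro nn_integral_count_space_eq) (auto simp: set_pmf_iff)
  finally show "(\<integral>\<^sup>+y. h pt y * ennreal (pmf (Q pt) y) \<partial>count_space Ext) = (\<integral>\<^sup>+y. h pt y \<partial>measure_pmf (Q pt))"
   by (simp add: mult.commute)
 qed
 finally show ?thesis .
qed

lemma YY_compose_measurable:
 assumes "\<And>y. (\<lambda>pt. f pt y) \<in> borel_measurable F"
 shows "(\<lambda>pt. f pt (YY pt)) \<in> borel_measurable M"
 by (rule measurable_compose_countable'[OF _ YY_measurable countable_Ext]) (use F_M[OF assms] in auto)

lemma YY_compose_event:
 assumes "\<And>y. {pt \<in> space M. P pt y} \<in> sets F"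
 shows "{pt \<in> space M. P pt (YY pt)} \<in> events"
proof -
 have "{pt \<in> space M. P pt (YY pt)} = (\<Union>y\<in>Ext. {pt \<in> space M. P pt y} \<inter> {pt \<in> space M. YY pt = y})"
  using YY_Ext by auto
 also have "\<dots> \<in> events"
  using countable_Ext sets_F_M[OF assms] YY_event by (intro sets.countable_UN') auto
 finally show ?thesis .
qed

lemma prob_YY_le:
 assumes ne: "m >= 1" "n >= 1" and P: "\<And>y. {pt \<in> space M. P pt y} \<in> sets F" and c: "c >= 0"
  and le: "\<And>pt. pt \<in> space M ==> measure (measure_pmf (Q pt)) {y. P pt y} <= c"
 shows "prob {pt \<in> space M. P pt (YY pt)} <= c"
proof -
 let ?h = "\<lambda>pt y. indicator {pt \<in> space M. P pt y} pt :: ennreal"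
 have "emeasure M {pt \<in> space M. P pt (YY pt)} = (\<integral>\<^sup>+pt. indicator {pt \<in> space M. P pt (YY pt)} pt \<partial>M)"
  using YY_compose_event[OF P] by simp
 also have "\<dots> = (\<integral>\<^sup>+pt. ?h pt (YY pt) \<partial>M)" by (intro nn_integral_cong) (auto simp: indicator_def)
 also have "\<dots> = (\<integral>\<^sup>+pt. (\<integral>\<^sup>+y. ?h pt y \<partial>measure_pmf (Q pt)) \<partial>M)"
  using P by (intro nn_integral_YY ne) auto
 also have "\<dots> <= (\<integral>\<^sup>+pt. ennreal c \<partial>M)"
 proof (rule nn_integral_mono)
  fix pt assume w: "pt \<in> space M"
  have "(\<integral>\<^sup>+y. ?h pt y \<partial>measure_pmf (Q pt)) = (\<integral>\<^sup>+y. indicator {y. P pt y} y \<partial>measure_pmf (Q pt))"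
   using w by (intro nn_integral_cong) (auto simp: indicator_def)
  also have "\<dots> = ennreal (measure (measure_pmf (Q pt)) {y. P pt y})" by (simp add: measure_pmf.emeasure_eq_measure)
  also have "\<dots> <= ennreal c" using le[OF w] by (rule ennreal_leI)
  finally show "(\<integral>\<^sup>+y. ?h pt y \<partial>measure_pmf (Q pt)) <= ennreal c" .
 qed
 also have "\<dots> = ennreal c" by (simp add: emeasure_space_1)
 finally show ?thesis using c by (simp add: emeasure_eq_measure)
qed

text \<open>Adding \<open>B\<close> makes all integrands nonnegative, so
  \<open>nn_integral_YY\<close> applies. An upper bound \<open>g\<close> for the conditional
  expectation is all that is asked, which spares proving that the conditional expectation is
  measurable in \<open>pt\<close>.\<close>

lemma expectation_YY_le:
 fixes h :: "'a => (nat \<times> nat => nat) => real"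
 assumes ne: "m >= 1" "n >= 1" and h: "\<And>y. (\<lambda>pt. h pt y) \<in> borel_measurable F"
  and B: "\<And>pt y. \<bar>h pt y\<bar> <= B" and g: "g \<in> borel_measurable M" "\<And>pt. \<bar>g pt\<bar> <= B"
  and le: "\<And>pt. pt \<in> space M ==> measure_pmf.expectation (Q pt) (h pt) <= g pt"
 shows "expectation (\<lambda>pt. h pt (YY pt)) <= expectation g"
proof -
 have pos: "h pt y + B >= 0" "g pt + B >= 0" for pt y using B[of pt y] g(2)[of pt] by (auto simp: abs_le_iff)
 have hM: "(\<lambda>pt. h pt (YY pt)) \<in> borel_measurable M" by (rule YY_compose_measurable[OF h])
 have ih: "integrable M (\<lambda>pt. h pt (YY pt))" by (rule integrable_const_bound[of _ B]) (use B hM in auto)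
 have ig: "integrable M g" by (rule integrable_const_bound[of _ B]) (use g in auto)
 have "ennreal (expectation (\<lambda>pt. h pt (YY pt) + B)) = (\<integral>\<^sup>+pt. ennreal (h pt (YY pt) + B) \<partial>M)"
  using ih pos by (intro nn_integral_eq_integral[symmetric]) auto
 also have "\<dots> = (\<integral>\<^sup>+pt. (\<integral>\<^sup>+y. ennreal (h pt y + B) \<partial>measure_pmf (Q pt)) \<partial>M)"
  using h by (intro nn_integral_YY ne) auto
 also have "\<dots> <= (\<integral>\<^sup>+pt. ennreal (g pt + B) \<partial>M)"
 proof (rule nn_integral_mono)
  fix pt assume w: "pt \<in> space M"
  have i: "integrable (measure_pmf (Q pt)) (h pt)"
   by (rule measure_pmf.integrable_const_bound[of _ B]) (use B in auto)
  have "(\<integral>\<^sup>+y. ennreal (h pt y + B) \<partial>measure_pmf (Q pt)) = ennreal (measure_pmf.expectation (Q pt) (\<lambda>y. h pt y + B))"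
   using i pos by (intro nn_integral_eq_integral) auto
  also have "\<dots> <= ennreal (g pt + B)" using i le[OF w] by (intro ennreal_leI) simp
  finally show "(\<integral>\<^sup>+y. ennreal (h pt y + B) \<partial>measure_pmf (Q pt)) <= ennreal (g pt + B)" .
 qed
 also have "\<dots> = ennreal (expectation (\<lambda>pt. g pt + B))"
  using ig pos by (intro nn_integral_eq_integral) auto
 finally have "expectation (\<lambda>pt. h pt (YY pt) + B) <= expectation (\<lambda>pt. g pt + B)"
  using pos by (subst (asm) ennreal_le_iff) (auto intro!: integral_nonneg_AE)
 then show ?thesis using ih ig by (simp add: prob_space)
qed

end

section \<open>Good data have high probability\<close>

lemma (in prob_space) indep_triple_zero:
 fixes f :: "real => real" and U1 U2 H :: "'a => real"
 assumes ind: "indep_vars (\<lambda>_. borel) (\<lambda>k::nat. if k = 0 then H else if k = 1 then U1 else U2) {0, 1, 2}"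
  and int: "integrable M H" "integrable M U1" "integrable M U2" and z: "expectation U1 = 0"
 shows "expectation (\<lambda>pt. H pt * (U1 pt * U2 pt)) = 0"
proof -
 have "expectation (\<lambda>pt. \<Prod>k\<in>{0, 1, 2::nat}. (if k = 0 then H else if k = 1 then U1 else U2) pt)
   = (\<Prod>k\<in>{0, 1, 2::nat}. expectation (if k = 0 then H else if k = 1 then U1 else U2))"
  by (rule indep_vars_lebesgue_integral[OF _ ind]) (use int in auto)
 then show ?thesis using z by simp
qed

lemma (in prob_space) indep_vars_subfamily:
 fixes W :: "'i => 'a => real"
 assumes ind: "indep_vars (\<lambda>_. borel) W I" and h: "inj_on h J" "h ` J \<subseteq> I"
 shows "indep_vars (\<lambda>_. borel) (\<lambda>j. W (h j)) J"
proof -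
 have "indep_vars (\<lambda>j. PiM {h j} (\<lambda>_. borel)) (\<lambda>j pt. restrict (\<lambda>k. W k pt) {h j}) J"
  by (rule indep_vars_restrict[OF ind]) (use h in \<open>auto simp: disjoint_family_on_def inj_on_def\<close>)
 then have "indep_vars (\<lambda>_. borel) (\<lambda>j pt. (\<lambda>z. z (h j)) (restrict (\<lambda>k. W k pt) {h j})) J"
  by (rule indep_vars_compose2) (auto intro: measurable_component_singleton)
 then show ?thesis by simp
qed

section \<open>Averages over predictors and intercepts\<close>

context simple_poisson_mixed_model
begin

lemma X_pairs_indep: "i \<in> {1..m} ==> indep_vars (\<lambda>_. borel) (X i) {1..n}"
proof -
 assume i: "i \<in> {1..m}"
 have "indep_vars (\<lambda>_. borel) (\<lambda>j. W (Inl (i, j))) {1..n}"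
  by (rule indep_vars_subfamily[OF indep_W]) (use i in \<open>auto simp: Ix_def inj_on_def\<close>)
 then show ?thesis by (simp add: W_def)
qed

lemma U_indep: "indep_vars (\<lambda>_. borel) U {1..m}"
proof -
 have "indep_vars (\<lambda>_. borel) (\<lambda>i. W (Inr i)) {1..m}"
  by (rule indep_vars_subfamily[OF indep_W]) (auto simp: inj_on_def)
 then show ?thesis by (simp add: W_def)
qed

definition Xv :: "'a => nat \<times> nat => real" where "Xv pt = (\<lambda>(i, j)\<in>Ix. X i j pt)"

lemma Xv_eq: "i \<in> {1..m} ==> j \<in> {1..n} ==> Xv pt (i, j) = X i j pt"
 by (simp add: Xv_def Ix_def)

text \<open>The weights of the averages to be bounded may involve the predictors of all groups, as
  \<open>R i - avg m R\<close> does, so the summands are not independent. They are still orthogonal: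
  a function of all predictors is independent of the two intercepts \<open>U i\<close> and
  \<open>U k\<close>, and one centred intercept factor makes the mixed expectation vanish.\<close>

lemma XU_triple:
 assumes ik: "i \<in> {1..m}" "k \<in> {1..m}" "i \<noteq> k" and f: "f \<in> borel_measurable borel"
  and G: "G \<in> borel_measurable (PiM Ix (\<lambda>_. borel))"
 shows "indep_vars (\<lambda>_. borel) (\<lambda>l::nat. if l = 0 then (\<lambda>pt. G (Xv pt)) else if l = 1 then (\<lambda>pt. f (U i pt)) else (\<lambda>pt. f (U k pt))) {0, 1, 2}"
proof -
 define K where "K = (\<lambda>l::nat. if l = 0 then Inl ` Ix else if l = 1 then {Inr i} else {Inr k} :: (nat \<times> nat + nat) set)"
 have 1: "indep_vars (\<lambda>l. PiM (K l) (\<lambda>_. borel)) (\<lambda>l pt. restrict (\<lambda>k. W k pt) (K l)) {0, 1, 2}"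
  by (rule indep_vars_restrict[OF indep_W]) (use ik in \<open>auto simp: K_def disjoint_family_on_def\<close>)
 define H where "H = (\<lambda>l (z :: nat \<times> nat + nat => real). if l = (0::nat) then G (\<lambda>k\<in>Ix. z (Inl k)) else if l = 1 then f (z (Inr i)) else f (z (Inr k)))"
 have "indep_vars (\<lambda>_. borel) (\<lambda>l pt. H l (restrict (\<lambda>k. W k pt) (K l))) {0, 1, 2}"
 proof (rule indep_vars_compose2[OF 1])
  fix l assume l: "l \<in> {0, 1, 2::nat}"
  have a: "(\<lambda>z. G (\<lambda>k\<in>Ix. z (Inl k))) \<in> borel_measurable (PiM (Inl ` Ix) (\<lambda>_. borel))"
  proof (rule measurable_compose[OF _ G])
   show "(\<lambda>z. \<lambda>k\<in>Ix. z (Inl k)) \<in> PiM (Inl ` Ix) (\<lambda>_. borel) \<rightarrow>\<^sub>M PiM Ix (\<lambda>_. borel)"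
    by (rule measurable_restrict) (auto intro: measurable_component_singleton)
  qed
  have b: "(\<lambda>z. f (z (Inr i'))) \<in> borel_measurable (PiM {Inr i'} (\<lambda>_. borel))" for i' :: nat
   by (rule measurable_compose[OF _ f]) (auto intro: measurable_component_singleton)
  show "H l \<in> borel_measurable (PiM (K l) (\<lambda>_. borel))"
   using l a b unfolding H_def K_def by auto
 qed
 then show ?thesis
 proof (rule indep_vars_cong[THEN iffD1, rotated -1])
  fix l :: nat assume "l \<in> {0, 1, 2}"
  have 0: "H 0 (restrict (\<lambda>k. W k pt) (K 0)) = G (Xv pt)" for pt
  proof -
   have e: "(\<lambda>k\<in>Ix. restrict (\<lambda>k. W k pt) (K 0) (Inl k)) = Xv pt"
    by (auto simp: Xv_def W_def K_def fun_eq_iff)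
   show ?thesis unfolding H_def e by (simp only: refl if_True)
  qed
  have 1: "H 1 (restrict (\<lambda>k. W k pt) (K 1)) = f (U i pt)" for pt by (simp add: H_def K_def W_def)
  have 2: "H 2 (restrict (\<lambda>k. W k pt) (K 2)) = f (U k pt)" for pt by (simp add: H_def K_def W_def)
  show "(\<lambda>pt. H l (restrict (\<lambda>k. W k pt) (K l))) = (if l = 0 then (\<lambda>pt. G (Xv pt)) else if l = 1 then (\<lambda>pt. f (U i pt)) else (\<lambda>pt. f (U k pt)))"
   using \<open>l \<in> {0, 1, 2}\<close> 0 1 2 by (auto simp: fun_eq_iff)
 qed auto
qed

lemma Xv_measurable: "Xv \<in> M \<rightarrow>\<^sub>M PiM Ix (\<lambda>_. borel)"
 unfolding Xv_def by (rule measurable_restrict) (auto simp: Ix_def intro: X_M)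

lemma U_integral:
 assumes i: "i \<in> {1..m}" and f: "f \<in> borel_measurable borel"
 shows "integrable M (\<lambda>pt. f (U i pt)) \<longleftrightarrow> integrable lborel (\<lambda>x. normal_density 0 (sqrt s) x * f x)"
  and "expectation (\<lambda>pt. f (U i pt)) = (\<integral>x. normal_density 0 (sqrt s) x * f x \<partial>lborel)"
 using distributed_integrable[OF distr_U[OF i], of f] distributed_integral[OF distr_U[OF i], of f] f by auto

lemma U_avg_bound:
 fixes f :: "real => real" and G :: "nat => (nat \<times> nat => real) => real"
 assumes m1: "m >= 1" and f[measurable]: "f \<in> borel_measurable borel"
  and sq: "integrable lborel (\<lambda>x. normal_density 0 (sqrt s) x * (f x)\<^sup>2)"
  and v: "(\<integral>x. normal_density 0 (sqrt s) x * (f x)\<^sup>2 \<partial>lborel) <= v"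
  and z: "(\<integral>x. normal_density 0 (sqrt s) x * f x \<partial>lborel) = 0"
  and G: "\<And>i. i \<in> {1..m} ==> G i \<in> borel_measurable (PiM Ix (\<lambda>_. borel))"
  and c: "\<And>i z. i \<in> {1..m} ==> \<bar>G i z\<bar> <= c" and a: "a > 0"
 shows "prob {pt \<in> space M. a < \<bar>avg m (\<lambda>i. f (U i pt) * G i (Xv pt))\<bar>} <= c\<^sup>2 * v / (real m * a\<^sup>2)"
proof -
 have c0: "c >= 0" using c[of 1 undefined] m1 by force
 have [measurable]: "(\<lambda>pt. G i (Xv pt)) \<in> borel_measurable M" if "i \<in> {1..m}" for i
  by (rule measurable_compose[OF Xv_measurable G[OF that]])
 have [measurable]: "U i \<in> borel_measurable M" if "i \<in> {1..m}" for i using U_M[OF that] .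
 have f2: "integrable M (\<lambda>pt. (f (U i pt))\<^sup>2)" "expectation (\<lambda>pt. (f (U i pt))\<^sup>2) <= v" if "i \<in> {1..m}" for i
  using U_integral[OF that, of "\<lambda>x. (f x)\<^sup>2"] sq v by auto
 have f1: "integrable M (\<lambda>pt. f (U i pt))" "expectation (\<lambda>pt. f (U i pt)) = 0" if "i \<in> {1..m}" for i
  using integrable_of_square[OF prob_space_axioms _ f2(1)[OF that]] U_integral(2)[OF that f] z that by auto
 have v0: "v >= 0"
 proof -
  have "0 <= expectation (\<lambda>pt. (f (U 1 pt))\<^sup>2)" by simp
  also have "\<dots> <= v" using f2(2)[of 1] m1 by simp
  finally show ?thesis .
 qed
 have le: "(f (U i pt) * G i (Xv pt))\<^sup>2 <= c\<^sup>2 * (f (U i pt))\<^sup>2" if "i \<in> {1..m}" for i pt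
 proof -
  have "(G i (Xv pt))\<^sup>2 <= c\<^sup>2" using c[OF that] c0 by (simp add: abs_le_square_iff[symmetric])
  then have "(G i (Xv pt))\<^sup>2 * (f (U i pt))\<^sup>2 <= c\<^sup>2 * (f (U i pt))\<^sup>2" by (intro mult_right_mono) auto
  then show ?thesis by (simp add: power_mult_distrib mult.commute)
 qed
 have sqi: "integrable M (\<lambda>pt. (f (U i pt) * G i (Xv pt))\<^sup>2)" if i: "i \<in> {1..m}" for i
 proof (rule Bochner_Integration.integrable_bound)
  show "integrable M (\<lambda>pt. c\<^sup>2 * (f (U i pt))\<^sup>2)" using f2(1)[OF i] by simp
 qed (use le[OF i] i in auto)
 have e: "{pt \<in> space M. a < \<bar>avg m (\<lambda>i. f (U i pt) * G i (Xv pt))\<bar>}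
   = {pt \<in> space M. real m * a < \<bar>\<Sum>i\<in>{1..m}. f (U i pt) * G i (Xv pt)\<bar>}"
  using m1 by (auto simp: avg_def abs_divide field_simps)
 have "prob {pt \<in> space M. real m * a < \<bar>\<Sum>i\<in>{1..m}. f (U i pt) * G i (Xv pt)\<bar>} <= real m * (c\<^sup>2 * v) / (real m * a)\<^sup>2"
 proof (rule orthogonal_sum_bound[OF _ _ sqi])
  show "(\<Sum>i\<in>{1..m}. expectation (\<lambda>pt. (f (U i pt) * G i (Xv pt))\<^sup>2)) <= real m * (c\<^sup>2 * v)"
  proof -
   have "expectation (\<lambda>pt. (f (U i pt) * G i (Xv pt))\<^sup>2) <= c\<^sup>2 * v" if i: "i \<in> {1..m}" for i
   proof -
    have "expectation (\<lambda>pt. (f (U i pt) * G i (Xv pt))\<^sup>2) <= expectation (\<lambda>pt. c\<^sup>2 * (f (U i pt))\<^sup>2)"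
     using le[OF i] sqi[OF i] f2(1)[OF i] by (intro integral_mono) auto
    also have "\<dots> <= c\<^sup>2 * v" using f2(2)[OF i] by (simp add: mult_left_mono)
    finally show ?thesis .
   qed
   then have "(\<Sum>i\<in>{1..m}. expectation (\<lambda>pt. (f (U i pt) * G i (Xv pt))\<^sup>2)) <= (\<Sum>i\<in>{1..m}. c\<^sup>2 * v)"
    by (intro sum_mono) auto
   then show ?thesis by simp
  qed
  fix i k assume ik: "i \<in> {1..m}" "k \<in> {1..m}" "i \<noteq> k"
  have "(\<lambda>z. G i z * G k z) \<in> borel_measurable (PiM Ix (\<lambda>_. borel))" using G ik by simp
  from XU_triple[OF ik f this]
  have "expectation (\<lambda>pt. (G i (Xv pt) * G k (Xv pt)) * (f (U i pt) * f (U k pt))) = 0"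
  proof (rule indep_triple_zero)
   show "integrable M (\<lambda>pt. G i (Xv pt) * G k (Xv pt))"
    by (rule integrable_const_bound[of _ "c * c"]) (use c ik c0 in \<open>auto simp: abs_mult intro!: mult_mono\<close>)
  qed (use f1 ik in auto)
  then show "expectation (\<lambda>pt. f (U i pt) * G i (Xv pt) * (f (U k pt) * G k (Xv pt))) = 0"
   by (simp add: mult_ac)
 qed (use m1 a in auto)
 also have "\<dots> = c\<^sup>2 * v / (real m * a\<^sup>2)" using m1 a by (simp add: power2_eq_square field_simps)
 finally show ?thesis unfolding e .
qed

lemma X_integral:
 assumes ij: "i \<in> {1..m}" "j \<in> {1..n}" and g: "g \<in> borel_measurable borel"
 shows "integrable M (\<lambda>pt. g (X i j pt)) \<longleftrightarrow> integrable D g"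
  and "expectation (\<lambda>pt. g (X i j pt)) = integral\<^sup>L D (g :: real => real)"
 using distr_X[OF ij] X_M[OF ij] g by (auto simp: integrable_distr_eq[symmetric] integral_distr[symmetric])

text \<open>Markov's inequality for the average over groups of squared errors; independence within a
  group makes each of them of expectation at most v/n.\<close>

lemma X_avg_bound:
 fixes g :: "real => real"
 assumes ne: "m >= 1" "n >= 1" and g[measurable]: "g \<in> borel_measurable borel"
  and sq: "integrable D (\<lambda>x. (g x)\<^sup>2)" and v: "integral\<^sup>L D (\<lambda>x. (g x)\<^sup>2) <= v" and a: "a > 0"
 shows "prob {pt \<in> space M. a < avg m (\<lambda>i. ((\<Sum>j=1..n. g (X i j pt)) / real n - integral\<^sup>L D g)\<^sup>2)} <= v / (real n * a)"
proof -
 define \<mu> where "\<mu> = integral\<^sup>L D g"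
 have [measurable]: "X i j \<in> borel_measurable M" if "i \<in> {1..m}" "j \<in> {1..n}" for i j using X_M that .
 define T where "T = (\<lambda>i pt. (\<Sum>j=1..n. g (X i j pt) - \<mu>))"
 have Tm: "T i \<in> borel_measurable M" if "i \<in> {1..m}" for i unfolding T_def using that by measurable
 have sqi: "integrable M (\<lambda>pt. (g (X i j pt))\<^sup>2)" "integrable M (\<lambda>pt. g (X i j pt))" if ij: "i \<in> {1..m}" "j \<in> {1..n}" for i j
 proof -
  show 1: "integrable M (\<lambda>pt. (g (X i j pt))\<^sup>2)" using X_integral(1)[OF ij, of "\<lambda>x. (g x)\<^sup>2"] sq by simp
  show "integrable M (\<lambda>pt. g (X i j pt))" using integrable_of_square[OF prob_space_axioms _ 1] ij by simp
 qed
 have E: "expectation (\<lambda>pt. g (X i j pt)) = \<mu>" if ij: "i \<in> {1..m}" "j \<in> {1..n}" for i j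
  using X_integral(2)[OF ij g] by (simp add: \<mu>_def)
 have T2: "integrable M (\<lambda>pt. (T i pt)\<^sup>2)" "expectation (\<lambda>pt. (T i pt)\<^sup>2) <= real n * v" if i: "i \<in> {1..m}" for i
 proof -
  let ?f = "\<lambda>j pt. g (X i j pt) - \<mu>"
  have ind: "indep_vars (\<lambda>_. borel) ?f {1..n}"
   using indep_vars_compose2[OF X_pairs_indep[OF i], of "\<lambda>_ x. g x - \<mu>" "\<lambda>_. borel"] by simp
  have e: "(?f j pt)\<^sup>2 = (g (X i j pt))\<^sup>2 - (2 * \<mu>) * g (X i j pt) + \<mu>\<^sup>2" for j pt by (simp add: power2_diff)
  have f2: "integrable M (\<lambda>pt. (?f j pt)\<^sup>2)" "expectation (\<lambda>pt. (?f j pt)\<^sup>2) <= v" if j: "j \<in> {1..n}" for j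
  proof -
   show "integrable M (\<lambda>pt. (?f j pt)\<^sup>2)" unfolding e using sqi[OF i j] by simp
   have "expectation (\<lambda>pt. (?f j pt)\<^sup>2) = expectation (\<lambda>pt. (g (X i j pt))\<^sup>2) - \<mu>\<^sup>2"
    unfolding e using sqi[OF i j] E[OF i j] by (simp add: prob_space power2_eq_square)
   also have "\<dots> <= expectation (\<lambda>pt. (g (X i j pt))\<^sup>2)" by simp
   also have "\<dots> <= v" using X_integral(2)[OF i j, of "\<lambda>x. (g x)\<^sup>2"] v by simp
   finally show "expectation (\<lambda>pt. (?f j pt)\<^sup>2) <= v" .
  qed
  have orth: "expectation (\<lambda>pt. ?f j pt * ?f k pt) = 0" if "j \<in> {1..n}" "k \<in> {1..n}" "j \<noteq> k" for j k
   by (rule indep_vars_orthogonal[OF ind _ _ that]) (use sqi(2)[OF i] E[OF i] in \<open>auto simp: prob_space\<close>)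
  have rv: "random_variable borel (?f j)" if "j \<in> {1..n}" for j using that i by simp
  show "integrable M (\<lambda>pt. (T i pt)\<^sup>2)" unfolding T_def
   by (rule orthogonal_sum(1)[OF _ rv f2(1) orth]) auto
  have "expectation (\<lambda>pt. (T i pt)\<^sup>2) = (\<Sum>j=1..n. expectation (\<lambda>pt. (?f j pt)\<^sup>2))" unfolding T_def
   by (rule orthogonal_sum(2)[OF _ rv f2(1) orth]) auto
  also have "\<dots> <= (\<Sum>j=1..n. v)" using f2(2) by (intro sum_mono) auto
  finally show "expectation (\<lambda>pt. (T i pt)\<^sup>2) <= real n * v" by simp
 qed
 define S where "S = (\<lambda>pt. \<Sum>i=1..m. (T i pt)\<^sup>2)"
 have Si: "integrable M S" unfolding S_def using T2(1) by (intro Bochner_Integration.integrable_sum) auto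
 have "expectation S = (\<Sum>i=1..m. expectation (\<lambda>pt. (T i pt)\<^sup>2))"
  unfolding S_def using T2(1) by (intro Bochner_Integration.integral_sum) auto
 also have "\<dots> <= (\<Sum>i=1..m. real n * v)" using T2(2) by (intro sum_mono) auto
 finally have SE: "expectation S <= real m * (real n * v)" by simp
 have "prob {pt \<in> space M. a < avg m (\<lambda>i. ((\<Sum>j=1..n. g (X i j pt)) / real n - integral\<^sup>L D g)\<^sup>2)}
   <= prob {pt \<in> space M. S pt >= real m * (real n)\<^sup>2 * a}"
 proof (rule finite_measure_mono)
  show "{pt \<in> space M. a < avg m (\<lambda>i. ((\<Sum>j=1..n. g (X i j pt)) / real n - integral\<^sup>L D g)\<^sup>2)}
    \<subseteq> {pt \<in> space M. S pt >= real m * (real n)\<^sup>2 * a}"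
  proof safe
   fix pt assume h: "a < avg m (\<lambda>i. ((\<Sum>j=1..n. g (X i j pt)) / real n - integral\<^sup>L D g)\<^sup>2)"
   have "avg m (\<lambda>i. ((\<Sum>j=1..n. g (X i j pt)) / real n - integral\<^sup>L D g)\<^sup>2) = avg m (\<lambda>i. (1 / (real n)\<^sup>2) * (T i pt)\<^sup>2)"
   proof (rule avg_cong)
    fix i
    have "(\<Sum>j=1..n. g (X i j pt)) / real n - integral\<^sup>L D g = T i pt / real n"
     using ne by (simp add: T_def sum_subtractf \<mu>_def field_simps)
    then show "((\<Sum>j=1..n. g (X i j pt)) / real n - integral\<^sup>L D g)\<^sup>2 = 1 / (real n)\<^sup>2 * (T i pt)\<^sup>2"
     by (simp add: power_divide)
   qed
   also have "\<dots> = S pt / (real m * (real n)\<^sup>2)" unfolding avg_cmult by (simp add: avg_def S_def)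
   finally have "a < S pt / (real m * (real n)\<^sup>2)" using h by (simp only:)
   then show "S pt >= real m * (real n)\<^sup>2 * a" using ne by (simp add: pos_less_divide_eq mult_ac)
  qed
  show "{pt \<in> space M. S pt >= real m * (real n)\<^sup>2 * a} \<in> events" using Si by measurable
 qed
 also have "\<dots> <= expectation S / (real m * (real n)\<^sup>2 * a)"
  by (rule integral_Markov_inequality_measure[OF Si, where A="{}"]) (use ne a in \<open>auto simp: S_def sum_nonneg\<close>)
 also have "\<dots> <= real m * (real n * v) / (real m * (real n)\<^sup>2 * a)"
  using SE a by (intro divide_right_mono) auto
 also have "\<dots> = v / (real n * a)" using ne a by (simp add: power2_eq_square field_simps)
 finally show ?thesis .
qed

text \<open>A bound on the outer probability: \<open>P\<close> need not be measurable.\<close>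

definition unlikely :: "real => ('a => bool) => bool" where
 "unlikely p P \<longleftrightarrow> (\<exists>B\<in>events. prob B <= p \<and> {pt \<in> space M. P pt} \<subseteq> B)"

lemma unlikelyI: "{pt \<in> space M. P pt} \<in> events ==> prob {pt \<in> space M. P pt} <= p ==> unlikely p P"
 unfolding unlikely_def by blast

lemma unlikely_mono: "unlikely p P ==> p <= p' ==> (\<And>pt. pt \<in> space M ==> P' pt ==> P pt) ==> unlikely p' P'"
proof -
 assume "unlikely p P" and p: "p <= p'" and P: "\<And>pt. pt \<in> space M ==> P' pt ==> P pt"
 then obtain B where B: "B \<in> events" "prob B <= p" "{pt \<in> space M. P pt} \<subseteq> B" unfolding unlikely_def by auto
 then have "{pt \<in> space M. P' pt} \<subseteq> B" using P by auto
 then show ?thesis using B p unfolding unlikely_def by (intro bexI[of _ B]) auto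
qed

lemma unlikely_or: "unlikely p P ==> unlikely p' P' ==> unlikely (p + p') (\<lambda>pt. P pt \<or> P' pt)"
proof -
 assume "unlikely p P" "unlikely p' P'"
 then obtain B B' where B: "B \<in> events" "prob B <= p" "{pt \<in> space M. P pt} \<subseteq> B"
  "B' \<in> events" "prob B' <= p'" "{pt \<in> space M. P' pt} \<subseteq> B'" unfolding unlikely_def by auto
 have "prob (B \<union> B') <= p + p'" using measure_Un_le[OF B(1,4)] B(2,5) by linarith
 moreover have "{pt \<in> space M. P pt \<or> P' pt} \<subseteq> B \<union> B'" using B by auto
 ultimately show ?thesis using B unfolding unlikely_def by (intro bexI[of _ "B \<union> B'"]) auto
qed

lemma unlikely_Bex:
 assumes "finite I" "\<And>i. i \<in> I ==> unlikely p (P i)"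
 shows "unlikely (real (card I) * p) (\<lambda>pt. \<exists>i\<in>I. P i pt)"
 using assms
proof (induction rule: finite_induct)
 case empty
 show ?case by (rule unlikelyI) auto
next
 case (insert i I)
 have "unlikely (p + real (card I) * p) (\<lambda>pt. P i pt \<or> (\<exists>i\<in>I. P i pt))"
  using insert by (intro unlikely_or) auto
 then show ?case by (rule unlikely_mono) (use insert in \<open>auto simp: algebra_simps\<close>)
qed

text \<open>A truncation depending on predictors and intercepts only. It belongs to
  \<open>F\<close>, so conditional bounds that are uniform on it can be integrated, and it makes all
  rates comparable with powers of \<open>L\<close>.\<close>

definition tamed :: "real => 'a => bool" where
 "tamed L pt \<longleftrightarrow> (\<forall>k\<in>Ix. \<bar>Xv pt k\<bar> <= L \<and> 1 / L <= exp (b0 + b1 * Xv pt k) \<and> exp (b0 + b1 * Xv pt k) <= L) \<and>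
   (\<forall>i\<in>{1..m}. \<bar>U i pt\<bar> <= L \<and> 1 / L <= exp (U i pt) \<and> exp (U i pt) <= L)"

lemma Xv_F: "k \<in> Ix ==> (\<lambda>pt. Xv pt k) \<in> borel_measurable F"
 using X_F by (auto simp: Xv_def Ix_def)

lemma tamed_F: "{pt \<in> space M. tamed L pt} \<in> sets F"
proof -
 have "{pt \<in> space F. (\<forall>k\<in>Ix. \<bar>Xv pt k\<bar> <= L \<and> 1 / L <= exp (b0 + b1 * Xv pt k) \<and> exp (b0 + b1 * Xv pt k) <= L) \<and>
   (\<forall>i\<in>{1..m}. \<bar>U i pt\<bar> <= L \<and> 1 / L <= exp (U i pt) \<and> exp (U i pt) <= L)} \<in> sets F"
 proof (intro sets.sets_Collect_conj sets.sets_Collect_finite_All)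
  fix k assume "k \<in> Ix"
  note [measurable] = Xv_F[OF this]
  show "{pt \<in> space F. \<bar>Xv pt k\<bar> <= L} \<in> sets F" "{pt \<in> space F. 1 / L <= exp (b0 + b1 * Xv pt k)} \<in> sets F"
   "{pt \<in> space F. exp (b0 + b1 * Xv pt k) <= L} \<in> sets F" by measurable
 next
  fix i assume "i \<in> {1..m}"
  note [measurable] = U_F[OF this]
  show "{pt \<in> space F. \<bar>U i pt\<bar> <= L} \<in> sets F" "{pt \<in> space F. 1 / L <= exp (U i pt)} \<in> sets F"
   "{pt \<in> space F. exp (U i pt) <= L} \<in> sets F" by measurable
 qed auto
 then show ?thesis by (simp add: tamed_def)
qed

lemma tamed_conj_F:
 assumes "{pt \<in> space F. P pt} \<in> sets F"
 shows "{pt \<in> space M. tamed L pt \<and> P pt} \<in> sets F"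
proof -
 have "{pt \<in> space M. tamed L pt \<and> P pt} = {pt \<in> space M. tamed L pt} \<inter> {pt \<in> space F. P pt}" by auto
 then show ?thesis using sets.Int[OF tamed_F assms] by simp
qed

lemma unlikely_not_tamed:
 assumes pX: "measure D {x. \<not> (\<bar>x\<bar> <= L \<and> 1 / L <= exp (b0 + b1 * x) \<and> exp (b0 + b1 * x) <= L)} <= pX"
  and pU: "(\<integral>x. normal_density 0 (sqrt s) x * indicator {x. \<not> (\<bar>x\<bar> <= L \<and> 1 / L <= exp x \<and> exp x <= L)} x \<partial>lborel) <= pU"
 shows "unlikely (real m * real n * pX + real m * pU) (\<lambda>pt. \<not> tamed L pt)"
proof -
 have 1: "unlikely pX (\<lambda>pt. \<not> (\<bar>Xv pt k\<bar> <= L \<and> 1 / L <= exp (b0 + b1 * Xv pt k) \<and> exp (b0 + b1 * Xv pt k) <= L))"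
  if k: "k \<in> Ix" for k
 proof -
  obtain i j where ij: "k = (i, j)" "i \<in> {1..m}" "j \<in> {1..n}" using k by (auto simp: Ix_def)
  let ?B = "{x. \<not> (\<bar>x\<bar> <= L \<and> 1 / L <= exp (b0 + b1 * x) \<and> exp (b0 + b1 * x) <= L)}"
  have B: "?B \<in> sets borel" by measurable
  note X = X_M[OF ij(2,3)]
  have e: "{pt \<in> space M. \<not> (\<bar>Xv pt k\<bar> <= L \<and> 1 / L <= exp (b0 + b1 * Xv pt k) \<and> exp (b0 + b1 * Xv pt k) <= L)} = X i j -` ?B \<inter> space M"
   using ij by (auto simp: Xv_eq)
  have "prob (X i j -` ?B \<inter> space M) = measure D ?B"
   using measure_distr[OF X B] distr_X[OF ij(2,3)] by simp
  then show ?thesis using pX measurable_sets[OF X B] unfolding e[symmetric] by (intro unlikelyI) auto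
 qed
 have 2: "unlikely pU (\<lambda>pt. \<not> (\<bar>U i pt\<bar> <= L \<and> 1 / L <= exp (U i pt) \<and> exp (U i pt) <= L))" if i: "i \<in> {1..m}" for i
 proof -
  let ?B = "{x. \<not> (\<bar>x\<bar> <= L \<and> 1 / L <= exp x \<and> exp x <= L)}"
  have B: "?B \<in> sets borel" by measurable
  note U = U_M[OF i]
  have e: "{pt \<in> space M. \<not> (\<bar>U i pt\<bar> <= L \<and> 1 / L <= exp (U i pt) \<and> exp (U i pt) <= L)} = U i -` ?B \<inter> space M" by auto
  define A where "A = U i -` ?B \<inter> space M"
  have A: "A \<in> events" using measurable_sets[OF U B] by (simp only: A_def)
  have "expectation (\<lambda>pt. indicator ?B (U i pt)) = expectation (indicator A)"
   by (intro Bochner_Integration.integral_cong refl) (auto simp: indicator_def A_def)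
  also have "\<dots> = prob A" using A by simp
  finally have "prob A = expectation (\<lambda>pt. indicator ?B (U i pt))" ..
  also have "\<dots> <= pU" using U_integral(2)[OF i, of "indicator ?B"] pU B by simp
  finally show ?thesis using A unfolding A_def e[symmetric] by (intro unlikelyI)
 qed
 show ?thesis
  by (rule unlikely_mono[OF unlikely_or[OF unlikely_Bex[OF finite_Ix 1] unlikely_Bex[OF _ 2]]])
    (auto simp: tamed_def Ix_def)
qed

section \<open>Conditional bounds for the Poisson noise\<close>

definition grp :: "'a => nat => real" where
 "grp pt i = exp (b0 + U i pt) * wsum n (\<lambda>j. X i j pt) 0 b1"

lemma grp_rate: "grp pt i = (\<Sum>j=1..n. rate pt (i, j))"
 by (simp add: grp_def rate_def wsum_def sum_distrib_left exp_add mult_ac)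

lemma grp_F: "i \<in> {1..m} ==> (\<lambda>pt. grp pt i) \<in> borel_measurable F"
 unfolding grp_rate by (intro borel_measurable_sum rate_F) (auto simp: Ix_def)

lemma YY_eq: "i \<in> {1..m} ==> j \<in> {1..n} ==> YY pt (i, j) = Y i j pt"
 by (simp add: YY_def Ix_def)

text \<open>Conditional Chebyshev: on the tamed event the conditional variance is at most
  \<open>v\<close>, and off it the event in question is empty. The bound is thus uniform in
  \<open>pt\<close> and passes to the unconditional probability.\<close>

lemma linear_noise:
 assumes ne: "m >= 1" "n >= 1" and c: "\<And>k. k \<in> Ix ==> (\<lambda>pt. c pt k) \<in> borel_measurable F"
  and v: "\<And>pt. tamed L pt ==> (\<Sum>k\<in>Ix. (c pt k)\<^sup>2 * rate pt k) <= v" and a: "a > 0" and v0: "v >= 0"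
 shows "unlikely (v / a\<^sup>2) (\<lambda>pt. tamed L pt \<and> a < \<bar>\<Sum>k\<in>Ix. c pt k * (real (YY pt k) - rate pt k)\<bar>)"
proof (rule unlikelyI)
 let ?P = "\<lambda>pt y. tamed L pt \<and> a < \<bar>\<Sum>k\<in>Ix. c pt k * (real (y k) - rate pt k)\<bar>"
 have P: "{pt \<in> space M. ?P pt y} \<in> sets F" for y :: "nat \<times> nat => nat"
 proof -
  have "(\<lambda>pt. \<Sum>k\<in>Ix. c pt k * (real (y k) - rate pt k)) \<in> borel_measurable F"
   by (intro borel_measurable_sum borel_measurable_times borel_measurable_diff c rate_F) auto
  then have "{pt \<in> space F. a < \<bar>\<Sum>k\<in>Ix. c pt k * (real (y k) - rate pt k)\<bar>} \<in> sets F" by measurable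
  then show ?thesis by (rule tamed_conj_F)
 qed
 show "{pt \<in> space M. ?P pt (YY pt)} \<in> events" by (rule YY_compose_event[OF P])
 show "prob {pt \<in> space M. ?P pt (YY pt)} <= v / a\<^sup>2"
 proof (rule prob_YY_le[OF ne P])
  show "0 <= v / a\<^sup>2" using v0 by simp
  fix pt
  show "measure (measure_pmf (Q pt)) {y. ?P pt y} <= v / a\<^sup>2"
  proof (cases "tamed L pt")
   case True
   then show ?thesis unfolding Q_def using Q_linear_noise[OF finite_Ix rate_pos v[OF True] a] by simp
  qed (use v0 in simp)
 qed
qed

lemma quadratic_noise:
 assumes ne: "m >= 1" "n >= 1" and c: "\<And>i. i \<in> {1..m} ==> (\<lambda>pt. c pt i) \<in> borel_measurable F"
  and v: "\<And>pt. tamed L pt ==> (\<Sum>i=1..m. (c pt i)\<^sup>2 * (2 * (grp pt i)\<^sup>2 + grp pt i)) <= v" and a: "a > 0" and v0: "v >= 0"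
 shows "unlikely (v / a\<^sup>2) (\<lambda>pt. tamed L pt \<and>
   a < \<bar>\<Sum>i=1..m. c pt i * ((real (\<Sum>j=1..n. YY pt (i, j)) - grp pt i)\<^sup>2 - grp pt i)\<bar>)"
proof (rule unlikelyI)
 let ?T = "\<lambda>pt y. \<Sum>i=1..m. c pt i * ((real (\<Sum>j=1..n. y (i, j)) - grp pt i)\<^sup>2 - grp pt i)"
 let ?P = "\<lambda>pt y. tamed L pt \<and> a < \<bar>?T pt y\<bar>"
 have P: "{pt \<in> space M. ?P pt y} \<in> sets F" for y :: "nat \<times> nat => nat"
 proof -
  have "(\<lambda>pt. ?T pt y) \<in> borel_measurable F"
   by (intro borel_measurable_sum borel_measurable_times borel_measurable_diff borel_measurable_power c grp_F) auto
  then have "{pt \<in> space F. a < \<bar>?T pt y\<bar>} \<in> sets F" by measurable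
  then show ?thesis by (rule tamed_conj_F)
 qed
 show "{pt \<in> space M. ?P pt (YY pt)} \<in> events" by (rule YY_compose_event[OF P])
 show "prob {pt \<in> space M. ?P pt (YY pt)} <= v / a\<^sup>2"
 proof (rule prob_YY_le[OF ne P])
  show "0 <= v / a\<^sup>2" using v0 by simp
  fix pt
  show "measure (measure_pmf (Q pt)) {y. ?P pt y} <= v / a\<^sup>2"
  proof (cases "tamed L pt")
   case True
   have "measure (measure_pmf (Q pt)) {y. a < \<bar>?T pt y\<bar>} <= v / a\<^sup>2"
    unfolding Q_def Ix_def
    by (rule Q_quadratic_noise) (use ne v[OF True] a rate_pos grp_rate in auto)
   then show ?thesis using True by simp
  qed (use v0 in simp)
 qed
qed

lemma tail_noise:
 assumes ne: "m >= 1" "n >= 1" and t: "0 < t" "t <= 1"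
  and th: "\<And>pt i. tamed L pt ==> i \<in> {1..m} ==> h <= grp pt i"
 shows "unlikely (real m * (2 * exp (- t\<^sup>2 * h))) (\<lambda>pt. tamed L pt \<and>
   (\<exists>i\<in>{1..m}. 2 * t * grp pt i < \<bar>real (\<Sum>j=1..n. YY pt (i, j)) - grp pt i\<bar>))"
proof -
 have "unlikely (2 * exp (- t\<^sup>2 * h)) (\<lambda>pt. tamed L pt \<and> 2 * t * grp pt i < \<bar>real (\<Sum>j=1..n. YY pt (i, j)) - grp pt i\<bar>)"
  if i: "i \<in> {1..m}" for i
 proof (rule unlikelyI)
  let ?P = "\<lambda>pt y. tamed L pt \<and> 2 * t * grp pt i < \<bar>real (\<Sum>j=1..n. y (i, j)) - grp pt i\<bar>"
  have P: "{pt \<in> space M. ?P pt y} \<in> sets F" for y :: "nat \<times> nat => nat"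
  proof -
   note [measurable] = grp_F[OF i]
   have "{pt \<in> space F. 2 * t * grp pt i < \<bar>real (\<Sum>j=1..n. y (i, j)) - grp pt i\<bar>} \<in> sets F" by measurable
   then show ?thesis by (rule tamed_conj_F)
  qed
  show "{pt \<in> space M. ?P pt (YY pt)} \<in> events" by (rule YY_compose_event[OF P])
  show "prob {pt \<in> space M. ?P pt (YY pt)} <= 2 * exp (- t\<^sup>2 * h)"
  proof (rule prob_YY_le[OF ne P])
   fix pt
   show "measure (measure_pmf (Q pt)) {y. ?P pt y} <= 2 * exp (- t\<^sup>2 * h)"
   proof (cases "tamed L pt")
    case True
    have sub: "{i} \<times> {1..n} \<subseteq> Ix" "{i} \<times> {1..n} \<noteq> {}" using i ne by (auto simp: Ix_def)
    have e: "(\<Sum>k\<in>{i} \<times> {1..n}. y k) = (\<Sum>j=1..n. y (i, j))" for y :: "nat \<times> nat => nat"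
     using sum.cartesian_product[of "\<lambda>i j. y (i, j)" "{1..n}" "{i}"] by simp
    have e': "(\<Sum>k\<in>{i} \<times> {1..n}. rate pt k) = grp pt i"
     using sum.cartesian_product[of "\<lambda>i j. rate pt (i, j)" "{1..n}" "{i}"] by (simp add: grp_rate)
    have g: "grp pt i > 0" using wsum_0_pos[OF ne(2)] by (simp add: grp_def)
    have law: "map_pmf (\<lambda>y. \<Sum>j=1..n. y (i, j)) (Q pt) = poisson_pmf (grp pt i)"
     unfolding e[symmetric] e'[symmetric] Q_def by (rule Q_group[OF finite_Ix rate_pos sub])
    have "measure (measure_pmf (Q pt)) {y. 2 * t * grp pt i < \<bar>real (\<Sum>j=1..n. y (i, j)) - grp pt i\<bar>}
      = measure (measure_pmf (poisson_pmf (grp pt i))) {k. 2 * t * grp pt i < \<bar>real k - grp pt i\<bar>}"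
     unfolding law[symmetric] measure_map_pmf by (simp add: vimage_def)
    also have "\<dots> <= 2 * exp (- t\<^sup>2 * grp pt i)" by (rule poisson_tail[OF g t])
    also have "\<dots> <= 2 * exp (- t\<^sup>2 * h)" using th[OF True i] by (simp add: mult_left_mono)
    finally show ?thesis using True by simp
   qed simp
  qed simp
 qed
 then have "unlikely (real (card {1..m}) * (2 * exp (- t\<^sup>2 * h))) (\<lambda>pt. \<exists>i\<in>{1..m}. tamed L pt \<and> 2 * t * grp pt i < \<bar>real (\<Sum>j=1..n. YY pt (i, j)) - grp pt i\<bar>)"
  by (rule unlikely_Bex[rotated]) auto
 then show ?thesis by (rule unlikely_mono) auto
qed

end

section \<open>From controlled averages to good data\<close>

definition separated :: "nat => nat => (nat => nat => real) => (nat => nat => nat) => bool" where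
 "separated m n x y \<longleftrightarrow> (\<exists>i1\<in>{1..m}. \<exists>j1\<in>{1..n}. \<exists>i2\<in>{1..m}. \<exists>j2\<in>{1..n}.
   y i1 j1 >= 1 \<and> y i2 j2 >= 1 \<and> x i1 j1 \<noteq> x i2 j2)"

text \<open>If all positive responses occur at a single predictor value, the Cauchy-Schwarz
  inequality for the response-weighted moments is an equality. On good data these moments are near
  population values with a definite gap, so separation can be read off from averages.\<close>

lemma not_separated_moments:
 assumes "\<not> separated m n x y"
 defines "T \<equiv> \<lambda>k. \<Sum>i=1..m. \<Sum>j=1..n. x i j ^ k * real (y i j)"
 shows "T 0 * T 2 = (T 1)\<^sup>2"
proof -
 obtain c where c: "\<And>i j. i \<in> {1..m} ==> j \<in> {1..n} ==> y i j >= 1 ==> x i j = c"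
  using assms(1) unfolding separated_def by metis
 have "T k = c ^ k * T 0" for k
  unfolding T_def sum_distrib_left
 proof (intro sum.cong refl)
  fix i j assume "i \<in> {1..m}" "j \<in> {1..n}"
  then show "x i j ^ k * real (y i j) = c ^ k * (x i j ^ 0 * real (y i j))"
   using c[of i j] by (cases "y i j >= 1") auto
 qed
 from this[of 1] this[of 2] show ?thesis by (simp add: power2_eq_square)
qed

text \<open>Passes from averages that Chebyshev's inequality controls to \<open>good_data\<close>.
  Two conditions need an argument: the concentration of the tilted means, which are quotients of
  \<open>Mk 1\<close> by \<open>Mk 0\<close>, and that of the information, which mixes intercepts,
  moments and noise. Separation comes from the same averages and is needed for existence of a
  maximiser.\<close>

lemma good_dataI:
 fixes m n :: nat and L b0 b1 s \<gamma> I q :: real and x :: "nat => nat => real" and u :: "nat => real" and y :: "nat => nat => nat" and c :: "nat => real"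
 assumes L10: "L >= 10"
 defines "Y \<equiv> \<lambda>i. real (\<Sum>j=1..n. y i j)"
  and "\<theta> \<equiv> \<lambda>i. exp (b0 + u i) * wsum n (x i) 0 b1"
 defines "Z \<equiv> \<lambda>i. Y i / \<theta> i - 1" and "R \<equiv> \<lambda>i. wmean n (x i) b1"
  and "Mk \<equiv> \<lambda>k i. exp b0 * wsum n (x i) k b1 / real n"
 assumes m1: "m >= 1" and nL: "real n = L powi 200"
  and q: "0 < q" "q <= L powi -100"
  and s0: "1 / L <= s" "s <= L" and I: "1 / L <= I" "I <= L" and es: "exp (s / 2) <= L" "s > 0"
  and c0: "1 / L <= c 0" and cL: "\<And>k. k \<in> {0, 1, 2} ==> \<bar>c k\<bar> <= L"
  and \<gamma>L: "\<bar>\<gamma>\<bar> <= L" and \<gamma>: "c 1 = \<gamma> * c 0" and Ic: "I = exp (s / 2) * (c 2 - \<gamma> * c 1)"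
  and x_bd: "\<And>i j. i \<in> {1..m} ==> j \<in> {1..n} ==> \<bar>x i j\<bar> <= L"
  and ex_bd: "\<And>i j. i \<in> {1..m} ==> j \<in> {1..n} ==> 1 / L <= exp (b0 + b1 * x i j) \<and> exp (b0 + b1 * x i j) <= L"
  and u_bd: "\<And>i. i \<in> {1..m} ==> \<bar>u i\<bar> <= L"
  and eu_bd: "\<And>i. i \<in> {1..m} ==> 1 / L <= exp (u i) \<and> exp (u i) <= L"
  and Z_bd: "\<And>i. i \<in> {1..m} ==> \<bar>Z i\<bar> <= L powi -97"
  and M_avg: "\<And>k. k \<in> {0, 1, 2} ==> avg m (\<lambda>i. (Mk k i - c k)\<^sup>2) <= L powi -190"
  and eM_avg: "\<And>k. k \<in> {0, 1, 2} ==> \<bar>avg m (\<lambda>i. (exp (u i) - exp (s / 2)) * Mk k i)\<bar> <= L powi -50"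
  and T_avg: "\<And>k. k \<in> {0, 1, 2} ==> \<bar>avg m (\<lambda>i. (\<Sum>j=1..n. x i j ^ k * (real (y i j) - exp (b0 + b1 * x i j + u i))) / real n)\<bar> <= L powi -50"
  and u_avg: "\<bar>avg m u\<bar> <= q * L" and u2_avg: "\<bar>avg m (\<lambda>i. (u i)\<^sup>2) - s\<bar> <= q * L"
  and uw_avg: "\<bar>avg m (\<lambda>i. u i * (R i - avg m R))\<bar> <= q * L powi 5"
  and Zw_avg: "\<bar>avg m (\<lambda>i. Z i * (R i - avg m R))\<bar> <= q * L powi 5"
  and Z_avg: "\<bar>avg m Z\<bar> <= q * L powi -10" and uZ_avg: "\<bar>avg m (\<lambda>i. u i * Z i)\<bar> <= q * L powi -10"
  and Z2_avg: "\<bar>avg m (\<lambda>i. (Z i)\<^sup>2 - 1 / \<theta> i)\<bar> <= L powi -250"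
  and uZ2_avg: "\<bar>avg m (\<lambda>i. u i * ((Z i)\<^sup>2 - 1 / \<theta> i))\<bar> <= L powi -250"
  and st1: "\<bar>avg m (\<lambda>i. (1 + u i / s) / \<theta> i)\<bar> <= L powi -250"
  and st2: "\<bar>avg m (\<lambda>i. (1 - u i - (u i)\<^sup>2 / s) / \<theta> i)\<bar> <= L powi -250"
  and S_avg: "\<bar>avg m (\<lambda>i. \<Sum>j=1..n. (x i j - R i) * real (y i j))\<bar> <= q * L powi 106"
 shows "good_data L m n b0 b1 s \<gamma> I q x u y" "separated m n x y"
proof -
 interpret scale L by standard (rule L10)
 have n1: "n >= 1" using nL powi_pos(1)[of 200] by (cases n) auto
 have inv_L: "1 / L = L powi -1" by (simp add: power_int_minus divide_inverse)
 have Mk: "Mk k i = (\<Sum>j=1..n. x i j ^ k * exp (b0 + b1 * x i j)) / real n" for k i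
  by (simp add: Mk_def wsum_def sum_distrib_left exp_add mult_ac)
 have M0: "L powi -1 <= Mk 0 i" if i: "i \<in> {1..m}" for i
 proof -
  have "(\<Sum>j=1..n. 1 / L) <= (\<Sum>j=1..n. x i j ^ 0 * exp (b0 + b1 * x i j))" using ex_bd[OF i] by (intro sum_mono) auto
  then have "real n * (1 / L) / real n <= Mk 0 i" unfolding Mk using n1 by (intro divide_right_mono) auto
  then show ?thesis using n1 by (simp add: inv_L)
 qed
 have ub_Mk: "ub (int k + 1) (Mk k i)" if i: "i \<in> {1..m}" for k i
 proof -
  have "\<bar>\<Sum>j=1..n. x i j ^ k * exp (b0 + b1 * x i j)\<bar> <= (\<Sum>j=1..n. L ^ k * L)"
   using x_bd[OF i] ex_bd[OF i]
   by (intro order_trans[OF sum_abs] sum_mono) (auto simp: abs_mult power_abs intro!: mult_mono power_mono)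
  then have "\<bar>Mk k i\<bar> <= L ^ k * L" unfolding Mk using n1 by (simp add: abs_divide field_simps)
  also have "L ^ k * L = L powi (int k + 1)" by (simp add: power_int_add)
  finally show ?thesis by (simp add: ub_def)
 qed
 have ub_eu: "i \<in> {1..m} ==> ub 1 (exp (u i))" for i using eu_bd by (simp add: ub_def)
 have ub_g: "ub 1 \<gamma>" using \<gamma>L by (simp add: ub_def)
 have ub_es: "ub 1 (exp (s / 2))" using es by (simp add: ub_def)
 have M_abs: "avg m (\<lambda>i. \<bar>Mk k i - c k\<bar>) <= L powi -95" if k: "k \<in> {0, 1, 2}" for k
 proof -
  have "avg m (\<lambda>i. \<bar>Mk k i - c k\<bar>) <= sqrt (L powi -190)"
   using avg_abs_le_sqrt[OF m1, of "\<lambda>i. Mk k i - c k"] M_avg[OF k] real_sqrt_le_mono order_trans by blast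
  also have "sqrt (L powi -190) = L powi -95"
   by (rule real_sqrt_unique) (simp_all add: power2_eq_square powi_mult)
  finally show ?thesis .
 qed
 have R: "R i = Mk 1 i / Mk 0 i" for i using n1 by (simp add: R_def Mk_def wmean_def)
 have M0p: "Mk 0 i > 0" if "i \<in> {1..m}" for i using M0[OF that] powi_pos(1)[of "-1"] by linarith
 have R_avg: "avg m (\<lambda>i. \<bar>R i - \<gamma>\<bar>) <= L powi -92"
 proof -
  have "avg m (\<lambda>i. \<bar>R i - \<gamma>\<bar>) <= avg m (\<lambda>i. L * \<bar>Mk 1 i - c 1\<bar> + (L * L) * \<bar>Mk 0 i - c 0\<bar>)"
  proof (rule avg_mono)
   fix i assume i: "i \<in> {1..m}"
   have "R i - \<gamma> = ((Mk 1 i - c 1) - \<gamma> * (Mk 0 i - c 0)) / Mk 0 i"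
    unfolding R using M0p[OF i] \<gamma> by (simp add: field_simps)
   then have "\<bar>R i - \<gamma>\<bar> = \<bar>(Mk 1 i - c 1) - \<gamma> * (Mk 0 i - c 0)\<bar> * (1 / Mk 0 i)"
    using M0p[OF i] by (simp add: abs_divide)
   also have "\<dots> <= (\<bar>Mk 1 i - c 1\<bar> + L * \<bar>Mk 0 i - c 0\<bar>) * L"
   proof (rule mult_mono)
    have "\<bar>\<gamma> * (Mk 0 i - c 0)\<bar> <= L * \<bar>Mk 0 i - c 0\<bar>" unfolding abs_mult using \<gamma>L by (intro mult_right_mono) auto
    then show "\<bar>(Mk 1 i - c 1) - \<gamma> * (Mk 0 i - c 0)\<bar> <= \<bar>Mk 1 i - c 1\<bar> + L * \<bar>Mk 0 i - c 0\<bar>" by linarith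
    have "1 / Mk 0 i <= 1 / (1 / L)" using M0[OF i] by (intro divide_left_mono) (auto simp: inv_L[symmetric] M0p[OF i])
    then show "1 / Mk 0 i <= L" by simp
   qed (use M0p[OF i] in auto)
   finally show "\<bar>R i - \<gamma>\<bar> <= L * \<bar>Mk 1 i - c 1\<bar> + (L * L) * \<bar>Mk 0 i - c 0\<bar>" by (simp add: algebra_simps)
  qed
  also have "\<dots> = L * avg m (\<lambda>i. \<bar>Mk 1 i - c 1\<bar>) + (L * L) * avg m (\<lambda>i. \<bar>Mk 0 i - c 0\<bar>)"
   unfolding avg_add avg_cmult ..
  also have "\<dots> <= L * L powi -95 + (L * L) * L powi -95"
   using M_abs[of 0] M_abs[of 1] by (intro add_mono mult_left_mono) auto
  also have "\<dots> = L powi -94 + L powi -93"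
   using powi_mult[of 1 "-95"] powi_mult[of 2 "-95"] powi_mult[of 1 1] by simp
  also have "\<dots> <= L powi -92" using powi_10[of "-94" "-92"] powi_10[of "-93" "-92"] powi_pos(1)[of "-92"] by linarith
  finally show ?thesis .
 qed
 have ub_R: "i \<in> {1..m} ==> ub 1 (R i)" for i
  unfolding R_def ub_def using wmean_abs_le[OF n1, of "x i" L] x_bd by simp
 have ub_V: "ub 2 (wvar n (x i) b1)" if i: "i \<in> {1..m}" for i
 proof -
  have "wvar n (x i) b1 <= L\<^sup>2" using wvar_le[OF n1, of "x i" L] x_bd[OF i] by auto
  moreover have "L powi 2 = L\<^sup>2" by (simp add: power_int_def)
  ultimately show ?thesis using wvar_nonneg[OF n1, of "x i" b1] by (simp add: ub_def)
 qed
 have th: "\<theta> i = real n * (exp (u i) * Mk 0 i)" for i using n1 by (simp add: \<theta>_def Mk_def exp_add)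
 have th_pos: "i \<in> {1..m} ==> \<theta> i > 0" for i unfolding th using n1 M0p[of i] by simp
 have e_avg: "ub (-48) (avg m (\<lambda>i. exp (u i) * Mk k i) - exp (s / 2) * c k)" if k: "k \<in> {0, 1, 2}" for k
 proof -
  have e: "avg m (\<lambda>i. exp (u i) * Mk k i) - exp (s / 2) * c k
    = avg m (\<lambda>i. (exp (u i) - exp (s / 2)) * Mk k i) + exp (s / 2) * avg m (\<lambda>i. Mk k i - c k)"
  proof -
   have "avg m (\<lambda>i. exp (u i) * Mk k i) = avg m (\<lambda>i. (exp (u i) - exp (s / 2)) * Mk k i + exp (s / 2) * (Mk k i - c k) + exp (s / 2) * c k)"
    by (intro avg_cong) (simp add: algebra_simps)
   then show ?thesis by (simp only: avg_add avg_cmult avg_const[OF m1])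
  qed
  have "ub (-95) (avg m (\<lambda>i. Mk k i - c k))"
   using M_abs[OF k] abs_avg_le[of m "\<lambda>i. Mk k i - c k"] unfolding ub_def by linarith
  then have "ub (-94) (exp (s / 2) * avg m (\<lambda>i. Mk k i - c k))" by (rule ub_mult[OF ub_es]) simp
  then show ?thesis unfolding e using eM_avg[OF k] by (intro ub_add[of "-50"]) (auto simp: ub_def)
 qed
 have I_avg: "\<bar>avg m (\<lambda>i. Y i * wvar n (x i) b1) - real n * I\<bar> <= L powi 180"
 proof -
  have "avg m (\<lambda>i. Y i * wvar n (x i) b1) = avg m (\<lambda>i. real n * (exp (u i) * Mk 2 i - \<gamma> * (exp (u i) * Mk 1 i)
    - exp (u i) * ((R i - \<gamma>) * Mk 1 i) + exp (u i) * (Mk 0 i * (wvar n (x i) b1 * Z i))))"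
  proof (rule avg_cong)
   fix i assume i: "i \<in> {1..m}"
   \<comment> \<open>Multiplying the tilted variance by \<open>Mk 0 i\<close> removes the quotients
     except for one factor \<open>R i\<close>; replacing that by \<open>\<gamma>\<close> leaves
     averages linear in the \<open>Mk\<close>.\<close>
   have V: "Mk 0 i * wvar n (x i) b1 = Mk 2 i - R i * Mk 1 i"
   proof -
    have "wvar n (x i) b1 = Mk 2 i / Mk 0 i - (R i)\<^sup>2" using n1 by (simp add: wvar_def R_def Mk_def)
    then show ?thesis using M0p[OF i] unfolding R by (simp add: field_simps power2_eq_square)
   qed
   have "Y i = \<theta> i * (1 + Z i)" using th_pos[OF i] by (simp add: Z_def)
   then have "Y i * wvar n (x i) b1 = real n * (exp (u i) * (Mk 0 i * wvar n (x i) b1) + exp (u i) * (Mk 0 i * (wvar n (x i) b1 * Z i)))"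
    unfolding th by (simp add: algebra_simps)
   then show "Y i * wvar n (x i) b1 = real n * (exp (u i) * Mk 2 i - \<gamma> * (exp (u i) * Mk 1 i)
    - exp (u i) * ((R i - \<gamma>) * Mk 1 i) + exp (u i) * (Mk 0 i * (wvar n (x i) b1 * Z i)))"
    unfolding V by (simp add: algebra_simps)
  qed
  also have "\<dots> = real n * (avg m (\<lambda>i. exp (u i) * Mk 2 i) - \<gamma> * avg m (\<lambda>i. exp (u i) * Mk 1 i)
    - avg m (\<lambda>i. exp (u i) * ((R i - \<gamma>) * Mk 1 i)) + avg m (\<lambda>i. exp (u i) * (Mk 0 i * (wvar n (x i) b1 * Z i))))"
   unfolding avg_cmult avg_add avg_diff ..
  finally have e: "avg m (\<lambda>i. Y i * wvar n (x i) b1) - real n * I = real n *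
   (((avg m (\<lambda>i. exp (u i) * Mk 2 i) - exp (s / 2) * c 2) - \<gamma> * (avg m (\<lambda>i. exp (u i) * Mk 1 i) - exp (s / 2) * c 1))
    - avg m (\<lambda>i. exp (u i) * ((R i - \<gamma>) * Mk 1 i)) + avg m (\<lambda>i. exp (u i) * (Mk 0 i * (wvar n (x i) b1 * Z i))))"
   unfolding Ic by (simp add: algebra_simps)
  have 1: "ub (-46) ((avg m (\<lambda>i. exp (u i) * Mk 2 i) - exp (s / 2) * c 2) - \<gamma> * (avg m (\<lambda>i. exp (u i) * Mk 1 i) - exp (s / 2) * c 1))"
   by (rule ub_diff[OF e_avg[of 2] ub_mult[OF ub_g e_avg[of 1], of "-47"]]) auto
  have 2: "ub (-89) (avg m (\<lambda>i. exp (u i) * ((R i - \<gamma>) * Mk 1 i)))"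
  proof -
   have "\<bar>avg m (\<lambda>i. exp (u i) * ((R i - \<gamma>) * Mk 1 i))\<bar> <= avg m (\<lambda>i. L powi 3 * \<bar>R i - \<gamma>\<bar>)"
   proof (rule order_trans[OF abs_avg_le avg_mono])
    fix i assume i: "i \<in> {1..m}"
    have "ub 3 (exp (u i) * Mk 1 i)" by (rule ub_mult[OF ub_eu[OF i] ub_Mk[OF i]]) simp
    then have "\<bar>exp (u i) * Mk 1 i\<bar> * \<bar>R i - \<gamma>\<bar> <= L powi 3 * \<bar>R i - \<gamma>\<bar>" unfolding ub_def by (intro mult_right_mono) auto
    then show "\<bar>exp (u i) * ((R i - \<gamma>) * Mk 1 i)\<bar> <= L powi 3 * \<bar>R i - \<gamma>\<bar>" by (simp add: abs_mult mult_ac)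
   qed
   also have "\<dots> <= L powi 3 * L powi -92" unfolding avg_cmult using R_avg by (intro mult_left_mono) auto
   finally show ?thesis by (simp add: ub_def powi_mult)
  qed
  have 3: "ub (-92) (avg m (\<lambda>i. exp (u i) * (Mk 0 i * (wvar n (x i) b1 * Z i))))"
  proof (rule ub_avg[OF m1])
   fix i assume i: "i \<in> {1..m}"
   have "ub (-95) (wvar n (x i) b1 * Z i)" by (rule ub_mult[OF ub_V[OF i], of "-97"]) (use Z_bd[OF i] in \<open>auto simp: ub_def\<close>)
   then have "ub (-94) (Mk 0 i * (wvar n (x i) b1 * Z i))" by (rule ub_mult[OF ub_Mk[OF i]]) simp
   then show "ub (-92) (exp (u i) * (Mk 0 i * (wvar n (x i) b1 * Z i)))" by (rule ub_mult[OF ub_eu[OF i]]) simp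
  qed
  have "ub (-44) (((avg m (\<lambda>i. exp (u i) * Mk 2 i) - exp (s / 2) * c 2) - \<gamma> * (avg m (\<lambda>i. exp (u i) * Mk 1 i) - exp (s / 2) * c 1))
    - avg m (\<lambda>i. exp (u i) * ((R i - \<gamma>) * Mk 1 i)) + avg m (\<lambda>i. exp (u i) * (Mk 0 i * (wvar n (x i) b1 * Z i))))"
   by (rule ub_add[OF ub_diff[OF 1 2, of "-45"] 3]) auto
  then have "ub 180 (avg m (\<lambda>i. Y i * wvar n (x i) b1) - real n * I)"
   unfolding e by (rule ub_mult[rotated, of "-44" _ 200]) (auto simp: ub_def nL)
  then show ?thesis by (simp add: ub_def)
 qed
 have R90: "avg m (\<lambda>i. \<bar>R i - \<gamma>\<bar>) <= L powi -90" using R_avg powi_mono[of "-92" "-90"] by linarith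
 show "good_data L m n b0 b1 s \<gamma> I q x u y"
  by unfold_locales
    (insert m1 nL q s0 I x_bd ex_bd u_bd eu_bd Z_bd R90 u_avg u2_avg uw_avg Zw_avg Z_avg uZ_avg Z2_avg uZ2_avg
     st1 st2 S_avg I_avg, unfold Y_def \<theta>_def Z_def R_def, (assumption | blast)+)
 show "separated m n x y"
 proof (rule ccontr)
  assume "\<not> separated m n x y"
  define T where "T = (\<lambda>k. avg m (\<lambda>i. (\<Sum>j=1..n. x i j ^ k * real (y i j)) / real n))"
  have T: "T k = (\<Sum>i=1..m. \<Sum>j=1..n. x i j ^ k * real (y i j)) / (real n * real m)" for k
   by (simp add: T_def avg_def sum_divide_distrib[symmetric])
  have TT: "T 0 * T 2 = (T 1)\<^sup>2"
   using not_separated_moments[OF \<open>\<not> separated m n x y\<close>] unfolding T by (simp add: power2_eq_square)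
  have T_lim: "ub (-46) (T k - exp (s / 2) * c k)" if k: "k \<in> {0, 1, 2}" for k
  proof -
   have "T k = avg m (\<lambda>i. (\<Sum>j=1..n. x i j ^ k * (real (y i j) - exp (b0 + b1 * x i j + u i))) / real n + exp (u i) * Mk k i)"
    unfolding T_def
   proof (rule avg_cong)
    fix i
    have "exp (u i) * Mk k i = (\<Sum>j=1..n. x i j ^ k * exp (b0 + b1 * x i j + u i)) / real n"
     unfolding Mk by (simp add: sum_distrib_left exp_add mult_ac)
    then show "(\<Sum>j=1..n. x i j ^ k * real (y i j)) / real n =
      (\<Sum>j=1..n. x i j ^ k * (real (y i j) - exp (b0 + b1 * x i j + u i))) / real n + exp (u i) * Mk k i"
     by (simp add: right_diff_distrib sum_subtractf diff_divide_distrib)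
   qed
   then have e: "T k - exp (s / 2) * c k = avg m (\<lambda>i. (\<Sum>j=1..n. x i j ^ k * (real (y i j) - exp (b0 + b1 * x i j + u i))) / real n)
     + (avg m (\<lambda>i. exp (u i) * Mk k i) - exp (s / 2) * c k)" by (simp add: avg_add)
   show ?thesis unfolding e using T_avg[OF k] e_avg[OF k] by (intro ub_add[of "-50" _ "-48"]) (auto simp: ub_def)
  qed
  define C where "C = (\<lambda>k. exp (s / 2) * c k)"
  have ubC: "ub 2 (C k)" if "k \<in> {0, 1, 2}" for k
   unfolding C_def by (rule ub_mult[OF ub_es, of 1]) (use cL[OF that] in \<open>auto simp: ub_def\<close>)
  have ubT: "ub 3 (T k)" if "k \<in> {0, 1, 2}" for k
   using ub_add[OF T_lim[OF that] ubC[OF that], of 3] by (simp add: C_def)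
  have e: "C 0 * C 2 - (C 1)\<^sup>2 = (C 1 - T 1) * (- (C 1 + T 1)) + (T 0 * (C 2 - T 2) + (C 0 - T 0) * C 2)"
   using TT by (simp add: power2_eq_square algebra_simps)
  have TC: "ub (-46) (C k - T k)" if "k \<in> {0, 1, 2}" for k
   using T_lim[OF that] unfolding C_def ub_def by (simp add: abs_minus_commute)
  have 0: "ub 4 (- (C 1 + T 1))" unfolding ub_minus by (rule ub_add[OF ubC ubT]) auto
  have 1: "ub (-42) ((C 1 - T 1) * (- (C 1 + T 1)))" by (rule ub_mult[OF TC[of 1] 0]) auto
  have 2: "ub (-42) (T 0 * (C 2 - T 2) + (C 0 - T 0) * C 2)"
   by (rule ub_add[OF ub_mult[OF ubT[of 0] TC[of 2], of "-43"] ub_mult[OF TC[of 0] ubC[of 2], of "-44"]]) auto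
  have "ub (-41) (C 0 * C 2 - (C 1)\<^sup>2)" unfolding e by (rule ub_add[OF 1 2]) auto
  \<comment> \<open>The Cauchy-Schwarz gap of the population moments. It is at least L^-2, while on
    unseparated data it would be at most L^-41.\<close>
  moreover have "C 0 * C 2 - (C 1)\<^sup>2 = exp (s / 2) * (c 0 * I)"
   unfolding C_def Ic using \<gamma> by (simp add: power2_eq_square algebra_simps)
  moreover have "L powi -2 <= c 0 * I" using c0 I(1) unfolding inv_L by (intro powi_le_mult[of "-1" _ "-1"]) auto
  moreover have "1 <= exp (s / 2)" using es by simp
  then have "1 * (c 0 * I) <= exp (s / 2) * (c 0 * I)"
   using \<open>L powi -2 <= c 0 * I\<close> powi_pos(1)[of "-2"] by (intro mult_right_mono) linarith+
  ultimately show False using powi_10[of "-41" "-2"] powi_pos(1)[of "-41"] unfolding ub_def by linarith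
 qed
qed

section \<open>Truncated weights\<close>

context simple_poisson_mixed_model
begin

definition tamed_X :: "real => (nat \<times> nat => real) => bool" where
 "tamed_X L z \<longleftrightarrow> (\<forall>k\<in>Ix. \<bar>z k\<bar> <= L \<and> 1 / L <= exp (b0 + b1 * z k) \<and> exp (b0 + b1 * z k) <= L)"

lemma tamed_imp_X: "tamed L pt ==> tamed_X L (Xv pt)"
 by (simp add: tamed_def tamed_X_def)

lemma tamed_X_measurable: "{z \<in> space (PiM Ix (\<lambda>_. borel)). tamed_X L z} \<in> sets (PiM Ix (\<lambda>_. borel))"
 unfolding tamed_X_def
proof (intro sets.sets_Collect_finite_All finite_Ix)
 fix k assume "k \<in> Ix"
 then have [measurable]: "(\<lambda>z. z k) \<in> borel_measurable (PiM Ix (\<lambda>_. borel))" by (rule measurable_component_singleton)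
 show "{z \<in> space (PiM Ix (\<lambda>_. borel)). \<bar>z k\<bar> <= L \<and> 1 / L <= exp (b0 + b1 * z k) \<and> exp (b0 + b1 * z k) <= L} \<in> sets (PiM Ix (\<lambda>_. borel))"
  by measurable
qed

lemma wsum_PiM: "i \<in> {1..m} ==> (\<lambda>z. wsum n (\<lambda>j. z (i, j)) k b) \<in> borel_measurable (PiM Ix (\<lambda>_. borel))"
proof -
 assume i: "i \<in> {1..m}"
 have "(\<lambda>z. z (i, j) ^ k * exp (b * z (i, j))) \<in> borel_measurable (PiM Ix (\<lambda>_. borel))" if "j \<in> {1..n}" for j
 proof -
  have [measurable]: "(\<lambda>z. z (i, j)) \<in> borel_measurable (PiM Ix (\<lambda>_. borel))"
   using i that by (intro measurable_component_singleton) (auto simp: Ix_def)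
  show ?thesis by measurable
 qed
 then show ?thesis unfolding wsum_def by (intro borel_measurable_sum) auto
qed

lemma truncated_measurable:
 assumes "g \<in> borel_measurable (PiM Ix (\<lambda>_. borel))"
 shows "(\<lambda>z. if tamed_X L z then g z else (0::real)) \<in> borel_measurable (PiM Ix (\<lambda>_. borel))"
 using assms tamed_X_measurable by (intro measurable_If) (auto simp: pred_def)

lemma wsum_Xv: "i \<in> {1..m} ==> wsum n (\<lambda>j. Xv pt (i, j)) k b = wsum n (\<lambda>j. X i j pt) k b"
 unfolding wsum_def by (intro sum.cong refl) (simp add: Xv_eq)

lemma wsum_F: "i \<in> {1..m} ==> (\<lambda>pt. wsum n (\<lambda>j. X i j pt) k b) \<in> borel_measurable F"
proof -
 assume i: "i \<in> {1..m}"
 have "(\<lambda>pt. X i j pt ^ k * exp (b * X i j pt)) \<in> borel_measurable F" if "j \<in> {1..n}" for j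
 proof -
  note [measurable] = X_F[OF i that]
  show ?thesis by measurable
 qed
 then show ?thesis unfolding wsum_def by (intro borel_measurable_sum) auto
qed

lemma wmean_F: "i \<in> {1..m} ==> (\<lambda>pt. wmean n (\<lambda>j. X i j pt) b) \<in> borel_measurable F"
 unfolding wmean_def by (intro borel_measurable_divide wsum_F)

lemma avg_F: "(\<And>i. i \<in> {1..m} ==> (\<lambda>pt. g i pt) \<in> borel_measurable F) ==> (\<lambda>pt. avg m (\<lambda>i. g i pt)) \<in> borel_measurable F"
 unfolding avg_def by (intro borel_measurable_divide borel_measurable_sum) auto

lemma sum_Ix: "(\<Sum>k\<in>Ix. g k) = (\<Sum>i=1..m. \<Sum>j=1..n. g (i, j))"
 unfolding Ix_def using sum.cartesian_product[of "\<lambda>i j. g (i, j)" "{1..n}" "{1..m}"] by simp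

text \<open>Chebyshev's inequality wants weights bounded everywhere, but \<open>G i\<close> is
  bounded on tamed predictors only. Setting it to 0 elsewhere keeps it a function of the predictors,
  so independence from the intercepts survives, and changes nothing on the tamed event.\<close>

lemma U_event:
 fixes f :: "real => real"
 assumes m1: "m >= 1" and f: "f \<in> borel_measurable borel"
  "integrable lborel (\<lambda>x. normal_density 0 (sqrt s) x * (f x)\<^sup>2)"
  "(\<integral>x. normal_density 0 (sqrt s) x * (f x)\<^sup>2 \<partial>lborel) <= v"
  "(\<integral>x. normal_density 0 (sqrt s) x * f x \<partial>lborel) = 0"
  and G: "\<And>i. i \<in> {1..m} ==> G i \<in> borel_measurable (PiM Ix (\<lambda>_. borel))"
  and c: "\<And>i z. i \<in> {1..m} ==> tamed_X L z ==> \<bar>G i z\<bar> <= c" and c0: "c >= 0" and a: "a > 0"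
  and g: "\<And>pt i. tamed L pt ==> i \<in> {1..m} ==> h pt i = f (U i pt) * G i (Xv pt)"
  and p: "c\<^sup>2 * v / (real m * a\<^sup>2) <= p"
 shows "unlikely p (\<lambda>pt. tamed L pt \<and> a < \<bar>avg m (h pt)\<bar>)"
proof -
 let ?G = "\<lambda>i z. if tamed_X L z then G i z else 0"
 have "unlikely p (\<lambda>pt. a < \<bar>avg m (\<lambda>i. f (U i pt) * ?G i (Xv pt))\<bar>)"
 proof (rule unlikelyI)
  have Gm: "?G i \<in> borel_measurable (PiM Ix (\<lambda>_. borel))" if "i \<in> {1..m}" for i
   by (rule truncated_measurable[OF G[OF that]])
  have "prob {pt \<in> space M. a < \<bar>avg m (\<lambda>i. f (U i pt) * ?G i (Xv pt))\<bar>} <= c\<^sup>2 * v / (real m * a\<^sup>2)"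
   by (rule U_avg_bound[OF m1 f Gm _ a]) (use c c0 in auto)
  then show "prob {pt \<in> space M. a < \<bar>avg m (\<lambda>i. f (U i pt) * ?G i (Xv pt))\<bar>} <= p" using p by linarith
  have "(\<lambda>pt. avg m (\<lambda>i. f (U i pt) * ?G i (Xv pt))) \<in> borel_measurable M"
   unfolding avg_def
   by (intro borel_measurable_divide borel_measurable_sum borel_measurable_times borel_measurable_const)
     (auto intro!: measurable_compose[OF U_M f(1)] measurable_compose[OF Xv_measurable Gm])
  then show "{pt \<in> space M. a < \<bar>avg m (\<lambda>i. f (U i pt) * ?G i (Xv pt))\<bar>} \<in> events" by measurable
 qed
 then show ?thesis
 proof (rule unlikely_mono)
  fix pt assume w: "tamed L pt \<and> a < \<bar>avg m (h pt)\<bar>"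
  have "avg m (h pt) = avg m (\<lambda>i. f (U i pt) * ?G i (Xv pt))"
   using w by (intro avg_cong) (auto simp: g tamed_imp_X)
  then show "a < \<bar>avg m (\<lambda>i. f (U i pt) * ?G i (Xv pt))\<bar>" using w by simp
 qed simp
qed

lemma linear_event:
 assumes ne: "m >= 1" "n >= 1" and c: "\<And>i j. i \<in> {1..m} ==> j \<in> {1..n} ==> (\<lambda>pt. c pt (i, j)) \<in> borel_measurable F"
  and v: "\<And>pt. tamed L pt ==> (\<Sum>i=1..m. \<Sum>j=1..n. (c pt (i, j))\<^sup>2 * rate pt (i, j)) <= v" and a: "a > 0" and v0: "v >= 0"
  and h: "\<And>pt. tamed L pt ==> h pt = (\<Sum>i=1..m. \<Sum>j=1..n. c pt (i, j) * (real (Y i j pt) - rate pt (i, j)))"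
  and p: "v / a\<^sup>2 <= p"
 shows "unlikely p (\<lambda>pt. tamed L pt \<and> a < \<bar>h pt\<bar>)"
proof (rule unlikely_mono[OF linear_noise[OF ne, of c L v a] p])
 show "(\<lambda>pt. c pt k) \<in> borel_measurable F" if "k \<in> Ix" for k using c that by (auto simp: Ix_def)
 show "(\<Sum>k\<in>Ix. (c pt k)\<^sup>2 * rate pt k) <= v" if "tamed L pt" for pt using v[OF that] by (simp add: sum_Ix)
 fix pt assume w: "tamed L pt \<and> a < \<bar>h pt\<bar>"
 have "h pt = (\<Sum>k\<in>Ix. c pt k * (real (YY pt k) - rate pt k))"
  using w unfolding sum_Ix by (simp add: h) (intro sum.cong refl, simp add: YY_eq)
 then show "tamed L pt \<and> a < \<bar>\<Sum>k\<in>Ix. c pt k * (real (YY pt k) - rate pt k)\<bar>" using w by simp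
qed (use a v0 in auto)

end

text \<open>The estimates for one fixed n. Limits enter only later, through \<open>L\<close>,
  \<open>pX\<close> and \<open>pU\<close>, with \<open>V\<close> a common bound for finitely many
  second moments. \<open>c k\<close>, \<open>\<gamma>\<close> and \<open>I\<close> are the
  population counterparts of the averages in \<open>good_dataI\<close>; the five functions in
  \<open>fi\<close> are the centred functions of an intercept whose averages must be small.\<close>

locale scaled_model = simple_poisson_mixed_model M m n X U Y D b0 b1 s + scale L
 for M :: "'a measure" and m n :: nat and X :: "nat => nat => 'a => real" and U :: "nat => 'a => real"
  and Y :: "nat => nat => 'a => nat" and D :: "real measure" and b0 b1 s L :: real +
 fixes V I \<gamma> pX pU :: real and c :: "nat => real"
 assumes nL: "real n = L powi 200" and mn: "m >= n"
  and s0: "1 / L <= s" "s <= L" and s_pos: "s > 0" and es: "exp (s / 2) <= L" and I: "1 / L <= I" "I <= L"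
  and c0: "1 / L <= c 0" and cL: "\<And>k. k \<in> {0, 1, 2} ==> \<bar>c k\<bar> <= L"
  and \<gamma>L: "\<bar>\<gamma>\<bar> <= L" and \<gamma>: "c 1 = \<gamma> * c 0" and Ic: "I = exp (s / 2) * (c 2 - \<gamma> * c 1)"
  and gi: "\<And>k. k \<in> {0, 1, 2} ==> integrable D (\<lambda>x. (x ^ k * exp (b0 + b1 * x))\<^sup>2)"
  and gV: "\<And>k. k \<in> {0, 1, 2} ==> integral\<^sup>L D (\<lambda>x. (x ^ k * exp (b0 + b1 * x))\<^sup>2) <= V"
  and gc: "\<And>k. k \<in> {0, 1, 2} ==> integral\<^sup>L D (\<lambda>x. x ^ k * exp (b0 + b1 * x)) = c k"
  and fi: "\<And>f. f \<in> {\<lambda>x. x, \<lambda>x. x\<^sup>2 - s, \<lambda>x. exp x - exp (s / 2), \<lambda>x. exp (- x) * (1 + x / s), \<lambda>x. exp (- x) * (1 - x - x\<^sup>2 / s)} ==>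
    integrable lborel (\<lambda>x. normal_density 0 (sqrt s) x * (f x)\<^sup>2)
    \<and> (\<integral>x. normal_density 0 (sqrt s) x * (f x)\<^sup>2 \<partial>lborel) <= V
    \<and> (\<integral>x. normal_density 0 (sqrt s) x * f x \<partial>lborel) = 0"
  and pX: "measure D {x. \<not> (\<bar>x\<bar> <= L \<and> 1 / L <= exp (b0 + b1 * x) \<and> exp (b0 + b1 * x) <= L)} <= pX"
  and pU: "(\<integral>x. normal_density 0 (sqrt s) x * indicator {x. \<not> (\<bar>x\<bar> <= L \<and> 1 / L <= exp x \<and> exp x <= L)} x \<partial>lborel) <= pU"
begin

abbreviation q :: real where "q \<equiv> 1 / sqrt (real m)"

lemma n1: "n >= 1" using nL powi_pos(1)[of 200] by (cases n) auto

lemma m1: "m >= 1" using n1 mn by simp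

lemma ne: "m >= 1" "n >= 1" using n1 m1 by auto

lemma inv_L: "1 / L = L powi -1" by (simp add: power_int_minus divide_inverse)

lemma m_ge: "L powi 200 <= real m" using nL mn by simp

lemma m_pos: "real m > 0" using m1 by simp

lemma q_pos: "q > 0" using m1 by simp

lemma q_sq: "q\<^sup>2 = 1 / real m" using m1 by (simp add: power_divide)

lemma q_le: "q <= L powi -100"
proof -
 have "(L powi 100)\<^sup>2 <= real m" using m_ge by (simp add: power2_eq_square powi_mult)
 then have "L powi 100 <= sqrt (real m)" by (intro real_le_rsqrt) simp
 then have "1 / sqrt (real m) <= 1 / L powi 100" using m_pos by (intro divide_left_mono) (auto intro!: mult_pos_pos)
 then show ?thesis using powi_div[of 0 100] by simp
qed

lemma V_pos: "V >= 0"
proof -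
 have "0 <= integral\<^sup>L D (\<lambda>x. (x ^ 0 * exp (b0 + b1 * x))\<^sup>2)" by simp
 then show ?thesis by (rule order_trans[OF _ gV[of 0]]) simp
qed

text \<open>Each bad event has probability at most V or 1 times a negative power of
  \<open>L\<close>; this brings them all to one common bound so that they can be counted.\<close>

lemma small: "e <= -1 ==> V * L powi e <= (V + 1) / L" "e <= -1 ==> L powi e <= (V + 1) / L"
proof -
 assume e: "e <= -1"
 have l: "L powi e <= 1 / L" unfolding inv_L using e by (rule powi_mono)
 then have "V * L powi e <= V * (1 / L)" using V_pos by (intro mult_left_mono)
 also have "\<dots> <= (V + 1) * (1 / L)" by (intro mult_right_mono) auto
 finally show "V * L powi e <= (V + 1) / L" by simp
 have "1 * (1 / L) <= (V + 1) * (1 / L)" using V_pos by (intro mult_right_mono) auto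
 then show "L powi e <= (V + 1) / L" using l by simp
qed

lemma div_m: "a >= 0 ==> a / real m <= a * L powi -200"
proof -
 assume a: "a >= 0"
 have "a / real m <= a / L powi 200" using m_ge a m_pos by (intro divide_left_mono) (auto intro!: mult_pos_pos)
 then show ?thesis using powi_div[of 0 200] by (simp add: divide_inverse)
qed

lemma tamedD:
 assumes "tamed L pt"
 shows "i \<in> {1..m} ==> j \<in> {1..n} ==> \<bar>X i j pt\<bar> <= L"
  and "i \<in> {1..m} ==> j \<in> {1..n} ==> 1 / L <= exp (b0 + b1 * X i j pt) \<and> exp (b0 + b1 * X i j pt) <= L"
  and "i \<in> {1..m} ==> \<bar>U i pt\<bar> <= L" "i \<in> {1..m} ==> 1 / L <= exp (U i pt) \<and> exp (U i pt) <= L"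
proof -
 assume "i \<in> {1..m}" "j \<in> {1..n}"
 then have "(i, j) \<in> Ix" "Xv pt (i, j) = X i j pt" by (auto simp: Ix_def Xv_eq)
 then show "\<bar>X i j pt\<bar> <= L" "1 / L <= exp (b0 + b1 * X i j pt) \<and> exp (b0 + b1 * X i j pt) <= L"
  using assms unfolding tamed_def by metis+
next
 assume "i \<in> {1..m}"
 then show "\<bar>U i pt\<bar> <= L" "1 / L <= exp (U i pt) \<and> exp (U i pt) <= L"
  using assms unfolding tamed_def by blast+
qed

lemma wsum_tamed:
 assumes z: "tamed_X L z" and i: "i \<in> {1..m}"
 shows "L powi 199 <= exp b0 * wsum n (\<lambda>j. z (i, j)) 0 b1"
  and "k \<in> {0, 1, 2} ==> \<bar>exp b0 * wsum n (\<lambda>j. z (i, j)) k b1 / real n\<bar> <= L powi 3"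
  and "\<bar>wmean n (\<lambda>j. z (i, j)) b\<bar> <= L"
proof -
 have zb: "\<bar>z (i, j)\<bar> <= L" "1 / L <= exp (b0 + b1 * z (i, j))" "exp (b0 + b1 * z (i, j)) <= L" if "j \<in> {1..n}" for j
  using z i that by (auto simp: tamed_X_def Ix_def)
 have e: "exp b0 * wsum n (\<lambda>j. z (i, j)) k b1 = (\<Sum>j=1..n. z (i, j) ^ k * exp (b0 + b1 * z (i, j)))" for k
  by (simp add: wsum_def sum_distrib_left exp_add mult_ac)
 have "(\<Sum>j=1..n. 1 / L) <= exp b0 * wsum n (\<lambda>j. z (i, j)) 0 b1"
  unfolding e using zb(2) by (intro sum_mono) auto
 moreover have "(\<Sum>j=1..n. 1 / L) = L powi 200 * L powi -1" by (simp only: inv_L sum_constant) (simp add: nL)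
 ultimately show "L powi 199 <= exp b0 * wsum n (\<lambda>j. z (i, j)) 0 b1" by (simp add: powi_mult)
 show "\<bar>wmean n (\<lambda>j. z (i, j)) b\<bar> <= L" by (rule wmean_abs_le[OF n1]) (use zb in auto)
 assume k: "k \<in> {0, 1, 2}"
 have "\<bar>exp b0 * wsum n (\<lambda>j. z (i, j)) k b1\<bar> <= (\<Sum>j=1..n. L\<^sup>2 * L)"
  unfolding e
 proof (rule order_trans[OF sum_abs sum_mono])
  fix j assume j: "j \<in> {1..n}"
  have "\<bar>z (i, j) ^ k\<bar> <= L ^ k" unfolding power_abs using zb(1)[OF j] by (intro power_mono) auto
  also have "L ^ k <= L\<^sup>2" using k by (intro power_increasing) auto
  finally show "\<bar>z (i, j) ^ k * exp (b0 + b1 * z (i, j))\<bar> <= L\<^sup>2 * L"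
   unfolding abs_mult using zb(3)[OF j] by (intro mult_mono) auto
 qed
 also have "\<dots> = real n * L powi 3" by (simp add: power_int_def power2_eq_square power3_eq_cube)
 finally show "\<bar>exp b0 * wsum n (\<lambda>j. z (i, j)) k b1 / real n\<bar> <= L powi 3"
  using n1 by (simp add: abs_divide field_simps)
qed

lemma grp_tamed:
 assumes w: "tamed L pt" and i: "i \<in> {1..m}"
 shows "L powi 198 <= grp pt i" "grp pt i <= L powi 202" "grp pt i > 0"
proof -
 have e: "grp pt i = (exp b0 * wsum n (\<lambda>j. X i j pt) 0 b1) * exp (U i pt)" by (simp add: grp_def exp_add)
 have l: "L powi 199 <= exp b0 * wsum n (\<lambda>j. X i j pt) 0 b1"
  using wsum_tamed(1)[OF tamed_imp_X[OF w] i] i by (simp add: wsum_Xv)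
 have "L powi -1 <= exp (U i pt)" using tamedD(4)[OF w i] by (simp only: inv_L)
 then show g: "L powi 198 <= grp pt i" unfolding e by (rule powi_le_mult[OF l]) simp
 then show "grp pt i > 0" using powi_pos(1)[of 198] by linarith
 have "exp b0 * wsum n (\<lambda>j. X i j pt) 0 b1 = (\<Sum>j=1..n. exp (b0 + b1 * X i j pt))"
  by (simp add: wsum_def sum_distrib_left exp_add)
 also have "\<dots> <= (\<Sum>j=1..n. L)" using tamedD(2)[OF w i] by (intro sum_mono) auto
 finally have "exp b0 * wsum n (\<lambda>j. X i j pt) 0 b1 <= L powi 201" using powi_mult[of 200 1] nL by simp
 then have "grp pt i <= L powi 201 * L powi 1" unfolding e using tamedD(4)[OF w i] powi_pos(1)[of 199] l
  by (intro mult_mono) auto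
 then show "grp pt i <= L powi 202" by (simp only: powi_mult) simp
qed

section \<open>The individual bad events\<close>

lemma event_M: "k \<in> {0, 1, 2} ==>
 unlikely ((V + 1) / L) (\<lambda>pt. L powi -190 < avg m (\<lambda>i. (exp b0 * wsum n (\<lambda>j. X i j pt) k b1 / real n - c k)\<^sup>2))"
proof (rule unlikelyI)
 assume k: "k \<in> {0, 1, 2}"
 let ?g = "\<lambda>x. x ^ k * exp (b0 + b1 * x)"
 have e: "exp b0 * wsum n (\<lambda>j. X i j pt) k b1 = (\<Sum>j=1..n. ?g (X i j pt))" for i pt
  by (simp add: wsum_def sum_distrib_left exp_add mult_ac)
 have "prob {pt \<in> space M. L powi -190 < avg m (\<lambda>i. ((\<Sum>j=1..n. ?g (X i j pt)) / real n - integral\<^sup>L D ?g)\<^sup>2)} <= V / (real n * L powi -190)"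
  by (rule X_avg_bound[OF ne _ gi[OF k] gV[OF k]]) auto
 also have "\<dots> = V * L powi -10" unfolding nL using powi_div[of 0 10] by (simp add: powi_mult divide_inverse)
 also have "\<dots> <= (V + 1) / L" by (rule small) simp
 finally show "prob {pt \<in> space M. L powi -190 < avg m (\<lambda>i. (exp b0 * wsum n (\<lambda>j. X i j pt) k b1 / real n - c k)\<^sup>2)} <= (V + 1) / L"
  unfolding e gc[OF k] .
 have "(\<lambda>pt. avg m (\<lambda>i. (exp b0 * wsum n (\<lambda>j. X i j pt) k b1 / real n - c k)\<^sup>2)) \<in> borel_measurable M"
  by (intro F_M avg_F borel_measurable_power borel_measurable_diff borel_measurable_divide borel_measurable_times wsum_F) auto
 then show "{pt \<in> space M. L powi -190 < avg m (\<lambda>i. (exp b0 * wsum n (\<lambda>j. X i j pt) k b1 / real n - c k)\<^sup>2)} \<in> events"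
  by measurable
qed

text \<open>With weights up to \<open>L powi e\<close> the average has standard deviation at most q
  L^e times the square root of \<open>V\<close>. A threshold on the scale \<open>q\<close> thus
  needs \<open>e < d\<close>; an absolute threshold gains L^100 from
  \<open>q <= L powi -100\<close>.\<close>

lemma U_event':
 assumes f: "f \<in> {\<lambda>x. x, \<lambda>x. x\<^sup>2 - s, \<lambda>x. exp x - exp (s / 2), \<lambda>x. exp (- x) * (1 + x / s), \<lambda>x. exp (- x) * (1 - x - x\<^sup>2 / s)}"
  and G: "\<And>i. i \<in> {1..m} ==> G i \<in> borel_measurable (PiM Ix (\<lambda>_. borel))"
  and c: "\<And>i z. i \<in> {1..m} ==> tamed_X L z ==> \<bar>G i z\<bar> <= L powi e"
  and g: "\<And>pt i. tamed L pt ==> i \<in> {1..m} ==> h pt i = f (U i pt) * G i (Xv pt)"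
 shows "e < d ==> unlikely ((V + 1) / L) (\<lambda>pt. tamed L pt \<and> q * L powi d < \<bar>avg m (h pt)\<bar>)"
  and "e < d + 100 ==> unlikely ((V + 1) / L) (\<lambda>pt. tamed L pt \<and> L powi d < \<bar>avg m (h pt)\<bar>)"
proof -
 have fb: "f \<in> borel_measurable borel" using f by auto
 note U = U_event[OF m1 fb fi[OF f, THEN conjunct1] fi[OF f, THEN conjunct2, THEN conjunct1] fi[OF f, THEN conjunct2, THEN conjunct2] G c powi_pos(2) _ g]
 {
  assume "e < d"
  have "(L powi e)\<^sup>2 * V / (real m * (q * L powi d)\<^sup>2) = V * ((L powi e)\<^sup>2 / (L powi d)\<^sup>2)"
   using m1 by (simp add: power_mult_distrib q_sq power_divide)
  also have "(L powi e)\<^sup>2 / (L powi d)\<^sup>2 = L powi (2 * e - 2 * d)"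
   by (simp add: power2_eq_square powi_mult powi_div)
  also have "V * \<dots> <= (V + 1) / L" using \<open>e < d\<close> by (intro small) auto
  finally show "unlikely ((V + 1) / L) (\<lambda>pt. tamed L pt \<and> q * L powi d < \<bar>avg m (h pt)\<bar>)"
   using q_pos by (intro U) auto
 next
  assume "e < d + 100"
  have "(L powi e)\<^sup>2 * V / (real m * (L powi d)\<^sup>2) = V * ((L powi e)\<^sup>2 / (L powi d)\<^sup>2) / real m"
   using m1 by (simp add: mult.commute)
  also have "\<dots> <= V * ((L powi e)\<^sup>2 / (L powi d)\<^sup>2) * L powi -200" using V_pos by (intro div_m) auto
  also have "\<dots> = V * L powi (2 * e - 2 * d - 200)"
   by (simp add: power2_eq_square powi_mult powi_div algebra_simps)
  also have "\<dots> <= (V + 1) / L" using \<open>e < d + 100\<close> by (intro small) auto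
  finally show "unlikely ((V + 1) / L) (\<lambda>pt. tamed L pt \<and> L powi d < \<bar>avg m (h pt)\<bar>)"
   by (intro U) auto
 }
qed

lemma event_u: "unlikely ((V + 1) / L) (\<lambda>pt. tamed L pt \<and> q * L powi 1 < \<bar>avg m (\<lambda>i. U i pt)\<bar>)"
 by (rule U_event'(1)[of "\<lambda>x. x" "\<lambda>i z. 1" 0]) auto

lemma event_u2: "unlikely ((V + 1) / L) (\<lambda>pt. tamed L pt \<and> q * L powi 1 < \<bar>avg m (\<lambda>i. (U i pt)\<^sup>2 - s)\<bar>)"
 by (rule U_event'(1)[of "\<lambda>x. x\<^sup>2 - s" "\<lambda>i z. 1" 0]) auto

lemma event_eM: "k \<in> {0, 1, 2} ==> unlikely ((V + 1) / L) (\<lambda>pt. tamed L pt \<and>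
  L powi -50 < \<bar>avg m (\<lambda>i. (exp (U i pt) - exp (s / 2)) * (exp b0 * wsum n (\<lambda>j. X i j pt) k b1 / real n))\<bar>)"
 by (rule U_event'(2)[of "\<lambda>x. exp x - exp (s / 2)" "\<lambda>i z. exp b0 * wsum n (\<lambda>j. z (i, j)) k b1 / real n" 3])
   (auto simp: wsum_Xv wsum_tamed(2) simp del: abs_divide intro!: borel_measurable_divide borel_measurable_times wsum_PiM)

lemma inv_wsum_tamed:
 assumes z: "tamed_X L z" and i: "i \<in> {1..m}"
 shows "\<bar>1 / (exp b0 * wsum n (\<lambda>j. z (i, j)) 0 b1)\<bar> <= L powi -199"
proof -
 have "ub (-199) (1 / (exp b0 * wsum n (\<lambda>j. z (i, j)) 0 b1))"
  by (rule ub_inverse[of 199]) (use order_trans[OF wsum_tamed(1)[OF z i] abs_ge_self] in auto)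
 then show ?thesis by (simp add: ub_def)
qed

lemma U_grp_tamed:
 assumes w: "tamed L pt" and i: "i \<in> {1..m}"
 shows "r / grp pt i = exp (- U i pt) * r * (1 / (exp b0 * wsum n (\<lambda>j. Xv pt (i, j)) 0 b1))"
 unfolding wsum_Xv[OF i] grp_def by (simp add: exp_add exp_minus divide_inverse)

lemma inv_wsum_PiM: "i \<in> {1..m} ==> (\<lambda>z. 1 / (exp b0 * wsum n (\<lambda>j. z (i, j)) 0 b1)) \<in> borel_measurable (PiM Ix (\<lambda>_. borel))"
 by (intro borel_measurable_divide borel_measurable_times wsum_PiM) auto

lemma event_st1: "unlikely ((V + 1) / L) (\<lambda>pt. tamed L pt \<and> L powi -250 < \<bar>avg m (\<lambda>i. (1 + U i pt / s) / grp pt i)\<bar>)"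
 by (rule U_event'(2)[of "\<lambda>x. exp (- x) * (1 + x / s)", OF _ inv_wsum_PiM inv_wsum_tamed U_grp_tamed]) simp_all

lemma event_st2: "unlikely ((V + 1) / L) (\<lambda>pt. tamed L pt \<and> L powi -250 < \<bar>avg m (\<lambda>i. (1 - U i pt - (U i pt)\<^sup>2 / s) / grp pt i)\<bar>)"
 by (rule U_event'(2)[of "\<lambda>x. exp (- x) * (1 - x - x\<^sup>2 / s)", OF _ inv_wsum_PiM inv_wsum_tamed U_grp_tamed]) simp_all

abbreviation R :: "'a => nat => real" where "R pt i \<equiv> wmean n (\<lambda>j. X i j pt) b1"

lemma R_tamed: "tamed L pt ==> i \<in> {1..m} ==> \<bar>R pt i\<bar> <= L"
 by (rule wmean_abs_le[OF n1]) (use tamedD(1) in auto)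

lemma two_L: "2 * L <= L powi 2"
 using powi_10[of 1 2] L10 by simp

lemma w_tamed: "tamed L pt ==> i \<in> {1..m} ==> \<bar>R pt i - avg m (R pt)\<bar> <= L powi 2"
proof -
 assume w: "tamed L pt" and i: "i \<in> {1..m}"
 have "\<bar>avg m (R pt)\<bar> <= L"
  using abs_avg_le[of m "R pt"] avg_le_const[OF m1, of "\<lambda>i. \<bar>R pt i\<bar>" L] R_tamed[OF w] by force
 then show ?thesis using R_tamed[OF w i] two_L by linarith
qed

lemma event_uw: "unlikely ((V + 1) / L) (\<lambda>pt. tamed L pt \<and> q * L powi 5 < \<bar>avg m (\<lambda>i. U i pt * (R pt i - avg m (R pt)))\<bar>)"
proof (rule U_event'(1)[of "\<lambda>x. x" "\<lambda>i z. wmean n (\<lambda>j. z (i, j)) b1 - avg m (\<lambda>i. wmean n (\<lambda>j. z (i, j)) b1)" 2])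
 fix i z assume i: "i \<in> {1..m}" and z: "tamed_X L z"
 have "\<bar>avg m (\<lambda>i. wmean n (\<lambda>j. z (i, j)) b1)\<bar> <= L"
  using abs_avg_le[of m "\<lambda>i. wmean n (\<lambda>j. z (i, j)) b1"]
   avg_le_const[OF m1, of "\<lambda>i. \<bar>wmean n (\<lambda>j. z (i, j)) b1\<bar>" L] wsum_tamed(3)[OF z] by force
 then show "\<bar>wmean n (\<lambda>j. z (i, j)) b1 - avg m (\<lambda>i. wmean n (\<lambda>j. z (i, j)) b1)\<bar> <= L powi 2"
  using wsum_tamed(3)[OF z i, of b1] two_L by linarith
next
 fix pt i assume i: "i \<in> {1..m}"
 have e: "wmean n (\<lambda>j. Xv pt (i, j)) b1 = R pt i" if "i \<in> {1..m}" for i using that by (simp add: wmean_def wsum_Xv)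
 have "avg m (\<lambda>i. wmean n (\<lambda>j. Xv pt (i, j)) b1) = avg m (R pt)" by (rule avg_cong) (rule e)
 then show "U i pt * (R pt i - avg m (R pt)) = U i pt * (wmean n (\<lambda>j. Xv pt (i, j)) b1 - avg m (\<lambda>i. wmean n (\<lambda>j. Xv pt (i, j)) b1))"
  using e[OF i] by simp
next
 fix i assume "i \<in> {1..m}"
 then show "(\<lambda>z. wmean n (\<lambda>j. z (i, j)) b1 - avg m (\<lambda>i. wmean n (\<lambda>j. z (i, j)) b1)) \<in> borel_measurable (PiM Ix (\<lambda>_. borel))"
  unfolding wmean_def avg_def
  by (intro borel_measurable_diff borel_measurable_divide borel_measurable_sum wsum_PiM) auto
qed auto

definition Zf :: "'a => nat => real" where "Zf pt i = real (\<Sum>j=1..n. Y i j pt) / grp pt i - 1"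

text \<open>The conditional variance of the average is at most L^(2e) times a group mean over m,
  that is L^(2e + 202) / m, and its root is q L^(e + 101). This is the source of the offset 101 on
  the scale \<open>q\<close>, and of the offset 1 for an absolute threshold.\<close>

lemma weighted_event:
 assumes cF: "\<And>i j. i \<in> {1..m} ==> j \<in> {1..n} ==> (\<lambda>pt. w pt i j) \<in> borel_measurable F"
  and bd: "\<And>pt i j. tamed L pt ==> i \<in> {1..m} ==> j \<in> {1..n} ==> \<bar>w pt i j\<bar> <= L powi e"
  and h: "\<And>pt. tamed L pt ==> h pt = avg m (\<lambda>i. \<Sum>j=1..n. w pt i j * (real (Y i j pt) - rate pt (i, j)))"
 shows "e + 101 < d ==> unlikely ((V + 1) / L) (\<lambda>pt. tamed L pt \<and> q * L powi d < \<bar>h pt\<bar>)"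
  and "e + 1 < d ==> unlikely ((V + 1) / L) (\<lambda>pt. tamed L pt \<and> L powi d < \<bar>h pt\<bar>)"
proof -
 define v where "v = L powi (2 * e + 202) / real m"
 have v: "(\<Sum>i=1..m. \<Sum>j=1..n. (w pt i j / real m)\<^sup>2 * rate pt (i, j)) <= v" if wt: "tamed L pt" for pt
 proof -
  have "(\<Sum>j=1..n. (w pt i j / real m)\<^sup>2 * rate pt (i, j)) <= L powi (2 * e + 202) / (real m)\<^sup>2" if i: "i \<in> {1..m}" for i
  proof -
   have "(\<Sum>j=1..n. (w pt i j / real m)\<^sup>2 * rate pt (i, j)) <= (\<Sum>j=1..n. L powi (2 * e) / (real m)\<^sup>2 * rate pt (i, j))"
   proof (intro sum_mono mult_right_mono)
    fix j assume j: "j \<in> {1..n}"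
    have "\<bar>w pt i j\<bar>\<^sup>2 <= (L powi e)\<^sup>2" using bd[OF wt i j] by (intro power_mono) auto
    then have "(w pt i j)\<^sup>2 <= L powi (2 * e)" by (simp add: power2_eq_square powi_mult)
    then show "(w pt i j / real m)\<^sup>2 <= L powi (2 * e) / (real m)\<^sup>2" by (simp add: power_divide divide_right_mono)
   qed (use rate_pos in \<open>auto intro: less_imp_le\<close>)
   also have "\<dots> = L powi (2 * e) / (real m)\<^sup>2 * grp pt i" by (simp add: sum_distrib_left grp_rate)
   also have "\<dots> <= L powi (2 * e) / (real m)\<^sup>2 * L powi 202" using grp_tamed(2)[OF wt i] by (intro mult_left_mono) auto
   also have "\<dots> = L powi (2 * e + 202) / (real m)\<^sup>2" by (simp add: powi_mult)
   finally show ?thesis .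
  qed
  then have "(\<Sum>i=1..m. \<Sum>j=1..n. (w pt i j / real m)\<^sup>2 * rate pt (i, j)) <= (\<Sum>i=1..m. L powi (2 * e + 202) / (real m)\<^sup>2)"
   by (rule sum_mono)
  also have "\<dots> = v" using m_pos by (simp add: v_def power2_eq_square)
  finally show ?thesis .
 qed
 have h': "h pt = (\<Sum>i=1..m. \<Sum>j=1..n. w pt i j / real m * (real (Y i j pt) - rate pt (i, j)))" if "tamed L pt" for pt
  unfolding h[OF that] avg_def by (simp add: sum_divide_distrib)
 have v0: "v >= 0" by (simp add: v_def)
 have F: "(\<lambda>pt. w pt i j / real m) \<in> borel_measurable F" if "i \<in> {1..m}" "j \<in> {1..n}" for i j
  using cF[OF that] by simp
 note ev = linear_event[OF ne, of "\<lambda>pt (i, j). w pt i j / real m" L v _ h, simplified prod.case, OF F v _ v0 h']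
 {
  assume ed: "e + 101 < d"
  have "v / (q * L powi d)\<^sup>2 = L powi (2 * e + 202 - 2 * d)"
   using m_pos by (simp add: v_def power_mult_distrib q_sq power_divide power2_eq_square powi_mult flip: powi_div)
  also have "\<dots> <= (V + 1) / L" using ed by (intro small) auto
  finally show "unlikely ((V + 1) / L) (\<lambda>pt. tamed L pt \<and> q * L powi d < \<bar>h pt\<bar>)"
   using q_pos by (intro ev) auto
 next
  assume ed: "e + 1 < d"
  have "v <= L powi (2 * e + 202) * L powi -200" unfolding v_def by (rule div_m) simp
  then have "v / (L powi d)\<^sup>2 <= L powi (2 * e + 2) / (L powi d)\<^sup>2" by (intro divide_right_mono) (auto simp: powi_mult add.commute)
  also have "\<dots> = L powi (2 * e + 2 - 2 * d)" by (simp add: power2_eq_square powi_mult powi_div)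
  also have "\<dots> <= (V + 1) / L" using ed by (intro small) auto
  finally show "unlikely ((V + 1) / L) (\<lambda>pt. tamed L pt \<and> L powi d < \<bar>h pt\<bar>)" by (intro ev) auto
 }
qed

lemma event_T: "k \<in> {0, 1, 2} ==> unlikely ((V + 1) / L) (\<lambda>pt. tamed L pt \<and>
  L powi -50 < \<bar>avg m (\<lambda>i. (\<Sum>j=1..n. X i j pt ^ k * (real (Y i j pt) - exp (b0 + b1 * X i j pt + U i pt))) / real n)\<bar>)"
proof (rule weighted_event(2)[of "\<lambda>pt i j. X i j pt ^ k / real n" "-198"])
 assume k: "k \<in> {0, 1, 2}"
 fix pt i j assume "tamed L pt" "i \<in> {1..m}" "j \<in> {1..n}"
 then have "\<bar>X i j pt ^ k\<bar> <= L ^ k" unfolding power_abs using tamedD(1) by (intro power_mono) auto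
 also have "L ^ k <= L\<^sup>2" using k L10 by (intro power_increasing) auto
 also have "L\<^sup>2 = L powi 2" by (simp add: power_int_def)
 finally have "\<bar>X i j pt ^ k / real n\<bar> <= L powi 2 / real n" by (simp add: divide_right_mono)
 then show "\<bar>X i j pt ^ k / real n\<bar> <= L powi -198" unfolding nL by (simp add: powi_div)
next
 fix pt
 show "avg m (\<lambda>i. (\<Sum>j=1..n. X i j pt ^ k * (real (Y i j pt) - exp (b0 + b1 * X i j pt + U i pt))) / real n)
  = avg m (\<lambda>i. \<Sum>j=1..n. X i j pt ^ k / real n * (real (Y i j pt) - rate pt (i, j)))"
  by (simp add: rate_def sum_divide_distrib)
next
 fix i j assume "i \<in> {1..m}" "j \<in> {1..n}"
 from X_F[OF this] have "X i j \<in> borel_measurable F" .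
 then show "(\<lambda>pt. X i j pt ^ k / real n) \<in> borel_measurable F" by simp
qed auto

lemma event_S: "unlikely ((V + 1) / L) (\<lambda>pt. tamed L pt \<and>
  q * L powi 106 < \<bar>avg m (\<lambda>i. \<Sum>j=1..n. (X i j pt - R pt i) * real (Y i j pt))\<bar>)"
proof (rule weighted_event(1)[of "\<lambda>pt i j. X i j pt - R pt i" 2])
 fix pt i j assume w: "tamed L pt" "i \<in> {1..m}" "j \<in> {1..n}"
 then show "\<bar>X i j pt - R pt i\<bar> <= L powi 2" using tamedD(1)[OF w] R_tamed[OF w(1,2)] two_L by linarith
next
 fix pt
 show "avg m (\<lambda>i. \<Sum>j=1..n. (X i j pt - R pt i) * real (Y i j pt))
  = avg m (\<lambda>i. \<Sum>j=1..n. (X i j pt - R pt i) * (real (Y i j pt) - rate pt (i, j)))"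
 proof (rule avg_cong)
  fix i assume i: "i \<in> {1..m}"
  \<comment> \<open>Centring at the tilted group mean makes the conditional mean of the score vanish
    exactly, whatever the intercept; so responses may be replaced by noise.\<close>
  have "(\<Sum>j=1..n. (X i j pt - R pt i) * rate pt (i, j)) = exp (b0 + U i pt) * (wsum n (\<lambda>j. X i j pt) 1 b1 - R pt i * wsum n (\<lambda>j. X i j pt) 0 b1)"
   by (simp add: rate_def wsum_def sum_distrib_left sum_subtractf algebra_simps exp_add)
  also have "\<dots> = 0" using wsum_0_pos[OF n1, of "\<lambda>j. X i j pt" b1] by (simp add: wmean_def)
  finally show "(\<Sum>j=1..n. (X i j pt - R pt i) * real (Y i j pt))
   = (\<Sum>j=1..n. (X i j pt - R pt i) * (real (Y i j pt) - rate pt (i, j)))"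
   by (simp add: right_diff_distrib sum_subtractf)
 qed
next
 fix i j assume ij: "i \<in> {1..m}" "j \<in> {1..n}"
 show "(\<lambda>pt. X i j pt - R pt i) \<in> borel_measurable F"
  by (intro borel_measurable_diff wmean_F ij X_F)
qed auto

lemma event_Z:
 assumes w: "\<And>i. i \<in> {1..m} ==> (\<lambda>pt. w pt i) \<in> borel_measurable F"
  and bd: "\<And>pt i. tamed L pt ==> i \<in> {1..m} ==> \<bar>w pt i\<bar> <= L powi e" and ed: "e - 97 < d"
 shows "unlikely ((V + 1) / L) (\<lambda>pt. tamed L pt \<and> q * L powi d < \<bar>avg m (\<lambda>i. w pt i * Zf pt i)\<bar>)"
proof (rule weighted_event(1)[of "\<lambda>pt i j. w pt i / grp pt i" "e - 198"])
 fix pt i assume t: "tamed L pt" "i \<in> {1..m}"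
 have "ub (e - 198) (w pt i / grp pt i)"
  by (rule ub_div[of e _ 198]) (use bd[OF t] grp_tamed[OF t] in \<open>auto simp: ub_def\<close>)
 then show "\<bar>w pt i / grp pt i\<bar> <= L powi (e - 198)" by (simp add: ub_def)
next
 fix pt assume t: "tamed L pt"
 show "avg m (\<lambda>i. w pt i * Zf pt i) = avg m (\<lambda>i. \<Sum>j=1..n. w pt i / grp pt i * (real (Y i j pt) - rate pt (i, j)))"
 proof (rule avg_cong)
  fix i assume i: "i \<in> {1..m}"
  have "(\<Sum>j=1..n. w pt i / grp pt i * (real (Y i j pt) - rate pt (i, j)))
   = w pt i / grp pt i * (real (\<Sum>j=1..n. Y i j pt) - grp pt i)"
   by (simp only: sum_distrib_left[symmetric] sum_subtractf grp_rate of_nat_sum)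
  also have "\<dots> = w pt i * Zf pt i" using grp_tamed(3)[OF t i] by (simp add: Zf_def field_simps)
  finally show "w pt i * Zf pt i = (\<Sum>j=1..n. w pt i / grp pt i * (real (Y i j pt) - rate pt (i, j)))" ..
 qed
next
 fix i assume i: "i \<in> {1..m}"
 show "(\<lambda>pt. w pt i / grp pt i) \<in> borel_measurable F"
  by (intro borel_measurable_divide w grp_F i)
qed (use ed in auto)

lemma event_Z2:
 assumes w: "\<And>i. i \<in> {1..m} ==> (\<lambda>pt. w pt i) \<in> borel_measurable F"
  and bd: "\<And>pt i. tamed L pt ==> i \<in> {1..m} ==> \<bar>w pt i\<bar> <= L powi 1"
 shows "unlikely ((V + 1) / L) (\<lambda>pt. tamed L pt \<and> L powi -250 < \<bar>avg m (\<lambda>i. w pt i * ((Zf pt i)\<^sup>2 - 1 / grp pt i))\<bar>)"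
proof -
 let ?c = "\<lambda>pt i. w pt i / (real m * (grp pt i)\<^sup>2)"
 define v where "v = L powi -391 / real m"
 have v: "(\<Sum>i=1..m. (?c pt i)\<^sup>2 * (2 * (grp pt i)\<^sup>2 + grp pt i)) <= v" if t: "tamed L pt" for pt
 proof -
  have "(?c pt i)\<^sup>2 * (2 * (grp pt i)\<^sup>2 + grp pt i) <= L powi -391 / (real m)\<^sup>2" if i: "i \<in> {1..m}" for i
  proof -
   note g = grp_tamed[OF t i]
   have "L powi 0 <= L powi 198" by (rule powi_mono) simp
   then have g1: "1 <= grp pt i" using g(1) unfolding power_int_0_right by (rule order_trans)
   have "grp pt i <= (grp pt i)\<^sup>2" using mult_left_mono[OF g1, of "grp pt i"] g(3) by (simp add: power2_eq_square)
   then have "(?c pt i)\<^sup>2 * (2 * (grp pt i)\<^sup>2 + grp pt i) <= (?c pt i)\<^sup>2 * (3 * (grp pt i)\<^sup>2)" by (intro mult_left_mono) auto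
   \<comment> \<open>Divided by \<open>(grp pt i)\<^sup>2\<close>, the squared noise of a group has
     conditional variance at most 3 / grp^2, of the order of its squared mean 1 / grp.\<close>
   also have "\<dots> = 3 * (w pt i / grp pt i)\<^sup>2 / (real m)\<^sup>2" using g(3) by (simp add: power_divide power_mult_distrib power2_eq_square field_simps)
   also have "\<dots> <= L powi -391 / (real m)\<^sup>2"
   proof (rule divide_right_mono)
    have "ub (-197) (w pt i / grp pt i)"
     by (rule ub_div[of 1 _ 198]) (use bd[OF t i] g in \<open>auto simp: ub_def\<close>)
    then have "\<bar>w pt i / grp pt i\<bar>\<^sup>2 <= (L powi -197)\<^sup>2" unfolding ub_def by (intro power_mono) auto
    then have "(w pt i / grp pt i)\<^sup>2 <= L powi -394" by (simp add: power2_eq_square powi_mult)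
    then show "3 * (w pt i / grp pt i)\<^sup>2 <= L powi -391" using powi_10[of "-394" "-391"] powi_pos(1)[of "-394"] by linarith
   qed simp
   finally show ?thesis .
  qed
  then have "(\<Sum>i=1..m. (?c pt i)\<^sup>2 * (2 * (grp pt i)\<^sup>2 + grp pt i)) <= (\<Sum>i=1..m. L powi -391 / (real m)\<^sup>2)" by (rule sum_mono)
  also have "\<dots> = v" using m_pos by (simp add: v_def power2_eq_square)
  finally show ?thesis .
 qed
 have "unlikely (v / (L powi -250)\<^sup>2) (\<lambda>pt. tamed L pt \<and>
   L powi -250 < \<bar>\<Sum>i=1..m. ?c pt i * ((real (\<Sum>j=1..n. YY pt (i, j)) - grp pt i)\<^sup>2 - grp pt i)\<bar>)"
 proof (rule quadratic_noise[OF ne _ v])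
  fix i assume i: "i \<in> {1..m}"
  show "(\<lambda>pt. w pt i / (real m * (grp pt i)\<^sup>2)) \<in> borel_measurable F"
   by (intro borel_measurable_divide borel_measurable_times borel_measurable_power w grp_F i) auto
 qed (auto simp: v_def)
 then show ?thesis
 proof (rule unlikely_mono)
  have "v <= L powi -391 * L powi -200" unfolding v_def by (rule div_m) simp
  then have "v / (L powi -250)\<^sup>2 <= L powi -591 / (L powi -250)\<^sup>2" by (intro divide_right_mono) (auto simp: powi_mult)
  also have "\<dots> = L powi -91" by (simp add: power2_eq_square powi_mult powi_div)
  also have "\<dots> <= (V + 1) / L" by (intro small) auto
  finally show "v / (L powi -250)\<^sup>2 <= (V + 1) / L" .
  fix pt assume t: "tamed L pt \<and> L powi -250 < \<bar>avg m (\<lambda>i. w pt i * ((Zf pt i)\<^sup>2 - 1 / grp pt i))\<bar>"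
  have "avg m (\<lambda>i. w pt i * ((Zf pt i)\<^sup>2 - 1 / grp pt i))
   = (\<Sum>i=1..m. ?c pt i * ((real (\<Sum>j=1..n. YY pt (i, j)) - grp pt i)\<^sup>2 - grp pt i))"
   unfolding avg_def sum_divide_distrib
  proof (rule sum.cong[OF refl])
   fix i assume i: "i \<in> {1..m}"
   have y: "(\<Sum>j=1..n. YY pt (i, j)) = (\<Sum>j=1..n. Y i j pt)" using i by (intro sum.cong) (auto simp: YY_eq)
   have g: "grp pt i > 0" using grp_tamed(3) t i by blast
   show "w pt i * ((Zf pt i)\<^sup>2 - 1 / grp pt i) / real m
    = ?c pt i * ((real (\<Sum>j=1..n. YY pt (i, j)) - grp pt i)\<^sup>2 - grp pt i)"
    unfolding y Zf_def using g m_pos by (simp add: field_simps power2_eq_square)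
  qed
  then show "tamed L pt \<and> L powi -250 < \<bar>\<Sum>i=1..m. ?c pt i * ((real (\<Sum>j=1..n. YY pt (i, j)) - grp pt i)\<^sup>2 - grp pt i)\<bar>"
   using t by simp
 qed
qed

text \<open>The threshold exceeds the standard deviation bound L^-99 by L^2, and with t = L^-97 / 2
  and group means at least L^198 the exponent t^2 L^198 is L^4 / 4. Only such an exponential bound
  survives the union over m groups, m being an arbitrary power of n.\<close>

lemma event_tail: "unlikely (real m * (2 * exp (- (L ^ 4 / 4)))) (\<lambda>pt. tamed L pt \<and> (\<exists>i\<in>{1..m}. L powi -97 < \<bar>Zf pt i\<bar>))"
proof -
 have t: "0 < L powi -97 / 2" "L powi -97 / 2 <= 1" using powi_mono[of "-97" 0] by auto
 have "(L powi -97 / 2)\<^sup>2 * L powi 198 = L powi 4 / 4"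
  by (simp add: power_divide power2_eq_square powi_mult)
 then have e: "- (L powi -97 / 2)\<^sup>2 * L powi 198 = - (L ^ 4 / 4)" by (simp add: power_int_def)
 show ?thesis
 proof (rule unlikely_mono[OF tail_noise[OF ne t grp_tamed(1)]])
  show "real m * (2 * exp (- (L powi -97 / 2)\<^sup>2 * L powi 198)) <= real m * (2 * exp (- (L ^ 4 / 4)))" unfolding e ..
  fix pt assume w: "tamed L pt \<and> (\<exists>i\<in>{1..m}. L powi -97 < \<bar>Zf pt i\<bar>)"
  then obtain i where i: "i \<in> {1..m}" "L powi -97 < \<bar>Zf pt i\<bar>" by blast
  have g: "grp pt i > 0" using grp_tamed(3) w i by blast
  have y: "(\<Sum>j=1..n. YY pt (i, j)) = (\<Sum>j=1..n. Y i j pt)" using i by (intro sum.cong) (auto simp: YY_eq)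
  have "real (\<Sum>j=1..n. Y i j pt) - grp pt i = grp pt i * Zf pt i" using g by (simp add: Zf_def field_simps)
  then have "\<bar>real (\<Sum>j=1..n. YY pt (i, j)) - grp pt i\<bar> = grp pt i * \<bar>Zf pt i\<bar>" unfolding y using g by (simp only: abs_mult abs_of_pos)
  moreover have "2 * (L powi -97 / 2) * grp pt i < grp pt i * \<bar>Zf pt i\<bar>" using i(2) g by simp
  ultimately have "2 * (L powi -97 / 2) * grp pt i < \<bar>real (\<Sum>j=1..n. YY pt (i, j)) - grp pt i\<bar>" by (simp only:)
  then show "tamed L pt \<and> (\<exists>i\<in>{1..m}. 2 * (L powi -97 / 2) * grp pt i < \<bar>real (\<Sum>j=1..n. YY pt (i, j)) - grp pt i\<bar>)"
   using w i(1) by blast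
 qed
qed

end

context scaled_model
begin

lemma event_good: "unlikely (real m * real n * pX + real m * pU + (20 * ((V + 1) / L) + real m * (2 * exp (- (L ^ 4 / 4)))))
 (\<lambda>pt. \<not> (tamed L pt \<and> good_data L m n b0 b1 s \<gamma> I q (\<lambda>i j. X i j pt) (\<lambda>i. U i pt) (\<lambda>i j. Y i j pt)
   \<and> separated m n (\<lambda>i j. X i j pt) (\<lambda>i j. Y i j pt)))"
proof -
 let ?p = "(V + 1) / L" and ?K = "{0, 1, 2 :: nat}"
 have finK: "finite ?K" by simp
 \<comment> \<open>Three families over k = 0, 1, 2 and eleven single events make up the factor 20;
   taming and the Poisson tails are counted separately.\<close>
 have total: "z + (3 * p + (3 * p + (3 * p + (p + (p + (p + (p + (p + (p + (p + (p + (p + (p + (p + t)))))))))))))) <= z + (20 * p + t)"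
  for z p t :: real by simp
 have c3: "real (card ?K) = 3" by simp
 have U_F': "(\<lambda>pt. U i pt) \<in> borel_measurable F" if "i \<in> {1..m}" for i using U_F[OF that] .
 have Z: "unlikely ?p (\<lambda>pt. tamed L pt \<and> q * L powi -10 < \<bar>avg m (\<lambda>i. 1 * Zf pt i)\<bar>)"
  by (rule event_Z[where e = 0]) auto
 have uZ: "unlikely ?p (\<lambda>pt. tamed L pt \<and> q * L powi -10 < \<bar>avg m (\<lambda>i. U i pt * Zf pt i)\<bar>)"
  by (rule event_Z[OF U_F', where e = 1]) (auto simp: tamedD(3))
 have Zw: "unlikely ?p (\<lambda>pt. tamed L pt \<and> q * L powi 5 < \<bar>avg m (\<lambda>i. (R pt i - avg m (R pt)) * Zf pt i)\<bar>)"
  by (rule event_Z[where e = 2]) (auto simp: w_tamed intro!: borel_measurable_diff wmean_F avg_F)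
 have Z2: "unlikely ?p (\<lambda>pt. tamed L pt \<and> L powi -250 < \<bar>avg m (\<lambda>i. 1 * ((Zf pt i)\<^sup>2 - 1 / grp pt i))\<bar>)"
  by (rule event_Z2) (use L10 in auto)
 have uZ2: "unlikely ?p (\<lambda>pt. tamed L pt \<and> L powi -250 < \<bar>avg m (\<lambda>i. U i pt * ((Zf pt i)\<^sup>2 - 1 / grp pt i))\<bar>)"
  by (rule event_Z2[OF U_F']) (auto simp: tamedD(3))
 note bad = unlikely_or[OF unlikely_not_tamed[OF pX pU]
  unlikely_or[OF unlikely_Bex[OF finK event_M] unlikely_or[OF unlikely_Bex[OF finK event_eM]
  unlikely_or[OF unlikely_Bex[OF finK event_T] unlikely_or[OF event_u unlikely_or[OF event_u2
  unlikely_or[OF event_uw unlikely_or[OF Zw unlikely_or[OF Z unlikely_or[OF uZ unlikely_or[OF Z2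
  unlikely_or[OF uZ2 unlikely_or[OF event_st1 unlikely_or[OF event_st2 unlikely_or[OF event_S event_tail]]]]]]]]]]]]]]]
 show ?thesis
 proof (rule unlikely_mono[OF bad])
  fix pt
  let ?x = "\<lambda>i j. X i j pt" and ?u = "\<lambda>i. U i pt" and ?y = "\<lambda>i j. Y i j pt"
  assume ng: "\<not> (tamed L pt \<and> good_data L m n b0 b1 s \<gamma> I q ?x ?u ?y \<and> separated m n ?x ?y)"
  let ?bad = "\<not> tamed L pt \<or>
   (\<exists>k\<in>?K. L powi -190 < avg m (\<lambda>i. (exp b0 * wsum n (\<lambda>j. X i j pt) k b1 / real n - c k)\<^sup>2)) \<or>
   (\<exists>k\<in>?K. tamed L pt \<and> L powi -50 < \<bar>avg m (\<lambda>i. (exp (U i pt) - exp (s / 2)) * (exp b0 * wsum n (\<lambda>j. X i j pt) k b1 / real n))\<bar>) \<or>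
   (\<exists>k\<in>?K. tamed L pt \<and> L powi -50 < \<bar>avg m (\<lambda>i. (\<Sum>j=1..n. X i j pt ^ k * (real (Y i j pt) - exp (b0 + b1 * X i j pt + U i pt))) / real n)\<bar>) \<or>
   tamed L pt \<and> q * L powi 1 < \<bar>avg m (\<lambda>i. U i pt)\<bar> \<or>
   tamed L pt \<and> q * L powi 1 < \<bar>avg m (\<lambda>i. (U i pt)\<^sup>2 - s)\<bar> \<or>
   tamed L pt \<and> q * L powi 5 < \<bar>avg m (\<lambda>i. U i pt * (R pt i - avg m (R pt)))\<bar> \<or>
   tamed L pt \<and> q * L powi 5 < \<bar>avg m (\<lambda>i. (R pt i - avg m (R pt)) * Zf pt i)\<bar> \<or>
   tamed L pt \<and> q * L powi -10 < \<bar>avg m (\<lambda>i. 1 * Zf pt i)\<bar> \<or>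
   tamed L pt \<and> q * L powi -10 < \<bar>avg m (\<lambda>i. U i pt * Zf pt i)\<bar> \<or>
   tamed L pt \<and> L powi -250 < \<bar>avg m (\<lambda>i. 1 * ((Zf pt i)\<^sup>2 - 1 / grp pt i))\<bar> \<or>
   tamed L pt \<and> L powi -250 < \<bar>avg m (\<lambda>i. U i pt * ((Zf pt i)\<^sup>2 - 1 / grp pt i))\<bar> \<or>
   tamed L pt \<and> L powi -250 < \<bar>avg m (\<lambda>i. (1 + U i pt / s) / grp pt i)\<bar> \<or>
   tamed L pt \<and> L powi -250 < \<bar>avg m (\<lambda>i. (1 - U i pt - (U i pt)\<^sup>2 / s) / grp pt i)\<bar> \<or>
   tamed L pt \<and> q * L powi 106 < \<bar>avg m (\<lambda>i. \<Sum>j=1..n. (X i j pt - R pt i) * real (Y i j pt))\<bar> \<or>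
   tamed L pt \<and> (\<exists>i\<in>{1..m}. L powi -97 < \<bar>Zf pt i\<bar>)"
  show ?bad
  proof (rule ccontr)
   assume nb: "\<not> ?bad"
   then have t: "tamed L pt" by blast
   have u2: "avg m (\<lambda>i. (U i pt)\<^sup>2) - s = avg m (\<lambda>i. (U i pt)\<^sup>2 - s)" by (simp only: avg_diff avg_const[OF m1])
   have nb': "\<And>k. k \<in> ?K ==> avg m (\<lambda>i. (exp b0 * wsum n (?x i) k b1 / real n - c k)\<^sup>2) <= L powi -190"
    "\<And>k. k \<in> ?K ==> \<bar>avg m (\<lambda>i. (exp (?u i) - exp (s / 2)) * (exp b0 * wsum n (?x i) k b1 / real n))\<bar> <= L powi -50"
    "\<And>k. k \<in> ?K ==> \<bar>avg m (\<lambda>i. (\<Sum>j=1..n. ?x i j ^ k * (real (?y i j) - exp (b0 + b1 * ?x i j + ?u i))) / real n)\<bar> <= L powi -50"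
    "\<bar>avg m ?u\<bar> <= q * L powi 1" "\<bar>avg m (\<lambda>i. (?u i)\<^sup>2 - s)\<bar> <= q * L powi 1"
    "\<bar>avg m (\<lambda>i. ?u i * (R pt i - avg m (R pt)))\<bar> <= q * L powi 5"
    "\<bar>avg m (\<lambda>i. (R pt i - avg m (R pt)) * Zf pt i)\<bar> <= q * L powi 5"
    "\<bar>avg m (\<lambda>i. 1 * Zf pt i)\<bar> <= q * L powi -10" "\<bar>avg m (\<lambda>i. ?u i * Zf pt i)\<bar> <= q * L powi -10"
    "\<bar>avg m (\<lambda>i. 1 * ((Zf pt i)\<^sup>2 - 1 / grp pt i))\<bar> <= L powi -250"
    "\<bar>avg m (\<lambda>i. ?u i * ((Zf pt i)\<^sup>2 - 1 / grp pt i))\<bar> <= L powi -250"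
    "\<bar>avg m (\<lambda>i. (1 + ?u i / s) / grp pt i)\<bar> <= L powi -250"
    "\<bar>avg m (\<lambda>i. (1 - ?u i - (?u i)\<^sup>2 / s) / grp pt i)\<bar> <= L powi -250"
    "\<bar>avg m (\<lambda>i. \<Sum>j=1..n. (?x i j - R pt i) * real (?y i j))\<bar> <= q * L powi 106"
    "\<And>i. i \<in> {1..m} ==> \<bar>Zf pt i\<bar> <= L powi -97"
    using nb t unfolding not_less[symmetric] by blast+
   have L1: "L powi 1 = L" by simp
   have w: "avg m (\<lambda>i. (R pt i - avg m (R pt)) * Zf pt i) = avg m (\<lambda>i. Zf pt i * (R pt i - avg m (R pt)))"
    by (rule avg_cong) (rule mult.commute)
   note N = nb'[unfolded mult_1_left L1 w, folded u2, unfolded Zf_def grp_def]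
   note G = good_dataI[where L=L and m=m and n=n and ?b0.0=b0 and ?b1.0=b1 and s=s and \<gamma>=\<gamma> and I=I and q=q and c=c
    and x="?x" and u="?u" and y="?y", OF L10 m1 nL q_pos q_le s0 I es s_pos c0 cL \<gamma>L \<gamma> Ic tamedD[OF t]
    N(15) N(1) N(2) N(3) N(4) N(5) N(6) N(7) N(8) N(9) N(10) N(11) N(12) N(13) N(14)]
   have "good_data L m n b0 b1 s \<gamma> I q ?x ?u ?y" by (rule G(1)) assumption+
   moreover have "separated m n ?x ?y" by (rule G(2)) assumption+
   ultimately have "good_data L m n b0 b1 s \<gamma> I q ?x ?u ?y \<and> separated m n ?x ?y" ..
   then show False using ng t by blast
  qed
 qed (assumption, assumption, assumption, unfold c3, rule total)
qed

end

section \<open>The score\<close>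

text \<open>The information with observed totals replaced by their conditional means. In this form
  it depends on predictors and intercepts alone and can serve as the conditional variance of the
  score.\<close>

lemma (in good_data) rate_wvar_avg: "\<bar>avg m (\<lambda>i. \<theta> i * wvar n (x i) b1) - real n * I\<bar> <= L powi 181"
proof -
 have "\<bar>avg m (\<lambda>i. \<theta> i * wvar n (x i) b1) - avg m (\<lambda>i. Y i * wvar n (x i) b1)\<bar> <= L powi 180"
  unfolding avg_diff[symmetric]
 proof (rule order_trans[OF abs_avg_le avg_le_const[OF m1]])
  fix i assume i: "i \<in> {1..m}"
  have n1: "n >= 1" using nL powi_pos(1)[of 200] by (cases n) auto
  have \<theta>: "\<theta> i > 0" using wsum_0_pos[OF n1] by (simp add: \<theta>_def)
  have w: "\<bar>wvar n (x i) b1\<bar> <= L powi 2"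
  proof -
   have "wvar n (x i) b1 <= L\<^sup>2" using wvar_le[OF n1, of "x i" L] x_bd[OF i] by auto
   moreover have "L powi 2 = L\<^sup>2" by (simp add: power_int_def)
   ultimately show ?thesis using wvar_nonneg[OF n1, of "x i" b1] by simp
  qed
  have "exp b0 * wsum n (x i) 0 b1 = (\<Sum>j=1..n. exp (b0 + b1 * x i j))"
   by (simp add: wsum_def sum_distrib_left exp_add)
  also have "\<dots> <= (\<Sum>j=1..n. L)" using ex_bd[OF i] by (intro sum_mono) auto
  finally have "exp b0 * wsum n (x i) 0 b1 <= L powi 201" using powi_mult[of 200 1] nL by simp
  then have "(exp b0 * wsum n (x i) 0 b1) * exp (u i) <= L powi 201 * L powi 1" using eu_bd[OF i] wsum_0_pos[OF n1, of "x i" b1]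
   by (intro mult_mono) auto
  then have "(exp b0 * wsum n (x i) 0 b1) * exp (u i) <= L powi 202" unfolding powi_mult by simp
  then have th: "ub 202 (\<theta> i)" using \<theta> by (simp add: ub_def \<theta>_def exp_add mult_ac)
  have "\<theta> i * wvar n (x i) b1 - Y i * wvar n (x i) b1 = \<theta> i * (- (Z i) * wvar n (x i) b1)"
   using \<theta> by (simp add: Z_def field_simps)
  moreover have "ub 107 (\<theta> i * (- (Z i) * wvar n (x i) b1))"
   by (rule ub_mult[OF th ub_mult[of "-97" _ 2]]) (use Z_bd[OF i] w in \<open>auto simp: ub_def\<close>)
  ultimately have "\<bar>\<theta> i * wvar n (x i) b1 - Y i * wvar n (x i) b1\<bar> <= L powi 107" by (simp add: ub_def)
  also have "\<dots> <= L powi 180" by (rule powi_mono) simp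
  finally show "\<bar>\<theta> i * wvar n (x i) b1 - Y i * wvar n (x i) b1\<bar> <= L powi 180" .
 qed
 then show ?thesis using I_avg powi_10[of 180 181] powi_pos(1)[of 180] by linarith
qed

lemma sum_centred_squares:
 assumes "n >= 1"
 shows "(\<Sum>j=1..n. (x j - wmean n x b)\<^sup>2 * exp (b * x j)) = wsum n x 0 b * wvar n x b"
proof -
 have "(\<Sum>j=1..n. (x j - r)\<^sup>2 * exp (b * x j)) = wsum n x 2 b - 2 * r * wsum n x 1 b + r\<^sup>2 * wsum n x 0 b" for r
 proof -
  have "(\<Sum>j=1..n. (x j - r)\<^sup>2 * exp (b * x j))
   = (\<Sum>j=1..n. x j ^ 2 * exp (b * x j) - 2 * r * (x j ^ 1 * exp (b * x j)) + r\<^sup>2 * (x j ^ 0 * exp (b * x j)))"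
   by (intro sum.cong refl) (simp add: power2_eq_square algebra_simps)
  also have "\<dots> = wsum n x 2 b - 2 * r * wsum n x 1 b + r\<^sup>2 * wsum n x 0 b"
   by (simp only: sum.distrib sum_subtractf sum_distrib_left[symmetric] wsum_def)
  finally show ?thesis .
 qed
 note e = this[of "wmean n x b"]
 show ?thesis unfolding e unfolding wvar_def wmean_def using wsum_0_pos[OF assms, of x b]
  by (simp add: field_simps power2_eq_square)
qed

text \<open>Recovers a complex distance from one-sided bounds on real parts, the form in which
  \<open>expectation_YY_le\<close> delivers conditional estimates.\<close>

lemma (in prob_space) char_distance_le:
 assumes f: "Sc \<in> borel_measurable M"
  and b: "\<And>\<zeta>. norm \<zeta> <= 1 ==> expectation (\<lambda>pt. Re (\<zeta> * iexp (t * Sc pt))) <= Re (\<zeta> * w) + d" and d: "d >= 0"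
 shows "norm (char (distr M borel Sc) t - w) <= d"
proof -
 define z where "z = char (distr M borel Sc) t - w"
 \<comment> \<open>This rotates \<open>z\<close> onto the nonnegative axis. For \<open>z = 0\<close>
   the quotient is 0, still of norm at most 1.\<close>
 define \<zeta> where "\<zeta> = cnj z / norm z"
 have i: "integrable M (\<lambda>pt. iexp (t * Sc pt))" using f by (intro integrable_const_bound[of _ 1]) auto
 have c: "char (distr M borel Sc) t = expectation (\<lambda>pt. iexp (t * Sc pt))"
  unfolding char_def using f by (subst integral_distr) auto
 have "Re (\<zeta> * char (distr M borel Sc) t) = expectation (\<lambda>pt. Re (\<zeta> * iexp (t * Sc pt)))"
  unfolding c using i by (subst integral_mult_right_zero[symmetric], subst integral_Re) auto
 also have "\<dots> <= Re (\<zeta> * w) + d" by (rule b) (simp add: \<zeta>_def norm_divide)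
 finally have "Re (\<zeta> * z) <= d" by (simp only: z_def right_diff_distrib minus_complex.sel)
 moreover have "\<zeta> * z = of_real (norm z)"
  by (cases "z = 0") (simp_all add: \<zeta>_def mult.commute[of "cnj z"] complex_norm_square[symmetric] power2_eq_square)
 ultimately have "norm z <= d" by (simp only: Re_complex_of_real)
 then show ?thesis by (simp only: z_def)
qed

lemma (in simple_poisson_mixed_model) unlikely_prob:
 assumes "unlikely p P" "\<And>pt. pt \<in> space M ==> P' pt ==> P pt"
 shows "prob {pt \<in> space M. P' pt} <= p"
proof -
 obtain B where B: "B \<in> events" "prob B <= p" "{pt \<in> space M. P pt} \<subseteq> B" using assms(1) unfolding unlikely_def by auto
 have "prob {pt \<in> space M. P' pt} <= prob B" using B assms(2) by (intro finite_measure_mono) auto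
 then show ?thesis using B by simp
qed

section \<open>Asymptotic normality of the score\<close>

context scaled_model
begin

definition fail :: real where
 "fail = real m * real n * pX + real m * pU + (20 * ((V + 1) / L) + real m * (2 * exp (- (L ^ 4 / 4))))"

definition score :: "'a => real" where
 "score pt = (\<Sum>i=1..m. \<Sum>j=1..n. (X i j pt - R pt i) * real (Y i j pt)) / sqrt (I * (real m * real n))"

lemma score_YY: "score pt = (\<Sum>k\<in>Ix. (X (fst k) (snd k) pt - R pt (fst k)) / sqrt (I * (real m * real n)) * real (YY pt k))"
 unfolding score_def sum_Ix sum_divide_distrib by (intro sum.cong refl) (simp add: YY_eq)

lemma score_coeff_F: "k \<in> Ix ==> (\<lambda>pt. X (fst k) (snd k) pt - R pt (fst k)) \<in> borel_measurable F"
 by (auto simp: Ix_def intro!: borel_measurable_diff X_F wmean_F)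

lemma score_measurable: "score \<in> borel_measurable M"
 unfolding score_YY by (rule YY_compose_measurable[of "\<lambda>pt y. \<Sum>k\<in>Ix. (X (fst k) (snd k) pt - R pt (fst k)) / sqrt (I * (real m * real n)) * real (y k)"])
  (intro borel_measurable_sum borel_measurable_times borel_measurable_divide borel_measurable_const score_coeff_F)

text \<open>Given predictors and intercepts the score is linear in independent Poisson variables, so
  its characteristic function is the exponential of the sum of rate (exp(i c) - 1). Centring removes
  the linear term of this exponent, \<open>A\<close> fixes the quadratic one at -t^2 / 2, and the
  cubic remainder is small. \<open>norm_exp_diff_le\<close> carries the comparison over to the
  exponentials.\<close>

lemma score_char_conditional:
 assumes w: "tamed L pt" and A: "\<bar>avg m (\<lambda>i. grp pt i * wvar n (\<lambda>j. X i j pt) b1) - real n * I\<bar> <= L powi 181"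
 shows "norm (measure_pmf.expectation (Q pt) (\<lambda>y. iexp (\<Sum>k\<in>Ix. t * ((X (fst k) (snd k) pt - R pt (fst k)) / sqrt (I * (real m * real n))) * real (y k)))
   - exp (- (t\<^sup>2) / 2)) <= (t\<^sup>2 + \<bar>t\<bar> ^ 3) / L"
proof -
 define K where "K = sqrt (I * (real m * real n))"
 have I0: "I > 0" using I(1) L10 by (smt (verit) divide_pos_pos)
 have mn0: "I * (real m * real n) > 0" using I0 m_pos n1 by simp
 have K0: "K > 0" and K2: "K\<^sup>2 = I * (real m * real n)" using mn0 by (auto simp: K_def)
 define ck where "ck = (\<lambda>k. t * ((X (fst k) (snd k) pt - R pt (fst k)) / K))"
 define a where "a = (\<Sum>k\<in>Ix. complex_of_real (rate pt k) * (iexp (ck k) - 1))"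
 have E: "measure_pmf.expectation (Q pt) (\<lambda>y. iexp (\<Sum>k\<in>Ix. ck k * real (y k))) = exp a"
  unfolding Q_def a_def by (rule Q_characteristic[OF finite_Ix rate_pos])
 have lin: "(\<Sum>k\<in>Ix. rate pt k * ck k) = 0"
 proof -
  have "(\<Sum>j=1..n. rate pt (i, j) * ck (i, j)) = 0" if i: "i \<in> {1..m}" for i
  proof -
   have "(\<Sum>j=1..n. rate pt (i, j) * ck (i, j)) = t / K * exp (b0 + U i pt) * (wsum n (\<lambda>j. X i j pt) 1 b1 - R pt i * wsum n (\<lambda>j. X i j pt) 0 b1)"
    by (simp add: rate_def ck_def wsum_def sum_distrib_left sum_subtractf algebra_simps exp_add diff_divide_distrib)
   also have "\<dots> = 0" using wsum_0_pos[OF n1, of "\<lambda>j. X i j pt" b1] by (simp add: wmean_def)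
   finally show ?thesis .
  qed
  then show ?thesis unfolding sum_Ix by simp
 qed
 define q2 where "q2 = (\<Sum>k\<in>Ix. rate pt k * (ck k)\<^sup>2)"
 have q2: "\<bar>q2 - t\<^sup>2\<bar> <= t\<^sup>2 / L"
 proof -
  have "(\<Sum>j=1..n. rate pt (i, j) * (ck (i, j))\<^sup>2) = t\<^sup>2 / K\<^sup>2 * (grp pt i * wvar n (\<lambda>j. X i j pt) b1)" if i: "i \<in> {1..m}" for i
  proof -
   have "(\<Sum>j=1..n. rate pt (i, j) * (ck (i, j))\<^sup>2) = t\<^sup>2 / K\<^sup>2 * exp (b0 + U i pt) * (\<Sum>j=1..n. (X i j pt - R pt i)\<^sup>2 * exp (b1 * X i j pt))"
    unfolding sum_distrib_left
    by (intro sum.cong refl) (simp add: rate_def ck_def power_mult_distrib power_divide exp_add mult_ac)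
   then show ?thesis unfolding sum_centred_squares[OF n1] grp_def by (simp add: mult_ac)
  qed
  then have "q2 = (\<Sum>i=1..m. t\<^sup>2 / K\<^sup>2 * (grp pt i * wvar n (\<lambda>j. X i j pt) b1))"
   unfolding q2_def sum_Ix by (intro sum.cong refl)
  then have "q2 = t\<^sup>2 / K\<^sup>2 * (real m * avg m (\<lambda>i. grp pt i * wvar n (\<lambda>j. X i j pt) b1))"
   unfolding avg_def sum_distrib_left[symmetric] using m_pos by simp
  then have "q2 - t\<^sup>2 = t\<^sup>2 * ((avg m (\<lambda>i. grp pt i * wvar n (\<lambda>j. X i j pt) b1) - real n * I) / (real n * I))"
   unfolding K2 using m_pos n1 I0 by (simp add: field_simps)
  moreover have "\<bar>(avg m (\<lambda>i. grp pt i * wvar n (\<lambda>j. X i j pt) b1) - real n * I) / (real n * I)\<bar> <= 1 / L"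
  proof -
   have "L powi 200 * L powi -1 <= real n * I" unfolding nL using I(1) unfolding inv_L by (intro mult_left_mono) auto
   then have nI: "L powi 199 <= real n * I" by (simp add: powi_mult)
   have "ub (-18) ((avg m (\<lambda>i. grp pt i * wvar n (\<lambda>j. X i j pt) b1) - real n * I) / (real n * I))"
    by (rule ub_div[of 181 _ 199]) (use A nI in \<open>auto simp: ub_def\<close>)
   moreover have "L powi -18 <= 1 / L" unfolding inv_L by (rule powi_mono) simp
   ultimately show ?thesis unfolding ub_def by linarith
  qed
  ultimately have "\<bar>q2 - t\<^sup>2\<bar> <= t\<^sup>2 * (1 / L)" by (simp only: abs_mult abs_power2) (intro mult_left_mono, simp_all only: zero_le_power2)
  then show ?thesis by simp
 qed
 \<comment> \<open>The coefficients are at most |t| L^2 / K, the rates add up to at most m L^202,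
   and m / K^2 is 1 / (I n) at most L^-199. With K at least L^199 the product is L^(208 - 199 - 199)
   = L^-190 times |t|^3.\<close>
 have cub: "(\<Sum>k\<in>Ix. rate pt k * \<bar>ck k\<bar> ^ 3) <= \<bar>t\<bar> ^ 3 / L"
 proof -
  have K1: "L powi 199 <= K"
  proof -
   have "L powi -1 * (L powi 200 * L powi 200) <= I * (real m * real n)"
    using I(1) I0 m_ge nL unfolding inv_L by (intro mult_mono) auto
   then have "(L powi 199)\<^sup>2 <= I * (real m * real n)"
    using powi_mono[of 398 399] by (simp add: power2_eq_square powi_mult)
   then show ?thesis unfolding K_def by (rule real_le_rsqrt)
  qed
  have c1: "\<bar>ck (i, j)\<bar> <= \<bar>t\<bar> * (L powi 2 / K)" if "i \<in> {1..m}" "j \<in> {1..n}" for i j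
  proof -
   have "\<bar>X i j pt - R pt i\<bar> <= L powi 2" using tamedD(1)[OF w that] R_tamed[OF w that(1)] two_L by linarith
   then show ?thesis using K0 by (simp add: ck_def abs_mult abs_divide divide_right_mono mult_left_mono)
  qed
  have "(\<Sum>j=1..n. rate pt (i, j) * \<bar>ck (i, j)\<bar> ^ 3) <= L powi 202 * (\<bar>t\<bar> * (L powi 2 / K)) ^ 3" if i: "i \<in> {1..m}" for i
  proof -
   have "(\<Sum>j=1..n. rate pt (i, j) * \<bar>ck (i, j)\<bar> ^ 3) <= (\<Sum>j=1..n. rate pt (i, j) * (\<bar>t\<bar> * (L powi 2 / K)) ^ 3)"
    using rate_pos c1[OF i] by (intro sum_mono mult_left_mono power_mono) (auto intro: less_imp_le)
   also have "\<dots> = grp pt i * (\<bar>t\<bar> * (L powi 2 / K)) ^ 3" unfolding grp_rate sum_distrib_right ..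
   also have "\<dots> <= L powi 202 * (\<bar>t\<bar> * (L powi 2 / K)) ^ 3"
    using grp_tamed(2)[OF w i] K0 by (intro mult_right_mono) auto
   finally show ?thesis .
  qed
  then have "(\<Sum>k\<in>Ix. rate pt k * \<bar>ck k\<bar> ^ 3) <= (\<Sum>i=1..m. L powi 202 * (\<bar>t\<bar> * (L powi 2 / K)) ^ 3)"
   unfolding sum_Ix by (rule sum_mono)
  also have "\<dots> = \<bar>t\<bar> ^ 3 * (L powi 208 * (real m / K\<^sup>2) * (1 / K))"
  proof -
   have "real m * (A * (a * (B / K)) ^ 3) = a ^ 3 * ((A * B ^ 3) * (real m / K\<^sup>2) * (1 / K))" for A B a :: real
    using K0 by (simp add: field_simps power3_eq_cube power2_eq_square)
   moreover have "L powi 202 * (L powi 2) ^ 3 = L powi 208" by (simp add: power3_eq_cube powi_mult)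
   ultimately show ?thesis by simp
  qed
  also have "\<dots> <= \<bar>t\<bar> ^ 3 * (1 / L)"
  proof (rule mult_left_mono)
   have "real m / K\<^sup>2 = 1 / (I * real n)" unfolding K2 using m_pos by simp
   moreover have "ub (-199) (1 / (I * real n))"
   proof (rule ub_inverse)
    have "L powi -1 * L powi 200 <= I * real n" unfolding nL using I(1) unfolding inv_L by (intro mult_right_mono) auto
    then show "L powi 199 <= \<bar>I * real n\<bar>" by (simp add: powi_mult)
   qed simp
   ultimately have 1: "ub (-199) (real m / K\<^sup>2)" by simp
   have 2: "ub (-199) (1 / K)" by (rule ub_inverse[of 199]) (use K1 in auto)
   have "ub (-190) (L powi 208 * (real m / K\<^sup>2) * (1 / K))"
   proof (rule ub_mult[OF _ 2, of 9])
    show "ub 9 (L powi 208 * (real m / K\<^sup>2))" by (rule ub_mult[OF _ 1, of 208]) (simp_all add: ub_def)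
   qed simp
   moreover have "L powi -190 <= 1 / L" unfolding inv_L by (rule powi_mono) simp
   ultimately show "L powi 208 * (real m / K\<^sup>2) * (1 / K) <= 1 / L" unfolding ub_def by linarith
  qed simp
  finally show ?thesis by simp
 qed
 have "norm (a - complex_of_real (- (t\<^sup>2) / 2)) <= (t\<^sup>2 + \<bar>t\<bar> ^ 3) / L"
 proof -
  have tm: "norm (complex_of_real (rate pt k) * (iexp (ck k) - (1 + \<i> * ck k - (ck k)\<^sup>2 / 2))) <= rate pt k * \<bar>ck k\<bar> ^ 3" for k
  proof -
   have "norm (iexp (ck k) - (1 + \<i> * ck k - (ck k)\<^sup>2 / 2)) <= \<bar>ck k\<bar> ^ 3 / 6"
    using iexp_approx1[of "ck k" 2] by (simp add: numeral_eq_Suc power_mult_distrib diff_diff_eq2 algebra_simps)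
   also have "\<dots> <= \<bar>ck k\<bar> ^ 3" by simp
   finally show ?thesis unfolding norm_mult using rate_pos[of pt k] by (simp add: mult_left_mono)
  qed
  define rm where "rm = (\<Sum>k\<in>Ix. complex_of_real (rate pt k) * (iexp (ck k) - (1 + \<i> * ck k - (ck k)\<^sup>2 / 2)))"
  have "a = rm + \<i> * complex_of_real (\<Sum>k\<in>Ix. rate pt k * ck k) - complex_of_real q2 / 2"
   unfolding a_def rm_def q2_def of_real_sum sum_distrib_left sum_divide_distrib sum.distrib[symmetric] sum_subtractf[symmetric]
   by (intro sum.cong refl) (simp add: algebra_simps)
  then have "a - complex_of_real (- (t\<^sup>2) / 2) = rm + complex_of_real ((t\<^sup>2 - q2) / 2)"
   unfolding lin by (simp add: diff_divide_distrib)
  then have "norm (a - complex_of_real (- (t\<^sup>2) / 2)) <= norm rm + norm (complex_of_real ((t\<^sup>2 - q2) / 2))"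
   by (simp only: norm_triangle_ineq)
  also have "\<dots> <= \<bar>t\<bar> ^ 3 / L + t\<^sup>2 / L"
  proof (rule add_mono)
   show "norm rm <= \<bar>t\<bar> ^ 3 / L" unfolding rm_def
    by (rule order_trans[OF sum_norm_le cub]) (rule tm)
   have "\<bar>(t\<^sup>2 - q2) / 2\<bar> <= \<bar>q2 - t\<^sup>2\<bar>" by (simp add: abs_minus_commute)
   then have "\<bar>(t\<^sup>2 - q2) / 2\<bar> <= t\<^sup>2 / L" using q2 by (rule order_trans)
   then show "norm (complex_of_real ((t\<^sup>2 - q2) / 2)) <= t\<^sup>2 / L" by (simp only: norm_of_real)
  qed
  finally show ?thesis by (simp add: add_divide_distrib)
 qed
 moreover have "norm (exp a - exp (complex_of_real (- (t\<^sup>2) / 2))) <= norm (a - complex_of_real (- (t\<^sup>2) / 2))"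
 proof (rule norm_exp_diff_le)
  show "Re a <= 0" unfolding a_def Re_sum
   by (intro sum_nonpos) (use rate_pos in \<open>auto simp: cos_le_one mult_nonneg_nonpos less_imp_le Re_exp\<close>)
 qed simp
 ultimately have "norm (exp a - exp (complex_of_real (- (t\<^sup>2) / 2))) <= (t\<^sup>2 + \<bar>t\<bar> ^ 3) / L" by linarith
 then show ?thesis unfolding E[unfolded ck_def K_def] exp_of_real .
qed

lemma score_char: "norm (char (distr M borel score) t - exp (- (t\<^sup>2) / 2)) <= (t\<^sup>2 + \<bar>t\<bar> ^ 3) / L + 2 * fail"
proof (rule char_distance_le[OF score_measurable])
 let ?A = "\<lambda>pt. tamed L pt \<and> \<bar>avg m (\<lambda>i. grp pt i * wvar n (\<lambda>j. X i j pt) b1) - real n * I\<bar> <= L powi 181"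
 have "(\<lambda>pt. avg m (\<lambda>i. grp pt i * wvar n (\<lambda>j. X i j pt) b1) - real n * I) \<in> borel_measurable F"
  unfolding wvar_def
  by (intro borel_measurable_diff avg_F borel_measurable_times grp_F borel_measurable_divide borel_measurable_power wsum_F wmean_F borel_measurable_const)
 then have "{pt \<in> space F. \<bar>avg m (\<lambda>i. grp pt i * wvar n (\<lambda>j. X i j pt) b1) - real n * I\<bar> <= L powi 181} \<in> sets F" by measurable
 then have "{pt \<in> space M. ?A pt} \<in> sets F" by (rule tamed_conj_F)
 then have AM: "{pt \<in> space M. ?A pt} \<in> events" using subalgebra_F by (auto simp: subalgebra_def)
 then have AM': "{pt \<in> space M. \<not> ?A pt} \<in> events" by (rule sets.sets_Collect_neg)
 have pA: "prob {pt \<in> space M. \<not> ?A pt} <= fail"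
  unfolding fail_def
 proof (rule unlikely_prob[OF event_good])
  fix pt assume "\<not> ?A pt"
  then show "\<not> (tamed L pt \<and> good_data L m n b0 b1 s \<gamma> I q (\<lambda>i j. X i j pt) (\<lambda>i. U i pt) (\<lambda>i j. Y i j pt)
   \<and> separated m n (\<lambda>i j. X i j pt) (\<lambda>i j. Y i j pt))"
   using good_data.rate_wvar_avg[of L m n b0 b1 s \<gamma> I q "\<lambda>i j. X i j pt" "\<lambda>i. U i pt" "\<lambda>i j. Y i j pt"]
   unfolding grp_def by blast
 qed
 have fail0: "fail >= 0" using pA measure_nonneg order_trans by blast
 define \<delta> where "\<delta> = (t\<^sup>2 + \<bar>t\<bar> ^ 3) / L"
 have \<delta>0: "\<delta> >= 0" using L10 by (simp add: \<delta>_def)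
 show "0 <= (t\<^sup>2 + \<bar>t\<bar> ^ 3) / L + 2 * fail" using fail0 \<delta>0 by (simp add: \<delta>_def)
 fix \<zeta> :: complex assume \<zeta>: "norm \<zeta> <= 1"
 let ?f = "\<lambda>pt y. iexp (\<Sum>k\<in>Ix. t * ((X (fst k) (snd k) pt - R pt (fst k)) / sqrt (I * (real m * real n))) * real (y k))"
 let ?w = "complex_of_real (exp (- (t\<^sup>2) / 2))"
 \<comment> \<open>Outside the good event the distance of the two characteristic functions is only
   known to be at most 2, which costs twice the probability of that event.\<close>
 let ?g = "\<lambda>pt. Re (\<zeta> * ?w) + \<delta> + 2 * indicator {pt \<in> space M. \<not> ?A pt} pt"
 have ind: "expectation (\<lambda>pt. r + 2 * indicat_real A pt) = r + 2 * prob A" if A: "A \<in> events" for A r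
 proof -
  have "integrable M (indicat_real A)" using A by (intro integrable_real_indicator) (auto simp: less_top[symmetric])
  then show ?thesis using A by (simp add: prob_space)
 qed
 have zf: "norm (\<zeta> * z) <= norm z" for z unfolding norm_mult using \<zeta> by (simp add: mult_left_le_one_le)
 have nf: "norm (?f pt y) = 1" for pt y by (simp only: norm_exp_i_times)
 have nw: "norm ?w <= 1" by simp
 have hb: "\<bar>Re (\<zeta> * ?f pt y)\<bar> <= 1" for pt y
  using abs_Re_le_cmod[of "\<zeta> * ?f pt y"] zf[of "?f pt y"] nf[of pt y] by linarith
 have "expectation (\<lambda>pt. Re (\<zeta> * ?f pt (YY pt))) <= expectation ?g"
 proof (rule expectation_YY_le[OF ne, where B = "3 + \<delta>"])
  show "(\<lambda>pt. Re (\<zeta> * ?f pt y)) \<in> borel_measurable F" for y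
  proof -
   have "(\<lambda>pt. \<Sum>k\<in>Ix. t * ((X (fst k) (snd k) pt - R pt (fst k)) / sqrt (I * (real m * real n))) * real (y k)) \<in> borel_measurable F"
    by (intro borel_measurable_sum borel_measurable_times borel_measurable_divide borel_measurable_const score_coeff_F)
   then show ?thesis by measurable
  qed
  show "\<bar>Re (\<zeta> * ?f pt y)\<bar> <= 3 + \<delta>" for pt y using hb[of pt y] \<delta>0 by linarith
  show "?g \<in> borel_measurable M" using AM' by (intro borel_measurable_add borel_measurable_const borel_measurable_times borel_measurable_indicator)
  have "\<bar>Re (\<zeta> * ?w)\<bar> <= 1" using abs_Re_le_cmod[of "\<zeta> * ?w"] zf[of ?w] nw by linarith
  moreover have "0 <= indicat_real {pt \<in> space M. \<not> ?A pt} pt" "indicat_real {pt \<in> space M. \<not> ?A pt} pt <= 1" for pt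
   by (simp_all only: indicator_pos_le indicator_le_1)
  ultimately show "\<bar>?g pt\<bar> <= 3 + \<delta>" for pt using \<delta>0 by (smt (verit))
  fix pt assume pt: "pt \<in> space M"
  let ?E = "measure_pmf.expectation (Q pt) (?f pt)"
  have i: "integrable (measure_pmf (Q pt)) (?f pt)"
   by (rule measure_pmf.integrable_const_bound[of _ 1]) (use nf in auto)
  have e: "measure_pmf.expectation (Q pt) (\<lambda>y. Re (\<zeta> * ?f pt y)) = Re (\<zeta> * ?E)"
   using i by (subst integral_mult_right_zero[symmetric], subst integral_Re) auto
  have d: "Re (\<zeta> * ?E) <= Re (\<zeta> * ?w) + norm (?E - ?w)"
   using complex_Re_le_cmod[of "\<zeta> * (?E - ?w)"] zf[of "?E - ?w"] by (simp add: right_diff_distrib)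
  show "measure_pmf.expectation (Q pt) (\<lambda>y. Re (\<zeta> * ?f pt y)) <= ?g pt"
  proof (cases "?A pt")
   case True
   then have "norm (?E - ?w) <= \<delta>" unfolding \<delta>_def using score_char_conditional[of pt t] by simp
   then show ?thesis unfolding e using d True by simp
  next
   case False
   have "norm ?E <= measure_pmf.expectation (Q pt) (\<lambda>y. norm (?f pt y))" by (rule integral_norm_bound)
   then have "norm ?E <= 1" unfolding nf by simp
   then have "norm (?E - ?w) <= 2" using norm_triangle_ineq4[of ?E ?w] nw by linarith
   then show ?thesis unfolding e using d False pt \<delta>0 by simp
  qed
 qed
 also have "expectation ?g = Re (\<zeta> * ?w) + \<delta> + 2 * prob {pt \<in> space M. \<not> ?A pt}"
  by (rule ind[OF AM'])
 also have "\<dots> <= Re (\<zeta> * ?w) + (\<delta> + 2 * fail)" using pA by simp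
 finally show "expectation (\<lambda>pt. Re (\<zeta> * iexp (t * score pt))) <= Re (\<zeta> * ?w) + ((t\<^sup>2 + \<bar>t\<bar> ^ 3) / L + 2 * fail)"
  unfolding score_YY sum_distrib_left \<delta>_def by (simp only: mult.assoc)
qed

end

text \<open>A group without events would have \<open>Z i = -1\<close>, far outside the permitted
  deviation.\<close>

lemma (in good_data) responses: "i \<in> {1..m} ==> \<exists>j\<in>{1..n}. y i j >= 1"
proof (rule ccontr)
 assume i: "i \<in> {1..m}" and "\<not> (\<exists>j\<in>{1..n}. y i j >= 1)"
 then have "(\<Sum>j=1..n. y i j) = 0" by (intro sum.neutral ballI) (force simp: not_le)
 then have "Y i = 0" unfolding Y_def by (simp only: of_nat_0)
 then have "\<bar>Z i\<bar> = 1" by (simp add: Z_def)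
 moreover have "L powi -97 < L powi 0" using powi_10[of "-97" 0] powi_pos(1)[of "-97"] by linarith
 ultimately show False using Z_bd[OF i] by simp
qed

definition accurate :: "real => nat => nat => real => real => real => bool" where
 "accurate L m n e0 e1 e2 \<longleftrightarrow> \<bar>e0\<bar> <= 1 / L * (1 / real n + 1 / sqrt (real m)) \<and>
   \<bar>e1\<bar> <= 1 / L * (1 / (real n)\<^sup>2 + 1 / sqrt (real m * real n)) \<and> \<bar>e2\<bar> <= 1 / L * (1 / real n + 1 / sqrt (real m))"

section \<open>From stationary points to the estimators\<close>

context scaled_model
begin

lemma estimator_bounds:
 assumes est: "gva_estimator M m n X Y B0 B1 S"
 shows "unlikely fail (\<lambda>pt. \<not> accurate L m n (B0 pt - b0 - avg m (\<lambda>i. U i pt))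
   (B1 pt - b1 - score pt / sqrt (I * (real m * real n))) (S pt - avg m (\<lambda>i. (U i pt)\<^sup>2)))"
proof (rule unlikely_mono[OF event_good[folded fail_def] order_refl], rule ccontr)
 fix pt assume pt: "pt \<in> space M"
 let ?x = "\<lambda>i j. X i j pt" and ?u = "\<lambda>i. U i pt" and ?y = "\<lambda>i j. Y i j pt"
 assume "\<not> \<not> (tamed L pt \<and> good_data L m n b0 b1 s \<gamma> I q ?x ?u ?y \<and> separated m n ?x ?y)"
 then have gd: "good_data L m n b0 b1 s \<gamma> I q ?x ?u ?y" and sep: "separated m n ?x ?y" by blast+
 \<comment> \<open>\<open>final_bounds\<close> derives \<open>s > 0\<close> from the stationarity
   equations, which a boundary solution would satisfy with \<open>s = 0\<close>. The alternative in
   \<open>mle_or_boundary\<close> is therefore a genuine maximiser, and the estimator must be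
   one.\<close>
 have nb: "\<not> gva_eq m n ?x ?y \<beta>0 \<beta>1 0 (\<lambda>_. 0) (\<lambda>_. 0) G" for \<beta>0 \<beta>1 G
  using good_data.final_bounds(1)[OF gd, of \<beta>0 \<beta>1 0 "\<lambda>_. 0" "\<lambda>_. 0" G] by blast
 obtain i1 j1 i2 j2 where ij: "i1 \<in> {1..m}" "j1 \<in> {1..n}" "i2 \<in> {1..m}" "j2 \<in> {1..n}" "?y i1 j1 >= 1" "?y i2 j2 >= 1"
  "?x i1 j1 \<noteq> ?x i2 j2" using sep unfolding separated_def by blast
 have "(\<exists>\<theta>. is_gva_mle m n ?x ?y \<theta>) \<or> (\<exists>\<beta>0 \<beta>1 G. gva_eq m n ?x ?y \<beta>0 \<beta>1 0 (\<lambda>_. 0) (\<lambda>_. 0) G)"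
  by (rule mle_or_boundary[OF n1 m1 good_data.responses[OF gd] ij])
 then have "\<exists>\<theta>. is_gva_mle m n ?x ?y \<theta>" using nb by blast
 then have "is_gva_mle m n ?x ?y (B0 pt, B1 pt, S pt)" using est pt unfolding gva_estimator_def by blast
 then obtain \<mu> lam where "is_arg_max (gva_loglik m n ?x ?y) (\<lambda>\<theta>. \<theta> \<in> gva_params m) (B0 pt, B1 pt, S pt, \<mu>, lam)"
  unfolding is_gva_mle_def by auto
 from argmax_imp_gva_eq[OF n1 m1 this] obtain G where eq: "gva_eq m n ?x ?y (B0 pt) (B1 pt) (S pt) \<mu> lam G" by blast
 note fb = good_data.final_bounds[OF gd eq, unfolded good_data.d0_def[OF gd eq] good_data.d1_def[OF gd eq] good_data.S_def[OF gd]]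
 have r: "L powi -200 = 1 / real n" unfolding nL using powi_div[of 0 200] by simp
 have r2: "L powi -400 = 1 / (real n)\<^sup>2" unfolding nL power2_eq_square powi_mult using powi_div[of 0 400] by simp
 have r3: "q * L powi -100 = 1 / sqrt (real m * real n)"
 proof -
  have "sqrt (real n) = L powi 100" unfolding nL by (rule real_sqrt_unique) (simp_all add: power2_eq_square powi_mult)
  moreover have "L powi -100 = 1 / L powi 100" using powi_div[of 0 100] by simp
  ultimately show ?thesis by (simp add: real_sqrt_mult mult.commute)
 qed
 have I0: "I > 0" using I(1) L10 by (smt (verit) divide_pos_pos)
 have sc: "score pt / sqrt (I * (real m * real n)) = avg m (\<lambda>i. \<Sum>j=1..n. (X i j pt - R pt i) * real (Y i j pt)) / (real n * I)"
  using I0 by (simp add: score_def avg_def mult_ac)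
 have "accurate L m n (B0 pt - b0 - avg m ?u) (B1 pt - b1 - score pt / sqrt (I * (real m * real n))) (S pt - avg m (\<lambda>i. (?u i)\<^sup>2))"
  using fb(2-4) unfolding r r2 r3 sc accurate_def by (simp add: mult.commute divide_inverse)
 moreover assume "\<not> accurate L m n (B0 pt - b0 - avg m ?u) (B1 pt - b1 - score pt / sqrt (I * (real m * real n))) (S pt - avg m (\<lambda>i. (?u i)\<^sup>2))"
 ultimately show False by blast
qed

end

section \<open>Exponential moments\<close>

text \<open>A class closed under sums, products and powers, on which finiteness of all exponential
  moments implies integrability; the many integrability claims then reduce to syntax.\<close>

definition exp_bounded :: "(real => real) => bool" where
 "exp_bounded f \<longleftrightarrow> f \<in> borel_measurable borel \<and> (\<exists>C B. \<forall>x. \<bar>f x\<bar> <= C * exp (B * \<bar>x\<bar>))"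

lemma exp_boundedE:
 assumes "exp_bounded f"
 obtains C B where "C >= 0" "B >= 0" "\<And>x. \<bar>f x\<bar> <= C * exp (B * \<bar>x\<bar>)" "f \<in> borel_measurable borel"
proof -
 obtain C B where CB: "\<And>x. \<bar>f x\<bar> <= C * exp (B * \<bar>x\<bar>)" and f: "f \<in> borel_measurable borel"
  using assms unfolding exp_bounded_def by blast
 have "\<bar>f x\<bar> <= max C 0 * exp (max B 0 * \<bar>x\<bar>)" for x
 proof -
  have "C * exp (B * \<bar>x\<bar>) <= max C 0 * exp (max B 0 * \<bar>x\<bar>)"
   by (intro mult_mono) (auto intro: mult_right_mono)
  then show ?thesis using CB[of x] by linarith
 qed
 then show ?thesis using that[of "max C 0" "max B 0"] f by simp
qed

lemma exp_bounded_add: "exp_bounded f ==> exp_bounded g ==> exp_bounded (\<lambda>x. f x + g x)"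
proof -
 assume "exp_bounded f" "exp_bounded g"
 then obtain C B C' B' where f: "C >= 0" "B >= 0" "\<And>x. \<bar>f x\<bar> <= C * exp (B * \<bar>x\<bar>)" "f \<in> borel_measurable borel"
  and g: "C' >= 0" "B' >= 0" "\<And>x. \<bar>g x\<bar> <= C' * exp (B' * \<bar>x\<bar>)" "g \<in> borel_measurable borel"
  by (metis exp_boundedE)
 have "\<bar>f x + g x\<bar> <= (C + C') * exp ((B + B') * \<bar>x\<bar>)" for x
 proof -
  have "C * exp (B * \<bar>x\<bar>) <= C * exp ((B + B') * \<bar>x\<bar>)" "C' * exp (B' * \<bar>x\<bar>) <= C' * exp ((B + B') * \<bar>x\<bar>)"
   using f(1,2) g(1,2) by (intro mult_left_mono; simp add: mult_right_mono)+
  then show ?thesis using f(3)[of x] g(3)[of x] unfolding distrib_right[of C C'] by linarith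
 qed
 then show ?thesis unfolding exp_bounded_def using f(4) g(4) by (intro conjI borel_measurable_add exI allI)
qed

lemma exp_bounded_mult: "exp_bounded f ==> exp_bounded g ==> exp_bounded (\<lambda>x. f x * g x)"
proof -
 assume "exp_bounded f" "exp_bounded g"
 then obtain C B C' B' where f: "C >= 0" "B >= 0" "\<And>x. \<bar>f x\<bar> <= C * exp (B * \<bar>x\<bar>)" "f \<in> borel_measurable borel"
  and g: "C' >= 0" "B' >= 0" "\<And>x. \<bar>g x\<bar> <= C' * exp (B' * \<bar>x\<bar>)" "g \<in> borel_measurable borel"
  by (metis exp_boundedE)
 have "\<bar>f x * g x\<bar> <= (C * C') * exp ((B + B') * \<bar>x\<bar>)" for x
 proof -
  have "\<bar>f x\<bar> * \<bar>g x\<bar> <= (C * exp (B * \<bar>x\<bar>)) * (C' * exp (B' * \<bar>x\<bar>))"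
   using f g by (intro mult_mono) auto
  moreover have "exp ((B + B') * \<bar>x\<bar>) = exp (B * \<bar>x\<bar>) * exp (B' * \<bar>x\<bar>)" by (simp add: distrib_right exp_add)
  ultimately show ?thesis by (simp only: abs_mult mult_ac)
 qed
 then show ?thesis unfolding exp_bounded_def using f(4) g(4) by (intro conjI borel_measurable_times exI allI)
qed

lemma exp_bounded_const: "exp_bounded (\<lambda>_. c)"
 unfolding exp_bounded_def
proof (intro conjI exI allI)
 show "\<bar>c\<bar> <= \<bar>c\<bar> * exp (0 * \<bar>x\<bar>)" for x :: real by simp
qed simp

lemma exp_bounded_id: "exp_bounded (\<lambda>x. x)"
 unfolding exp_bounded_def
proof (intro conjI exI allI)
 show "\<bar>x\<bar> <= 1 * exp (1 * \<bar>x\<bar>)" for x :: real using exp_ge_add_one_self[of "\<bar>x\<bar>"] unfolding mult_1_left by linarith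
qed simp

lemma exp_bounded_exp: "exp_bounded (\<lambda>x. exp (a * x))"
 unfolding exp_bounded_def
proof (intro conjI exI allI)
 show "\<bar>exp (a * x)\<bar> <= 1 * exp (\<bar>a\<bar> * \<bar>x\<bar>)" for x :: real using abs_ge_self[of "a * x"] by (simp add: abs_mult)
qed simp

lemma exp_bounded_abs: "exp_bounded f ==> exp_bounded (\<lambda>x. \<bar>f x\<bar>)"
 unfolding exp_bounded_def by auto

lemma exp_bounded_exp_abs: "exp_bounded (\<lambda>x. exp (a * \<bar>x\<bar>))"
 unfolding exp_bounded_def
proof (intro conjI exI allI)
 show "\<bar>exp (a * \<bar>x\<bar>)\<bar> <= 1 * exp (a * \<bar>x\<bar>)" for x :: real by simp
qed simp

lemma exp_bounded_power: "exp_bounded f ==> exp_bounded (\<lambda>x. f x ^ k)"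
 by (induction k) (auto intro: exp_bounded_const exp_bounded_mult)

lemma exp_bounded_minus: "exp_bounded f ==> exp_bounded (\<lambda>x. - f x)"
 using exp_bounded_mult[OF exp_bounded_const[of "-1"]] by simp

lemma exp_bounded_diff: "exp_bounded f ==> exp_bounded g ==> exp_bounded (\<lambda>x. f x - g x)"
 using exp_bounded_add[OF _ exp_bounded_minus] by simp

lemma exp_bounded_divide: "exp_bounded f ==> exp_bounded (\<lambda>x. f x / c)"
 using exp_bounded_mult[OF _ exp_bounded_const[of "1 / c"]] by simp

lemmas exp_bounded_intros = exp_bounded_add exp_bounded_mult exp_bounded_const exp_bounded_id exp_bounded_exp
 exp_bounded_abs exp_bounded_exp_abs exp_bounded_power exp_bounded_minus exp_bounded_diff exp_bounded_divide

locale exponential_moments = prob_space P for P :: "'b measure" +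
 fixes X :: "'b => real"
 assumes X_meas: "X \<in> borel_measurable P" and exp_integrable: "\<And>t. integrable P (\<lambda>pt. exp (t * X pt))"
begin

lemma exp_bounded_integrable:
 assumes "exp_bounded f"
 shows "integrable P (\<lambda>pt. f (X pt))"
proof -
 obtain C B where CB: "C >= 0" "B >= 0" "\<And>x. \<bar>f x\<bar> <= C * exp (B * \<bar>x\<bar>)" and f: "f \<in> borel_measurable borel"
  by (rule exp_boundedE[OF assms]) (rule that)
 show ?thesis
 proof (rule Bochner_Integration.integrable_bound)
  show "integrable P (\<lambda>pt. C * (exp (B * X pt) + exp (- B * X pt)))"
   by (intro integrable_mult_right Bochner_Integration.integrable_add exp_integrable)
  show "(\<lambda>pt. f (X pt)) \<in> borel_measurable P" by (rule measurable_compose[OF X_meas f])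
  have "exp (B * \<bar>x\<bar>) <= exp (B * x) + exp (- B * x)" for x by (cases "x >= 0") auto
  then have "C * exp (B * \<bar>x\<bar>) <= C * (exp (B * x) + exp (- B * x))" for x using CB(1) by (rule mult_left_mono)
  then have "\<bar>f x\<bar> <= C * (exp (B * x) + exp (- B * x))" for x using CB(3) order_trans by blast
  moreover have "C * (exp (B * x) + exp (- B * x)) >= 0" for x
   using CB(1) by (intro mult_nonneg_nonneg add_nonneg_nonneg) auto
  ultimately show "AE pt in P. norm (f (X pt)) <= norm (C * (exp (B * X pt) + exp (- B * X pt)))"
   by (intro AE_I2) (simp only: real_norm_def abs_of_nonneg)
 qed
qed

definition moment :: "nat => real => real" where "moment k t = expectation (\<lambda>pt. X pt ^ k * exp (t * X pt))"

lemma moment_0: "moment 0 = mgf P X"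
 by (simp add: moment_def mgf_def fun_eq_iff)

lemma moment_integrable: "integrable P (\<lambda>pt. X pt ^ k * exp (t * X pt))"
 by (rule exp_bounded_integrable[of "\<lambda>x. x ^ k * exp (t * x)"]) (intro exp_bounded_intros)

lemma abs_exp_taylor2: "\<bar>exp y - 1 - y\<bar> <= y\<^sup>2 * exp \<bar>y\<bar>" for y :: real
proof -
 obtain t where t: "\<bar>t\<bar> <= \<bar>y\<bar>" "exp y = (\<Sum>m<2. y ^ m / fact m) + exp t / fact 2 * y ^ 2"
  using Maclaurin_exp_le[of y 2] by blast
 have e: "exp y - 1 - y = exp t / 2 * y\<^sup>2" using t(2) by (simp add: numeral_2_eq_2)
 have "exp t <= exp \<bar>y\<bar>" using t(1) by simp
 then have "exp t / 2 <= exp \<bar>y\<bar>" using exp_gt_zero[of t] by linarith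
 then have "exp t / 2 * y\<^sup>2 <= exp \<bar>y\<bar> * y\<^sup>2" by (intro mult_right_mono) auto
 moreover have "0 <= exp t / 2 * y\<^sup>2" by simp
 ultimately show ?thesis unfolding e by (simp only: abs_of_nonneg mult.commute[of "y\<^sup>2"])
qed

text \<open>Differentiation under the expectation. The second-order remainder of exp(h x) is
  dominated by h^2 x^2 exp(|x|) for |h| at most 1, so the difference quotient is within |h| C of its
  limit.\<close>

lemma moment_deriv: "(moment k has_field_derivative moment (Suc k) t) (at t)"
 unfolding DERIV_def
proof (rule LIM_zero_cancel, rule Lim_null_comparison)
 define C where "C = expectation (\<lambda>pt. \<bar>X pt\<bar> ^ (k + 2) * exp (t * X pt) * exp (1 * \<bar>X pt\<bar>))"
 have iC: "integrable P (\<lambda>pt. \<bar>X pt\<bar> ^ (k + 2) * exp (t * X pt) * exp (1 * \<bar>X pt\<bar>))"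
  by (rule exp_bounded_integrable[of "\<lambda>x. \<bar>x\<bar> ^ (k + 2) * exp (t * x) * exp (1 * \<bar>x\<bar>)"]) (intro exp_bounded_intros)
 have "norm ((moment k (t + h) - moment k t) / h - moment (Suc k) t) <= \<bar>h\<bar> * C" if h: "h \<noteq> 0" "\<bar>h\<bar> <= 1" for h
 proof -
  have e: "moment k (t + h) - moment k t - h * moment (Suc k) t
   = expectation (\<lambda>pt. X pt ^ k * exp (t * X pt) * (exp (h * X pt) - 1 - h * X pt))"
   unfolding moment_def using moment_integrable[of k t] moment_integrable[of k "t + h"] moment_integrable[of "Suc k" t]
   by (subst Bochner_Integration.integral_diff[symmetric], simp, simp,
     subst Bochner_Integration.integral_mult_right_zero[symmetric], subst Bochner_Integration.integral_diff[symmetric])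
    (auto intro!: Bochner_Integration.integral_cong simp: algebra_simps exp_add)
  have "\<bar>moment k (t + h) - moment k t - h * moment (Suc k) t\<bar> <= expectation (\<lambda>pt. h\<^sup>2 * (\<bar>X pt\<bar> ^ (k + 2) * exp (t * X pt) * exp (1 * \<bar>X pt\<bar>)))"
   unfolding e
  proof (rule order_trans[OF integral_abs_bound integral_mono])
   show "integrable P (\<lambda>pt. h\<^sup>2 * (\<bar>X pt\<bar> ^ (k + 2) * exp (t * X pt) * exp (1 * \<bar>X pt\<bar>)))" using iC by simp
   have "exp_bounded (\<lambda>x. x ^ k * exp (t * x) * (exp (h * x) - 1 - h * x))" by (intro exp_bounded_intros)
   from exp_bounded_integrable[OF this]
   show "integrable P (\<lambda>pt. \<bar>X pt ^ k * exp (t * X pt) * (exp (h * X pt) - 1 - h * X pt)\<bar>)" by (rule integrable_abs)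
   fix pt
   have "\<bar>exp (h * X pt) - 1 - h * X pt\<bar> <= (h * X pt)\<^sup>2 * exp \<bar>h * X pt\<bar>" by (rule abs_exp_taylor2)
   also have "\<dots> <= (h * X pt)\<^sup>2 * exp (1 * \<bar>X pt\<bar>)"
    using mult_right_mono[OF h(2), of "\<bar>X pt\<bar>"] by (intro mult_left_mono) (auto simp: abs_mult)
   finally have "\<bar>X pt\<bar> ^ k * exp (t * X pt) * \<bar>exp (h * X pt) - 1 - h * X pt\<bar>
    <= \<bar>X pt\<bar> ^ k * exp (t * X pt) * ((h * X pt)\<^sup>2 * exp (1 * \<bar>X pt\<bar>))" by (intro mult_left_mono) auto
   also have "\<dots> = h\<^sup>2 * (\<bar>X pt\<bar> ^ (k + 2) * exp (t * X pt) * exp (1 * \<bar>X pt\<bar>))"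
    by (simp add: power_add power_mult_distrib power2_eq_square mult_ac)
   finally show "\<bar>X pt ^ k * exp (t * X pt) * (exp (h * X pt) - 1 - h * X pt)\<bar> <= h\<^sup>2 * (\<bar>X pt\<bar> ^ (k + 2) * exp (t * X pt) * exp (1 * \<bar>X pt\<bar>))"
    by (simp only: abs_mult power_abs abs_exp_cancel)
  qed
  also have "\<dots> = h\<^sup>2 * C" by (simp add: C_def)
  finally have "\<bar>moment k (t + h) - moment k t - h * moment (Suc k) t\<bar> / \<bar>h\<bar> <= h\<^sup>2 * C / \<bar>h\<bar>" by (rule divide_right_mono) simp
  moreover have "(moment k (t + h) - moment k t) / h - moment (Suc k) t = (moment k (t + h) - moment k t - h * moment (Suc k) t) / h"
   using h by (simp add: field_simps)
  moreover have "h\<^sup>2 * C / \<bar>h\<bar> = \<bar>h\<bar> * C" using h by (simp add: field_simps power2_eq_square abs_mult_self_eq)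
  ultimately show ?thesis by (simp only: real_norm_def abs_divide)
 qed
 then have "eventually (\<lambda>h. norm ((moment k (t + h) - moment k t) / h - moment (Suc k) t) <= \<bar>h\<bar> * C) (at 0)"
  unfolding eventually_at by (intro exI[of _ 1]) (auto simp: dist_real_def)
 then show "\<forall>\<^sub>F h in at 0. norm ((moment k (t + h) - moment k t) / h - moment (Suc k) t) <= \<bar>h\<bar> * C" .
 show "((\<lambda>h. \<bar>h\<bar> * C) \<longlongrightarrow> 0) (at 0)" by (auto intro!: tendsto_eq_intros)
qed

lemma deriv_mgf: "deriv (mgf P X) = moment 1" "(deriv ^^ 2) (mgf P X) = moment 2"
proof -
 have d: "deriv (moment k) = moment (Suc k)" for k
  using DERIV_imp_deriv[OF moment_deriv] by (simp add: fun_eq_iff)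
 then show "deriv (mgf P X) = moment 1" "(deriv ^^ 2) (mgf P X) = moment 2"
  by (simp_all add: moment_0[symmetric] numeral_2_eq_2)
qed

lemma moment_0_pos: "moment 0 t > 0"
proof -
 have "moment 0 t \<noteq> 0"
 proof
  assume "moment 0 t = 0"
  then have "AE pt in P. exp (t * X pt) = 0"
   using integral_nonneg_eq_0_iff_AE[OF exp_integrable[of t]] by (simp add: moment_def)
  then show False by simp
 qed
 moreover have "moment 0 t >= 0" by (simp add: moment_def)
 ultimately show ?thesis by simp
qed

text \<open>The second derivative of the logarithm is this expression over the square of
  \<open>moment 0 t\<close>. It is nonnegative, as the variance under the tilted law up to a
  positive factor, so that being nonzero makes it positive.\<close>

lemma weighted_variance_pos:
 assumes "(deriv ^^ 2) (\<lambda>b. ln (mgf P X b)) t \<noteq> 0"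
 shows "moment 2 t * moment 0 t - (moment 1 t)\<^sup>2 > 0"
proof -
 have "((\<lambda>b. ln (moment 0 b)) has_field_derivative moment 1 b / moment 0 b) (at b)" for b
  using DERIV_chain2[OF DERIV_ln[OF moment_0_pos] moment_deriv[of 0 b]] by (simp add: divide_inverse mult.commute)
 then have "deriv (\<lambda>b. ln (moment 0 b)) = (\<lambda>b. moment 1 b / moment 0 b)" by (auto intro: DERIV_imp_deriv)
 moreover have "((\<lambda>b. moment 1 b / moment 0 b) has_field_derivative
   (moment 2 b * moment 0 b - moment 1 b * moment 1 b) / (moment 0 b * moment 0 b)) (at b)" for b
  using DERIV_divide[OF moment_deriv[of 1 b] moment_deriv[of 0 b]] moment_0_pos[of b] by (simp add: numeral_2_eq_2)
 ultimately have "(deriv ^^ 2) (\<lambda>b. ln (moment 0 b)) t = (moment 2 t * moment 0 t - moment 1 t * moment 1 t) / (moment 0 t * moment 0 t)"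
  by (simp add: numeral_2_eq_2 DERIV_imp_deriv)
 then have ne: "moment 2 t * moment 0 t - (moment 1 t)\<^sup>2 \<noteq> 0"
  using assms unfolding moment_0[symmetric] by (auto simp: power2_eq_square)
 define g where "g = moment 1 t / moment 0 t"
 have e: "(X pt - g)\<^sup>2 * exp (t * X pt) = X pt ^ 2 * exp (t * X pt) - (2 * g) * (X pt ^ 1 * exp (t * X pt)) + g\<^sup>2 * (X pt ^ 0 * exp (t * X pt))" for pt
  by (simp add: power2_eq_square algebra_simps)
 have "0 <= expectation (\<lambda>pt. (X pt - g)\<^sup>2 * exp (t * X pt))" by (intro integral_nonneg_AE) auto
 also have "\<dots> = moment 2 t - (2 * g) * moment 1 t + g\<^sup>2 * moment 0 t"
  unfolding e moment_def
  by (subst Bochner_Integration.integral_add, (intro Bochner_Integration.integrable_diff integrable_mult_right moment_integrable)+,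
    subst Bochner_Integration.integral_diff, (intro integrable_mult_right moment_integrable)+) (simp only: integral_mult_right_zero)
 finally have "0 <= (moment 2 t - (2 * g) * moment 1 t + g\<^sup>2 * moment 0 t) * moment 0 t" using moment_0_pos[of t] by simp
 also have "\<dots> = moment 2 t * moment 0 t - (moment 1 t)\<^sup>2"
  unfolding g_def using moment_0_pos[of t] by (simp add: field_simps power2_eq_square)
 finally show ?thesis using ne by simp
qed

text \<open>Any violation forces L <= exp(|a| + (1 + |b|) |x|), and every power of the right side is
  integrable. Markov's inequality gives decay of arbitrary polynomial order in \<open>L\<close>, as
  needed for a union bound over m n predictors when m is only known to be polynomial in n.\<close>

lemma tail_bound:
 assumes r: "r >= 0"
 obtains K where "K >= 0"
  "\<And>L. L > 0 ==> prob {pt \<in> space P. \<not> (\<bar>X pt\<bar> <= L \<and> 1 / L <= exp (a + b * X pt) \<and> exp (a + b * X pt) <= L)} <= K * L powr - r"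
proof -
 define h where "h = (\<lambda>x::real. exp (r * \<bar>a\<bar>) * exp (r * (1 + \<bar>b\<bar>) * \<bar>x\<bar>))"
 have hb: "exp_bounded h" unfolding h_def by (intro exp_bounded_intros)
 have ih: "integrable P (\<lambda>pt. h (X pt))" by (rule exp_bounded_integrable[OF hb])
 show ?thesis
 proof (rule that[of "expectation (\<lambda>pt. h (X pt))"])
  show "0 <= expectation (\<lambda>pt. h (X pt))" by (simp add: h_def)
  fix L :: real assume L: "L > 0"
  let ?B = "{pt \<in> space P. \<not> (\<bar>X pt\<bar> <= L \<and> 1 / L <= exp (a + b * X pt) \<and> exp (a + b * X pt) <= L)}"
  have key: "L powr r <= h x" if bad: "\<not> (\<bar>x\<bar> <= L \<and> 1 / L <= exp (a + b * x) \<and> exp (a + b * x) <= L)" for x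
  proof -
   have ab: "\<bar>a + b * x\<bar> <= \<bar>a\<bar> + \<bar>b\<bar> * \<bar>x\<bar>" using abs_triangle_ineq[of a "b * x"] by (simp add: abs_mult)
   have b0: "0 <= \<bar>b\<bar> * \<bar>x\<bar>" by simp
   have le: "L <= exp (\<bar>a\<bar> + (1 + \<bar>b\<bar>) * \<bar>x\<bar>)"
   proof -
    consider "\<bar>x\<bar> > L" | "exp (a + b * x) < 1 / L" | "exp (a + b * x) > L" using bad by linarith
    then show ?thesis
    proof cases
     case 1
     have "L <= exp \<bar>x\<bar>" using 1 exp_ge_add_one_self[of "\<bar>x\<bar>"] by linarith
     also have "\<dots> <= exp (\<bar>a\<bar> + (1 + \<bar>b\<bar>) * \<bar>x\<bar>)" using b0 by (simp add: distrib_right)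
     finally show ?thesis .
    next
     case 2
     then have "L < exp (- (a + b * x))" using L unfolding exp_minus by (simp add: field_simps)
     also have "\<dots> <= exp (\<bar>a\<bar> + (1 + \<bar>b\<bar>) * \<bar>x\<bar>)" using ab abs_ge_minus_self[of "a + b * x"] abs_ge_zero[of x] unfolding exp_le_cancel_iff distrib_right mult_1_left by linarith
     finally show ?thesis by simp
    next
     case 3
     also have "exp (a + b * x) <= exp (\<bar>a\<bar> + (1 + \<bar>b\<bar>) * \<bar>x\<bar>)" using ab abs_ge_self[of "a + b * x"] abs_ge_zero[of x] unfolding exp_le_cancel_iff distrib_right mult_1_left by linarith
     finally show ?thesis by simp
    qed
   qed
   then have "L powr r <= exp (\<bar>a\<bar> + (1 + \<bar>b\<bar>) * \<bar>x\<bar>) powr r" using L r by (intro powr_mono2) auto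
   also have "\<dots> = h x" by (simp add: h_def powr_def exp_add[symmetric] algebra_simps)
   finally show ?thesis .
  qed
  have X[measurable]: "X \<in> borel_measurable P" by (rule X_meas)
  have B: "?B \<in> events" by measurable
  have "L powr r * prob ?B = expectation (\<lambda>pt. L powr r * indicator ?B pt)" using B by simp
  also have "\<dots> <= expectation (\<lambda>pt. h (X pt))"
  proof (rule integral_mono[OF _ ih])
   show "integrable P (\<lambda>pt. L powr r * indicator ?B pt)"
    using B by (intro integrable_mult_right integrable_real_indicator) (auto simp: less_top[symmetric])
   fix pt
   show "L powr r * indicator ?B pt <= h (X pt)"
    using key[of "X pt"] by (cases "pt \<in> ?B") (auto simp: h_def)
  qed
  finally show "prob ?B <= expectation (\<lambda>pt. h (X pt)) * L powr - r"
   using L by (simp add: powr_minus field_simps)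
 qed
qed

end

section \<open>Normal moments and the central limit theorem\<close>

abbreviation normal_law :: "real => real measure" where
 "normal_law s \<equiv> density lborel (\<lambda>x. ennreal (normal_density 0 (sqrt s) x))"

lemma normal_law_exp:
 assumes s: "s > 0"
 shows "integrable (normal_law s) (\<lambda>x. exp (t * x))" "(\<integral>x. exp (t * x) \<partial>normal_law s) = exp (s * t\<^sup>2 / 2)"
proof -
 have e: "normal_density 0 (sqrt s) x * exp (t * x) = exp (s * t\<^sup>2 / 2) * normal_density (s * t) (sqrt s) x" for x
 proof -
  have "- (x\<^sup>2) / (2 * s) + t * x = s * t\<^sup>2 / 2 - (x - s * t)\<^sup>2 / (2 * s)"
   using s by (simp add: field_simps power2_eq_square)
  then have "exp (- (x\<^sup>2) / (2 * s)) * exp (t * x) = exp (s * t\<^sup>2 / 2) * exp (- (x - s * t)\<^sup>2 / (2 * s))"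
   unfolding exp_add[symmetric] by simp
  then show ?thesis using s unfolding normal_density_def by (simp add: field_simps)
 qed
 show "integrable (normal_law s) (\<lambda>x. exp (t * x))"
  using s by (subst integrable_density) (auto simp: e)
 show "(\<integral>x. exp (t * x) \<partial>normal_law s) = exp (s * t\<^sup>2 / 2)"
  using s by (subst integral_density) (auto simp: e)
qed

lemma normal_law_moments:
 assumes s: "s > 0"
 shows "exponential_moments (normal_law s) (\<lambda>x. x)"
  and "exponential_moments.moment (normal_law s) (\<lambda>x. x) 0 t = exp (s * t\<^sup>2 / 2)"
  and "exponential_moments.moment (normal_law s) (\<lambda>x. x) 1 t = s * t * exp (s * t\<^sup>2 / 2)"
  and "exponential_moments.moment (normal_law s) (\<lambda>x. x) 2 t = (s + s\<^sup>2 * t\<^sup>2) * exp (s * t\<^sup>2 / 2)"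
proof -
 interpret prob_space "normal_law s" using prob_space_normal_density[of "sqrt s" 0] s by simp
 show "exponential_moments (normal_law s) (\<lambda>x. x)" by unfold_locales (auto simp: normal_law_exp(1)[OF s])
 then interpret exponential_moments "normal_law s" "\<lambda>x. x" .
 have 0: "moment 0 = (\<lambda>t. exp (s * t\<^sup>2 / 2))" by (simp add: moment_def normal_law_exp(2)[OF s] fun_eq_iff)
 have 1: "moment 1 = (\<lambda>t. s * t * exp (s * t\<^sup>2 / 2))"
 proof
  fix t
  have "((\<lambda>t. exp (s * t\<^sup>2 / 2)) has_field_derivative s * t * exp (s * t\<^sup>2 / 2)) (at t)"
   by (auto intro!: derivative_eq_intros)
  then show "moment 1 t = s * t * exp (s * t\<^sup>2 / 2)" using moment_deriv[of 0 t] unfolding 0 by (auto intro: DERIV_unique)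
 qed
 have "((\<lambda>t. s * t * exp (s * t\<^sup>2 / 2)) has_field_derivative (s + s\<^sup>2 * t\<^sup>2) * exp (s * t\<^sup>2 / 2)) (at t)"
  by (auto intro!: derivative_eq_intros simp: power2_eq_square algebra_simps)
 moreover have "(moment 1 has_field_derivative moment 2 t) (at t)" using moment_deriv[of 1 t] by (simp add: numeral_2_eq_2)
 ultimately show "moment 2 t = (s + s\<^sup>2 * t\<^sup>2) * exp (s * t\<^sup>2 / 2)" unfolding 1 by (auto intro: DERIV_unique)
 show "moment 0 t = exp (s * t\<^sup>2 / 2)" "moment 1 t = s * t * exp (s * t\<^sup>2 / 2)" by (simp_all only: 0 1)
qed

text \<open>Tilted by exp(-x), the normal law has mean -s and second moment s + s^2. Hence 1 + x/s
  averages to 1 - 1, and 1 - x - x^2/s to 1 + s - (1 + s); these are the cancellations of the 1/n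
  terms.\<close>

lemma normal_law_zero_means:
 fixes f :: "real => real"
 assumes s: "s > 0"
  and f: "f \<in> {\<lambda>x. x, \<lambda>x. x\<^sup>2 - s, \<lambda>x. exp x - exp (s / 2), \<lambda>x. exp (- x) * (1 + x / s), \<lambda>x. exp (- x) * (1 - x - x\<^sup>2 / s)}"
 shows "integrable lborel (\<lambda>x. normal_density 0 (sqrt s) x * (f x)\<^sup>2)" "(\<integral>x. normal_density 0 (sqrt s) x * f x \<partial>lborel) = 0"
proof -
 interpret exponential_moments "normal_law s" "\<lambda>x. x" by (rule normal_law_moments(1)[OF s])
 note m = normal_law_moments(2-4)[OF s]
 have x1: "exp_bounded (\<lambda>x. exp x)" and x2: "exp_bounded (\<lambda>x. exp (- x))"
  using exp_bounded_exp[of 1] exp_bounded_exp[of "-1"] by simp_all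
 have fb: "exp_bounded f" using f by (auto intro!: exp_bounded_intros x1 x2)
 have fm: "f \<in> borel_measurable borel" using fb by (simp add: exp_bounded_def)
 have "integrable (normal_law s) (\<lambda>x. (f x)\<^sup>2)" by (rule exp_bounded_integrable) (intro exp_bounded_power fb)
 then show "integrable lborel (\<lambda>x. normal_density 0 (sqrt s) x * (f x)\<^sup>2)"
  using fm by (subst (asm) integrable_density) auto
 have i: "integrable (normal_law s) (\<lambda>x. x ^ k * exp (t * x))" for k t using moment_integrable .
 have comb: "(\<integral>x. a * (x ^ 0 * exp (t * x)) + b * (x ^ 1 * exp (t * x)) + c * (x ^ 2 * exp (t * x)) + d * (x ^ 0 * exp (0 * x)) \<partial>normal_law s)
   = a * moment 0 t + b * moment 1 t + c * moment 2 t + d * moment 0 0" for a b c d t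
  unfolding moment_def
  by (subst Bochner_Integration.integral_add, (intro Bochner_Integration.integrable_add integrable_mult_right i)+)+
    (simp only: integral_mult_right_zero)
 have "(\<integral>x. f x \<partial>normal_law s) = 0"
  using f
 proof (elim insertE emptyE)
  assume "f = (\<lambda>x. x)"
  then show ?thesis using comb[of 0 0 1 0 0] m[of 0] by simp
 next
  assume "f = (\<lambda>x. x\<^sup>2 - s)"
  then show ?thesis using comb[of 0 0 0 1 "- s"] m[of 0] by simp
 next
  assume "f = (\<lambda>x. exp x - exp (s / 2))"
  then show ?thesis using comb[of 1 1 0 0 "- exp (s / 2)"] m[of 0] m[of 1] by simp
 next
  assume "f = (\<lambda>x. exp (- x) * (1 + x / s))"
  then have "f = (\<lambda>x. 1 * (x ^ 0 * exp (- 1 * x)) + 1 / s * (x ^ 1 * exp (- 1 * x)) + 0 * (x ^ 2 * exp (- 1 * x)) + 0 * (x ^ 0 * exp (0 * x)))"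
   by (auto simp: algebra_simps)
  then show ?thesis using s by (simp only: comb m) (simp add: field_simps)
 next
  assume "f = (\<lambda>x. exp (- x) * (1 - x - x\<^sup>2 / s))"
  then have "f = (\<lambda>x. 1 * (x ^ 0 * exp (- 1 * x)) + - 1 * (x ^ 1 * exp (- 1 * x)) + - 1 / s * (x ^ 2 * exp (- 1 * x)) + 0 * (x ^ 0 * exp (0 * x)))"
   by (auto simp: algebra_simps)
  then show ?thesis using s by (simp only: comb m) (simp add: field_simps power2_eq_square)
 qed
 then show "(\<integral>x. normal_density 0 (sqrt s) x * f x \<partial>lborel) = 0"
  using fm by (subst (asm) integral_density) auto
qed

lemma (in prob_space) iid_char:
 fixes X :: "'i => 'a => real"
 assumes ind: "indep_vars (\<lambda>_. borel) X A" and d: "\<And>i. i \<in> A ==> distr M borel (X i) = \<mu>"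
 shows "char (distr M borel (\<lambda>pt. (\<Sum>i\<in>A. X i pt) / r)) t = char \<mu> (t / r) ^ card A"
proof -
 have rv: "X i \<in> borel_measurable M" if "i \<in> A" for i using ind that unfolding indep_vars_def2 by simp
 then have S: "(\<lambda>pt. \<Sum>i\<in>A. X i pt) \<in> borel_measurable M" by (rule borel_measurable_sum)
 have "char (distr M borel (\<lambda>pt. (\<Sum>i\<in>A. X i pt) / r)) t = char (distr M borel (\<lambda>pt. \<Sum>i\<in>A. X i pt)) (t / r)"
  unfolding char_def using S by (subst (1 2) integral_distr) auto
 also have "\<dots> = (\<Prod>i\<in>A. char (distr M borel (X i)) (t / r))" by (rule char_distr_sum[OF ind])
 also have "\<dots> = char \<mu> (t / r) ^ card A" using d by simp
 finally show ?thesis .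
qed

text \<open>The central limit theorem on the level of characteristic functions alone. For each n the
  sample lives on its own space and has size \<open>m n\<close>, so the limit is stated for powers
  of one function and composed with \<open>m\<close> later. Third moments are available and keep the
  error bound explicit.\<close>

lemma (in real_distribution) char_power_tendsto:
 assumes i: "integrable M (\<lambda>x. x)" "integrable M (\<lambda>x. x\<^sup>2)" "integrable M (\<lambda>x. \<bar>x\<bar> ^ 3)"
  and z: "expectation (\<lambda>x. x) = 0" and v: "expectation (\<lambda>x. x\<^sup>2) = v" "v > 0"
 shows "(\<lambda>k. char M (t / sqrt (real k * v)) ^ k) \<longlonglongrightarrow> complex_of_real (exp (- (t\<^sup>2) / 2))"
proof -
 define C where "C = expectation (\<lambda>x. \<bar>x\<bar> ^ 3)"
 let ?w = "\<lambda>k. complex_of_real (1 + (- (t\<^sup>2) / 2) / real k)"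
 have bound: "norm (char M (t / sqrt (real k * v)) ^ k - ?w k ^ k) <= t\<^sup>2 / (6 * v) * (\<bar>t / sqrt (real k * v)\<bar> * C)"
  if k: "k >= 1" "t\<^sup>2 <= real k" for k
 proof -
  define \<tau> where "\<tau> = t / sqrt (real k * v)"
  have \<tau>2: "\<tau>\<^sup>2 * v = t\<^sup>2 / real k" using v(2) k by (simp add: \<tau>_def power_divide field_simps)
  have "norm (char M \<tau> - (1 - \<tau>\<^sup>2 * v / 2)) <= \<tau>\<^sup>2 / 6 * expectation (\<lambda>x. min (6 * x\<^sup>2) (\<bar>\<tau>\<bar> * \<bar>x\<bar> ^ 3))"
   by (rule char_approx3) (use i z v in auto)
  also have "\<dots> <= \<tau>\<^sup>2 / 6 * expectation (\<lambda>x. \<bar>\<tau>\<bar> * \<bar>x\<bar> ^ 3)"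
   using i by (intro mult_left_mono integral_mono integrable_min integrable_mult_right) auto
  finally have "norm (char M \<tau> - (1 - \<tau>\<^sup>2 * v / 2)) <= \<tau>\<^sup>2 / 6 * (\<bar>\<tau>\<bar> * C)" by (simp add: C_def)
  then have "norm (char M \<tau> - complex_of_real (1 - \<tau>\<^sup>2 * v / 2)) <= \<tau>\<^sup>2 / 6 * (\<bar>\<tau>\<bar> * C)" by simp
  moreover have "1 - \<tau>\<^sup>2 * v / 2 = 1 + (- (t\<^sup>2) / 2) / real k" unfolding \<tau>2 by simp
  ultimately have le: "norm (char M \<tau> - ?w k) <= \<tau>\<^sup>2 / 6 * (\<bar>\<tau>\<bar> * C)" by (simp only:)
  \<comment> \<open>The condition \<open>t\<^sup>2 <= real k\<close> keeps the approximating factor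
    in the unit disc, as is needed to bound a difference of k-th powers by k times the
    difference.\<close>
  have "norm (?w k) <= 1" unfolding norm_of_real using k by (simp add: abs_le_iff field_simps)
  then have "norm (char M \<tau> ^ k - ?w k ^ k) <= real k * norm (char M \<tau> - ?w k)"
   using cmod_char_le_1 by (intro norm_power_diff)
  also have "\<dots> <= real k * (\<tau>\<^sup>2 / 6 * (\<bar>\<tau>\<bar> * C))" using le by (rule mult_left_mono) simp
  also have "\<dots> = t\<^sup>2 / (6 * v) * (\<bar>\<tau>\<bar> * C)"
  proof -
   have "real k * \<tau>\<^sup>2 = t\<^sup>2 / v" using \<tau>2 v(2) k by (simp add: field_simps)
   then show ?thesis by (simp add: mult_ac)
  qed
  finally show ?thesis by (simp only: \<tau>_def)
 qed
 have "eventually (\<lambda>k::nat. k >= nat \<lceil>t\<^sup>2\<rceil> + 1) sequentially" by (rule eventually_ge_at_top)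
 then have ev: "\<forall>\<^sub>F k in sequentially. norm (char M (t / sqrt (real k * v)) ^ k - ?w k ^ k) <= t\<^sup>2 / (6 * v) * (\<bar>t / sqrt (real k * v)\<bar> * C)"
 proof (rule eventually_mono)
  fix k assume "k >= nat \<lceil>t\<^sup>2\<rceil> + 1"
  then show "norm (char M (t / sqrt (real k * v)) ^ k - ?w k ^ k) <= t\<^sup>2 / (6 * v) * (\<bar>t / sqrt (real k * v)\<bar> * C)"
   by (intro bound) linarith+
 qed
 have "filterlim (\<lambda>k. sqrt (real k * v)) at_top sequentially"
  using v(2) by (intro filterlim_compose[OF sqrt_at_top] filterlim_at_top_mult_tendsto_pos[OF tendsto_const]) (auto intro: filterlim_real_sequentially)
 then have "(\<lambda>k. t / sqrt (real k * v)) \<longlonglongrightarrow> 0" by (intro tendsto_divide_0[OF tendsto_const] filterlim_at_top_imp_at_infinity)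
 then have "(\<lambda>k. t\<^sup>2 / (6 * v) * (\<bar>t / sqrt (real k * v)\<bar> * C)) \<longlonglongrightarrow> t\<^sup>2 / (6 * v) * (\<bar>0\<bar> * C)"
  by (intro tendsto_intros)
 then have "(\<lambda>k. t\<^sup>2 / (6 * v) * (\<bar>t / sqrt (real k * v)\<bar> * C)) \<longlonglongrightarrow> 0" by simp
 then have 1: "(\<lambda>k. char M (t / sqrt (real k * v)) ^ k - ?w k ^ k) \<longlonglongrightarrow> 0" by (rule Lim_null_comparison[OF ev])
 have "(\<lambda>k. complex_of_real ((1 + (- (t\<^sup>2) / 2) / real k) ^ k)) \<longlonglongrightarrow> complex_of_real (exp (- (t\<^sup>2) / 2))"
  by (intro tendsto_of_real tendsto_exp_limit_sequentially)
 then have "(\<lambda>k. ?w k ^ k) \<longlonglongrightarrow> complex_of_real (exp (- (t\<^sup>2) / 2))" by (simp only: of_real_power)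
 from tendsto_add[OF 1 this] show ?thesis by simp
qed

lemma centred_square_char:
 assumes s: "s > 0"
 shows "(\<lambda>k. char (distr (normal_law s) borel (\<lambda>x. x\<^sup>2 - s)) (t / sqrt (real k * (2 * s\<^sup>2))) ^ k) \<longlonglongrightarrow> complex_of_real (exp (- (t\<^sup>2) / 2))"
proof -
 interpret N: exponential_moments "normal_law s" "\<lambda>x. x" by (rule normal_law_moments(1)[OF s])
 interpret real_distribution "distr (normal_law s) borel (\<lambda>x. x\<^sup>2 - s)"
  by (rule N.real_distribution_distr) simp
 have eb: "exp_bounded (\<lambda>x. x\<^sup>2 - s)" by (intro exp_bounded_intros)
 have i: "integrable (distr (normal_law s) borel (\<lambda>x. x\<^sup>2 - s)) g" if "exp_bounded (\<lambda>x. g (x\<^sup>2 - s))" "g \<in> borel_measurable borel" for g :: "real => real"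
  using N.exp_bounded_integrable[OF that(1)] that(2) by (subst integrable_distr_eq) auto
 have m2: "N.expectation (\<lambda>x. x\<^sup>2) = s" using normal_law_moments(4)[OF s, of 0] by (simp add: N.moment_def)
 have m4: "N.expectation (\<lambda>x. x ^ 4) = 3 * s\<^sup>2"
 proof -
  have "(\<integral>x. normal_density 0 (sqrt s) x * (x - 0) ^ (2 * 2) \<partial>lborel) = fact (2 * 2) / ((2 / (sqrt s)\<^sup>2) ^ 2 * fact 2)"
   by (rule integral_normal_moment_even) (use s in simp)
  also have "\<dots> = 3 * s\<^sup>2" using s by (simp add: fact_numeral power2_eq_square field_simps)
  finally show ?thesis by (subst integral_density) auto
 qed
 have i2: "integrable (normal_law s) (\<lambda>x. x\<^sup>2)" "integrable (normal_law s) (\<lambda>x. x ^ 4)"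
  by (rule N.exp_bounded_integrable; intro exp_bounded_intros)+
 have e: "(x\<^sup>2 - s)\<^sup>2 = x ^ 4 - (2 * s) * x\<^sup>2 + s\<^sup>2" for x by (simp add: power2_eq_square algebra_simps numeral_eq_Suc)
 have v: "expectation (\<lambda>x. x\<^sup>2) = 2 * s\<^sup>2"
 proof -
  have "expectation (\<lambda>x. x\<^sup>2) = N.expectation (\<lambda>x. (x\<^sup>2 - s)\<^sup>2)" by (subst integral_distr) auto
  also have "\<dots> = 3 * s\<^sup>2 - (2 * s) * s + s\<^sup>2"
   unfolding e m4[symmetric] using i2 m2 N.prob_space by simp
  finally show ?thesis by (simp add: power2_eq_square)
 qed
 have z: "expectation (\<lambda>x. x) = 0"
  using i2 m2 N.prob_space by (subst integral_distr) auto
 show ?thesis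
  by (rule char_power_tendsto[OF i i i z v]) (use s in \<open>auto intro!: exp_bounded_intros eb\<close>)
qed

lemma (in prob_space) distributed_scaled_std_normal:
 assumes N: "N \<in> borel_measurable M" "distr M borel N = std_normal_distribution" and \<sigma>: "\<sigma> > 0"
 shows "distributed M lborel (\<lambda>pt. \<sigma> * N pt) (normal_density 0 \<sigma>)"
proof -
 have "distr M lborel N = distr M borel N" by (rule distr_cong) auto
 then have "distributed M lborel N std_normal_density" using N by (simp add: distributed_def)
 from normal_density_affine[OF this, of \<sigma> 0] \<sigma> show ?thesis by simp
qed

text \<open>Combines two approximations: \<open>T\<close> by the explicit statistic \<open>Z\<close>
  up to \<open>d n * a n\<close> off a set of small probability, and \<open>Z\<close> by the exactly
  normal \<open>N\<close>. The second is multiplied by \<open>r n\<close>, which the condition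
  \<open>r n <= a n\<close> turns into an error on the scale \<open>a n\<close>.\<close>

lemma small_o_p_coupling:
 assumes P: "\<And>n. n >= 1 ==> prob_space (M n)"
  and N: "\<And>n. n >= 1 ==> N n \<in> borel_measurable (M n)" and Z: "\<And>n. n >= 1 ==> Z n \<in> borel_measurable (M n)"
  and close: "\<And>e. e > 0 ==> (\<lambda>n. measure (M n) {pt \<in> space (M n). \<bar>N n pt - Z n pt\<bar> > e}) \<longlonglongrightarrow> 0"
  and ap: "\<forall>\<^sub>F n in sequentially. \<exists>B\<in>sets (M n). measure (M n) B <= f n \<and>
    (\<forall>pt\<in>space (M n) - B. \<bar>T n pt - \<sigma> * Z n pt * r n\<bar> <= d n * a n)"
  and f: "f \<longlonglongrightarrow> 0" and d: "d \<longlonglongrightarrow> 0" and \<sigma>: "\<sigma> > 0"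
  and r: "\<And>n. n >= 1 ==> 0 < r n \<and> r n <= (a n :: real)"
 shows "small_o_p M (\<lambda>n pt. T n pt - \<sigma> * N n pt * r n) a"
 unfolding small_o_p_def
proof (intro allI impI)
 fix \<epsilon> :: real assume \<epsilon>: "\<epsilon> > 0"
 define e where "e = \<epsilon> / (2 * \<sigma>)"
 have e0: "e > 0" using \<epsilon> \<sigma> by (simp add: e_def)
 let ?D = "\<lambda>n. {pt \<in> space (M n). \<bar>N n pt - Z n pt\<bar> > e}"
 let ?S = "\<lambda>n. {pt \<in> space (M n). \<epsilon> < \<bar>(T n pt - \<sigma> * N n pt * r n) / a n\<bar>}"
 have "\<forall>\<^sub>F n in sequentially. d n < \<epsilon> / 2" using order_tendstoD(2)[OF d, of "\<epsilon> / 2"] \<epsilon> by simp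
 then have "\<forall>\<^sub>F n in sequentially. measure (M n) (?S n) <= f n + measure (M n) (?D n)"
  using ap eventually_ge_at_top[of 1]
 proof eventually_elim
  fix n :: nat assume dn: "d n < \<epsilon> / 2" and n: "1 <= n"
   and "\<exists>B\<in>sets (M n). measure (M n) B <= f n \<and> (\<forall>pt\<in>space (M n) - B. \<bar>T n pt - \<sigma> * Z n pt * r n\<bar> <= d n * a n)"
  then obtain B where B: "B \<in> sets (M n)" "measure (M n) B <= f n"
   "\<And>pt. pt \<in> space (M n) ==> pt \<notin> B ==> \<bar>T n pt - \<sigma> * Z n pt * r n\<bar> <= d n * a n" by blast
  interpret prob_space "M n" by (rule P[OF n])
  note [measurable] = N[OF n] Z[OF n]
  have D: "?D n \<in> events" by measurable
  have rn: "0 < r n" "r n <= a n" "0 < a n" using r[OF n] by auto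
  have "?S n \<subseteq> B \<union> ?D n"
  proof
   fix pt assume pt: "pt \<in> ?S n"
   show "pt \<in> B \<union> ?D n"
   proof (rule ccontr)
    assume no: "pt \<notin> B \<union> ?D n"
    then have c: "\<bar>N n pt - Z n pt\<bar> <= e" and t: "\<bar>T n pt - \<sigma> * Z n pt * r n\<bar> <= d n * a n" using pt B(3) by auto
    have "\<bar>\<sigma> * (N n pt - Z n pt) * r n\<bar> <= \<sigma> * e * a n"
     unfolding abs_mult using c \<sigma> rn e0 by (intro mult_mono) auto
    also have "\<sigma> * e * a n = \<epsilon> / 2 * a n" using \<sigma> by (simp add: e_def)
    finally have c': "\<bar>\<sigma> * (N n pt - Z n pt) * r n\<bar> <= \<epsilon> / 2 * a n" .
    have e: "T n pt - \<sigma> * N n pt * r n = (T n pt - \<sigma> * Z n pt * r n) - \<sigma> * (N n pt - Z n pt) * r n"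
     by (simp add: algebra_simps)
    have "\<bar>T n pt - \<sigma> * N n pt * r n\<bar> <= d n * a n + \<epsilon> / 2 * a n"
     unfolding e by (rule order_trans[OF abs_triangle_ineq4 add_mono[OF t c']])
    also have "\<dots> < \<epsilon> / 2 * a n + \<epsilon> / 2 * a n" using mult_strict_right_mono[OF dn rn(3)] by simp
    finally have "\<bar>(T n pt - \<sigma> * N n pt * r n) / a n\<bar> < \<epsilon>" using rn by (simp add: abs_divide field_simps)
    then show False using pt by simp
   qed
  qed
  then have "prob (?S n) <= prob (B \<union> ?D n)" using B D by (intro finite_measure_mono) auto
  also have "\<dots> <= prob B + prob (?D n)" using B D by (intro measure_Un_le) auto
  finally show "prob (?S n) <= f n + prob (?D n)" using B(2) by linarith
 qed
 moreover have "(\<lambda>n. f n + measure (M n) (?D n)) \<longlonglongrightarrow> 0" using tendsto_add[OF f close[OF e0]] by simp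
 ultimately show "(\<lambda>n. measure (M n) (?S n)) \<longlonglongrightarrow> 0"
  by (rule tendsto_sandwich[OF _ _ tendsto_const, rotated]) simp
qed

section \<open>Asymptotic expansions\<close>

locale poisson_sequence =
 fixes M :: "nat => 'a measure" and P :: "'b measure" and m :: "nat => nat"
  and X :: "nat => nat => nat => 'a => real" and U :: "nat => nat => 'a => real"
  and Y :: "nat => nat => nat => 'a => nat" and X0 :: "'b => real" and b0 b1 s :: real
 assumes s_pos: "s > 0" and moments: "exponential_moments P X0"
  and m_pos: "\<And>n. n >= 1 ==> m n >= 1"
  and model: "\<And>n. n >= 1 ==>
     simple_poisson_mixed_model (M n) (m n) n (X n) (U n) (Y n) (distr P borel X0) b0 b1 s"
  and curvature: "(deriv ^^ 2) (\<lambda>b. ln (mgf P X0 b)) b1 \<noteq> 0"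
  and A4: "filterlim m at_top sequentially" "(\<lambda>n. real n / real (m n)) \<longlonglongrightarrow> 0"
  and A5: "\<exists>C>0. (\<lambda>n. real (m n)) \<in> O(\<lambda>n. real n powr C)"
begin

sublocale mom: exponential_moments P X0 by (rule moments)

text \<open>The expectation of X^k exp(b0 + b1 X). So \<open>\<gamma>\<close> is the mean of X under
  its law tilted by \<open>b1\<close>, and \<open>I\<close> is the information on the slope per
  observation, with exp(s/2) the mean of exp(U).\<close>

definition c :: "nat => real" where "c k = exp b0 * mom.moment k b1"
definition \<gamma> :: real where "\<gamma> = c 1 / c 0"
definition I :: real where "I = exp (s / 2) * (c 2 - \<gamma> * c 1)"
definition Lf :: "nat => real" where "Lf n = real n powr (1 / 200)"
definition bad :: "real => real => real => real set" where
 "bad a b L = {x. \<not> (\<bar>x\<bar> <= L \<and> 1 / L <= exp (a + b * x) \<and> exp (a + b * x) <= L)}"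
definition pX :: "nat => real" where "pX n = measure (distr P borel X0) (bad b0 b1 (Lf n))"
definition pU :: "nat => real" where "pU n = measure (normal_law s) (bad 0 1 (Lf n))"
definition test_functions :: "(real => real) set" where
 "test_functions = {\<lambda>x. x, \<lambda>x. x\<^sup>2 - s, \<lambda>x. exp x - exp (s / 2), \<lambda>x. exp (- x) * (1 + x / s), \<lambda>x. exp (- x) * (1 - x - x\<^sup>2 / s)}"
definition V :: real where
 "V = (\<Sum>k\<in>{0, 1, 2}. integral\<^sup>L (distr P borel X0) (\<lambda>x. (x ^ k * exp (b0 + b1 * x))\<^sup>2))
   + (\<Sum>f\<in>test_functions. \<integral>x. normal_density 0 (sqrt s) x * (f x)\<^sup>2 \<partial>lborel)"

lemma bad_borel: "bad a b L \<in> sets borel"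
 unfolding bad_def by measurable

lemma V_bounds:
 shows "k \<in> {0, 1, 2} ==> integral\<^sup>L (distr P borel X0) (\<lambda>x. (x ^ k * exp (b0 + b1 * x))\<^sup>2) <= V"
  and "f \<in> test_functions ==> (\<integral>x. normal_density 0 (sqrt s) x * (f x)\<^sup>2 \<partial>lborel) <= V"
proof -
 let ?A = "\<lambda>k. integral\<^sup>L (distr P borel X0) (\<lambda>x. (x ^ k * exp (b0 + b1 * x))\<^sup>2)"
 let ?B = "\<lambda>f. \<integral>x. normal_density 0 (sqrt s) x * (f x)\<^sup>2 \<partial>lborel"
 have A: "?A k >= 0" for k by (intro integral_nonneg_AE) auto
 have B: "?B f >= 0" for f by (intro integral_nonneg_AE) auto
 have fin: "finite test_functions" by (simp add: test_functions_def)
 have sA: "(\<Sum>k\<in>{0, 1, 2}. ?A k) >= 0" and sB: "(\<Sum>f\<in>test_functions. ?B f) >= 0" using A B by (auto intro: sum_nonneg)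
 show "?A k <= V" if "k \<in> {0, 1, 2}"
 proof -
  have "?A k <= (\<Sum>k\<in>{0, 1, 2}. ?A k)" by (rule member_le_sum) (use that A in auto)
  then show ?thesis unfolding V_def using sB by linarith
 qed
 show "?B f <= V" if "f \<in> test_functions"
 proof -
  have "?B f <= (\<Sum>f\<in>test_functions. ?B f)" by (rule member_le_sum) (use that B fin in auto)
  then show ?thesis unfolding V_def using sA by linarith
 qed
qed

lemma c0_pos: "c 0 > 0"
 using mom.moment_0_pos by (simp add: c_def)

lemma I_pos: "I > 0" and tau: "tau_sq (mgf P X0) b0 b1 s = 1 / I"
proof -
 let ?p = "\<lambda>k. mom.moment k b1"
 have v: "?p 2 * ?p 0 - (?p 1)\<^sup>2 > 0" by (rule mom.weighted_variance_pos[OF curvature])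
 have p0: "?p 0 > 0" by (rule mom.moment_0_pos)
 have I: "I = exp (s / 2) * exp b0 * ((?p 2 * ?p 0 - (?p 1)\<^sup>2) / ?p 0)"
  using p0 by (simp add: I_def \<gamma>_def c_def field_simps power2_eq_square)
 show "I > 0" unfolding I using v p0 by simp
 have "- s / 2 - b0 = - (s / 2 + b0)" by simp
 then have "exp (- s / 2 - b0) = 1 / (exp (s / 2) * exp b0)" by (simp only: exp_minus exp_add inverse_eq_divide)
 then show "tau_sq (mgf P X0) b0 b1 s = 1 / I"
  unfolding I tau_sq_def mom.deriv_mgf unfolding mom.moment_0[symmetric] by simp
qed

lemma eventually_scaled_model:
 "\<forall>\<^sub>F n in sequentially. 1 <= n \<and> scaled_model (M n) (m n) n (X n) (U n) (Y n) (distr P borel X0) b0 b1 s (Lf n) V I \<gamma> (pX n) (pU n) c"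
proof -
 have Lf: "filterlim Lf at_top sequentially" unfolding Lf_def by real_asymp
 have big: "\<forall>\<^sub>F n in sequentially. K <= Lf n" for K using Lf by (simp add: filterlim_at_top)
 have small: "\<forall>\<^sub>F n in sequentially. 1 / Lf n <= K" if "K > 0" for K
  using big[of "1 / K"] eventually_gt_at_top[of 0]
 proof eventually_elim
  fix n :: nat assume n: "1 / K <= Lf n" "0 < n"
  then have "Lf n > 0" using that by (smt (verit) divide_pos_pos)
  then show "1 / Lf n <= K" using n that by (simp add: field_simps)
 qed
 have mn: "\<forall>\<^sub>F n in sequentially. real n / real (m n) < 1" using order_tendstoD(2)[OF A4(2), of 1] by simp
 have "\<forall>\<^sub>F n in sequentially. \<forall>k\<in>{0, 1, 2}. \<bar>c k\<bar> <= Lf n" by (intro eventually_ball_finite) (auto intro: big)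
 with eventually_ge_at_top[of 1] mn big[of 10] small[OF s_pos] big[of s] big[of "exp (s / 2)"] small[OF I_pos] big[of I]
  small[OF c0_pos] big[of "\<bar>\<gamma>\<bar>"]
 show ?thesis
 proof eventually_elim
  fix n :: nat
  assume n: "1 <= n" and mn: "real n / real (m n) < 1" and b: "10 <= Lf n" "1 / Lf n <= s" "s <= Lf n" "exp (s / 2) <= Lf n"
   "1 / Lf n <= I" "I <= Lf n" "1 / Lf n <= c 0" "\<bar>\<gamma>\<bar> <= Lf n" "\<forall>k\<in>{0, 1, 2}. \<bar>c k\<bar> <= Lf n"
  interpret simple_poisson_mixed_model "M n" "m n" n "X n" "U n" "Y n" "distr P borel X0" b0 b1 s by (rule model[OF n])
  have nL: "real n = Lf n powi 200"
  proof -
   have "Lf n powi 200 = Lf n ^ 200" by (simp add: power_int_def)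
   also have "\<dots> = Lf n powr 200" using n by (subst powr_realpow[symmetric]) (auto simp: Lf_def)
   also have "\<dots> = real n" using n by (simp add: Lf_def powr_powr)
   finally show ?thesis ..
  qed
  have mn': "n <= m n" using mn m_pos[OF n] by (simp add: field_simps)
  have eb: "exp_bounded (\<lambda>x. exp (b0 + b1 * x))"
   using exp_bounded_mult[OF exp_bounded_const[of "exp b0"] exp_bounded_exp[of b1]] by (simp add: exp_add)
  have gm: "exp_bounded (\<lambda>x. x ^ k * exp (b0 + b1 * x))" for k by (intro exp_bounded_intros eb)
  have gi: "integrable (distr P borel X0) (\<lambda>x. (x ^ k * exp (b0 + b1 * x))\<^sup>2)" for k
   using mom.exp_bounded_integrable[OF exp_bounded_power[OF gm[of k], of 2]] mom.X_meas
   by (subst integrable_distr_eq) auto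
  have gc: "integral\<^sup>L (distr P borel X0) (\<lambda>x. x ^ k * exp (b0 + b1 * x)) = c k" for k
  proof -
   have "integral\<^sup>L (distr P borel X0) (\<lambda>x. x ^ k * exp (b0 + b1 * x)) = mom.expectation (\<lambda>pt. exp b0 * (X0 pt ^ k * exp (b1 * X0 pt)))"
    using mom.X_meas by (subst integral_distr) (auto simp: exp_add mult_ac)
   then show ?thesis by (simp add: c_def mom.moment_def)
  qed
  have "scaled_model (M n) (m n) n (X n) (U n) (Y n) (distr P borel X0) b0 b1 s (Lf n) V I \<gamma> (pX n) (pU n) c"
  proof (unfold_locales)
   fix f :: "real => real"
   assume f: "f \<in> {\<lambda>x. x, \<lambda>x. x\<^sup>2 - s, \<lambda>x. exp x - exp (s / 2), \<lambda>x. exp (- x) * (1 + x / s), \<lambda>x. exp (- x) * (1 - x - x\<^sup>2 / s)}"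
   show "integrable lborel (\<lambda>x. normal_density 0 (sqrt s) x * (f x)\<^sup>2)
    \<and> (\<integral>x. normal_density 0 (sqrt s) x * (f x)\<^sup>2 \<partial>lborel) <= V
    \<and> (\<integral>x. normal_density 0 (sqrt s) x * f x \<partial>lborel) = 0"
    by (intro conjI normal_law_zero_means[OF s_pos f] V_bounds(2)) (use f in \<open>simp only: test_functions_def\<close>)
  next
   show "measure (distr P borel X0) {x. \<not> (\<bar>x\<bar> <= Lf n \<and> 1 / Lf n <= exp (b0 + b1 * x) \<and> exp (b0 + b1 * x) <= Lf n)} <= pX n"
    by (simp add: pX_def bad_def)
   have B: "{x::real. \<not> (\<bar>x\<bar> <= Lf n \<and> 1 / Lf n <= exp x \<and> exp x <= Lf n)} = bad 0 1 (Lf n)" by (simp add: bad_def)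
   have "pU n = (\<integral>x. indicator (bad 0 1 (Lf n)) x \<partial>normal_law s)" using bad_borel by (simp add: pU_def)
   also have "\<dots> = (\<integral>x. normal_density 0 (sqrt s) x * indicator (bad 0 1 (Lf n)) x \<partial>lborel)"
    using bad_borel by (subst integral_density) auto
   finally show "(\<integral>x. normal_density 0 (sqrt s) x * indicator {x. \<not> (\<bar>x\<bar> <= Lf n \<and> 1 / Lf n <= exp x \<and> exp x <= Lf n)} x \<partial>lborel) <= pU n"
    unfolding B by simp
  next
   show "c 1 = \<gamma> * c 0" using c0_pos by (simp add: \<gamma>_def)
  qed (use b nL mn' s_pos gi gc V_bounds(1) I_def in \<open>blast | simp\<close>)+
  then show "1 <= n \<and> scaled_model (M n) (m n) n (X n) (U n) (Y n) (distr P borel X0) b0 b1 s (Lf n) V I \<gamma> (pX n) (pU n) c"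
   using n by simp
 qed
qed

section \<open>The failure probability tends to zero\<close>

definition failure :: "nat => real" where
 "failure n = real (m n) * real n * pX n + real (m n) * pU n + (20 * ((V + 1) / Lf n) + real (m n) * (2 * exp (- (Lf n ^ 4 / 4))))"

lemma inverse_Lf_tendsto: "(\<lambda>n. 1 / Lf n) \<longlonglongrightarrow> 0"
 unfolding Lf_def by real_asymp

lemma failure_tendsto: "failure \<longlonglongrightarrow> 0"
proof -
 obtain C where C: "C > 0" "(\<lambda>n. real (m n)) \<in> O(\<lambda>n. real n powr C)" using A5 by blast
 obtain K where K: "K > 0" "\<forall>\<^sub>F n in sequentially. norm (real (m n)) <= K * norm (real n powr C)" using C(2) by (elim landau_o.bigE)
 interpret N: exponential_moments "normal_law s" "\<lambda>x. x" by (rule normal_law_moments(1)[OF s_pos])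
 \<comment> \<open>As \<open>Lf n\<close> is the 200th root of n, tails of this order in
   \<open>Lf n\<close> are of order n^-(C + 2), and the union bound over m n = O(n^(C + 1))
   predictors leaves O(1/n).\<close>
 have r: "0 <= 200 * (C + 2)" using C by simp
 obtain KX where KX: "KX >= 0" "\<And>L. L > 0 ==> mom.prob {pt \<in> space P. \<not> (\<bar>X0 pt\<bar> <= L \<and> 1 / L <= exp (b0 + b1 * X0 pt) \<and> exp (b0 + b1 * X0 pt) <= L)} <= KX * L powr - (200 * (C + 2))"
  using mom.tail_bound[OF r] by blast
 obtain KU where KU: "KU >= 0" "\<And>L. L > 0 ==> N.prob {pt \<in> space (normal_law s). \<not> (\<bar>pt\<bar> <= L \<and> 1 / L <= exp (0 + 1 * pt) \<and> exp (0 + 1 * pt) <= L)} <= KU * L powr - (200 * (C + 2))"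
  using N.tail_bound[OF r] by blast
 have pw: "Lf n powr - (200 * (C + 2)) = real n powr - (C + 2)" for n
 proof -
  have "1 / 200 * - (200 * (C + 2)) = - (C + 2)" by simp
  then show ?thesis unfolding Lf_def powr_powr by (simp only:)
 qed
 have Lf_pos: "Lf n > 0" if "n >= 1" for n using that by (simp add: Lf_def)
 have X: "pX n <= KX * real n powr - (C + 2)" if "n >= 1" for n
 proof -
  have "pX n = mom.prob {pt \<in> space P. \<not> (\<bar>X0 pt\<bar> <= Lf n \<and> 1 / Lf n <= exp (b0 + b1 * X0 pt) \<and> exp (b0 + b1 * X0 pt) <= Lf n)}"
   unfolding pX_def by (subst measure_distr[OF mom.X_meas bad_borel]) (auto simp: bad_def intro!: arg_cong[where f = "measure P"])
  also have "\<dots> <= KX * real n powr - (C + 2)" by (rule KX(2)[OF Lf_pos[OF that], unfolded pw])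
  finally show ?thesis .
 qed
 have U: "pU n <= KU * real n powr - (C + 2)" if "n >= 1" for n
 proof -
  have "pU n = N.prob {pt \<in> space (normal_law s). \<not> (\<bar>pt\<bar> <= Lf n \<and> 1 / Lf n <= exp (0 + 1 * pt) \<and> exp (0 + 1 * pt) <= Lf n)}"
   unfolding pU_def by (simp add: bad_def)
  also have "\<dots> <= KU * real n powr - (C + 2)" by (rule KU(2)[OF Lf_pos[OF that], unfolded pw])
  finally show ?thesis .
 qed
 let ?g = "\<lambda>n. K * (KX + KU) / real n + (20 * ((V + 1) / real n powr (1 / 200)) + K * (2 * (real n powr C * exp (- (real n powr (1 / 50) / 4)))))"
 have hi: "\<forall>\<^sub>F n in sequentially. failure n <= ?g n"
  using K(2) eventually_ge_at_top[of 1]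
 proof eventually_elim
  fix n :: nat assume mk: "norm (real (m n)) <= K * norm (real n powr C)" and n: "1 <= n"
  have mk: "real (m n) <= K * real n powr C" using mk by simp
  have i: "real n powr C * real n * real n powr - (C + 2) = 1 / real n"
  proof -
   have "C + 1 + - (C + 2) = - 1" by simp
   then have "real n powr C * real n powr 1 * real n powr - (C + 2) = real n powr - 1" by (simp only: powr_add[symmetric])
   moreover have "real n powr 1 = real n" "real n powr - 1 = 1 / real n" using n by (simp_all add: powr_minus_divide)
   ultimately show ?thesis by (simp only:)
  qed
  have "real (m n) * real n * pX n <= (K * real n powr C) * real n * (KX * real n powr - (C + 2))"
   using mk X[OF n] K(1) by (intro mult_mono) (auto simp: pX_def)
  also have "\<dots> = K * KX * (real n powr C * real n * real n powr - (C + 2))" by (simp add: mult_ac)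
  finally have 1: "real (m n) * real n * pX n <= K * KX / real n" unfolding i by simp
  have "real (m n) * pU n <= real (m n) * real n * pU n" using n by (intro mult_right_mono) (auto simp: pU_def mult_le_cancel_left1)
  also have "\<dots> <= (K * real n powr C) * real n * (KU * real n powr - (C + 2))"
   using mk U[OF n] K(1) by (intro mult_mono) (auto simp: pU_def)
  also have "\<dots> = K * KU * (real n powr C * real n * real n powr - (C + 2))" by (simp add: mult_ac)
  finally have 2: "real (m n) * pU n <= K * KU / real n" unfolding i by simp
  have L4: "Lf n ^ 4 = real n powr (1 / 50)" using n by (simp add: Lf_def powr_realpow[symmetric] powr_powr)
  have "real (m n) * (2 * exp (- (Lf n ^ 4 / 4))) <= (K * real n powr C) * (2 * exp (- (Lf n ^ 4 / 4)))"
   using mk by (intro mult_right_mono) auto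
  then have 3: "real (m n) * (2 * exp (- (Lf n ^ 4 / 4))) <= K * (2 * (real n powr C * exp (- (real n powr (1 / 50) / 4))))"
   unfolding L4 by (simp add: mult_ac)
  show "failure n <= ?g n" unfolding failure_def using 1 2 3 by (simp add: Lf_def distrib_left add_divide_distrib)
 qed
 have lo: "\<forall>\<^sub>F n in sequentially. 0 <= failure n"
  using eventually_ge_at_top[of 1]
 proof eventually_elim
  fix n :: nat assume "1 <= n"
  have "V >= 0" using order_trans[OF _ V_bounds(1)[of 0]] by simp
  then show "0 <= failure n" unfolding failure_def
   by (intro add_nonneg_nonneg mult_nonneg_nonneg) (auto simp: pX_def pU_def Lf_def)
 qed
 have g: "?g \<longlonglongrightarrow> 0"
 proof -
  have "(\<lambda>n. K * (KX + KU) / real n) \<longlonglongrightarrow> 0" by real_asymp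
  moreover have "(\<lambda>n. 20 * ((V + 1) / real n powr (1 / 200))) \<longlonglongrightarrow> 0"
   using tendsto_mult[OF tendsto_const[of "20 * (V + 1)"] inverse_Lf_tendsto[unfolded Lf_def]] by simp
  moreover have "(\<lambda>n. K * (2 * (real n powr C * exp (- (real n powr (1 / 50) / 4))))) \<longlonglongrightarrow> 0"
   using C(1) by real_asymp
  ultimately have "?g \<longlonglongrightarrow> 0 + (0 + 0)" by (intro tendsto_add)
  then show ?thesis by simp
 qed
 show ?thesis by (rule tendsto_sandwich[OF lo hi tendsto_const g])
qed

end

section \<open>The three asymptotic expansions\<close>

context poisson_sequence
begin

lemma prob_M: "n >= 1 ==> prob_space (M n)"
 using model simple_poisson_mixed_model.axioms(1) by blast

lemma U_atomless: "n >= 1 ==> measure (M n) {pt \<in> space (M n). U n 1 pt = a} = 0"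
proof -
 assume n: "n >= 1"
 interpret simple_poisson_mixed_model "M n" "m n" n "X n" "U n" "Y n" "distr P borel X0" b0 b1 s by (rule model[OF n])
 have 1: "1 \<in> {1..m n}" using m_pos[OF n] by simp
 note [measurable] = U_M[OF 1]
 have "AE x in lborel. x \<noteq> a" by (rule AE_lborel_singleton)
 then have "AE x in lborel. 0 < ennreal (normal_density 0 (sqrt s) x) \<longrightarrow> x \<noteq> a" by auto
 then have "AE pt in M n. U n 1 pt \<noteq> a" by (subst distributed_AE2[OF distr_U[OF 1]]) auto
 moreover have s: "{pt \<in> space (M n). U n 1 pt = a} \<in> events" by measurable
 ultimately show ?thesis unfolding prob_Collect_eq_0[OF s] by simp
qed

lemma estimator_approximations:
 assumes est: "\<forall>n\<ge>1. gva_estimator (M n) (m n) n (X n) (Y n) (B0 n) (B1 n) (S n)"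
 shows "\<forall>\<^sub>F n in sequentially. \<exists>B\<in>sets (M n). measure (M n) B <= failure n \<and> (\<forall>pt\<in>space (M n) - B.
   accurate (Lf n) (m n) n (B0 n pt - b0 - avg (m n) (\<lambda>i. U n i pt))
    (B1 n pt - b1 - scaled_model.score (m n) n (X n) (Y n) b1 I pt / sqrt (I * (real (m n) * real n))) (S n pt - avg (m n) (\<lambda>i. (U n i pt)\<^sup>2)))"
 using eventually_scaled_model
proof eventually_elim
 fix n assume "1 <= n \<and> scaled_model (M n) (m n) n (X n) (U n) (Y n) (distr P borel X0) b0 b1 s (Lf n) V I \<gamma> (pX n) (pU n) c"
 then have n: "n >= 1" and sm: "scaled_model (M n) (m n) n (X n) (U n) (Y n) (distr P borel X0) b0 b1 s (Lf n) V I \<gamma> (pX n) (pU n) c" by auto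
 interpret sm: scaled_model "M n" "m n" n "X n" "U n" "Y n" "distr P borel X0" b0 b1 s "Lf n" V I \<gamma> "pX n" "pU n" c by (rule sm)
 have f: "sm.fail = failure n" unfolding sm.fail_def failure_def ..
 show "\<exists>B\<in>sets (M n). measure (M n) B <= failure n \<and> (\<forall>pt\<in>space (M n) - B.
   accurate (Lf n) (m n) n (B0 n pt - b0 - avg (m n) (\<lambda>i. U n i pt))
    (B1 n pt - b1 - sm.score pt / sqrt (I * (real (m n) * real n))) (S n pt - avg (m n) (\<lambda>i. (U n i pt)\<^sup>2)))"
  using sm.estimator_bounds[OF est[rule_format, OF n]] unfolding f sm.unlikely_def by blast
qed

text \<open>The average of the intercepts is exactly normal for every n, so no coupling is required:
  \<open>small_o_p_coupling\<close> is used with \<open>N\<close> and \<open>Z\<close> both equal to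
  the standardised sum \<open>G\<close>.\<close>

lemma intercept_expansion:
 assumes est: "\<forall>n\<ge>1. gva_estimator (M n) (m n) n (X n) (Y n) (B0 n) (B1 n) (S n)"
 shows "\<exists>N0. (\<forall>n\<ge>1. distributed (M n) lborel (N0 n) (normal_density 0 (sqrt s))) \<and>
      small_o_p M (\<lambda>n pt. (B0 n pt - b0) - N0 n pt / sqrt (real (m n))) (\<lambda>n. 1 / real n + 1 / sqrt (real (m n)))"
proof -
 define G where "G = (\<lambda>n pt. (\<Sum>i=1..m n. U n i pt) / (sqrt s * sqrt (real (m n))))"
 have law: "distributed (M n) lborel (\<lambda>pt. sqrt s * G n pt) (normal_density 0 (sqrt s))"
  and Gm: "G n \<in> borel_measurable (M n)" if n: "n >= 1" for n
 proof -
  interpret simple_poisson_mixed_model "M n" "m n" n "X n" "U n" "Y n" "distr P borel X0" b0 b1 s by (rule model[OF n])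
  have mp: "real (m n) > 0" using m_pos[OF n] by simp
  have "distributed (M n) lborel (\<lambda>pt. \<Sum>i=1..m n. U n i pt) (normal_density (\<Sum>i=1..m n. 0) (sqrt (\<Sum>i=1..m n. (sqrt s)\<^sup>2)))"
   by (rule sum_indep_normal[OF _ _ U_indep]) (use s_pos m_pos[OF n] distr_U in auto)
  then have "distributed (M n) lborel (\<lambda>pt. \<Sum>i=1..m n. U n i pt) (normal_density 0 (sqrt (real (m n) * s)))"
   using s_pos by simp
  from normal_density_affine[OF this, of "1 / sqrt (real (m n))" 0] s_pos mp
  have "distributed (M n) lborel (\<lambda>pt. 0 + 1 / sqrt (real (m n)) * (\<Sum>i=1..m n. U n i pt)) (normal_density 0 (sqrt s))"
   by (simp add: real_sqrt_mult)
  moreover have "(\<lambda>pt. 0 + 1 / sqrt (real (m n)) * (\<Sum>i=1..m n. U n i pt)) = (\<lambda>pt. sqrt s * G n pt)"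
   using s_pos by (auto simp: G_def)
  ultimately show "distributed (M n) lborel (\<lambda>pt. sqrt s * G n pt) (normal_density 0 (sqrt s))" by (simp only:)
  show "G n \<in> borel_measurable (M n)"
   unfolding G_def by (intro borel_measurable_divide borel_measurable_sum U_M) auto
 qed
 have "small_o_p M (\<lambda>n pt. (B0 n pt - b0) - sqrt s * G n pt * (1 / sqrt (real (m n)))) (\<lambda>n. 1 / real n + 1 / sqrt (real (m n)))"
 proof (rule small_o_p_coupling[OF prob_M Gm Gm _ _ failure_tendsto inverse_Lf_tendsto])
  show "\<forall>\<^sub>F n in sequentially. \<exists>B\<in>sets (M n). measure (M n) B <= failure n \<and> (\<forall>pt\<in>space (M n) - B.
   \<bar>B0 n pt - b0 - sqrt s * G n pt * (1 / sqrt (real (m n)))\<bar> <= 1 / Lf n * (1 / real n + 1 / sqrt (real (m n))))"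
   using estimator_approximations[OF est] eventually_ge_at_top[of 1]
  proof eventually_elim
   case (elim n)
   have "sqrt s * G n pt * (1 / sqrt (real (m n))) = avg (m n) (\<lambda>i. U n i pt)" for pt
    using s_pos m_pos[OF elim(2)] by (simp add: G_def avg_def)
   then show ?case using elim(1) by (auto simp: accurate_def)
  qed
 qed (use s_pos m_pos in \<open>auto simp: add_nonneg_nonneg Suc_le_eq\<close>)
 then show ?thesis using law by (intro exI[of _ "\<lambda>n pt. sqrt s * G n pt"]) simp
qed

lemma slope_expansion:
 assumes est: "\<forall>n\<ge>1. gva_estimator (M n) (m n) n (X n) (Y n) (B0 n) (B1 n) (S n)"
 shows "\<exists>N1. (\<forall>n\<ge>1. distributed (M n) lborel (N1 n) (normal_density 0 (sqrt (tau_sq (mgf P X0) b0 b1 s)))) \<and>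
      small_o_p M (\<lambda>n pt. (B1 n pt - b1) - N1 n pt / sqrt (real (m n) * real n))
       (\<lambda>n. 1 / (real n)\<^sup>2 + 1 / sqrt (real (m n) * real n))"
proof -
 obtain n0 where n0: "\<And>n. n >= n0 ==> 1 <= n \<and> scaled_model (M n) (m n) n (X n) (U n) (Y n) (distr P borel X0) b0 b1 s (Lf n) V I \<gamma> (pX n) (pU n) c"
  using eventually_scaled_model unfolding eventually_sequentially by blast
 \<comment> \<open>The score is studied only where \<open>scaled_model\<close> holds, that is for n
   at least \<open>n0\<close>. The constant 0 before that provides measurability for all n and does
   not affect limits.\<close>
 define Z where "Z = (\<lambda>n. if n >= n0 then scaled_model.score (m n) n (X n) (Y n) b1 I else (\<lambda>_. 0))"
 have Zm: "Z n \<in> borel_measurable (M n)" for n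
  using scaled_model.score_measurable[OF n0[THEN conjunct2], of n] by (simp add: Z_def)
 have ch: "(\<lambda>n. char (distr (M n) borel (Z n)) t) \<longlonglongrightarrow> complex_of_real (exp (- (t\<^sup>2) / 2))" for t
 proof (rule LIM_zero_cancel, rule Lim_null_comparison)
  show "\<forall>\<^sub>F n in sequentially. norm (char (distr (M n) borel (Z n)) t - complex_of_real (exp (- (t\<^sup>2) / 2))) <= (t\<^sup>2 + \<bar>t\<bar> ^ 3) * (1 / Lf n) + 2 * failure n"
   using eventually_ge_at_top[of n0]
  proof eventually_elim
   fix n assume n: "n0 <= n"
   interpret sm: scaled_model "M n" "m n" n "X n" "U n" "Y n" "distr P borel X0" b0 b1 s "Lf n" V I \<gamma> "pX n" "pU n" c using n0[OF n] by blast
   have f: "sm.fail = failure n" unfolding sm.fail_def failure_def ..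
   show "norm (char (distr (M n) borel (Z n)) t - complex_of_real (exp (- (t\<^sup>2) / 2))) <= (t\<^sup>2 + \<bar>t\<bar> ^ 3) * (1 / Lf n) + 2 * failure n"
    using sm.score_char[of t] n unfolding f by (simp add: Z_def)
  qed
  have "(\<lambda>n. (t\<^sup>2 + \<bar>t\<bar> ^ 3) * (1 / Lf n) + 2 * failure n) \<longlonglongrightarrow> (t\<^sup>2 + \<bar>t\<bar> ^ 3) * 0 + 2 * 0"
   by (intro tendsto_add tendsto_mult tendsto_const inverse_Lf_tendsto failure_tendsto)
  then show "(\<lambda>n. (t\<^sup>2 + \<bar>t\<bar> ^ 3) * (1 / Lf n) + 2 * failure n) \<longlonglongrightarrow> 0" by simp
 qed
 have Um: "U n 1 \<in> borel_measurable (M n)" if "n >= 1" for n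
  using simple_poisson_mixed_model.U_M[OF model[OF that], of 1] m_pos[OF that] by simp
 obtain N where N: "\<And>n. n >= 1 ==> N n \<in> borel_measurable (M n) \<and> distr (M n) borel (N n) = std_normal_distribution"
  and close: "\<And>e. e > 0 ==> (\<lambda>n. measure (M n) {pt \<in> space (M n). \<bar>N n pt - Z n pt\<bar> > e}) \<longlonglongrightarrow> 0"
  using normal_coupling[OF prob_M Zm Um U_atomless ch] by blast
 have "small_o_p M (\<lambda>n pt. (B1 n pt - b1) - sqrt (1 / I) * N n pt * (1 / sqrt (real (m n) * real n))) (\<lambda>n. 1 / (real n)\<^sup>2 + 1 / sqrt (real (m n) * real n))"
 proof (rule small_o_p_coupling[OF prob_M N[THEN conjunct1] Zm close _ failure_tendsto inverse_Lf_tendsto])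
  show "\<forall>\<^sub>F n in sequentially. \<exists>B\<in>sets (M n). measure (M n) B <= failure n \<and> (\<forall>pt\<in>space (M n) - B.
   \<bar>B1 n pt - b1 - sqrt (1 / I) * Z n pt * (1 / sqrt (real (m n) * real n))\<bar> <= 1 / Lf n * (1 / (real n)\<^sup>2 + 1 / sqrt (real (m n) * real n)))"
   using estimator_approximations[OF est] eventually_ge_at_top[of n0]
  proof eventually_elim
   case (elim n)
   have "sqrt (1 / I) * Z n pt * (1 / sqrt (real (m n) * real n)) = scaled_model.score (m n) n (X n) (Y n) b1 I pt / sqrt (I * (real (m n) * real n))" for pt
    using elim(2) by (simp add: Z_def real_sqrt_mult real_sqrt_divide)
   then show ?case using elim(1) by (auto simp: accurate_def)
  qed
 qed (use I_pos m_pos in \<open>auto simp: Suc_le_eq\<close>)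
 moreover have "distributed (M n) lborel (\<lambda>pt. sqrt (1 / I) * N n pt) (normal_density 0 (sqrt (tau_sq (mgf P X0) b0 b1 s)))" if "n >= 1" for n
  unfolding tau by (rule prob_space.distributed_scaled_std_normal[OF prob_M[OF that]]) (use N[OF that] I_pos in auto)
 ultimately show ?thesis by (intro exI[of _ "\<lambda>n pt. sqrt (1 / I) * N n pt"]) simp
qed

lemma variance_expansion:
 assumes est: "\<forall>n\<ge>1. gva_estimator (M n) (m n) n (X n) (Y n) (B0 n) (B1 n) (S n)"
 shows "\<exists>N2. (\<forall>n\<ge>1. distributed (M n) lborel (N2 n) (normal_density 0 (sqrt (2 * s\<^sup>2)))) \<and>
      small_o_p M (\<lambda>n pt. (S n pt - s) - N2 n pt / sqrt (real (m n))) (\<lambda>n. 1 / real n + 1 / sqrt (real (m n)))"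
proof -
 define Z where "Z = (\<lambda>n pt. (\<Sum>i=1..m n. (U n i pt)\<^sup>2 - s) / sqrt (real (m n) * (2 * s\<^sup>2)))"
 have Um: "U n i \<in> borel_measurable (M n)" if "n >= 1" "i \<in> {1..m n}" for n i
  using simple_poisson_mixed_model.U_M[OF model[OF that(1)] that(2)] .
 have Um1: "U n 1 \<in> borel_measurable (M n)" if "n >= 1" for n using Um[OF that, of 1] m_pos[OF that] by simp
 have Zm: "Z n \<in> borel_measurable (M n)" if n: "n >= 1" for n
  unfolding Z_def by (intro borel_measurable_divide borel_measurable_sum borel_measurable_diff borel_measurable_power Um[OF n]) auto
 let ?\<mu> = "distr (normal_law s) borel (\<lambda>x. x\<^sup>2 - s)"
 have ch: "(\<lambda>n. char (distr (M n) borel (Z n)) t) \<longlonglongrightarrow> complex_of_real (exp (- (t\<^sup>2) / 2))" for t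
 proof -
  have "\<forall>\<^sub>F n in sequentially. char ?\<mu> (t / sqrt (real (m n) * (2 * s\<^sup>2))) ^ m n = char (distr (M n) borel (Z n)) t"
   using eventually_ge_at_top[of 1]
  proof eventually_elim
   fix n :: nat assume n: "1 <= n"
   interpret simple_poisson_mixed_model "M n" "m n" n "X n" "U n" "Y n" "distr P borel X0" b0 b1 s by (rule model[OF n])
   have ind: "indep_vars (\<lambda>_. borel) (\<lambda>i pt. (U n i pt)\<^sup>2 - s) {1..m n}"
    using indep_vars_compose2[OF U_indep, of "\<lambda>_ x. x\<^sup>2 - s" "\<lambda>_. borel"] by simp
   have "distr (M n) borel (\<lambda>pt. (U n i pt)\<^sup>2 - s) = ?\<mu>" if i: "i \<in> {1..m n}" for i
   proof -
    have d: "distr (M n) lborel (U n i) = normal_law s" using distr_U[OF i] by (simp add: distributed_def)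
    show ?thesis unfolding d[symmetric]
     by (subst distr_distr) (use U_M[OF i] in \<open>auto simp: comp_def\<close>)
   qed
   from iid_char[OF ind this, where r = "sqrt (real (m n) * (2 * s\<^sup>2))" and t = t]
   show "char ?\<mu> (t / sqrt (real (m n) * (2 * s\<^sup>2))) ^ m n = char (distr (M n) borel (Z n)) t" by (simp add: Z_def)
  qed
  moreover have "(\<lambda>n. char ?\<mu> (t / sqrt (real (m n) * (2 * s\<^sup>2))) ^ m n) \<longlonglongrightarrow> complex_of_real (exp (- (t\<^sup>2) / 2))"
   by (rule filterlim_compose[OF centred_square_char[OF s_pos] A4(1)])
  ultimately show ?thesis by (rule Lim_transform_eventually[rotated])
 qed
 obtain N where N: "\<And>n. n >= 1 ==> N n \<in> borel_measurable (M n) \<and> distr (M n) borel (N n) = std_normal_distribution"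
  and close: "\<And>e. e > 0 ==> (\<lambda>n. measure (M n) {pt \<in> space (M n). \<bar>N n pt - Z n pt\<bar> > e}) \<longlonglongrightarrow> 0"
  using normal_coupling[OF prob_M Zm Um1 U_atomless ch] by blast
 have s2: "sqrt (2 * s\<^sup>2) > 0" using s_pos by simp
 have "small_o_p M (\<lambda>n pt. (S n pt - s) - sqrt (2 * s\<^sup>2) * N n pt * (1 / sqrt (real (m n)))) (\<lambda>n. 1 / real n + 1 / sqrt (real (m n)))"
 proof (rule small_o_p_coupling[OF prob_M N[THEN conjunct1] Zm close _ failure_tendsto inverse_Lf_tendsto s2])
  show "\<forall>\<^sub>F n in sequentially. \<exists>B\<in>sets (M n). measure (M n) B <= failure n \<and> (\<forall>pt\<in>space (M n) - B.
   \<bar>S n pt - s - sqrt (2 * s\<^sup>2) * Z n pt * (1 / sqrt (real (m n)))\<bar> <= 1 / Lf n * (1 / real n + 1 / sqrt (real (m n))))"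
   using estimator_approximations[OF est] eventually_ge_at_top[of 1]
  proof eventually_elim
   case (elim n)
   have mp: "real (m n) > 0" using m_pos[OF elim(2)] by simp
   have "sqrt (2 * s\<^sup>2) * Z n pt * (1 / sqrt (real (m n))) = avg (m n) (\<lambda>i. (U n i pt)\<^sup>2) - s" for pt
   proof -
    have "sqrt (2 * s\<^sup>2) * Z n pt * (1 / sqrt (real (m n))) = (\<Sum>i=1..m n. (U n i pt)\<^sup>2 - s) / real (m n)"
     using s2 mp unfolding Z_def real_sqrt_mult[of "real (m n)"] by simp
    also have "\<dots> = avg (m n) (\<lambda>i. (U n i pt)\<^sup>2) - s"
     using mp by (simp add: avg_def sum_subtractf diff_divide_distrib)
    finally show ?thesis .
   qed
   then show ?case using elim(1) by (auto simp: accurate_def)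
  qed
 qed (use m_pos in \<open>auto simp: Suc_le_eq\<close>)
 moreover have "distributed (M n) lborel (\<lambda>pt. sqrt (2 * s\<^sup>2) * N n pt) (normal_density 0 (sqrt (2 * s\<^sup>2)))" if "n >= 1" for n
  by (rule prob_space.distributed_scaled_std_normal[OF prob_M[OF that] _ _ s2]) (use N[OF that] in auto)
 ultimately show ?thesis by (intro exI[of _ "\<lambda>n pt. sqrt (2 * s\<^sup>2) * N n pt"]) simp
qed

end

theorem theorem3p1:
  fixes M :: "nat \<Rightarrow> 'a measure" and P :: "'b measure"
    and m :: "nat \<Rightarrow> nat"
    and X :: "nat \<Rightarrow> nat \<Rightarrow> nat \<Rightarrow> 'a \<Rightarrow> real"
    and U :: "nat \<Rightarrow> nat \<Rightarrow> 'a \<Rightarrow> real"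
    and Y :: "nat \<Rightarrow> nat \<Rightarrow> nat \<Rightarrow> 'a \<Rightarrow> nat"
    and X0 :: "'b \<Rightarrow> real"
    and b0 b1 s :: real
    and B0 B1 S :: "nat \<Rightarrow> 'a \<Rightarrow> real"
  assumes s_pos: "s > 0"
    and P: "prob_space P" and X0: "X0 \<in> borel_measurable P"
    and m_pos: "\<And>n. n \<ge> 1 \<Longrightarrow> m n \<ge> 1"
    and model: "\<And>n. n \<ge> 1 \<Longrightarrow>
          simple_poisson_mixed_model (M n) (m n) n (X n) (U n) (Y n) (distr P borel X0) b0 b1 s"
    and estimator: "\<And>n. n \<ge> 1 \<Longrightarrow>
          gva_estimator (M n) (m n) n (X n) (Y n) (B0 n) (B1 n) (S n)"
    and A1: "\<And>t. integrable P (\<lambda>\<omega>. exp (t * X0 \<omega>))"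
    and A2: "inj (\<lambda>\<beta>. deriv (mgf P X0) \<beta> / mgf P X0 \<beta>)"
    and A3: "\<forall>\<^sub>F \<beta> in nhds b1. (deriv ^^ 2) (\<lambda>b. ln (mgf P X0 b)) \<beta> \<noteq> 0"
    and A4: "filterlim m at_top sequentially" "(\<lambda>n. real n / real (m n)) \<longlonglongrightarrow> 0"
    and A5: "\<exists>C>0. (\<lambda>n. real (m n)) \<in> O(\<lambda>n. real n powr C)"
  shows "(\<exists>N0. (\<forall>n\<ge>1. distributed (M n) lborel (N0 n) (normal_density 0 (sqrt s))) \<and>
            small_o_p M (\<lambda>n \<omega>. (B0 n \<omega> - b0) - N0 n \<omega> / sqrt (real (m n)))
              (\<lambda>n. 1 / real n + 1 / sqrt (real (m n)))) \<and>
         (\<exists>N1. (\<forall>n\<ge>1. distributed (M n) lborel (N1 n)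
                        (normal_density 0 (sqrt (tau_sq (mgf P X0) b0 b1 s)))) \<and>
            small_o_p M (\<lambda>n \<omega>. (B1 n \<omega> - b1) - N1 n \<omega> / sqrt (real (m n) * real n))
              (\<lambda>n. 1 / (real n)\<^sup>2 + 1 / sqrt (real (m n) * real n))) \<and>
         (\<exists>N2. (\<forall>n\<ge>1. distributed (M n) lborel (N2 n) (normal_density 0 (sqrt (2 * s\<^sup>2)))) \<and>
            small_o_p M (\<lambda>n \<omega>. (S n \<omega> - s) - N2 n \<omega> / sqrt (real (m n)))
              (\<lambda>n. 1 / real n + 1 / sqrt (real (m n))))"
proof -
 have c: "(deriv ^^ 2) (\<lambda>b. ln (mgf P X0 b)) b1 \<noteq> 0" by (rule eventually_nhds_x_imp_x[OF A3])
 have est: "\<forall>n\<ge>1. gva_estimator (M n) (m n) n (X n) (Y n) (B0 n) (B1 n) (S n)" using estimator by blast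
 have e: "exponential_moments P X0"
  by (rule exponential_moments.intro[OF P exponential_moments_axioms.intro[OF X0 A1]])
 interpret poisson_sequence M P m X U Y X0 b0 b1 s
  by (rule poisson_sequence.intro[OF s_pos e m_pos model c A4 A5])
 show ?thesis
  by (intro conjI intercept_expansion[OF est] slope_expansion[OF est] variance_expansion[OF est])
qed

end
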